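(* Let $N\ge2$, let $m\in\mathbb{N}$ be an odd number, $\sigma\in(0,1)$, and $s=m+\sigma$. Moreover, let $\Omega=B_1(0)\cup B_1(3e_1)\subset\mathbb{R}^N$, $L:=\{te_1:0<t<3\}$, and $$\Omega_n=\Omega\cup\Big\{x\in\mathbb{R}^N:\operatorname{dist}(x,L)<\frac1n\Big\}\qquad\text{for }n\in\mathbb{N}.$$ There are $n\in\mathbb{N}$, a nonnegative function $f_n\in L^\infty(\Omega_n)$, and a weak solution $u_n\in\mathcal{H}^s_0(\Omega_n)$ of $$(-\Delta)^su_n=f_n\ge0\ \text{ in }\Omega_n,\qquad u_n=0\ \text{ on }\mathbb{R}^N\setminus\Omega_n,$$ such that $\operatorname{essinf}_{\Omega_n}u_n<0$ and $\operatorname{esssup}_{\Omega_n}u_n>0$.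
   Context: $e_1$ is the first coordinate vector and $B_1(x)$ the open unit ball centered at $x$. $H^s(\mathbb{R}^N)=\{u\in L^2:(1+|\xi|^2)^{s/2}\widehat u\in L^2\}$; for an open set $U$, $\mathcal{H}^s_0(U)=\{u\in H^s(\mathbb{R}^N):u=0\text{ on }\mathbb{R}^N\setminus U\}$. For $\sigma\in(0,1)$, $\mathcal{E}_\sigma(u,v)=\frac{c_{N,\sigma}}2\int_{\mathbb{R}^N}\int_{\mathbb{R}^N}\frac{(u(x)-u(y))(v(x)-v(y))}{|x-y|^{N+2\sigma}}dx\,dy$ with $c_{N,\sigma}=\frac{4^\sigma\Gamma(\frac N2+\sigma)}{\pi^{N/2}|\Gamma(-\sigma)|}$. For $s=m+\sigma$ with $m$ odd, $\mathcal{E}_s(u,v)=\sum_{k=1}^N\mathcal{E}_\sigma(\partial_k(-\Delta)^{\frac{m-1}2}u,\partial_k(-\Delta)^{\frac{m-1}2}v)$. A function $u\in\mathcal{H}^s_0(U)$ is a weak solution of $(-\Delta)^su=f$ in $U$ with $u=0$ on $\mathbb{R}^N\setminus U$ if $\mathcal{E}_s(u,\varphi)=\int_Uf\varphi\,dx$ for all $\varphi\in\mathcal{H}^s_0(U)$. *)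

theory Defs
  imports "HOL-Probability.Essential_Supremum"
begin

text \<open>
  The Euclidean space is \<open>real ^ 'n\<close>, so the dimension is \<open>CARD('n)\<close>. Elements of Lebesgue and
  Sobolev spaces are represented by functions on the whole space; all the notions below are
  invariant under changes on null sets.
\<close>

section \<open>Square integrable functions, Fourier transform, Sobolev spaces\<close>

definition L2 :: "(real ^ 'n \<Rightarrow> 'b::{real_normed_vector, second_countable_topology}) set" where
  "L2 = {u. u \<in> borel_measurable lebesgue \<and> integrable lebesgue (\<lambda>x. (norm (u x))\<^sup>2)}"

definition trunc_fourier :: "real \<Rightarrow> (real ^ 'n \<Rightarrow> real) \<Rightarrow> real ^ 'n \<Rightarrow> complex" where
  "trunc_fourier R u \<xi> =
     complex_of_real ((2 * pi) powr (- real CARD('n) / 2)) *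
     (LINT x:cball 0 R|lebesgue. complex_of_real (u x) * cis (- (x \<bullet> \<xi>)))"

text \<open>
  The Fourier--Plancherel transform on \<open>L2\<close>, as a relation (it determines \<open>v\<close> up to a null set):
  \<open>v\<close> is the \<open>L2\<close>-limit of the Fourier integrals over growing balls.
\<close>

definition has_fourier :: "(real ^ 'n \<Rightarrow> real) \<Rightarrow> (real ^ 'n \<Rightarrow> complex) \<Rightarrow> bool" where
  "has_fourier u v \<longleftrightarrow> u \<in> L2 \<and> v \<in> L2 \<and>
     ((\<lambda>R. \<integral>\<^sup>+ \<xi>. ennreal ((norm (v \<xi> - trunc_fourier R u \<xi>))\<^sup>2) \<partial>lebesgue) \<longlongrightarrow> 0) at_top"

definition sobolev :: "real \<Rightarrow> (real ^ 'n \<Rightarrow> real) set" where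
  "sobolev s = {u \<in> L2. \<exists>v. has_fourier u v \<and>
     (\<lambda>\<xi>. complex_of_real ((1 + (norm \<xi>)\<^sup>2) powr (s / 2)) * v \<xi>) \<in> L2}"

definition sobolev0 :: "real \<Rightarrow> (real ^ 'n) set \<Rightarrow> (real ^ 'n \<Rightarrow> real) set" where
  "sobolev0 s U = {u \<in> sobolev s. AE x in lebesgue. x \<notin> U \<longrightarrow> u x = 0}"

section \<open>Weak derivatives\<close>

definition partial_deriv :: "'n \<Rightarrow> (real ^ 'n \<Rightarrow> real) \<Rightarrow> real ^ 'n \<Rightarrow> real" where
  "partial_deriv k f x = frechet_derivative f (at x) (axis k 1)"

definition test_functions :: "(real ^ 'n \<Rightarrow> real) set" where
  "test_functions = {\<phi>. (\<forall>ks. foldr partial_deriv ks \<phi> differentiable_on UNIV) \<and>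
     compact (closure {x. \<phi> x \<noteq> 0})}"

definition locally_integrable :: "(real ^ 'n \<Rightarrow> real) \<Rightarrow> bool" where
  "locally_integrable u \<longleftrightarrow> (\<forall>K. compact K \<longrightarrow> set_integrable lebesgue K u)"

definition has_weak_partial :: "'n \<Rightarrow> (real ^ 'n \<Rightarrow> real) \<Rightarrow> (real ^ 'n \<Rightarrow> real) \<Rightarrow> bool" where
  "has_weak_partial k u g \<longleftrightarrow> locally_integrable u \<and> locally_integrable g \<and>
     (\<forall>\<phi>\<in>test_functions.
        (LINT x|lebesgue. u x * partial_deriv k \<phi> x) = - (LINT x|lebesgue. g x * \<phi> x))"

text \<open>
  Weak derivatives are unique up to null sets, so the choice below is harmless. It is arbitrary
  if there is no weak derivative, which does not occur for the derivatives of order at most \<open>m\<close>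
  of functions in \<open>sobolev s\<close>, \<open>m \<le> s\<close>, used below.
\<close>

definition weak_partial :: "'n \<Rightarrow> (real ^ 'n \<Rightarrow> real) \<Rightarrow> real ^ 'n \<Rightarrow> real" where
  "weak_partial k u = (SOME g. has_weak_partial k u g)"

definition neg_laplacian :: "(real ^ 'n \<Rightarrow> real) \<Rightarrow> real ^ 'n \<Rightarrow> real" where
  "neg_laplacian u = (\<lambda>x. - (\<Sum>k\<in>UNIV. weak_partial k (weak_partial k u) x))"

section \<open>The bilinear forms and weak solutions\<close>

definition frac_const :: "'n::finite itself \<Rightarrow> real \<Rightarrow> real" where
  "frac_const _ \<sigma> = 4 powr \<sigma> * Gamma (real CARD('n) / 2 + \<sigma>) /
     (pi powr (real CARD('n) / 2) * \<bar>Gamma (- \<sigma>)\<bar>)"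

definition form_frac :: "real \<Rightarrow> (real ^ 'n \<Rightarrow> real) \<Rightarrow> (real ^ 'n \<Rightarrow> real) \<Rightarrow> real" where
  "form_frac \<sigma> u v = frac_const TYPE('n) \<sigma> / 2 *
     (LINT x|lebesgue. LINT y|lebesgue.
        (u x - u y) * (v x - v y) / norm (x - y) powr (real CARD('n) + 2 * \<sigma>))"

text \<open>The form for \<open>s = m + \<sigma>\<close> with \<open>m\<close> odd and \<open>0 < \<sigma> < 1\<close>; meaningful only for odd \<open>m\<close>.\<close>

definition form_odd :: "nat \<Rightarrow> real \<Rightarrow> (real ^ 'n \<Rightarrow> real) \<Rightarrow> (real ^ 'n \<Rightarrow> real) \<Rightarrow> real" where
  "form_odd m \<sigma> u v = (\<Sum>k\<in>UNIV.
     form_frac \<sigma> (weak_partial k ((neg_laplacian ^^ ((m - 1) div 2)) u))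
                 (weak_partial k ((neg_laplacian ^^ ((m - 1) div 2)) v)))"

definition weak_solution ::
  "nat \<Rightarrow> real \<Rightarrow> (real ^ 'n) set \<Rightarrow> (real ^ 'n \<Rightarrow> real) \<Rightarrow> (real ^ 'n \<Rightarrow> real) \<Rightarrow> bool" where
  "weak_solution m \<sigma> U f u \<longleftrightarrow> u \<in> sobolev0 (real m + \<sigma>) U \<and>
     (\<forall>\<phi>\<in>sobolev0 (real m + \<sigma>) U. form_odd m \<sigma> u \<phi> = (LINT x:U|lebesgue. f x * \<phi> x))"

section \<open>Bounded functions and essential infimum\<close>

definition Linfty :: "(real ^ 'n) set \<Rightarrow> (real ^ 'n \<Rightarrow> real) set" where
  "Linfty U = {f. f \<in> borel_measurable (lebesgue_on U) \<and>
     (\<exists>C. AE x in lebesgue_on U. \<bar>f x\<bar> \<le> C)}"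

definition essinf :: "'a measure \<Rightarrow> ('a \<Rightarrow> ereal) \<Rightarrow> ereal" where
  "essinf M f = - esssup M (\<lambda>x. - f x)"

section \<open>The dumbbell domains\<close>

text \<open>The index \<open>i\<close> is the coordinate that plays the role of the first one.\<close>

definition two_balls :: "'n \<Rightarrow> (real ^ 'n) set" where
  "two_balls i = ball 0 1 \<union> ball (3 *\<^sub>R axis i 1) 1"

definition axis_segment :: "'n \<Rightarrow> (real ^ 'n) set" where
  "axis_segment i = {t *\<^sub>R axis i 1 | t. 0 < t \<and> t < 3}"

text \<open>To be used for \<open>n \<ge> 1\<close> only, since \<open>1 / 0 = 0\<close>.\<close>

definition dumbbell :: "'n \<Rightarrow> nat \<Rightarrow> (real ^ 'n) set" where
  "dumbbell i n = two_balls i \<union> {x. infdist x (axis_segment i) < 1 / real n}"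

end

theory Submission
  imports Defs "HOL-Probability.Characteristic_Functions"
begin

text \<open>
  The datum \<open>f\<close> is the indicator of the first ball. On the Fourier side the form \<open>form_odd m \<sigma>\<close> is a
  positive multiple of \<open>energy s\<close>, \<open>s = m + \<sigma>\<close>, whose weight is \<open>norm \<xi> powr (2 * s)\<close>
  (\<open>form_odd_fourier\<close>; this rests on Plancherel's identity and on the uniqueness of weak derivatives).
  Hence weak solutions \<open>u n\<close> on all dumbbells exist by the Dirichlet principle and the Poincare
  inequality (\<open>energy_solution_exists\<close>). Suppose that all of them were nonnegative.

  The dumbbells decrease, so the energies of the solutions decrease, and the energy of the
  difference of two solutions is the difference of their energies. Therefore the solutions converge
  in mean square to a solution \<open>w\<close> on the intersection (\<open>energy_solutions_decreasing_domains\<close>). In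
  dimension \<open>N \<ge> 2\<close> the axis is a null set, so \<open>w\<close> vanishes outside the two balls
  (\<open>zero_outside_two_balls\<close>), and \<open>w\<close> is nonnegative.

  The two balls have distance \<open>1\<close>. So \<open>w = w1 + w2\<close>, where the parts of \<open>w\<close> in the two balls
  belong to the Sobolev space again (\<open>sobolev_restrict_separated\<close>). The decisive point is a sign: for
  nonnegative functions with separated supports the mixed energy is nonnegative, and it is positive
  unless one of them vanishes (\<open>energy_separated_sign\<close>). For disjoint supports the mixed energy is
  the integral of \<open>f x * g y / norm (x - y) powr (N + 2 * s)\<close> times a constant whose sign
  is \<open>(-1) ^ (m + 1)\<close>. This is why the maximum principle fails for odd \<open>m\<close>: interaction across
  the gap raises the energy, whereas it lowers the energy for \<open>m = 0\<close>. The proof below obtains the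
  sign from the heat semigroup. The weight \<open>norm \<xi> powr (2 * s)\<close> is a Mellin integral over \<open>t\<close> of
  \<open>(1 - exp (- t * (norm \<xi>)\<^sup>2)) ^ M\<close> with \<open>M = m + 1\<close>, that is, of an \<open>M\<close>-th difference in time of the heat
  semigroup. Heat pairings of separated functions are smaller than every power of \<open>t\<close> at \<open>t = 0\<close>, so the
  terms of the difference may be integrated one by one. Scaling \<open>t\<close> collects them into \<open>(-1) ^ M\<close> times
  the \<open>M\<close>-th forward difference of \<open>x powr s\<close> at \<open>0\<close>, which is positive, times an integral of
  heat pairings, which is positive because the heat kernel is.

  Since \<open>f\<close> vanishes on the second ball, testing the equation of \<open>w\<close> with \<open>w2\<close> gives
  \<open>energy s w1 w2 + energy s w2 w2 = 0\<close> with two nonnegative summands. So \<open>w2\<close> has no energy. Testing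
  with a bump \<open>\<phi>\<close> in the second ball now gives \<open>energy s w1 \<phi> = 0\<close>, and the strict sign forces
  \<open>w1 = 0\<close>. This contradicts the equation tested with a bump in the first ball. So some \<open>u n\<close> is
  negative on a set of positive measure. It is also positive on such a set, since
  otherwise its energy, a positive multiple of its integral over the first ball, would be at most \<open>0\<close>,
  and \<open>u n\<close> would vanish.
\<close>

section \<open>Square integrable functions\<close>

definition sqn :: "(real ^ 'n \<Rightarrow> 'b::{real_normed_vector, second_countable_topology}) \<Rightarrow> real" where
  "sqn u = (LINT x|lebesgue. (norm (u x))\<^sup>2)"

lemma L2_measurable: "u \<in> L2 \<Longrightarrow> u \<in> borel_measurable lebesgue"
  by (simp add: L2_def)

lemma L2_integrable: "u \<in> L2 \<Longrightarrow> integrable lebesgue (\<lambda>x. (norm (u x))\<^sup>2)"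
  by (simp add: L2_def)

lemma L2_dominated:
  assumes "u \<in> L2" "w \<in> borel_measurable lebesgue" "AE x in lebesgue. norm (w x) \<le> norm (u x)"
  shows "w \<in> L2" "sqn w \<le> sqn u"
proof -
  have i: "integrable lebesgue (\<lambda>x. (norm (w x))\<^sup>2)"
    by (rule Bochner_Integration.integrable_bound[OF L2_integrable[OF assms(1)]])
       (use assms in \<open>auto intro!: borel_measurable_power elim!: eventually_mono simp: power_mono\<close>)
  then show "w \<in> L2" using assms by (simp add: L2_def)
  show "sqn w \<le> sqn u" unfolding sqn_def
    by (rule integral_mono_AE[OF i L2_integrable[OF assms(1)]])
       (use assms in \<open>auto elim!: eventually_mono simp: power_mono\<close>)
qed

lemma sqn_nonneg [simp]: "0 \<le> sqn u"
  by (simp add: sqn_def)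

lemma sqn_cong_AE:
  assumes "u \<in> borel_measurable lebesgue" "w \<in> borel_measurable lebesgue"
    and "AE x in lebesgue. norm (u x) = norm (w x)"
  shows "sqn u = sqn w"
  unfolding sqn_def
  by (rule integral_cong_AE) (use assms in \<open>auto elim!: eventually_mono\<close>)

lemma lebesgue_measurable_cong_AE:
  assumes "u \<in> borel_measurable lebesgue" and "AE x in lebesgue. u x = w x"
  shows "w \<in> borel_measurable lebesgue"
proof -
  obtain N where N: "N \<in> null_sets lebesgue" "{x. u x \<noteq> w x} \<subseteq> N"
    using assms(2) by (auto simp: eventually_ae_filter)
  show ?thesis
  proof (rule measurableI)
    fix A assume A: "A \<in> sets (borel :: 'b measure)"
    have "w -` A \<inter> space lebesgue = (u -` A - N) \<union> (w -` A \<inter> N)"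
      using N(2) by (auto; metis (mono_tags, lifting) mem_Collect_eq subsetD)
    moreover have "u -` A - N \<in> sets lebesgue"
      using measurable_sets[OF assms(1) A] N(1) by auto
    moreover have "w -` A \<inter> N \<in> sets lebesgue"
      using completion.complete2[of "w -` A \<inter> N" N] N(1) by auto
    ultimately show "w -` A \<inter> space lebesgue \<in> sets lebesgue"
      by (metis sets.Un)
  qed simp
qed

lemma L2_cong_AE:
  assumes "u \<in> L2" "AE x in lebesgue. u x = w x"
  shows "w \<in> L2" "sqn w = sqn u"
proof -
  have w: "w \<in> borel_measurable lebesgue"
    using lebesgue_measurable_cong_AE assms L2_measurable by blast
  show "w \<in> L2" by (rule L2_dominated(1)[OF assms(1) w]) (rule eventually_mono[OF assms(2)], simp)
  show "sqn w = sqn u"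
    by (rule sqn_cong_AE[OF w L2_measurable[OF assms(1)]]) (rule eventually_mono[OF assms(2)], simp)
qed

lemma L2_add_and_sqn:
  assumes "u \<in> L2" "w \<in> L2"
  shows "(\<lambda>x. u x + w x) \<in> L2 \<and> sqn (\<lambda>x. u x + w x) \<le> 2 * sqn u + 2 * sqn w"
proof -
  have [measurable]: "u \<in> borel_measurable lebesgue" "w \<in> borel_measurable lebesgue"
    using assms L2_measurable by auto
  have i: "integrable lebesgue (\<lambda>x. 2 * (norm (u x))\<^sup>2 + 2 * (norm (w x))\<^sup>2)"
    using assms[THEN L2_integrable] by simp
  have b: "(norm (u x + w x))\<^sup>2 \<le> 2 * (norm (u x))\<^sup>2 + 2 * (norm (w x))\<^sup>2" for x
  proof -
    have "(norm (u x + w x))\<^sup>2 \<le> (norm (u x) + norm (w x))\<^sup>2"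
      by (intro power_mono norm_triangle_ineq) simp
    also have "\<dots> \<le> 2 * (norm (u x))\<^sup>2 + 2 * (norm (w x))\<^sup>2"
      using sum_squares_bound[of "norm (u x)" "norm (w x)"] by (simp add: power2_sum)
    finally show ?thesis .
  qed
  have i2: "integrable lebesgue (\<lambda>x. (norm (u x + w x))\<^sup>2)"
    by (rule Bochner_Integration.integrable_bound[OF i]) (use b in \<open>auto intro: order_trans\<close>)
  have "sqn (\<lambda>x. u x + w x) \<le> (LINT x|lebesgue. 2 * (norm (u x))\<^sup>2 + 2 * (norm (w x))\<^sup>2)"
    unfolding sqn_def by (rule integral_mono[OF i2 i]) (rule b)
  also have "\<dots> = 2 * sqn u + 2 * sqn w"
    using assms[THEN L2_integrable] by (simp add: sqn_def)
  finally show ?thesis using i2 by (simp add: L2_def)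
qed

lemmas L2_add = L2_add_and_sqn[THEN conjunct1] and sqn_add_le = L2_add_and_sqn[THEN conjunct2]

lemma L2_scaleR:
  assumes "u \<in> L2" shows "(\<lambda>x. c *\<^sub>R u x) \<in> L2" "sqn (\<lambda>x. c *\<^sub>R u x) = c\<^sup>2 * sqn u"
  using assms by (auto simp: L2_def sqn_def power_mult_distrib)

lemma L2_cmult:
  fixes u :: "real ^ 'n \<Rightarrow> real"
  assumes "u \<in> L2" shows "(\<lambda>x. c * u x) \<in> L2" "sqn (\<lambda>x. c * u x) = c\<^sup>2 * sqn u"
  using L2_scaleR[OF assms, of c] by auto

lemma L2_zero: "(\<lambda>x. 0) \<in> L2" "sqn (\<lambda>x. 0) = 0"
  by (auto simp: L2_def sqn_def)

lemma L2_diff: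
  assumes "u \<in> L2" "w \<in> L2"
  shows "(\<lambda>x. u x - w x) \<in> L2"
  using L2_add[OF assms(1) L2_scaleR(1)[OF assms(2), of "-1"]] by simp

lemma sqn_commute: "sqn (\<lambda>x. u x - w x) = sqn (\<lambda>x. w x - u x)"
  by (simp add: sqn_def norm_minus_commute)

lemma sqn_triangle:
  assumes "u \<in> L2" "v \<in> L2" "w \<in> L2"
  shows "sqn (\<lambda>x. u x - w x) \<le> 2 * sqn (\<lambda>x. u x - v x) + 2 * sqn (\<lambda>x. v x - w x)"
  using sqn_add_le[OF L2_diff[OF assms(1,2)] L2_diff[OF assms(2,3)]] by simp

lemma sqn_eq_0D:
  assumes "u \<in> L2" "sqn u = 0"
  shows "AE x in lebesgue. u x = 0"
  using integral_nonneg_eq_0_iff_AE[OF L2_integrable[OF assms(1)]] assms(2)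
  by (simp add: sqn_def)

lemma L2_mult_bounded:
  fixes g :: "real ^ 'n \<Rightarrow> 'b::{real_normed_algebra, second_countable_topology}"
  assumes "u \<in> L2" "g \<in> borel_measurable lebesgue" "\<And>x. norm (g x) \<le> C"
  shows "(\<lambda>x. g x * u x) \<in> L2" "sqn (\<lambda>x. g x * u x) \<le> C\<^sup>2 * sqn u"
proof -
  have C: "0 \<le> C" using assms(3) norm_ge_zero order_trans by blast
  have [measurable]: "u \<in> borel_measurable lebesgue" "g \<in> borel_measurable lebesgue"
    using assms L2_measurable by auto
  have *: "AE x in lebesgue. norm (g x * u x) \<le> norm (C *\<^sub>R u x)"
    using C by (auto intro!: order_trans[OF norm_mult_ineq] mult_right_mono assms(3))
  have m: "(\<lambda>x. g x * u x) \<in> borel_measurable lebesgue" by measurable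
  show "(\<lambda>x. g x * u x) \<in> L2" by (rule L2_dominated(1)[OF L2_scaleR(1)[OF assms(1)] m *])
  show "sqn (\<lambda>x. g x * u x) \<le> C\<^sup>2 * sqn u"
    using L2_dominated(2)[OF L2_scaleR(1)[OF assms(1)] m *] L2_scaleR(2)[OF assms(1)] by simp
qed

lemma L2_indicator:
  fixes u :: "real ^ 'n \<Rightarrow> real"
  assumes "u \<in> L2" "A \<in> sets lebesgue"
  shows "(\<lambda>x. indicator A x * u x) \<in> L2"
  by (rule L2_mult_bounded(1)[OF assms(1), of _ 1]) (use assms in \<open>auto simp: indicator_def\<close>)

lemma L2_product_integrable:
  assumes "u \<in> L2" "w \<in> L2"
  shows "integrable lebesgue (\<lambda>x. norm (u x) * norm (w x))"
proof (rule Bochner_Integration.integrable_bound)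
  show "integrable lebesgue (\<lambda>x. (norm (u x))\<^sup>2 + (norm (w x))\<^sup>2)"
    using L2_integrable[OF assms(1)] L2_integrable[OF assms(2)] by simp
  show "(\<lambda>x. norm (u x) * norm (w x)) \<in> borel_measurable lebesgue"
    using L2_measurable[OF assms(1)] L2_measurable[OF assms(2)] by simp
  show "AE x in lebesgue. norm (norm (u x) * norm (w x)) \<le> norm ((norm (u x))\<^sup>2 + (norm (w x))\<^sup>2)"
  proof (intro AE_I2)
    fix x
    have "2 * norm (u x) * norm (w x) \<le> (norm (u x))\<^sup>2 + (norm (w x))\<^sup>2"
      by (rule sum_squares_bound)
    moreover have "0 \<le> norm (u x) * norm (w x)" by simp
    ultimately have "norm (u x) * norm (w x) \<le> (norm (u x))\<^sup>2 + (norm (w x))\<^sup>2"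
      by linarith
    then show "norm (norm (u x) * norm (w x)) \<le> norm ((norm (u x))\<^sup>2 + (norm (w x))\<^sup>2)"
      by simp
  qed
qed

lemma quadratic_nonneg_imp_discriminant:
  fixes a b c :: real
  assumes "\<And>t. 0 \<le> a + 2 * t * b + t\<^sup>2 * c" "0 \<le> c"
  shows "b\<^sup>2 \<le> a * c"
proof (cases "c = 0")
  case True
  have "b = 0"
  proof (rule ccontr)
    assume "b \<noteq> 0"
    have "0 \<le> a + 2 * (- (a + 1) / (2 * b)) * b" using assms(1)[of "- (a + 1) / (2 * b)"] True by simp
    then show False using \<open>b \<noteq> 0\<close> by (simp add: field_simps)
  qed
  then show ?thesis using True by simp
next
  case False
  have "0 \<le> (a + 2 * (- b / c) * b + (- b / c)\<^sup>2 * c) * c"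
    by (intro mult_nonneg_nonneg assms)
  also have "\<dots> = a * c - b\<^sup>2" using False by (simp add: field_simps power2_eq_square)
  finally show ?thesis by simp
qed

lemma L2_Cauchy_Schwarz:
  assumes "u \<in> L2" "w \<in> L2"
  shows "(LINT x|lebesgue. norm (u x) * norm (w x))\<^sup>2 \<le> sqn u * sqn w"
proof (rule quadratic_nonneg_imp_discriminant)
  fix t :: real
  have "0 \<le> (LINT x|lebesgue. (norm (u x) + t * norm (w x))\<^sup>2)" by simp
  also have "\<dots> = (LINT x|lebesgue. (norm (u x))\<^sup>2 + (2 * t) * (norm (u x) * norm (w x)) + t\<^sup>2 * (norm (w x))\<^sup>2)"
    by (intro Bochner_Integration.integral_cong) (auto simp: power2_eq_square algebra_simps)
  also have "\<dots> = sqn u + (2 * t) * (LINT x|lebesgue. norm (u x) * norm (w x)) + t\<^sup>2 * sqn w"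
    using L2_product_integrable[OF assms] L2_integrable[OF assms(1)] L2_integrable[OF assms(2)]
    by (simp add: sqn_def)
  finally show "0 \<le> sqn u + 2 * t * (LINT x|lebesgue. norm (u x) * norm (w x)) + t\<^sup>2 * sqn w" .
qed simp

lemma L2_real_product_integrable:
  fixes u w :: "real ^ 'n \<Rightarrow> real"
  assumes "u \<in> L2" "w \<in> L2"
  shows "integrable lebesgue (\<lambda>x. u x * w x)"
  by (rule Bochner_Integration.integrable_bound[OF L2_product_integrable[OF assms]])
     (use L2_measurable[OF assms(1)] L2_measurable[OF assms(2)] in \<open>auto simp: abs_mult\<close>)

lemma L2_real_Cauchy_Schwarz:
  fixes u w :: "real ^ 'n \<Rightarrow> real"
  assumes "u \<in> L2" "w \<in> L2"
  shows "(LINT x|lebesgue. u x * w x)\<^sup>2 \<le> sqn u * sqn w"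
proof -
  have "\<bar>LINT x|lebesgue. u x * w x\<bar> \<le> (LINT x|lebesgue. norm (u x) * norm (w x))"
    using integral_norm_bound[of lebesgue "\<lambda>x. u x * w x"] by (simp add: abs_mult)
  then have "(LINT x|lebesgue. u x * w x)\<^sup>2 \<le> (LINT x|lebesgue. norm (u x) * norm (w x))\<^sup>2"
    by (metis abs_ge_zero power2_abs power_mono)
  then show ?thesis using L2_Cauchy_Schwarz[OF assms] by linarith
qed

lemma L2_inner_tendsto:
  fixes u :: "real ^ 'n \<Rightarrow> real"
  assumes "\<And>k. f k \<in> L2" "u \<in> L2" "w \<in> L2" "((\<lambda>k. sqn (\<lambda>x. f k x - u x)) \<longlongrightarrow> 0) F"
  shows "((\<lambda>k. LINT x|lebesgue. f k x * w x) \<longlongrightarrow> (LINT x|lebesgue. u x * w x)) F"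
proof -
  have e: "(LINT x|lebesgue. (f k x - u x) * w x) = (LINT x|lebesgue. f k x * w x) - (LINT x|lebesgue. u x * w x)" for k
    using L2_real_product_integrable[OF assms(1,3)] L2_real_product_integrable[OF assms(2,3)]
    by (simp add: left_diff_distrib)
  have "((\<lambda>k. ((LINT x|lebesgue. f k x * w x) - (LINT x|lebesgue. u x * w x))\<^sup>2) \<longlongrightarrow> 0) F"
  proof (rule tendsto_sandwich[OF _ _ tendsto_const])
    show "\<forall>\<^sub>F k in F. ((LINT x|lebesgue. f k x * w x) - (LINT x|lebesgue. u x * w x))\<^sup>2 \<le> sqn (\<lambda>x. f k x - u x) * sqn w"
      using L2_real_Cauchy_Schwarz[OF L2_diff[OF assms(1,2)] assms(3)] e by simp
    show "((\<lambda>k. sqn (\<lambda>x. f k x - u x) * sqn w) \<longlongrightarrow> 0) F"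
      using tendsto_mult_left_zero[OF assms(4)] .
  qed simp
  then have "((\<lambda>k. sqrt (((LINT x|lebesgue. f k x * w x) - (LINT x|lebesgue. u x * w x))\<^sup>2)) \<longlongrightarrow> sqrt 0) F"
    by (rule tendsto_real_sqrt)
  then show ?thesis
    by (simp add: tendsto_rabs_zero_iff Lim_null[symmetric])
qed

lemma sqn_tendsto:
  assumes "\<And>k. f k \<in> L2" "u \<in> L2" "((\<lambda>k. sqn (\<lambda>x. f k x - u x)) \<longlongrightarrow> 0) F"
  shows "((\<lambda>k. sqn (f k)) \<longlongrightarrow> sqn u) F"
proof -
  have b: "\<bar>sqn (f k) - sqn u\<bar> \<le> sqn (\<lambda>x. f k x - u x) + 2 * sqrt (sqn (\<lambda>x. f k x - u x) * sqn u)" for k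
  proof -
    note d = L2_diff[OF assms(1,2), of k]
    note i = L2_integrable[OF assms(1), of k] L2_integrable[OF assms(2)] L2_integrable[OF d] L2_product_integrable[OF d assms(2)]
    have p: "\<bar>a\<^sup>2 - b\<^sup>2\<bar> \<le> c\<^sup>2 + 2 * (c * b)" if "a \<le> b + c" "b \<le> a + c" "0 \<le> a" "0 \<le> b" for a b c :: real
    proof -
      have "\<bar>a - b\<bar> \<le> c" using that by linarith
      have "\<bar>a\<^sup>2 - b\<^sup>2\<bar> = \<bar>a - b\<bar> * (a + b)" using that by (simp add: power2_eq_square square_diff_square_factored abs_mult)
      also have "\<dots> \<le> c * (c + 2 * b)" using that \<open>\<bar>a - b\<bar> \<le> c\<close> by (intro mult_mono) auto
      finally show ?thesis by (simp add: power2_eq_square algebra_simps)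
    qed
    have "\<bar>sqn (f k) - sqn u\<bar> = \<bar>LINT x|lebesgue. (norm (f k x))\<^sup>2 - (norm (u x))\<^sup>2\<bar>"
      using i by (simp add: sqn_def)
    also have "\<dots> \<le> (LINT x|lebesgue. \<bar>(norm (f k x))\<^sup>2 - (norm (u x))\<^sup>2\<bar>)"
      by (rule integral_abs_bound)
    also have "\<dots> \<le> (LINT x|lebesgue. (norm (f k x - u x))\<^sup>2 + 2 * (norm (f k x - u x) * norm (u x)))"
    proof (rule integral_mono)
      fix x
      show "\<bar>(norm (f k x))\<^sup>2 - (norm (u x))\<^sup>2\<bar> \<le> (norm (f k x - u x))\<^sup>2 + 2 * (norm (f k x - u x) * norm (u x))"
        by (rule p) (use norm_triangle_ineq[of "u x" "f k x - u x"] norm_triangle_ineq2[of "u x" "f k x"] norm_minus_commute[of "u x" "f k x"] in auto)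
    qed (use i in auto)
    also have "\<dots> = sqn (\<lambda>x. f k x - u x) + 2 * (LINT x|lebesgue. norm (f k x - u x) * norm (u x))"
      using i by (simp add: sqn_def)
    also have "(LINT x|lebesgue. norm (f k x - u x) * norm (u x)) \<le> sqrt (sqn (\<lambda>x. f k x - u x) * sqn u)"
      using L2_Cauchy_Schwarz[OF d assms(2)] by (rule real_le_rsqrt)
    finally show ?thesis by simp
  qed
  have "((\<lambda>k. sqn (\<lambda>x. f k x - u x) + 2 * sqrt (sqn (\<lambda>x. f k x - u x) * sqn u)) \<longlongrightarrow> 0 + 2 * sqrt (0 * sqn u)) F"
    by (intro tendsto_intros assms)
  then have lim: "((\<lambda>k. sqn (\<lambda>x. f k x - u x) + 2 * sqrt (sqn (\<lambda>x. f k x - u x) * sqn u)) \<longlongrightarrow> 0) F"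
    by simp
  have "((\<lambda>k. \<bar>sqn (f k) - sqn u\<bar>) \<longlongrightarrow> 0) F"
    by (rule tendsto_sandwich[OF _ _ tendsto_const lim]) (use b in auto)
  then show ?thesis
    by (simp add: tendsto_rabs_zero_iff Lim_null[symmetric])
qed

lemma L2_convergence_AE_subseq:
  assumes "\<And>k. f k \<in> L2" "u \<in> L2" "(\<lambda>k. sqn (\<lambda>x. f k x - u x)) \<longlonglongrightarrow> 0"
  shows "\<exists>r. strict_mono (r::nat\<Rightarrow>nat) \<and> (AE x in lebesgue. (\<lambda>k. f (r k) x) \<longlonglongrightarrow> u x)"
proof -
  have "\<exists>r::nat\<Rightarrow>nat. strict_mono r \<and> (AE x in lebesgue. (\<lambda>k. (norm (f (r k) x - u x))\<^sup>2) \<longlonglongrightarrow> 0)"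
    by (rule tendsto_L1_AE_subseq) (use assms L2_integrable[OF L2_diff[OF assms(1,2)]] in \<open>auto simp: sqn_def\<close>)
  then obtain r :: "nat \<Rightarrow> nat" where r: "strict_mono r" "AE x in lebesgue. (\<lambda>k. (norm (f (r k) x - u x))\<^sup>2) \<longlonglongrightarrow> 0"
    by blast
  have "AE x in lebesgue. (\<lambda>k. f (r k) x) \<longlonglongrightarrow> u x"
    using r(2)
  proof (rule eventually_mono)
    fix x assume "(\<lambda>k. (norm (f (r k) x - u x))\<^sup>2) \<longlonglongrightarrow> 0"
    then have "(\<lambda>k. sqrt ((norm (f (r k) x - u x))\<^sup>2)) \<longlonglongrightarrow> sqrt 0" by (rule tendsto_real_sqrt)
    then show "(\<lambda>k. f (r k) x) \<longlonglongrightarrow> u x" by (simp add: tendsto_norm_zero_iff Lim_null[symmetric])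
  qed
  then show ?thesis using r(1) by blast
qed

lemma L2_Fatou:
  assumes "\<And>k. f k \<in> L2" "u \<in> borel_measurable lebesgue"
    and "AE x in lebesgue. (\<lambda>k. f k x) \<longlonglongrightarrow> u x" "\<And>k. k \<ge> K \<Longrightarrow> sqn (f k) \<le> C"
  shows "u \<in> L2" "sqn u \<le> C"
proof -
  have [measurable]: "f k \<in> borel_measurable lebesgue" for k using assms L2_measurable by auto
  note assms(2)[measurable]
  have s: "(\<integral>\<^sup>+x. ennreal ((norm (f k x))\<^sup>2) \<partial>lebesgue) = ennreal (sqn (f k))" for k
    unfolding sqn_def by (rule nn_integral_eq_integral) (use L2_integrable[OF assms(1)] in auto)
  have C: "0 \<le> C" using assms(4)[of K] sqn_nonneg[of "f K"] by linarith
  have "(\<integral>\<^sup>+x. ennreal ((norm (u x))\<^sup>2) \<partial>lebesgue) = (\<integral>\<^sup>+x. liminf (\<lambda>k. ennreal ((norm (f k x))\<^sup>2)) \<partial>lebesgue)"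
  proof (rule nn_integral_cong_AE, use assms(3) in eventually_elim)
    case (elim x)
    then have "(\<lambda>k. ennreal ((norm (f k x))\<^sup>2)) \<longlonglongrightarrow> ennreal ((norm (u x))\<^sup>2)"
      by (intro tendsto_intros)
    then have "liminf (\<lambda>k. ennreal ((norm (f k x))\<^sup>2)) = ennreal ((norm (u x))\<^sup>2)"
      by (rule lim_imp_Liminf[OF sequentially_bot])
    then show ?case by (rule sym)
  qed
  also have "\<dots> \<le> liminf (\<lambda>k. (\<integral>\<^sup>+x. ennreal ((norm (f k x))\<^sup>2) \<partial>lebesgue))"
    by (rule nn_integral_liminf) measurable
  also have "\<dots> \<le> ennreal C"
  proof -
    have "liminf (\<lambda>k. (\<integral>\<^sup>+x. ennreal ((norm (f k x))\<^sup>2) \<partial>lebesgue)) \<le> liminf (\<lambda>k::nat. ennreal C)"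
      by (rule Liminf_mono) (use assms(4) s in \<open>auto simp: eventually_sequentially intro!: exI[of _ K] ennreal_leI\<close>)
    also have "\<dots> = ennreal C" by (simp add: Liminf_const)
    finally show ?thesis .
  qed
  finally have le: "(\<integral>\<^sup>+x. ennreal ((norm (u x))\<^sup>2) \<partial>lebesgue) \<le> ennreal C" .
  have i: "integrable lebesgue (\<lambda>x. (norm (u x))\<^sup>2)"
  proof (rule integrableI_bounded)
    show "(\<integral>\<^sup>+x. ennreal (norm ((norm (u x))\<^sup>2)) \<partial>lebesgue) < \<infinity>"
      using le_less_trans[OF le ennreal_less_top] by simp
  qed simp
  then show "u \<in> L2" using assms(2) by (simp add: L2_def)
  show "sqn u \<le> C" using le C nn_integral_eq_integral[OF i] by (simp add: sqn_def)
qed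

text \<open>Along a fast subsequence the increments \<open>d j\<close> satisfy \<open>sqn (d j) \<le> 8 ^ - j\<close>, so \<open>\<Sum>j. 2 ^ j * (norm (d j))\<^sup>2\<close>
  is integrable, hence finite almost everywhere: the increments are summable pointwise, and
  Fatou's lemma turns the pointwise limit into a limit in mean square.\<close>
theorem L2_complete:
  fixes f :: "nat \<Rightarrow> real ^ 'n \<Rightarrow> 'b::{banach, second_countable_topology}"
  assumes f: "\<And>k. f k \<in> L2"
    and cauchy: "\<And>e. e > 0 \<Longrightarrow> \<exists>K. \<forall>k\<ge>K. \<forall>l\<ge>K. sqn (\<lambda>x. f k x - f l x) < e"
  shows "\<exists>g\<in>L2. (\<lambda>k. sqn (\<lambda>x. f k x - g x)) \<longlonglongrightarrow> 0"
proof -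
  have "\<exists>r::nat\<Rightarrow>nat. \<forall>j. (\<forall>k\<ge>r j. \<forall>l\<ge>r j. sqn (\<lambda>x. f k x - f l x) < (1/8)^j) \<and> r j < r (Suc j)"
  proof (rule dependent_nat_choice)
    show "\<exists>x. \<forall>k\<ge>x. \<forall>l\<ge>x. sqn (\<lambda>x. f k x - f l x) < (1/8)^0" using cauchy[of 1] by auto
    fix x n assume "\<forall>k\<ge>x. \<forall>l\<ge>x. sqn (\<lambda>x. f k x - f l x) < (1 / 8) ^ n"
    obtain K where "\<forall>k\<ge>K. \<forall>l\<ge>K. sqn (\<lambda>x. f k x - f l x) < (1/8)^(Suc n)" using cauchy[of "(1/8)^Suc n"] by auto
    then show "\<exists>y. (\<forall>k\<ge>y. \<forall>l\<ge>y. sqn (\<lambda>x. f k x - f l x) < (1/8)^(Suc n)) \<and> x < y"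
      by (intro exI[of _ "max K (Suc x)"]) auto
  qed
  then obtain r :: "nat \<Rightarrow> nat" where r: "\<And>j k l. k \<ge> r j \<Longrightarrow> l \<ge> r j \<Longrightarrow> sqn (\<lambda>x. f k x - f l x) < (1/8)^j"
      "\<And>j. r j < r (Suc j)" by blast
  have sm: "strict_mono r" using r(2) by (simp add: strict_mono_Suc_iff)
  define d where "d j x = f (r (Suc j)) x - f (r j) x" for j x
  have fm[measurable]: "f k \<in> borel_measurable lebesgue" for k using f L2_measurable by auto
  have dm[measurable]: "d j \<in> borel_measurable lebesgue" for j unfolding d_def by measurable
  have dL2: "d j \<in> L2" for j unfolding d_def using L2_diff[OF f f] by blast
  have ds: "sqn (d j) \<le> (1/8)^j" for j
    using r(1)[of j "r (Suc j)" "r j"] r(2)[of j] unfolding d_def by (simp add: less_imp_le)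
  have "(\<integral>\<^sup>+x. (\<Sum>j. ennreal (2^j * (norm (d j x))\<^sup>2)) \<partial>lebesgue) = (\<Sum>j. \<integral>\<^sup>+x. ennreal (2^j * (norm (d j x))\<^sup>2) \<partial>lebesgue)"
    by (rule nn_integral_suminf) measurable
  also have "\<dots> = (\<Sum>j. ennreal (2^j * sqn (d j)))"
  proof (rule suminf_cong)
    fix j
    have "integrable lebesgue (\<lambda>x. 2^j * (norm (d j x))\<^sup>2)" using L2_integrable[OF dL2] by auto
    then show "(\<integral>\<^sup>+x. ennreal (2^j * (norm (d j x))\<^sup>2) \<partial>lebesgue) = ennreal (2^j * sqn (d j))"
      by (subst nn_integral_eq_integral) (auto simp: sqn_def)
  qed
  also have "\<dots> \<le> (\<Sum>j. ennreal ((1/4)^j))"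
  proof (rule suminf_le)
    fix j
    have "2^j * sqn (d j) \<le> 2^j * (1/8)^j" using ds by (intro mult_left_mono) auto
    also have "\<dots> = (1/4)^j" by (simp add: power_mult_distrib[symmetric])
    finally show "ennreal (2^j * sqn (d j)) \<le> ennreal ((1/4)^j)" by (rule ennreal_leI)
  qed auto
  also have "\<dots> = ennreal (\<Sum>j. (1/4)^j)" by (rule suminf_ennreal2) auto
  also have "\<dots> < \<infinity>" by simp
  finally have fin: "(\<integral>\<^sup>+x. (\<Sum>j. ennreal (2^j * (norm (d j x))\<^sup>2)) \<partial>lebesgue) < \<infinity>" .
  have "AE x in lebesgue. (\<Sum>j. ennreal (2^j * (norm (d j x))\<^sup>2)) \<noteq> \<infinity>"
    by (rule nn_integral_noteq_infinite) (use fin in auto)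
  then have conv: "AE x in lebesgue. convergent (\<lambda>j. f (r j) x)"
  proof (rule eventually_mono)
    fix x assume a: "(\<Sum>j. ennreal (2^j * (norm (d j x))\<^sup>2)) \<noteq> \<infinity>"
    have "summable (\<lambda>j. 2^j * (norm (d j x))\<^sup>2)"
      using a by (intro summable_suminf_not_top) auto
    then have bnd: "Bseq (\<lambda>j. 2^j * (norm (d j x))\<^sup>2)"
      using summable_LIMSEQ_zero convergentI convergent_imp_Bseq by blast
    then obtain B where B: "B > 0" "\<And>j. \<bar>2^j * (norm (d j x))\<^sup>2\<bar> \<le> B"
      by (auto simp: Bseq_def)
    have "norm (d j x) \<le> sqrt B * (sqrt (1/2))^j" for j
    proof -
      have "(norm (d j x))\<^sup>2 \<le> B * (1/2)^j" using B(2)[of j] by (simp add: field_simps)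
      then have "norm (d j x) \<le> sqrt (B * (1/2)^j)" by (rule real_le_rsqrt)
      then show ?thesis by (simp add: real_sqrt_mult real_sqrt_power)
    qed
    moreover have "summable (\<lambda>j. sqrt B * (sqrt (1/2))^j)"
      by (intro summable_mult summable_geometric) (simp add: real_sqrt_lt_1_iff)
    ultimately have "summable (\<lambda>j. d j x)"
      using summable_comparison_test'[of "\<lambda>j. sqrt B * (sqrt (1/2))^j" 0 "\<lambda>j. d j x"] by blast
    then have "convergent (\<lambda>n. \<Sum>j<n. d j x)" by (simp add: summable_iff_convergent)
    moreover have "(\<Sum>j<n. d j x) = f (r n) x - f (r 0) x" for n
      unfolding d_def by (rule sum_lessThan_telescope)
    ultimately have "convergent (\<lambda>n. f (r n) x - f (r 0) x)" by simp
    then obtain L where "(\<lambda>n. f (r n) x - f (r 0) x) \<longlonglongrightarrow> L" by (auto simp: convergent_def)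
    from tendsto_add[OF this tendsto_const[of "f (r 0) x"]] have "(\<lambda>n. f (r n) x) \<longlonglongrightarrow> L + f (r 0) x" by simp
    then show "convergent (\<lambda>j. f (r j) x)" by (auto simp: convergent_def)
  qed
  define g where "g x = lim (\<lambda>j. f (r j) x)" for x
  have gm: "g \<in> borel_measurable lebesgue" unfolding g_def
    by (rule borel_measurable_lim_metric) measurable
  have glim: "AE x in lebesgue. (\<lambda>j. f (r j) x) \<longlonglongrightarrow> g x"
    using conv by (auto elim!: eventually_mono simp: g_def convergent_LIMSEQ_iff)
  have key: "(\<lambda>x. f k x - g x) \<in> L2 \<and> sqn (\<lambda>x. f k x - g x) \<le> (1/8)^j" if "k \<ge> r j" for k j
  proof -
    have 1: "AE x in lebesgue. (\<lambda>i. f k x - f (r i) x) \<longlonglongrightarrow> f k x - g x"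
      using glim by (auto elim!: eventually_mono intro!: tendsto_intros)
    have 2: "sqn (\<lambda>x. f k x - f (r i) x) \<le> (1/8)^j" if "i \<ge> j" for i
      using r(1)[of j k "r i"] \<open>k \<ge> r j\<close> sm that by (auto simp: less_imp_le strict_mono_less_eq)
    show ?thesis
      using L2_Fatou[of "\<lambda>i x. f k x - f (r i) x" "\<lambda>x. f k x - g x" j "(1/8)^j", OF L2_diff[OF f f] _ 1 2] gm
      by auto
  qed
  have g: "g \<in> L2" using L2_diff[OF f[of "r 0"], of "\<lambda>x. f (r 0) x - g x"] key[of 0 "r 0"] by simp
  have "(\<lambda>k. sqn (\<lambda>x. f k x - g x)) \<longlonglongrightarrow> 0"
  proof (rule LIMSEQ_I)
    fix e :: real assume "e > 0"
    obtain j where j: "(1/8)^j < e" using real_arch_pow_inv[of e "1/8"] \<open>e > 0\<close> by auto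
    then show "\<exists>no. \<forall>n\<ge>no. norm (sqn (\<lambda>x. f n x - g x) - 0) < e"
      using key[of j] by (intro exI[of _ "r j"]) (auto intro: le_less_trans)
  qed
  then show ?thesis using g by blast
qed

section \<open>Translations\<close>

lemma lebesgue_shift:
  fixes h :: "real ^ 'n"
  shows lebesgue_distr_shift: "distr lebesgue lebesgue (\<lambda>x. x + h) = lebesgue"
    and lebesgue_measurable_shift [measurable]: "(\<lambda>x. x + h) \<in> lebesgue \<rightarrow>\<^sub>M lebesgue"
proof -
  have T: "(\<lambda>x. h + (\<Sum>j\<in>Basis. (1 * (x \<bullet> j)) *\<^sub>R j)) = (\<lambda>x. x + h)"
    by (simp add: euclidean_representation add.commute)
  show "(\<lambda>x. x + h) \<in> lebesgue \<rightarrow>\<^sub>M lebesgue"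
    using lebesgue_affine_measurable[of "\<lambda>_. 1" h] unfolding T by simp
  show "distr lebesgue lebesgue (\<lambda>x. x + h) = lebesgue"
    using lebesgue_affine_euclidean[of "\<lambda>_. 1" h] unfolding T by (simp add: density_1)
qed

lemma integral_lebesgue_shift:
  fixes u :: "real ^ 'n \<Rightarrow> 'b::{banach, second_countable_topology}"
  assumes "u \<in> borel_measurable lebesgue"
  shows "(LINT x|lebesgue. u (x + h)) = (LINT x|lebesgue. u x)"
  using integral_distr[OF lebesgue_measurable_shift assms, of h] by (simp add: lebesgue_distr_shift)

lemma integrable_lebesgue_shift:
  fixes u :: "real ^ 'n \<Rightarrow> 'b::{banach, second_countable_topology}"
  assumes "integrable lebesgue u"
  shows "integrable lebesgue (\<lambda>x. u (x + h))"
  by (rule integrable_distr[OF lebesgue_measurable_shift]) (simp add: lebesgue_distr_shift assms)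

lemma L2_shift:
  assumes "u \<in> L2"
  shows "(\<lambda>x. u (x + h)) \<in> L2" "sqn (\<lambda>x. u (x + h)) = sqn u"
proof -
  have [measurable]: "u \<in> borel_measurable lebesgue" using L2_measurable[OF assms] .
  have "(\<lambda>x. u (x + h)) \<in> borel_measurable lebesgue" by measurable
  then show "(\<lambda>x. u (x + h)) \<in> L2"
    using integrable_lebesgue_shift[OF L2_integrable[OF assms]] by (simp add: L2_def)
  show "sqn (\<lambda>x. u (x + h)) = sqn u"
    using integral_lebesgue_shift[of "\<lambda>x. (norm (u x))\<^sup>2" h] by (simp add: sqn_def)
qed

lemma L2_dominated_convergence:
  fixes u :: "real ^ 'n \<Rightarrow> 'b::{real_normed_vector, second_countable_topology}" and w :: "real ^ 'n \<Rightarrow> real"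
  assumes w: "w \<in> L2" and u: "u \<in> borel_measurable lebesgue"
    and f: "\<And>k. f k \<in> borel_measurable lebesgue"
    and bound: "\<And>k. AE x in lebesgue. norm (f k x) \<le> w x"
    and lim: "AE x in lebesgue. (\<lambda>k::nat. f k x) \<longlonglongrightarrow> u x"
  shows "\<And>k. f k \<in> L2" "u \<in> L2" "(\<lambda>k. sqn (\<lambda>x. f k x - u x)) \<longlonglongrightarrow> 0"
proof -
  note [measurable] = u f
  show fL: "f k \<in> L2" for k
    by (rule L2_dominated(1)[OF w f], rule eventually_mono[OF bound[of k]]) simp
  have ub: "AE x in lebesgue. norm (u x) \<le> w x"
  proof -
    have "AE x in lebesgue. \<forall>k. norm (f k x) \<le> w x" using bound by (simp add: AE_all_countable)
    then show ?thesis using lim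
    proof eventually_elim
      case (elim x)
      show ?case by (rule LIMSEQ_le_const2[OF tendsto_norm[OF elim(2)]]) (use elim(1) in auto)
    qed
  qed
  show uL: "u \<in> L2"
    by (rule L2_dominated(1)[OF w u], rule eventually_mono[OF ub]) simp
  have "(\<lambda>k. LINT x|lebesgue. (norm (f k x - u x))\<^sup>2) \<longlonglongrightarrow> (LINT x::real^'n|lebesgue. (0::real))"
  proof (rule integral_dominated_convergence[where w="\<lambda>x. 4 * (norm (w x))\<^sup>2"])
    show "integrable lebesgue (\<lambda>x. 4 * (norm (w x))\<^sup>2)" using L2_integrable[OF w] by simp
    show "AE x in lebesgue. (\<lambda>k. (norm (f k x - u x))\<^sup>2) \<longlonglongrightarrow> 0"
      using lim
    proof eventually_elim
      case (elim x)
      have "(\<lambda>k. (norm (f k x - u x))\<^sup>2) \<longlonglongrightarrow> (norm (u x - u x))\<^sup>2"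
        by (intro tendsto_intros elim)
      then show ?case by simp
    qed
    show "AE x in lebesgue. norm ((norm (f k x - u x))\<^sup>2) \<le> 4 * (norm (w x))\<^sup>2" for k
      using bound[of k] ub
    proof eventually_elim
      case (elim x)
      have "norm (f k x - u x) \<le> 2 * w x" using elim norm_triangle_ineq4[of "f k x" "u x"] by linarith
      then have "(norm (f k x - u x))\<^sup>2 \<le> (2 * w x)\<^sup>2" by (rule power_mono) simp
      then show ?case by (simp add: power_mult_distrib)
    qed
  qed auto
  then show "(\<lambda>k. sqn (\<lambda>x. f k x - u x)) \<longlonglongrightarrow> 0" by (simp add: sqn_def)
qed

lemma cball_in_lebesgue [measurable, simp]: "cball (a :: real ^ 'n) r \<in> sets lebesgue"
  by (intro sets_completionI_sets) simp

lemma L2_bounded_support: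
  fixes u :: "real ^ 'n \<Rightarrow> 'b::{real_normed_vector, second_countable_topology}"
  assumes "u \<in> borel_measurable lebesgue" "\<And>x. norm (u x) \<le> C * indicator (cball 0 r) x"
  shows "u \<in> L2"
proof -
  have i: "integrable lebesgue (\<lambda>x. C\<^sup>2 * indicator (cball 0 r :: (real ^ 'n) set) x)"
    by (intro integrable_mult_right integrable_real_indicator) (use emeasure_bounded_finite[OF bounded_cball] in auto)
  have [simp]: "(indicator A x)\<^sup>2 = (indicator A x :: real)" for A and x :: "real ^ 'n" by (simp add: indicator_def)
  have b: "(norm (u x))\<^sup>2 \<le> C\<^sup>2 * indicator (cball 0 r) x" for x
    using power_mono[OF assms(2)[of x], of 2] by (simp add: power_mult_distrib)
  have "integrable lebesgue (\<lambda>x. (norm (u x))\<^sup>2)"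
    by (rule Bochner_Integration.integrable_bound[OF i]) (use assms(1) b in auto)
  then show ?thesis using assms(1) by (simp add: L2_def)
qed

lemma L2_shift_tendsto_closed:
  fixes u :: "real ^ 'n \<Rightarrow> real"
  assumes u: "u \<in> L2"
    and app: "\<And>e. e > 0 \<Longrightarrow> \<exists>g\<in>L2. sqn (\<lambda>x. u x - g x) < e \<and> (\<lambda>k. sqn (\<lambda>x. g (x + h k) - g x)) \<longlonglongrightarrow> 0"
  shows "(\<lambda>k::nat. sqn (\<lambda>x. u (x + h k) - u x)) \<longlonglongrightarrow> 0"
proof (rule LIMSEQ_I)
  fix e :: real assume "e > 0"
  then obtain g where g: "g \<in> L2" "sqn (\<lambda>x. u x - g x) < e / 12" "(\<lambda>k. sqn (\<lambda>x. g (x + h k) - g x)) \<longlonglongrightarrow> 0"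
    using app[of "e / 12"] by auto
  have "\<forall>\<^sub>F k in sequentially. sqn (\<lambda>x. g (x + h k) - g x) < e / 12"
    using order_tendstoD(2)[OF g(3), of "e / 12"] \<open>e > 0\<close> by simp
  then obtain K where K: "\<And>k. k \<ge> K \<Longrightarrow> sqn (\<lambda>x. g (x + h k) - g x) < e / 12"
    by (auto simp: eventually_sequentially)
  have "sqn (\<lambda>x. u (x + h k) - u x) < e" if "k \<ge> K" for k
  proof -
    note s = L2_shift(1)[OF u, of "h k"] L2_shift(1)[OF g(1), of "h k"]
    have "sqn (\<lambda>x. u (x + h k) - u x) \<le> 2 * sqn (\<lambda>x. u (x + h k) - g (x + h k)) + 2 * sqn (\<lambda>x. g (x + h k) - u x)"
      by (rule sqn_triangle[OF s(1,2) u])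
    moreover have "sqn (\<lambda>x. g (x + h k) - u x) \<le> 2 * sqn (\<lambda>x. g (x + h k) - g x) + 2 * sqn (\<lambda>x. g x - u x)"
      by (rule sqn_triangle[OF s(2) g(1) u])
    moreover have "sqn (\<lambda>x. u (x + h k) - g (x + h k)) = sqn (\<lambda>x. u x - g x)"
      using L2_shift(2)[OF L2_diff[OF u g(1)], of "h k"] .
    moreover have "sqn (\<lambda>x. g x - u x) = sqn (\<lambda>x. u x - g x)" by (rule sqn_commute)
    ultimately show ?thesis using g(2) K[OF that] \<open>e > 0\<close> by linarith
  qed
  then show "\<exists>no. \<forall>n\<ge>no. norm (sqn (\<lambda>x. u (x + h n) - u x) - 0) < e" by auto
qed

lemma L2_shift_tendsto_continuous:
  fixes g :: "real ^ 'n \<Rightarrow> real"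
  assumes cont: "continuous_on UNIV g" and b: "\<And>x. \<bar>g x\<bar> \<le> C * indicator (cball 0 r) x" and h: "h \<longlonglongrightarrow> 0"
  shows "(\<lambda>k::nat. sqn (\<lambda>x. g (x + h k) - g x)) \<longlonglongrightarrow> 0"
proof -
  have gm: "g \<in> borel_measurable borel" using cont by (rule borel_measurable_continuous_onI)
  then have [measurable]: "g \<in> borel_measurable lebesgue" by (simp add: measurable_completion)
  have gL: "g \<in> L2" by (rule L2_bounded_support[of _ C r]) (use b in auto)
  have "Bseq h" using h convergentI convergent_imp_Bseq by blast
  then obtain B where B: "B > 0" "\<And>k. norm (h k) \<le> B" by (auto simp: Bseq_def)
  have wL: "(\<lambda>x. \<bar>C\<bar> * indicator (cball 0 (r + B)) x) \<in> (L2 :: (real ^ 'n \<Rightarrow> real) set)"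
    by (rule L2_bounded_support[of _ "\<bar>C\<bar>" "r + B"]) (intro borel_measurable_times borel_measurable_const borel_measurable_indicator cball_in_lebesgue, simp add: abs_mult)
  show ?thesis
  proof (rule L2_dominated_convergence(3)[OF wL])
    show "(\<lambda>x. g (x + h k)) \<in> borel_measurable lebesgue" for k by measurable
    show "AE x in lebesgue. norm (g (x + h k)) \<le> \<bar>C\<bar> * indicator (cball 0 (r + B)) x" for k
    proof (rule AE_I2)
      fix x
      have "x \<in> cball 0 (r + B)" if "x + h k \<in> cball 0 r"
        using that B(2)[of k] norm_triangle_ineq4[of "x + h k" "h k"] by simp
      then show "norm (g (x + h k)) \<le> \<bar>C\<bar> * indicator (cball 0 (r + B)) x"
        using b[of "x + h k"] by (cases "norm (x + h k) \<le> r") (auto simp: indicator_def split: if_splits)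
    qed
    show "AE x in lebesgue. (\<lambda>k. g (x + h k)) \<longlonglongrightarrow> g x"
    proof (rule AE_I2)
      fix x
      have "(\<lambda>k. x + h k) \<longlonglongrightarrow> x + 0" by (intro tendsto_intros h)
      moreover have "isCont g (x + 0)" using cont by (simp add: continuous_on_eq_continuous_at)
      ultimately have "(\<lambda>k. g (x + h k)) \<longlonglongrightarrow> g (x + 0)" by (rule isCont_tendsto_compose[rotated])
      then show "(\<lambda>k. g (x + h k)) \<longlonglongrightarrow> g x" by simp
    qed
  qed measurable
qed

definition clamp_real :: "real \<Rightarrow> real \<Rightarrow> real" where "clamp_real c y = max (- c) (min c y)"

lemma clamp_real_props:
  "\<bar>clamp_real c y\<bar> \<le> \<bar>y\<bar>" "0 \<le> c \<Longrightarrow> \<bar>clamp_real c y\<bar> \<le> c" "\<bar>y\<bar> \<le> c \<Longrightarrow> clamp_real c y = y" if "0 \<le> c"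
  using that by (auto simp: clamp_real_def)

lemma continuous_clamp_real: "continuous_on UNIV (clamp_real c)"
  unfolding clamp_real_def by (intro continuous_intros)

text \<open>The set of functions with \<open>L2\<close>-continuous translations is closed and contains the
  continuous functions of bounded support, which are dense: a measurable function is almost
  everywhere a limit of continuous ones, and these may be truncated in size and in space.\<close>
lemma L2_shift_tendsto:
  fixes u :: "real ^ 'n \<Rightarrow> real"
  assumes u: "u \<in> L2" and h: "h \<longlonglongrightarrow> 0"
  shows "(\<lambda>k::nat. sqn (\<lambda>x. u (x + h k) - u x)) \<longlonglongrightarrow> 0"
proof -
  have um: "u \<in> borel_measurable lebesgue" by (rule L2_measurable[OF u])
  then have "u measurable_on UNIV" by (simp add: measurable_on_iff_borel_measurable)
  then obtain N g where N: "negligible N" and gc: "\<And>n::nat. continuous_on UNIV (g n)"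
      and gl: "\<And>x. x \<notin> N \<Longrightarrow> (\<lambda>n. g n x) \<longlonglongrightarrow> u x"
    unfolding measurable_on_def by auto
  have AEN: "AE x in lebesgue. x \<notin> N" using N by (simp add: negligible_iff_null_sets AE_not_in)
  define \<psi> where "\<psi> j x = max 0 (min 1 (real j + 1 - norm x))" for j and x :: "real ^ 'n"
  have \<psi>c: "continuous_on UNIV (\<psi> j)" for j unfolding \<psi>_def by (intro continuous_intros)
  have \<psi>b: "0 \<le> \<psi> j x" "\<psi> j x \<le> indicator (cball 0 (real j + 1)) x" for j x
    by (auto simp: \<psi>_def indicator_def)
  have \<psi>1: "\<psi> j x \<le> 1" for j x by (auto simp: \<psi>_def)
  have [measurable]: "\<psi> j \<in> borel_measurable lebesgue" "clamp_real c \<in> borel_measurable borel" "u \<in> borel_measurable lebesgue" for j c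
    using borel_measurable_continuous_onI[OF \<psi>c] borel_measurable_continuous_onI[OF continuous_clamp_real] um
    by (auto simp: measurable_completion)
  define uj where "uj j x = clamp_real (real j) (u x) * \<psi> j x" for j x
  define gj where "gj j n x = clamp_real (real j) (g n x) * \<psi> j x" for j n x
  have [measurable]: "uj j \<in> borel_measurable lebesgue" for j
    unfolding uj_def using um by measurable
  have gjc: "continuous_on UNIV (gj j n)" for j n
    unfolding gj_def by (intro continuous_intros \<psi>c continuous_on_compose2[OF continuous_clamp_real gc]) auto
  have [measurable]: "gj j n \<in> borel_measurable lebesgue" for j n
    using borel_measurable_continuous_onI[OF gjc] by (simp add: measurable_completion)
  have gjb: "\<bar>gj j n x\<bar> \<le> real j * indicator (cball 0 (real j + 1)) x" for j n x
    unfolding gj_def abs_mult by (intro mult_mono clamp_real_props) (use \<psi>b in auto)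
  have gjs: "(\<lambda>k. sqn (\<lambda>x. gj j n (x + h k) - gj j n x)) \<longlonglongrightarrow> 0" for j n
    by (rule L2_shift_tendsto_continuous[OF gjc gjb h])
  have uL: "(\<lambda>x. \<bar>u x\<bar>) \<in> L2" using u by (rule L2_dominated(1)) auto
  have ujb: "AE x in lebesgue. norm (uj j x) \<le> \<bar>u x\<bar>" for j
  proof (rule AE_I2)
    fix x
    have "\<bar>clamp_real (real j) (u x)\<bar> * \<bar>\<psi> j x\<bar> \<le> \<bar>u x\<bar> * 1"
      by (intro mult_mono clamp_real_props) (use \<psi>b \<psi>1 in auto)
    then show "norm (uj j x) \<le> \<bar>u x\<bar>" by (simp add: uj_def abs_mult)
  qed
  have ujl: "AE x in lebesgue. (\<lambda>j. uj j x) \<longlonglongrightarrow> u x"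
  proof (rule AE_I2)
    fix x
    obtain J where J: "\<bar>u x\<bar> + norm x \<le> real J" using real_arch_simple by blast
    have "uj j x = u x" if "j \<ge> J" for j
    proof -
      have "\<bar>u x\<bar> + norm x \<le> real j" using J that by linarith
      then have "\<bar>u x\<bar> \<le> real j" "norm x \<le> real j" by (auto intro: order_trans[rotated])
      then show ?thesis by (simp add: uj_def \<psi>_def clamp_real_props)
    qed
    then show "(\<lambda>j. uj j x) \<longlonglongrightarrow> u x" by (intro tendsto_eventually) (auto simp: eventually_sequentially)
  qed
  note uj = L2_dominated_convergence[OF uL um _ ujb ujl]
  have gjl: "AE x in lebesgue. (\<lambda>n. gj j n x) \<longlonglongrightarrow> uj j x" for j
    using AEN
  proof eventually_elim
    case (elim x)
    have "isCont (clamp_real (real j)) (u x)" using continuous_clamp_real by (simp add: continuous_on_eq_continuous_at)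
    then show ?case unfolding gj_def uj_def
      by (intro tendsto_mult tendsto_const isCont_tendsto_compose[OF _ gl[OF elim]])
  qed
  have wL: "(\<lambda>x. real j * indicator (cball 0 (real j + 1)) x) \<in> (L2 :: (real ^ 'n \<Rightarrow> real) set)" for j
    by (rule L2_bounded_support[of _ "real j" "real j + 1"]) (intro borel_measurable_times borel_measurable_const borel_measurable_indicator cball_in_lebesgue, simp add: abs_mult)
  have gj: "gj j n \<in> L2" "(\<lambda>n. sqn (\<lambda>x. gj j n x - uj j x)) \<longlonglongrightarrow> 0" for j n
    by (rule L2_dominated_convergence(1,3)[OF wL[of j] _ _ _ gjl]; use gjb in auto)+
  show ?thesis
  proof (rule L2_shift_tendsto_closed[OF u])
    fix e :: real assume "e > 0"
    have "\<forall>\<^sub>F j in sequentially. sqn (\<lambda>x. uj j x - u x) < e / 4"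
      by (rule order_tendstoD(2)[OF uj(3)]) (use \<open>e > 0\<close> in auto)
    then obtain j where j: "sqn (\<lambda>x. uj j x - u x) < e / 4" by (auto simp: eventually_sequentially)
    have "\<forall>\<^sub>F n in sequentially. sqn (\<lambda>x. gj j n x - uj j x) < e / 4"
      by (rule order_tendstoD(2)[OF gj(2)]) (use \<open>e > 0\<close> in auto)
    then obtain n where n: "sqn (\<lambda>x. gj j n x - uj j x) < e / 4" by (auto simp: eventually_sequentially)
    have "sqn (\<lambda>x. u x - gj j n x) \<le> 2 * sqn (\<lambda>x. u x - uj j x) + 2 * sqn (\<lambda>x. uj j x - gj j n x)"
      by (rule sqn_triangle[OF u _ gj(1)]) (rule uj(1), measurable)
    then have "sqn (\<lambda>x. u x - gj j n x) < e"
      using j n sqn_commute[of u "uj j"] sqn_commute[of "uj j" "gj j n"] by linarith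
    then show "\<exists>g\<in>L2. sqn (\<lambda>x. u x - g x) < e \<and> (\<lambda>k. sqn (\<lambda>x. g (x + h k) - g x)) \<longlonglongrightarrow> 0"
      using gj(1) gjs by blast
  qed
qed

section \<open>Gaussian integrals\<close>

text \<open>This is the characteristic function of the standard normal distribution, after scaling.\<close>
lemma gaussian_integral_1:
  fixes t z :: real
  assumes "t > 0"
  shows "integrable lborel (\<lambda>x. complex_of_real (exp (- t * x\<^sup>2)) * cis (z * x))"
    and "(LINT x|lborel. complex_of_real (exp (- t * x\<^sup>2)) * cis (z * x)) =
      complex_of_real (sqrt (pi / t) * exp (- z\<^sup>2 / (4 * t)))"
proof -
  define c where "c = sqrt (2 * t)"
  have c: "c > 0" "c\<^sup>2 = 2 * t" using assms by (auto simp: c_def)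
  have ex: "complex_of_real (exp (- t * x\<^sup>2)) * cis (z * x) =
      complex_of_real (sqrt (2 * pi)) * (std_normal_density (0 + c * x) *\<^sub>R iexp ((z / c) * (0 + c * x)))" for x
  proof -
    have "(c * x)\<^sup>2 = 2 * (t * x\<^sup>2)" using c by (simp add: power_mult_distrib)
    then show ?thesis using c
      by (simp add: std_normal_density_def cis_conv_exp scaleR_conv_of_real)
  qed
  have isn: "integrable lborel (\<lambda>x. std_normal_density x *\<^sub>R iexp ((z / c) * x))"
  proof (rule Bochner_Integration.integrable_bound)
    show "integrable lborel std_normal_density" using integrable_std_normal_moment[of 0] by simp
  qed auto
  have vsn: "(LINT x|lborel. std_normal_density x *\<^sub>R iexp ((z / c) * x)) = complex_of_real (exp (- ((z / c)\<^sup>2) / 2))"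
    using fun_cong[OF char_std_normal_distribution, of "z / c"]
    unfolding char_def by (subst (asm) integral_density) auto
  show "integrable lborel (\<lambda>x. complex_of_real (exp (- t * x\<^sup>2)) * cis (z * x))"
    unfolding ex by (intro integrable_mult_right lborel_integrable_real_affine[OF isn]) (use c in auto)
  have "(LINT x|lborel. complex_of_real (exp (- t * x\<^sup>2)) * cis (z * x)) =
      complex_of_real (sqrt (2 * pi)) * (LINT x|lborel. (std_normal_density (0 + c * x) *\<^sub>R iexp ((z / c) * (0 + c * x))))"
    unfolding ex by (rule integral_mult_right_zero)
  also have "(LINT x|lborel. (std_normal_density (0 + c * x) *\<^sub>R iexp ((z / c) * (0 + c * x)))) =
     complex_of_real (exp (- ((z / c)\<^sup>2) / 2)) / c"
    using lborel_integral_real_affine[of c "\<lambda>x. std_normal_density x *\<^sub>R iexp ((z / c) * x)" 0] c vsn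
    by (simp add: scaleR_conv_of_real field_simps)
  finally show "(LINT x|lborel. complex_of_real (exp (- t * x\<^sup>2)) * cis (z * x)) =
      complex_of_real (sqrt (pi / t) * exp (- z\<^sup>2 / (4 * t)))"
    using c assms by (simp add: power_divide c_def real_sqrt_divide real_sqrt_mult)
qed

lemma lborel_integral_prod:
  fixes f :: "'a::euclidean_space \<Rightarrow> real \<Rightarrow> complex"
  assumes f: "\<And>b. b \<in> Basis \<Longrightarrow> integrable lborel (f b)"
  shows "integrable lborel (\<lambda>x. \<Prod>b\<in>Basis. f b (x \<bullet> b))"
    and "(LINT x|lborel. (\<Prod>b\<in>Basis. f b (x \<bullet> b))) = (\<Prod>b\<in>Basis. (LINT x|lborel. f b x))"
proof -
  interpret product_sigma_finite "\<lambda>b::'a. lborel :: real measure" ..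
  have m: "(\<lambda>x. \<Prod>b\<in>Basis. f b (x \<bullet> b)) \<in> borel_measurable borel"
    using f[THEN borel_measurable_integrable] by measurable
  have e: "(\<Prod>b\<in>Basis. f b ((\<Sum>b'\<in>Basis. x b' *\<^sub>R b') \<bullet> b)) = (\<Prod>b\<in>Basis. f b (x b))" for x :: "'a \<Rightarrow> real"
    by (intro prod.cong refl) (simp add: inner_sum_left inner_Basis if_distrib cong: if_cong)
  have T: "(\<lambda>x. \<Sum>b\<in>Basis. x b *\<^sub>R b) \<in> (\<Pi>\<^sub>M b\<in>(Basis::'a set). lborel) \<rightarrow>\<^sub>M borel"
    by measurable
  show "integrable lborel (\<lambda>x. \<Prod>b\<in>Basis. f b (x \<bullet> b))"
    unfolding lborel_eq[where 'a='a] integrable_distr_eq[OF T m] e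
    by (rule product_integrable_prod) (use f in auto)
  show "(LINT x|lborel. (\<Prod>b\<in>Basis. f b (x \<bullet> b))) = (\<Prod>b\<in>Basis. (LINT x|lborel. f b x))"
    unfolding lborel_eq[where 'a='a] integral_distr[OF T m] e
    by (rule product_integral_prod) (use f in auto)
qed

lemma gaussian_integral:
  fixes z :: "real ^ 'n"
  assumes "t > 0"
  shows "integrable lborel (\<lambda>x. complex_of_real (exp (- t * (norm x)\<^sup>2)) * cis (z \<bullet> x))"
    and "(LINT x|lborel. complex_of_real (exp (- t * (norm x)\<^sup>2)) * cis (z \<bullet> x)) =
      complex_of_real (sqrt (pi / t) ^ CARD('n) * exp (- (norm z)\<^sup>2 / (4 * t)))"
proof -
  have e: "complex_of_real (exp (- t * (norm x)\<^sup>2)) * cis (z \<bullet> x) =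
     (\<Prod>b\<in>Basis. complex_of_real (exp (- t * (x \<bullet> b)\<^sup>2)) * cis ((z \<bullet> b) * (x \<bullet> b)))" for x
  proof -
    have 1: "(norm x)\<^sup>2 = (\<Sum>b\<in>Basis. (x \<bullet> b)\<^sup>2)"
      by (subst power2_norm_eq_inner, subst euclidean_inner) (simp add: power2_eq_square)
    have 2: "cis (\<Sum>b\<in>A. g b) = (\<Prod>b\<in>A. cis (g b))" if "finite A" for A and g :: "real ^ 'n \<Rightarrow> real"
      using that by (induction A rule: finite_induct) (auto simp: cis_mult[symmetric])
    show ?thesis
      unfolding prod.distrib 2[OF finite_Basis, symmetric] euclidean_inner[of z x]
      by (simp add: 1 sum_distrib_left exp_sum flip: of_real_prod)
  qed
  have p: "(\<Prod>b\<in>(Basis::(real ^ 'n) set). exp (- (z \<bullet> b)\<^sup>2 / (4 * t))) = exp (- (norm z)\<^sup>2 / (4 * t))"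
  proof -
    have "(norm z)\<^sup>2 = (\<Sum>b\<in>Basis. (z \<bullet> b)\<^sup>2)"
      by (subst power2_norm_eq_inner, subst euclidean_inner) (simp add: power2_eq_square)
    then show ?thesis by (simp add: exp_sum[symmetric] sum_divide_distrib sum_negf)
  qed
  show "integrable lborel (\<lambda>x. complex_of_real (exp (- t * (norm x)\<^sup>2)) * cis (z \<bullet> x))"
    unfolding e by (rule lborel_integral_prod(1)) (rule gaussian_integral_1(1)[OF assms])
  show "(LINT x|lborel. complex_of_real (exp (- t * (norm x)\<^sup>2)) * cis (z \<bullet> x)) =
      complex_of_real (sqrt (pi / t) ^ CARD('n) * exp (- (norm z)\<^sup>2 / (4 * t)))"
    unfolding e
    by (subst lborel_integral_prod(2), rule gaussian_integral_1(1)[OF assms])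
       (simp only: gaussian_integral_1(2)[OF assms] prod.distrib p prod_constant of_real_mult of_real_prod[symmetric], simp)
qed

section \<open>The Fourier integral of an integrable function\<close>

text \<open>The symmetric normalisation makes the transform isometric in mean square.\<close>
definition FI :: "(real ^ 'n \<Rightarrow> real) \<Rightarrow> real ^ 'n \<Rightarrow> complex" where
  "FI f \<xi> = complex_of_real ((2 * pi) powr (- real CARD('n) / 2)) *
     (LINT x|lebesgue. complex_of_real (f x) * cis (- (x \<bullet> \<xi>)))"

text \<open>The Gauss--Weierstrass kernel.\<close>
definition heat :: "real \<Rightarrow> real ^ 'n \<Rightarrow> real" where
  "heat t z = (1 / sqrt (4 * pi * t)) ^ CARD('n) * exp (- (norm z)\<^sup>2 / (4 * t))"

text \<open>Fubini's theorem is applied to products of Borel measures, hence to Borel representatives.\<close>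
lemma lebesgue_borel_representative:
  fixes f :: "real ^ 'n \<Rightarrow> real"
  assumes "f \<in> borel_measurable lebesgue"
  obtains g where "g \<in> borel_measurable borel" "AE x in lebesgue. f x = g x"
proof -
  obtain g where "g \<in> borel_measurable lborel" "AE x in lborel. f x = g x"
    using completion_ex_borel_measurable_real[OF assms] by blast
  then show thesis using that[of g] AE_completion by auto
qed

lemma FI_cong_AE:
  fixes f :: "real ^ 'n \<Rightarrow> real"
  assumes f: "f \<in> borel_measurable lebesgue" and ae: "AE x in lebesgue. f x = g x"
  shows "FI f = FI g"
proof
  fix \<xi> :: "real ^ 'n"
  have [measurable]: "f \<in> borel_measurable lebesgue" "g \<in> borel_measurable lebesgue"
    using f lebesgue_measurable_cong_AE[OF f ae] by auto
  have c: "(\<lambda>x. cis (- (x \<bullet> \<xi>))) \<in> borel_measurable lebesgue"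
    by (intro measurable_completion) (simp add: cis_conv_exp)
  show "FI f \<xi> = FI g \<xi>" unfolding FI_def
    by (intro arg_cong[where f="(*) _"] integral_cong_AE borel_measurable_times c)
       (auto intro: eventually_mono[OF ae])
qed

lemma cis_measurable [measurable]: "cis \<in> borel_measurable borel"
  unfolding cis_conv_exp[abs_def] by measurable

lemma FI_integrand_integrable:
  assumes "integrable lebesgue f"
  shows "integrable lebesgue (\<lambda>x. complex_of_real (f x) * cis (- (x \<bullet> \<xi>)))"
proof (rule Bochner_Integration.integrable_bound[OF assms])
  have [measurable]: "f \<in> borel_measurable lebesgue" using assms by simp
  have c: "(\<lambda>x. cis (- (x \<bullet> \<xi>))) \<in> borel_measurable lebesgue"
    by (intro measurable_completion) measurable
  show "(\<lambda>x. complex_of_real (f x) * cis (- (x \<bullet> \<xi>))) \<in> borel_measurable lebesgue"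
    by (intro borel_measurable_times c) measurable
qed (auto simp: norm_mult)

lemma FI_linear:
  assumes "integrable lebesgue f" "integrable lebesgue g"
  shows "FI (\<lambda>x. a * f x + b * g x) \<xi> = of_real a * FI f \<xi> + of_real b * FI g \<xi>"
proof -
  have "(LINT x|lebesgue. complex_of_real (a * f x + b * g x) * cis (- (x \<bullet> \<xi>))) =
     (LINT x|lebesgue. of_real a * (complex_of_real (f x) * cis (- (x \<bullet> \<xi>))) + of_real b * (complex_of_real (g x) * cis (- (x \<bullet> \<xi>))))"
    by (simp add: algebra_simps)
  also have "\<dots> = of_real a * (LINT x|lebesgue. complex_of_real (f x) * cis (- (x \<bullet> \<xi>))) + of_real b * (LINT x|lebesgue. complex_of_real (g x) * cis (- (x \<bullet> \<xi>)))"
    using FI_integrand_integrable[OF assms(1)] FI_integrand_integrable[OF assms(2)] by simp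
  finally show ?thesis by (simp add: FI_def algebra_simps)
qed

lemma norm_FI_le:
  fixes f :: "real ^ 'n \<Rightarrow> real"
  shows "norm (FI f \<xi>) \<le> (2 * pi) powr (- real CARD('n) / 2) * (LINT x|lebesgue. \<bar>f x\<bar>)"
proof -
  have "norm (LINT x|lebesgue. complex_of_real (f x) * cis (- (x \<bullet> \<xi>))) \<le> (LINT x|lebesgue. \<bar>f x\<bar>)"
    using integral_norm_bound[of lebesgue "\<lambda>x. complex_of_real (f x) * cis (- (x \<bullet> \<xi>))"] by (simp add: norm_mult)
  then show ?thesis by (simp add: FI_def norm_mult mult_left_mono)
qed

lemma FI_shift:
  fixes f :: "real ^ 'n \<Rightarrow> real"
  assumes "integrable lebesgue f"
  shows "FI (\<lambda>x. f (x + h)) \<xi> = cis (h \<bullet> \<xi>) * FI f \<xi>"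
proof -
  have "(LINT x|lebesgue. complex_of_real (f (x + h)) * cis (- (x \<bullet> \<xi>))) =
    (LINT x|lebesgue. cis (h \<bullet> \<xi>) * (complex_of_real (f (x + h)) * cis (- ((x + h) \<bullet> \<xi>))))"
    by (intro Bochner_Integration.integral_cong refl) (simp add: cis_mult inner_add_left algebra_simps)
  also have "\<dots> = cis (h \<bullet> \<xi>) * (LINT x|lebesgue. (complex_of_real (f x) * cis (- (x \<bullet> \<xi>))))"
    using integral_lebesgue_shift[of "\<lambda>x. complex_of_real (f x) * cis (- (x \<bullet> \<xi>))" h] FI_integrand_integrable[OF assms, of \<xi>]
    by simp
  finally show ?thesis by (simp add: FI_def algebra_simps)
qed

lemma lborel_product_integral:
  fixes a :: "'a::euclidean_space \<Rightarrow> 'c::{real_normed_field,banach,second_countable_topology}" and b :: "'b::euclidean_space \<Rightarrow> 'c"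
  assumes a: "integrable lborel a" and b: "integrable lborel b"
  shows "integrable (lborel \<Otimes>\<^sub>M lborel) (\<lambda>p. a (fst p) * b (snd p))"
    and "(LINT p|(lborel \<Otimes>\<^sub>M lborel). a (fst p) * b (snd p)) = (LINT x|lborel. a x) * (LINT y|lborel. b y)"
proof -
  have [measurable]: "a \<in> borel_measurable borel" "b \<in> borel_measurable borel"
    using a b by (auto dest: borel_measurable_integrable)
  show i: "integrable (lborel \<Otimes>\<^sub>M lborel) (\<lambda>p. a (fst p) * b (snd p))"
  proof (rule lborel_pair.Fubini_integrable)
    show "(\<lambda>p. a (fst p) * b (snd p)) \<in> borel_measurable (lborel \<Otimes>\<^sub>M lborel)" by measurable
    show "integrable lborel (\<lambda>x. LINT y|lborel. norm (a (fst (x, y)) * b (snd (x, y))))"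
      using integrable_norm[OF a] by (simp add: norm_mult)
    show "AE x in lborel. integrable lborel (\<lambda>y. a (fst (x, y)) * b (snd (x, y)))"
      using b by simp
  qed
  show "(LINT p|(lborel \<Otimes>\<^sub>M lborel). a (fst p) * b (snd p)) = (LINT x|lborel. a x) * (LINT y|lborel. b y)"
    using lborel_pair.integral_fst'[OF i] by simp
qed

lemma fourier_const: "(2 * pi) powr (- real n / 2) = (1 / sqrt (2 * pi)) ^ n"
proof -
  have "(1 / sqrt (2 * pi)) ^ n = ((2 * pi) powr (- 1 / 2)) ^ n"
    by (simp add: powr_minus powr_half_sqrt field_simps)
  also have "\<dots> = (2 * pi) powr (- real n / 2)"
    by (simp add: powr_power)
  finally show ?thesis by simp
qed

lemma heat_const:
  assumes "t > 0"
  shows "((2 * pi) powr (- real n / 2))\<^sup>2 * sqrt (pi / t) ^ n = (1 / sqrt (4 * pi * t)) ^ n"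
proof -
  have "((2 * pi) powr (- real n / 2))\<^sup>2 * sqrt (pi / t) ^ n = ((1 / sqrt (2 * pi))\<^sup>2 * sqrt (pi / t)) ^ n"
    unfolding fourier_const by (simp add: power_mult_distrib power_mult[symmetric] mult.commute)
  also have "(1 / sqrt (2 * pi))\<^sup>2 * sqrt (pi / t) = 1 / sqrt (4 * pi * t)"
    using assms by (simp add: power_divide real_sqrt_mult real_sqrt_divide field_simps)
  finally show ?thesis .
qed

lemma FI_measurable:
  fixes f :: "real ^ 'n \<Rightarrow> real"
  assumes "f \<in> borel_measurable lebesgue"
  shows "FI f \<in> borel_measurable borel"
proof -
  obtain g where g: "g \<in> borel_measurable borel" "AE x in lebesgue. f x = g x"
    using lebesgue_borel_representative[OF assms] by blast
  note [measurable] = g(1)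
  have "FI f = FI g" by (rule FI_cong_AE[OF assms g(2)])
  also have "\<dots> = (\<lambda>\<xi>. complex_of_real ((2 * pi) powr (- real CARD('n) / 2)) *
     (LINT x|lborel. complex_of_real (g x) * cis (- (x \<bullet> \<xi>))))"
    unfolding FI_def[abs_def] by (subst integral_completion) measurable
  also have "\<dots> \<in> borel_measurable borel"
    by (intro borel_measurable_times borel_measurable_const lborel.borel_measurable_lebesgue_integral) measurable
  finally show ?thesis .
qed

text \<open>Fubini's theorem turns the pairing of two Fourier integrals against a Gaussian into
  the pairing of the functions against the heat kernel, the Gaussian being explicit.\<close>
lemma gaussian_pairing_borel:
  fixes f g :: "real ^ 'n \<Rightarrow> real"
  assumes t: "t > 0" and f: "integrable lborel f" and g: "integrable lborel g"
  shows "integrable (lborel \<Otimes>\<^sub>M lborel) (\<lambda>p. heat t (fst p - snd p) * (f (fst p) * g (snd p)))"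
    and "(LINT \<xi>|lborel. exp (- t * (norm \<xi>)\<^sup>2) * Re (FI f \<xi> * cnj (FI g \<xi>))) =
      (LINT p|(lborel \<Otimes>\<^sub>M lborel). heat t (fst p - snd p) * (f (fst p) * g (snd p)))"
proof -
  have [measurable]: "f \<in> borel_measurable borel" "g \<in> borel_measurable borel"
    using f g by (auto dest: borel_measurable_integrable)
  define c where "c = (2 * pi) powr (- real CARD('n) / 2)"
  let ?P = "lborel \<Otimes>\<^sub>M lborel :: ((real ^ 'n) \<times> (real ^ 'n)) measure"
  define F where "F p = complex_of_real (f (fst p)) * complex_of_real (g (snd p))" for p
  have FI: "FI u \<xi> = of_real c * (LINT x|lborel. complex_of_real (u x) * cis (- (x \<bullet> \<xi>)))"
    if [measurable]: "u \<in> borel_measurable borel" for u and \<xi> :: "real ^ 'n"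
    unfolding FI_def c_def by (subst integral_completion) measurable
  have iF: "integrable ?P F" unfolding F_def
    by (rule lborel_product_integral(1)) (use f g in auto)
  then have [measurable]: "F \<in> borel_measurable ?P" by simp
  have iu: "integrable lborel (\<lambda>x. complex_of_real (u x) * cis (x \<bullet> \<xi>))" if "integrable lborel u" for u \<xi>
    by (rule Bochner_Integration.integrable_bound[OF that])
       (use borel_measurable_integrable[OF that] in \<open>auto simp: norm_mult\<close>)
  have pt: "FI f \<xi> * cnj (FI g \<xi>) = of_real (c\<^sup>2) * (LINT p|?P. F p * cis ((snd p - fst p) \<bullet> \<xi>))" for \<xi>
  proof -
    have "cnj (LINT x|lborel. complex_of_real (g x) * cis (- (x \<bullet> \<xi>))) = (LINT x|lborel. complex_of_real (g x) * cis (x \<bullet> \<xi>))"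
      using Bochner_Integration.integral_cnj[of lborel "\<lambda>x. complex_of_real (g x) * cis (- (x \<bullet> \<xi>))"] by (simp add: cis_cnj)
    then have "FI f \<xi> * cnj (FI g \<xi>) = of_real (c\<^sup>2) * ((LINT x|lborel. complex_of_real (f x) * cis (- (x \<bullet> \<xi>))) *
        (LINT x|lborel. complex_of_real (g x) * cis (x \<bullet> \<xi>)))"
      by (simp add: FI power2_eq_square)
    also have "(LINT x|lborel. complex_of_real (f x) * cis (- (x \<bullet> \<xi>))) * (LINT x|lborel. complex_of_real (g x) * cis (x \<bullet> \<xi>)) =
       (LINT p|?P. (complex_of_real (f (fst p)) * cis (- (fst p \<bullet> \<xi>))) * (complex_of_real (g (snd p)) * cis (snd p \<bullet> \<xi>)))"
      by (rule lborel_product_integral(2)[symmetric]) (use iu[OF f, of "- \<xi>"] iu[OF g, of \<xi>] in auto)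
    also have "\<dots> = (LINT p|?P. F p * cis ((snd p - fst p) \<bullet> \<xi>))"
      unfolding F_def by (intro Bochner_Integration.integral_cong refl)
        (simp add: inner_diff_left cis_mult[symmetric] cis_divide[symmetric] divide_inverse cis_inverse algebra_simps)
    finally show ?thesis .
  qed
  define H where "H = (\<lambda>(p, \<xi>). F p * (complex_of_real (exp (- t * (norm \<xi>)\<^sup>2)) * cis ((snd p - fst p) \<bullet> \<xi>)))"
  have gi: "integrable lborel (\<lambda>\<xi>::real^'n. complex_of_real (exp (- t * (norm \<xi>)\<^sup>2)))"
    using gaussian_integral(1)[OF t, of 0] by simp
  interpret Q: pair_sigma_finite ?P "lborel :: (real^'n) measure"
    by (rule pair_sigma_finite.intro) (unfold lborel_prod, rule sigma_finite_lborel, rule sigma_finite_lborel)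
  have iH: "integrable (?P \<Otimes>\<^sub>M lborel) H"
  proof (rule Q.Fubini_integrable)
    show "H \<in> borel_measurable (?P \<Otimes>\<^sub>M lborel)" unfolding H_def by measurable
    show "integrable ?P (\<lambda>p. LINT \<xi>|lborel. norm (H (p, \<xi>)))"
      using integrable_norm[OF iF] unfolding H_def by (simp add: norm_mult)
    show "AE p in ?P. integrable lborel (\<lambda>\<xi>. H (p, \<xi>))"
      unfolding H_def prod.case by (intro AE_I2 integrable_mult_right gaussian_integral(1)[OF t])
  qed
  have inner: "(LINT \<xi>|lborel. H (p, \<xi>)) = of_real (sqrt (pi / t) ^ CARD('n) * exp (- (norm (fst p - snd p))\<^sup>2 / (4 * t)) * (f (fst p) * g (snd p)))" for p
    unfolding H_def prod.case integral_mult_right_zero gaussian_integral(2)[OF t] F_def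
    by (simp add: norm_minus_commute algebra_simps)
  have e: "c\<^sup>2 * (sqrt (pi / t) ^ CARD('n) * exp (- (norm (fst p - snd p))\<^sup>2 / (4 * t)) * (f (fst p) * g (snd p))) =
     heat t (fst p - snd p) * (f (fst p) * g (snd p))" for p :: "(real ^ 'n) \<times> (real ^ 'n)"
    unfolding heat_def heat_const[OF t, symmetric] c_def by simp
  have i1: "integrable ?P (\<lambda>p. sqrt (pi / t) ^ CARD('n) * exp (- (norm (fst p - snd p))\<^sup>2 / (4 * t)) * (f (fst p) * g (snd p)))"
    using integrable_Re[OF Q.integrable_fst'[OF iH]] unfolding inner by simp
  show "integrable ?P (\<lambda>p. heat t (fst p - snd p) * (f (fst p) * g (snd p)))"
    using integrable_mult_right[OF i1, of "c\<^sup>2"] unfolding e by simp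
  have "(LINT \<xi>|lborel. complex_of_real (exp (- t * (norm \<xi>)\<^sup>2)) * (FI f \<xi> * cnj (FI g \<xi>))) =
     of_real (c\<^sup>2) * (LINT \<xi>|lborel. (LINT p|?P. H (p, \<xi>)))"
    unfolding pt integral_mult_right_zero[symmetric] H_def prod.case
    by (intro Bochner_Integration.integral_cong refl) (simp add: algebra_simps)
  also have "(LINT \<xi>|lborel. (LINT p|?P. H (p, \<xi>))) = (LINT p|?P. (LINT \<xi>|lborel. H (p, \<xi>)))"
    using Q.Fubini_integral[of "\<lambda>p \<xi>. H (p, \<xi>)"] iH by simp
  also have "of_real (c\<^sup>2) * \<dots> = of_real (LINT p|?P. heat t (fst p - snd p) * (f (fst p) * g (snd p)))"
    unfolding inner integral_complex_of_real of_real_mult[symmetric]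
    by (simp only: e integral_mult_right_zero[symmetric])
  finally have main: "(LINT \<xi>|lborel. complex_of_real (exp (- t * (norm \<xi>)\<^sup>2)) * (FI f \<xi> * cnj (FI g \<xi>))) =
     of_real (LINT p|?P. heat t (fst p - snd p) * (f (fst p) * g (snd p)))" .
  have "integrable lborel (\<lambda>\<xi>. complex_of_real (exp (- t * (norm \<xi>)\<^sup>2)) * (FI f \<xi> * cnj (FI g \<xi>)))"
  proof -
    have "integrable lborel (\<lambda>\<xi>. of_real (c\<^sup>2) * (LINT p|?P. H (p, \<xi>)))"
      by (intro integrable_mult_right Q.integrable_snd) (use iH in simp)
    then show ?thesis unfolding pt integral_mult_right_zero[symmetric] H_def prod.case
      by (simp add: algebra_simps)
  qed
  then have "Re (LINT \<xi>|lborel. complex_of_real (exp (- t * (norm \<xi>)\<^sup>2)) * (FI f \<xi> * cnj (FI g \<xi>))) =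
    (LINT \<xi>|lborel. Re (complex_of_real (exp (- t * (norm \<xi>)\<^sup>2)) * (FI f \<xi> * cnj (FI g \<xi>))))"
    by (rule integral_Re[symmetric])
  then show "(LINT \<xi>|lborel. exp (- t * (norm \<xi>)\<^sup>2) * Re (FI f \<xi> * cnj (FI g \<xi>))) =
      (LINT p|?P. heat t (fst p - snd p) * (f (fst p) * g (snd p)))"
    unfolding main by (simp add: Re_complex_of_real del: mult_minus_left)
qed

lemma heat_integral:
  assumes "t > 0"
  shows "integrable lborel (heat t :: real ^ 'n \<Rightarrow> real)" "(LINT z|lborel. heat t (z :: real ^ 'n)) = 1"
proof -
  have t4: "1 / (4 * t) > 0" using assms by simp
  have e: "heat t = (\<lambda>z :: real ^ 'n. (1 / sqrt (4 * pi * t)) ^ CARD('n) * Re (complex_of_real (exp (- (1 / (4 * t)) * (norm z)\<^sup>2)) * cis (0 \<bullet> z)))"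
    by (auto simp: heat_def fun_eq_iff)
  show "integrable lborel (heat t :: real ^ 'n \<Rightarrow> real)"
    unfolding e by (intro integrable_mult_right integrable_Re gaussian_integral t4)
  show "(LINT z|lborel. heat t (z :: real ^ 'n)) = 1"
    unfolding e integral_mult_right_zero integral_Re[OF gaussian_integral(1)[OF t4]] gaussian_integral(2)[OF t4]
    using assms by (simp add: power_mult_distrib[symmetric] ac_simps)
qed

lemma lborel_integral_affine:
  fixes f :: "real ^ 'n \<Rightarrow> real"
  assumes c: "c > 0" and [measurable]: "f \<in> borel_measurable borel"
  shows "(LINT y|lborel. f y) = c ^ CARD('n) * (LINT h|lborel. f (x + c *\<^sub>R h))"
proof -
  have "(LINT y|lborel. f y) = (LINT y|density (distr lborel borel (\<lambda>h. x + c *\<^sub>R h)) (\<lambda>_. \<bar>c\<bar>^DIM(real ^ 'n)). f y)"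
    using lborel_affine[of c x] c by simp
  also have "\<dots> = c ^ CARD('n) * (LINT h|lborel. f (x + c *\<^sub>R h))"
    using c by (subst ennreal_power[symmetric] integral_density; simp add: integral_distr)
  finally show ?thesis .
qed

lemma Re_mult_cnj: "Re (z * cnj z) = (norm z)\<^sup>2"
  by (metis complex_norm_square Re_complex_of_real)

text \<open>Plancherel's identity: the Gaussian \<open>exp (- t * (norm \<xi>)\<^sup>2)\<close> increases to \<open>1\<close> as \<open>t\<close> tends to
  \<open>0\<close>, whereas the heat kernel concentrates at \<open>0\<close>, where the autocorrelation of \<open>f\<close> is continuous.\<close>
lemma plancherel_FI_borel:
  fixes f :: "real ^ 'n \<Rightarrow> real"
  assumes f: "integrable lborel f" "f \<in> L2" "f \<in> borel_measurable borel"
  shows "FI f \<in> L2" "sqn (FI f) = sqn f"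
proof -
  note [measurable] = f(3)
  have FIm[measurable]: "FI f \<in> borel_measurable borel" by (rule FI_measurable[OF L2_measurable[OF f(2)]])
  define A where "A h = (LINT x|lborel. f x * f (x + h))" for h
  have A_leb: "A h = (LINT x|lebesgue. f x * f (x + h))" for h
    unfolding A_def by (rule integral_completion[symmetric]) measurable
  have A_le: "\<bar>A h\<bar> \<le> sqn f" for h
  proof -
    have "(A h)\<^sup>2 \<le> (sqn f)\<^sup>2"
      using L2_real_Cauchy_Schwarz[OF f(2) L2_shift(1)[OF f(2), of h]] L2_shift(2)[OF f(2), of h]
      unfolding A_leb by (simp add: power2_eq_square)
    then show ?thesis using abs_le_square_iff[of "A h" "sqn f"] by simp
  qed
  have A0: "A 0 = sqn f" unfolding A_leb sqn_def by (simp add: power2_eq_square)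
  have Am[measurable]: "A \<in> borel_measurable borel"
    unfolding A_def by (rule lborel.borel_measurable_lebesgue_integral) measurable
  have A_lim: "(\<lambda>k::nat. A (h k)) \<longlonglongrightarrow> sqn f" if "h \<longlonglongrightarrow> 0" for h
  proof -
    have "(\<lambda>k. LINT x|lebesgue. f (x + h k) * f x) \<longlonglongrightarrow> (LINT x|lebesgue. f x * f x)"
      by (rule L2_inner_tendsto[OF L2_shift(1)[OF f(2)] f(2) f(2) L2_shift_tendsto[OF f(2) that]])
    then show ?thesis unfolding A_leb A0[symmetric] by (simp add: mult.commute)
  qed
  have hm[measurable]: "heat t \<in> borel_measurable borel" for t :: real unfolding heat_def by measurable
  \<comment> \<open>The time is written as \<open>s\<^sup>2\<close>, since the heat kernel at that time is the one at time \<open>1\<close> scaled by \<open>s\<close>.\<close>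
  have key: "(LINT \<xi>|lborel. exp (- s\<^sup>2 * (norm \<xi>)\<^sup>2) * (norm (FI f \<xi>))\<^sup>2) = (LINT h|lborel. heat 1 h * A (s *\<^sub>R h))"
    if s: "s > 0" for s
  proof -
    have s2: "s\<^sup>2 > 0" using s by simp
    have sc: "s ^ CARD('n) * heat (s\<^sup>2) (s *\<^sub>R h) = heat 1 h" for h :: "real ^ 'n"
    proof -
      have "heat (s\<^sup>2) (s *\<^sub>R h) = (1 / (s * sqrt (4 * pi))) ^ CARD('n) * exp (- (norm h)\<^sup>2 / 4)"
        using s by (simp add: heat_def real_sqrt_mult power_mult_distrib mult.commute)
      then show ?thesis using s by (simp add: heat_def power_mult_distrib power_divide)
    qed
    have "(LINT \<xi>|lborel. exp (- s\<^sup>2 * (norm \<xi>)\<^sup>2) * (norm (FI f \<xi>))\<^sup>2) =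
       (LINT \<xi>|lborel. exp (- s\<^sup>2 * (norm \<xi>)\<^sup>2) * Re (FI f \<xi> * cnj (FI f \<xi>)))"
      by (simp only: Re_mult_cnj)
    also have "\<dots> = (LINT p|(lborel \<Otimes>\<^sub>M lborel). heat (s\<^sup>2) (fst p - snd p) * (f (fst p) * f (snd p)))"
      by (rule gaussian_pairing_borel(2)[OF s2 f(1) f(1)])
    also have "\<dots> = (LINT x|lborel. (LINT y|lborel. heat (s\<^sup>2) (x - y) * (f x * f y)))"
      using lborel_pair.integral_fst'[OF gaussian_pairing_borel(1)[OF s2 f(1) f(1)]] by simp
    also have "\<dots> = (LINT x|lborel. (LINT h|lborel. heat 1 h * (f x * f (x + s *\<^sub>R h))))"
    proof (rule Bochner_Integration.integral_cong[OF refl])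
      fix x
      have "(LINT y|lborel. heat (s\<^sup>2) (x - y) * (f x * f y)) =
         s ^ CARD('n) * (LINT h|lborel. heat (s\<^sup>2) (x - (x + s *\<^sub>R h)) * (f x * f (x + s *\<^sub>R h)))"
        by (rule lborel_integral_affine[OF s]) measurable
      also have "\<dots> = (LINT h|lborel. (s ^ CARD('n) * heat (s\<^sup>2) (s *\<^sub>R h)) * (f x * f (x + s *\<^sub>R h)))"
        by (subst integral_mult_right_zero[symmetric]) (simp add: heat_def mult.assoc)
      finally show "(LINT y|lborel. heat (s\<^sup>2) (x - y) * (f x * f y)) = (LINT h|lborel. heat 1 h * (f x * f (x + s *\<^sub>R h)))"
        by (simp only: sc)
    qed
    also have "\<dots> = (LINT h|lborel. (LINT x|lborel. heat 1 h * (f x * f (x + s *\<^sub>R h))))"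
    proof (rule lborel_pair.Fubini_integral[symmetric])
      have "integrable (lborel \<Otimes>\<^sub>M lborel) (\<lambda>(h, x). heat 1 h * (f x * f (x + s *\<^sub>R h)))"
      proof (rule lborel_pair.Fubini_integrable)
        have ip: "integrable lborel (\<lambda>x. f x * f (x + s *\<^sub>R h))" for h
          using L2_real_product_integrable[OF f(2) L2_shift(1)[OF f(2)], of "s *\<^sub>R h"]
          by (subst (asm) integrable_completion) auto
        show "integrable lborel (\<lambda>h. LINT x|lborel. norm ((\<lambda>(h, x). heat 1 h * (f x * f (x + s *\<^sub>R h))) (h, x)))"
        proof (rule Bochner_Integration.integrable_bound)
          show "integrable lborel (\<lambda>h::real^'n. heat 1 h * sqn f)" using heat_integral(1)[where 'n='n, of 1] by simp
          show "AE h in lborel. norm (LINT x|lborel. norm ((\<lambda>(h, x). heat 1 h * (f x * f (x + s *\<^sub>R h))) (h, x))) \<le> norm (heat 1 h * sqn f)"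
          proof (rule AE_I2)
            fix h :: "real ^ 'n"
            have h0: "0 \<le> heat 1 h" by (simp add: heat_def)
            have "(LINT x|lebesgue. norm (f x) * norm (f (x + s *\<^sub>R h)))\<^sup>2 \<le> (sqn f)\<^sup>2"
              using L2_Cauchy_Schwarz[OF f(2) L2_shift(1)[OF f(2), of "s *\<^sub>R h"]] L2_shift(2)[OF f(2), of "s *\<^sub>R h"]
              by (simp add: power2_eq_square)
            then have "(LINT x|lebesgue. norm (f x) * norm (f (x + s *\<^sub>R h))) \<le> sqn f"
              by (rule power2_le_imp_le) simp
            also have "(LINT x|lebesgue. norm (f x) * norm (f (x + s *\<^sub>R h))) = (LINT x|lborel. norm (f x) * norm (f (x + s *\<^sub>R h)))"
              by (rule integral_completion) measurable
            finally have "(LINT x|lborel. norm (f x) * norm (f (x + s *\<^sub>R h))) \<le> sqn f" .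
            then show "norm (LINT x|lborel. norm ((\<lambda>(h, x). heat 1 h * (f x * f (x + s *\<^sub>R h))) (h, x))) \<le> norm (heat 1 h * sqn f)"
              using h0 by (simp add: abs_mult mult_left_mono)
          qed
        qed measurable
        show "AE h in lborel. integrable lborel (\<lambda>x. (\<lambda>(h, x). heat 1 h * (f x * f (x + s *\<^sub>R h))) (h, x))"
          using ip by simp
      qed measurable
      then have "integrable (lborel \<Otimes>\<^sub>M lborel) (\<lambda>(x, h). (\<lambda>(h, x). heat 1 h * (f x * f (x + s *\<^sub>R h))) (h, x))"
        by (rule lborel_pair.integrable_product_swap)
      then show "integrable (lborel \<Otimes>\<^sub>M lborel) (\<lambda>(x, h). heat 1 h * (f x * f (x + s *\<^sub>R h)))" by simp
    qed
    also have "\<dots> = (LINT h|lborel. heat 1 h * A (s *\<^sub>R h))" unfolding A_def by simp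
    finally show ?thesis .
  qed
  define s where "s k = inverse (real (Suc k))" for k
  have s: "s k > 0" "s \<longlonglongrightarrow> 0" "s (Suc k) \<le> s k" for k
    unfolding s_def using LIMSEQ_inverse_real_of_nat by (auto simp: field_simps)
  have "(\<lambda>k. LINT h|lborel. heat 1 h * A (s k *\<^sub>R h)) \<longlonglongrightarrow> (LINT h::real^'n|lborel. heat 1 h * sqn f)"
  proof (rule integral_dominated_convergence[where w="\<lambda>h. heat 1 h * sqn f"])
    show "integrable lborel (\<lambda>h::real^'n. heat 1 h * sqn f)" using heat_integral(1)[where 'n='n, of 1] by simp
    show "AE h in lborel. (\<lambda>k. heat 1 h * A (s k *\<^sub>R h)) \<longlonglongrightarrow> heat 1 h * sqn f"
    proof (rule AE_I2)
      fix h :: "real ^ 'n"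
      have "(\<lambda>k. s k *\<^sub>R h) \<longlonglongrightarrow> 0 *\<^sub>R h" by (intro tendsto_intros s)
      then show "(\<lambda>k. heat 1 h * A (s k *\<^sub>R h)) \<longlonglongrightarrow> heat 1 h * sqn f"
        by (intro tendsto_mult tendsto_const A_lim) simp
    qed
    show "AE h in lborel. norm (heat 1 h * A (s k *\<^sub>R h)) \<le> heat 1 h * sqn f" for k
      using A_le by (auto intro!: AE_I2 mult_left_mono simp: abs_mult heat_def)
  qed measurable
  then have lim: "(\<lambda>k. (LINT \<xi>|lborel. exp (- (s k)\<^sup>2 * (norm \<xi>)\<^sup>2) * (norm (FI f \<xi>))\<^sup>2)) \<longlonglongrightarrow> sqn f"
    using heat_integral(2)[where 'n='n, of 1] by (simp only: key[OF s(1)] integral_mult_left_zero) simp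
  have bnd: "integrable lborel (\<lambda>\<xi>. exp (- (s k)\<^sup>2 * (norm \<xi>)\<^sup>2) * (norm (FI f \<xi>))\<^sup>2)" for k
  proof (rule Bochner_Integration.integrable_bound)
    define C where "C = (2 * pi) powr (- real CARD('n) / 2) * (LINT x|lebesgue. \<bar>f x\<bar>)"
    have sp: "(s k)\<^sup>2 > 0" using s(1)[of k] by simp
    show "integrable lborel (\<lambda>\<xi>::real^'n. norm (complex_of_real (exp (- (s k)\<^sup>2 * (norm \<xi>)\<^sup>2)) * cis (0 \<bullet> \<xi>)) * C\<^sup>2)"
      by (intro integrable_mult_left integrable_norm gaussian_integral(1)[OF sp])
    show "AE \<xi> in lborel. norm (exp (- (s k)\<^sup>2 * (norm \<xi>)\<^sup>2) * (norm (FI f \<xi>))\<^sup>2) \<le>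
        norm (norm (complex_of_real (exp (- (s k)\<^sup>2 * (norm \<xi>)\<^sup>2)) * cis (0 \<bullet> \<xi>)) * C\<^sup>2)"
      using norm_FI_le[of f] unfolding C_def[symmetric]
      by (intro AE_I2) (auto simp: norm_mult intro!: mult_left_mono power_mono)
  qed measurable
  have mc: "AE \<xi> in lborel. mono (\<lambda>k. exp (- (s k)\<^sup>2 * (norm \<xi>)\<^sup>2) * (norm (FI f \<xi>))\<^sup>2)"
  proof (rule AE_I2)
    fix \<xi> :: "real ^ 'n"
    have "(s (Suc k))\<^sup>2 \<le> (s k)\<^sup>2" for k using s(3)[of k] s(1)[of "Suc k"] by (intro power_mono) auto
    then show "mono (\<lambda>k. exp (- (s k)\<^sup>2 * (norm \<xi>)\<^sup>2) * (norm (FI f \<xi>))\<^sup>2)"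
      by (auto simp: mono_iff_le_Suc intro!: mult_right_mono)
  qed
  have pl: "AE \<xi> in lborel. (\<lambda>k. exp (- (s k)\<^sup>2 * (norm \<xi>)\<^sup>2) * (norm (FI f \<xi>))\<^sup>2) \<longlonglongrightarrow> (norm (FI f \<xi>))\<^sup>2"
  proof (rule AE_I2)
    fix \<xi> :: "real ^ 'n"
    have "(\<lambda>k. exp (- (s k)\<^sup>2 * (norm \<xi>)\<^sup>2) * (norm (FI f \<xi>))\<^sup>2) \<longlonglongrightarrow> exp (- 0\<^sup>2 * (norm \<xi>)\<^sup>2) * (norm (FI f \<xi>))\<^sup>2"
      by (intro tendsto_intros s)
    then show "(\<lambda>k. exp (- (s k)\<^sup>2 * (norm \<xi>)\<^sup>2) * (norm (FI f \<xi>))\<^sup>2) \<longlonglongrightarrow> (norm (FI f \<xi>))\<^sup>2" by simp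
  qed
  have m: "(\<lambda>\<xi>. (norm (FI f \<xi>))\<^sup>2) \<in> borel_measurable lborel" by measurable
  have i: "integrable lborel (\<lambda>\<xi>. (norm (FI f \<xi>))\<^sup>2)"
    by (rule integrable_monotone_convergence[OF bnd mc pl lim m])
  have v: "(LINT \<xi>|lborel. (norm (FI f \<xi>))\<^sup>2) = sqn f"
    by (rule integral_monotone_convergence[OF bnd mc pl lim m])
  show "FI f \<in> L2" using i FIm by (simp add: L2_def measurable_completion integrable_completion)
  show "sqn (FI f) = sqn f" using v by (simp add: sqn_def integral_completion)
qed

lemma plancherel_FI:
  assumes "integrable lebesgue f" "f \<in> L2"
  shows "FI f \<in> L2" "sqn (FI f) = sqn f"
proof -
  have fm: "f \<in> borel_measurable lebesgue" using assms by simp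
  obtain g where g: "g \<in> borel_measurable borel" "AE x in lebesgue. f x = g x"
    using lebesgue_borel_representative[OF fm] by blast
  have 1: "FI f = FI g" by (rule FI_cong_AE[OF fm g(2)])
  have gm: "g \<in> borel_measurable lebesgue" using g(1) by (simp add: measurable_completion)
  have "integrable lebesgue g" using integrable_cong_AE[OF fm gm g(2)] assms(1) by simp
  then have 2: "integrable lborel g" using g(1) by (simp add: integrable_completion)
  have 3: "g \<in> L2" "sqn g = sqn f" using L2_cong_AE[OF assms(2) g(2)] by auto
  show "FI f \<in> L2" "sqn (FI f) = sqn f" using plancherel_FI_borel[OF 2 3(1) g(1)] 1 3(2) by auto
qed

section \<open>The Fourier--Plancherel transform\<close>

lemma L2_indicator_integrable:
  fixes u :: "real ^ 'n \<Rightarrow> real"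
  assumes "u \<in> L2" "bounded S" "S \<in> sets lebesgue"
  shows "integrable lebesgue (\<lambda>x. indicator S x * u x)"
proof -
  obtain r where r: "S \<subseteq> cball 0 r" using assms(2) by (metis bounded_iff mem_cball_0 subsetI)
  have "(indicator S :: real ^ 'n \<Rightarrow> real) \<in> L2"
    by (rule L2_bounded_support[of _ 1 r]) (use r assms in \<open>auto simp: indicator_def\<close>)
  then show ?thesis by (rule L2_real_product_integrable) (rule assms(1))
qed

lemma L2_bounded_support_integrable:
  fixes u :: "real ^ 'n \<Rightarrow> real"
  assumes "u \<in> L2" "bounded S" "S \<in> sets lebesgue" "AE x in lebesgue. x \<notin> S \<longrightarrow> u x = 0"
  shows "integrable lebesgue u"
proof -
  have e: "AE x in lebesgue. indicator S x * u x = u x"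
    by (rule eventually_mono[OF assms(4)]) (auto simp: indicator_def)
  note i = L2_indicator_integrable[OF assms(1-3)]
  show ?thesis using integrable_cong_AE[OF borel_measurable_integrable[OF i] L2_measurable[OF assms(1)] e] i by simp
qed

definition trunc :: "real \<Rightarrow> (real ^ 'n \<Rightarrow> real) \<Rightarrow> real ^ 'n \<Rightarrow> real" where
  "trunc R u x = indicator (cball 0 R) x * u x"

lemma trunc_fourier_eq_FI:
  fixes u :: "real ^ 'n \<Rightarrow> real"
  shows "trunc_fourier R u = FI (trunc R u)"
proof
  fix \<xi> :: "real ^ 'n"
  have "(LINT x:cball (0::real^'n) R|lebesgue. complex_of_real (u x) * cis (- (x \<bullet> \<xi>))) =
    (LINT x|lebesgue. complex_of_real (indicator (cball 0 R) x * u x) * cis (- (x \<bullet> \<xi>)))"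
    unfolding set_lebesgue_integral_def
    by (intro Bochner_Integration.integral_cong refl) (auto simp: indicator_def)
  then show "trunc_fourier R u \<xi> = FI (trunc R u) \<xi>"
    unfolding trunc_fourier_def FI_def trunc_def by simp
qed

lemma trunc_L2:
  fixes u :: "real ^ 'n \<Rightarrow> real"
  assumes "u \<in> L2"
  shows "trunc R u \<in> L2" "integrable lebesgue (trunc R u)"
  using L2_indicator[OF assms cball_in_lebesgue] L2_indicator_integrable[OF assms bounded_cball cball_in_lebesgue]
  unfolding trunc_def[abs_def] by auto

lemma FI_trunc_L2:
  fixes u :: "real ^ 'n \<Rightarrow> real"
  assumes "u \<in> L2" shows "FI (trunc R u) \<in> L2"
  using plancherel_FI(1) trunc_L2[OF assms] by blast

lemma trunc_tendsto:
  fixes u :: "real ^ 'n \<Rightarrow> real"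
  assumes "u \<in> L2"
  shows "((\<lambda>R. sqn (\<lambda>x. trunc R u x - u x)) \<longlongrightarrow> 0) at_top"
proof (rule tendsto_at_topI_sequentially)
  fix X :: "nat \<Rightarrow> real" assume X: "filterlim X at_top sequentially"
  have uL: "(\<lambda>x. \<bar>u x\<bar>) \<in> L2" using assms by (rule L2_dominated(1)) (use L2_measurable[OF assms] in auto)
  show "(\<lambda>k. sqn (\<lambda>x. trunc (X k) u x - u x)) \<longlonglongrightarrow> 0"
  proof (rule L2_dominated_convergence(3)[OF uL L2_measurable[OF assms] L2_measurable[OF trunc_L2(1)[OF assms]]])
    show "AE x::real^'n in lebesgue. norm (trunc (X k) u x) \<le> \<bar>u x\<bar>" for k
      by (auto simp: trunc_def indicator_def)
    show "AE x::real^'n in lebesgue. (\<lambda>k. trunc (X k) u x) \<longlonglongrightarrow> u x"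
    proof (rule AE_I2)
      fix x :: "real ^ 'n"
      have "\<forall>\<^sub>F k in sequentially. X k \<ge> norm x" using X by (simp add: filterlim_at_top)
      then show "(\<lambda>k. trunc (X k) u x) \<longlonglongrightarrow> u x"
        by (intro tendsto_eventually) (auto elim!: eventually_mono simp: trunc_def indicator_def)
    qed
  qed
qed

lemma sqn_FI_diff:
  fixes f g :: "real ^ 'n \<Rightarrow> real"
  assumes f: "f \<in> L2" "integrable lebesgue f" and g: "g \<in> L2" "integrable lebesgue g"
  shows "sqn (\<lambda>\<xi>. FI f \<xi> - FI g \<xi>) = sqn (\<lambda>x. f x - g x)"
proof -
  have "(\<lambda>\<xi>. FI f \<xi> - FI g \<xi>) = FI (\<lambda>x. f x - g x)"
    using FI_linear[OF f(2) g(2), of 1 "-1"] by (auto simp: fun_eq_iff)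
  then show ?thesis using plancherel_FI(2)[of "\<lambda>x. f x - g x"] L2_diff[OF f(1) g(1)] f g by simp
qed

lemma has_fourier_iff:
  fixes u :: "real ^ 'n \<Rightarrow> real"
  shows "has_fourier u v \<longleftrightarrow> u \<in> L2 \<and> v \<in> L2 \<and> ((\<lambda>R. sqn (\<lambda>\<xi>. FI (trunc R u) \<xi> - v \<xi>)) \<longlongrightarrow> 0) at_top"
proof (cases "u \<in> L2 \<and> v \<in> L2")
  case True
  have "(\<integral>\<^sup>+ \<xi>. ennreal ((norm (v \<xi> - trunc_fourier R u \<xi>))\<^sup>2) \<partial>lebesgue) = ennreal (sqn (\<lambda>\<xi>. FI (trunc R u) \<xi> - v \<xi>))" for R
    unfolding sqn_commute[of _ v] trunc_fourier_eq_FI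
    using nn_integral_eq_integral[OF L2_integrable[OF L2_diff[OF conjunct2[OF True] FI_trunc_L2[OF conjunct1[OF True]]]]]
    by (simp add: sqn_def)
  then have "has_fourier u v \<longleftrightarrow> ((\<lambda>R. ennreal (sqn (\<lambda>\<xi>. FI (trunc R u) \<xi> - v \<xi>))) \<longlongrightarrow> ennreal 0) at_top"
    using True by (simp add: has_fourier_def)
  also have "\<dots> \<longleftrightarrow> ((\<lambda>R. sqn (\<lambda>\<xi>. FI (trunc R u) \<xi> - v \<xi>)) \<longlongrightarrow> 0) at_top"
    by (rule tendsto_ennreal_iff) auto
  finally show ?thesis using True by simp
qed (auto simp: has_fourier_def)

lemma has_fourier_L2: "has_fourier u v \<Longrightarrow> u \<in> L2" "has_fourier u v \<Longrightarrow> v \<in> L2"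
  by (auto simp: has_fourier_def)

text \<open>The transforms of the truncations form a Cauchy sequence along integer radii because their distances
  are those of the truncations. The same isometry controls the remaining radii.\<close>
lemma has_fourier_exists:
  fixes u :: "real ^ 'n \<Rightarrow> real"
  assumes u: "u \<in> L2"
  shows "\<exists>v. has_fourier u v"
proof -
  note tu = trunc_L2[OF u]
  have d: "sqn (\<lambda>\<xi>. FI (trunc R u) \<xi> - FI (trunc S u) \<xi>) \<le> 2 * sqn (\<lambda>x. trunc R u x - u x) + 2 * sqn (\<lambda>x. trunc S u x - u x)" for R S
    unfolding sqn_FI_diff[OF tu tu] using sqn_triangle[OF tu(1) u tu(1), of R S] sqn_commute[of u "trunc S u"] by simp
  have small: "\<exists>K. \<forall>R\<ge>K. sqn (\<lambda>x. trunc R u x - u x) < e" if "e > 0" for e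
    using order_tendstoD(2)[OF trunc_tendsto[OF u] that] by (simp add: eventually_at_top_linorder)
  have "\<exists>v\<in>L2. (\<lambda>k::nat. sqn (\<lambda>\<xi>. FI (trunc (real k) u) \<xi> - v \<xi>)) \<longlonglongrightarrow> 0"
  proof (rule L2_complete[OF FI_trunc_L2[OF u]])
    fix e :: real assume "e > 0"
    then obtain K where K: "\<And>R. R \<ge> K \<Longrightarrow> sqn (\<lambda>x. trunc R u x - u x) < e / 4" using small[of "e/4"] by auto
    obtain n :: nat where n: "K \<le> real n" using real_arch_simple by blast
    have "sqn (\<lambda>\<xi>. FI (trunc (real k) u) \<xi> - FI (trunc (real l) u) \<xi>) < e" if "k \<ge> n" "l \<ge> n" for k l
      using d[of "real k" "real l"] K[of "real k"] K[of "real l"] n that by linarith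
    then show "\<exists>K. \<forall>k\<ge>K. \<forall>l\<ge>K. sqn (\<lambda>\<xi>. FI (trunc (real k) u) \<xi> - FI (trunc (real l) u) \<xi>) < e" by blast
  qed
  then obtain v where v: "v \<in> L2" "(\<lambda>k::nat. sqn (\<lambda>\<xi>. FI (trunc (real k) u) \<xi> - v \<xi>)) \<longlonglongrightarrow> 0" by blast
  have le: "sqn (\<lambda>\<xi>. FI (trunc R u) \<xi> - v \<xi>) \<le> 4 * sqn (\<lambda>x. trunc R u x - u x)" for R
  proof (rule tendsto_lowerbound)
    have "(\<lambda>k. 2 * (2 * sqn (\<lambda>x. trunc R u x - u x) + 2 * sqn (\<lambda>x. trunc (real k) u x - u x)) + 2 * sqn (\<lambda>\<xi>. FI (trunc (real k) u) \<xi> - v \<xi>))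
       \<longlonglongrightarrow> 2 * (2 * sqn (\<lambda>x. trunc R u x - u x) + 2 * 0) + 2 * 0"
      by (intro tendsto_intros v filterlim_compose[OF trunc_tendsto[OF u]] filterlim_real_sequentially)
    then show "(\<lambda>k. 2 * (2 * sqn (\<lambda>x. trunc R u x - u x) + 2 * sqn (\<lambda>x. trunc (real k) u x - u x)) + 2 * sqn (\<lambda>\<xi>. FI (trunc (real k) u) \<xi> - v \<xi>)) \<longlonglongrightarrow> 4 * sqn (\<lambda>x. trunc R u x - u x)"
      by simp
    show "\<forall>\<^sub>F k in sequentially. sqn (\<lambda>\<xi>. FI (trunc R u) \<xi> - v \<xi>) \<le>
        2 * (2 * sqn (\<lambda>x. trunc R u x - u x) + 2 * sqn (\<lambda>x. trunc (real k) u x - u x)) + 2 * sqn (\<lambda>\<xi>. FI (trunc (real k) u) \<xi> - v \<xi>)"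
    proof (rule always_eventually, rule allI)
      fix k
      show "sqn (\<lambda>\<xi>. FI (trunc R u) \<xi> - v \<xi>) \<le>
        2 * (2 * sqn (\<lambda>x. trunc R u x - u x) + 2 * sqn (\<lambda>x. trunc (real k) u x - u x)) + 2 * sqn (\<lambda>\<xi>. FI (trunc (real k) u) \<xi> - v \<xi>)"
        by (rule order_trans[OF sqn_triangle[OF FI_trunc_L2[OF u] FI_trunc_L2[OF u] v(1), of R "real k"]])
          (intro add_right_mono mult_left_mono d, simp)
    qed
  qed simp
  have "((\<lambda>R. sqn (\<lambda>\<xi>. FI (trunc R u) \<xi> - v \<xi>)) \<longlongrightarrow> 0) at_top"
  proof (rule tendsto_sandwich[OF _ _ tendsto_const])
    show "((\<lambda>R. 4 * sqn (\<lambda>x. trunc R u x - u x)) \<longlongrightarrow> 0) at_top"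
      using tendsto_mult_right_zero[OF trunc_tendsto[OF u], of 4] .
  qed (use le in auto)
  then show ?thesis using u v(1) has_fourier_iff by blast
qed

lemma has_fourier_sqn:
  fixes u :: "real ^ 'n \<Rightarrow> real"
  assumes "has_fourier u v" shows "sqn v = sqn u"
proof -
  note * = assms[unfolded has_fourier_iff]
  have "((\<lambda>R. sqn (FI (trunc R u))) \<longlongrightarrow> sqn v) at_top"
    by (rule sqn_tendsto) (use * FI_trunc_L2 in auto)
  moreover have "((\<lambda>R. sqn (trunc R u)) \<longlongrightarrow> sqn u) at_top"
    by (rule sqn_tendsto) (use * trunc_L2 trunc_tendsto in auto)
  moreover have "sqn (FI (trunc R u)) = sqn (trunc R u)" for R
    using plancherel_FI(2)[of "trunc R u"] trunc_L2 * by blast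
  ultimately show ?thesis using tendsto_unique[of "at_top :: real filter"] by simp
qed

lemma has_fourier_linear:
  fixes u w :: "real ^ 'n \<Rightarrow> real"
  assumes "has_fourier u v" "has_fourier w z"
  shows "has_fourier (\<lambda>x. a * u x + b * w x) (\<lambda>\<xi>. of_real a * v \<xi> + of_real b * z \<xi>)"
proof -
  note 1 = assms(1)[unfolded has_fourier_iff] and 2 = assms(2)[unfolded has_fourier_iff]
  have L: "(\<lambda>x. a * u x + b * w x) \<in> L2" using 1 2 L2_cmult(1) by (intro L2_add) auto
  have sc: "(\<lambda>\<xi>. of_real c * q \<xi>) \<in> L2 \<and> sqn (\<lambda>\<xi>. of_real c * q \<xi>) = c\<^sup>2 * sqn q" if "q \<in> L2" for c and q :: "real ^ 'n \<Rightarrow> complex"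
    using L2_scaleR[OF that, of c] by (simp add: scaleR_conv_of_real)
  have L': "(\<lambda>\<xi>. of_real a * v \<xi> + of_real b * z \<xi>) \<in> L2"
    using 1 2 sc by (intro L2_add) auto
  have "trunc R (\<lambda>x. a * u x + b * w x) = (\<lambda>x. a * trunc R u x + b * trunc R w x)" for R
    by (auto simp: trunc_def algebra_simps)
  then have F: "FI (trunc R (\<lambda>x. a * u x + b * w x)) \<xi> = of_real a * FI (trunc R u) \<xi> + of_real b * FI (trunc R w) \<xi>" for R \<xi>
    using FI_linear[OF trunc_L2(2) trunc_L2(2), of u w a R b R] 1 2 by simp
  have le: "sqn (\<lambda>\<xi>. FI (trunc R (\<lambda>x. a * u x + b * w x)) \<xi> - (of_real a * v \<xi> + of_real b * z \<xi>))
    \<le> 2 * (a\<^sup>2 * sqn (\<lambda>\<xi>. FI (trunc R u) \<xi> - v \<xi>)) + 2 * (b\<^sup>2 * sqn (\<lambda>\<xi>. FI (trunc R w) \<xi> - z \<xi>))" for R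
  proof -
    have d1: "(\<lambda>\<xi>. FI (trunc R u) \<xi> - v \<xi>) \<in> L2" and d2: "(\<lambda>\<xi>. FI (trunc R w) \<xi> - z \<xi>) \<in> L2"
      using 1 2 FI_trunc_L2 by (auto intro!: L2_diff)
    have "(\<lambda>\<xi>. FI (trunc R (\<lambda>x. a * u x + b * w x)) \<xi> - (of_real a * v \<xi> + of_real b * z \<xi>)) =
       (\<lambda>\<xi>. of_real a * (FI (trunc R u) \<xi> - v \<xi>) + of_real b * (FI (trunc R w) \<xi> - z \<xi>))"
      unfolding F by (auto simp: algebra_simps)
    then show ?thesis
      using sqn_add_le[OF conjunct1[OF sc[OF d1, of a]] conjunct1[OF sc[OF d2, of b]]] sc[OF d1, of a] sc[OF d2, of b] by simp
  qed
  have "((\<lambda>R. 2 * (a\<^sup>2 * sqn (\<lambda>\<xi>. FI (trunc R u) \<xi> - v \<xi>)) + 2 * (b\<^sup>2 * sqn (\<lambda>\<xi>. FI (trunc R w) \<xi> - z \<xi>))) \<longlongrightarrow> 2 * (a\<^sup>2 * 0) + 2 * (b\<^sup>2 * 0)) at_top"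
    using 1 2 by (intro tendsto_intros) auto
  then have lim: "((\<lambda>R. 2 * (a\<^sup>2 * sqn (\<lambda>\<xi>. FI (trunc R u) \<xi> - v \<xi>)) + 2 * (b\<^sup>2 * sqn (\<lambda>\<xi>. FI (trunc R w) \<xi> - z \<xi>))) \<longlongrightarrow> 0) at_top"
    by simp
  have "((\<lambda>R. sqn (\<lambda>\<xi>. FI (trunc R (\<lambda>x. a * u x + b * w x)) \<xi> - (of_real a * v \<xi> + of_real b * z \<xi>))) \<longlongrightarrow> 0) at_top"
    by (rule tendsto_sandwich[OF _ _ tendsto_const lim]) (use le in auto)
  then show ?thesis using L L' has_fourier_iff by blast
qed

lemma has_fourier_add: "has_fourier u v \<Longrightarrow> has_fourier w z \<Longrightarrow> has_fourier (\<lambda>x. u x + w x) (\<lambda>\<xi>. v \<xi> + z \<xi>)"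
  using has_fourier_linear[of u v w z 1 1] by simp

lemma has_fourier_diff: "has_fourier u v \<Longrightarrow> has_fourier w z \<Longrightarrow> has_fourier (\<lambda>x. u x - w x) (\<lambda>\<xi>. v \<xi> - z \<xi>)"
  using has_fourier_linear[of u v w z 1 "-1"] by simp

lemma has_fourier_cmult: "has_fourier u v \<Longrightarrow> has_fourier (\<lambda>x. a * u x) (\<lambda>\<xi>. of_real a * v \<xi>)"
  using has_fourier_linear[of u v u v a 0] by simp

lemma has_fourier_zero: "has_fourier (\<lambda>x. 0 :: real) (\<lambda>\<xi>. 0)"
proof -
  obtain v where "has_fourier (\<lambda>x::real^'a. 0) v" using has_fourier_exists[OF L2_zero(1)] by blast
  from has_fourier_cmult[OF this, of 0] show ?thesis by simp
qed

lemma has_fourier_sum: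
  assumes "finite I" "\<And>i. i \<in> I \<Longrightarrow> has_fourier (u i) (v i)"
  shows "has_fourier (\<lambda>x. \<Sum>i\<in>I. u i x) (\<lambda>\<xi>. \<Sum>i\<in>I. v i \<xi>)"
  using assms by (induction rule: finite_induct) (auto intro: has_fourier_add has_fourier_zero)

lemma has_fourier_unique:
  fixes u :: "real ^ 'n \<Rightarrow> real"
  assumes "has_fourier u v" "has_fourier u w" shows "AE \<xi> in lebesgue. v \<xi> = w \<xi>"
proof -
  have h: "has_fourier (\<lambda>x. 0 :: real) (\<lambda>\<xi>. v \<xi> - w \<xi>)" using has_fourier_diff[OF assms] by simp
  have "sqn (\<lambda>\<xi>. v \<xi> - w \<xi>) = 0" using has_fourier_sqn[OF h] L2_zero(2) by simp
  then show ?thesis using sqn_eq_0D[OF has_fourier_L2(2)[OF h]] by simp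
qed

lemma has_fourier_cong:
  fixes u :: "real ^ 'n \<Rightarrow> real"
  assumes h: "has_fourier u v" and u: "AE x in lebesgue. u x = u' x" and v: "AE \<xi> in lebesgue. v \<xi> = v' \<xi>"
  shows "has_fourier u' v'"
proof -
  note * = h[unfolded has_fourier_iff]
  have L: "u' \<in> L2" "v' \<in> L2" using L2_cong_AE(1)[OF _ u] L2_cong_AE(1)[OF _ v] * by auto
  have "FI (trunc R u') = FI (trunc R u)" for R
  proof (rule FI_cong_AE[symmetric])
    show "trunc R u \<in> borel_measurable lebesgue" using trunc_L2(1) * L2_measurable by blast
    show "AE x in lebesgue. trunc R u x = trunc R u' x"
      by (rule eventually_mono[OF u]) (simp add: trunc_def)
  qed
  moreover have "sqn (\<lambda>\<xi>. FI (trunc R u) \<xi> - v' \<xi>) = sqn (\<lambda>\<xi>. FI (trunc R u) \<xi> - v \<xi>)" for R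
    by (rule L2_cong_AE(2)) (use * FI_trunc_L2 in \<open>auto intro: L2_diff eventually_mono[OF v]\<close>)
  ultimately show ?thesis using * L by (simp add: has_fourier_iff)
qed

lemma has_fourier_FI:
  fixes u :: "real ^ 'n \<Rightarrow> real"
  assumes u: "u \<in> L2" "integrable lebesgue u"
  shows "has_fourier u (FI u)"
proof -
  have "sqn (\<lambda>\<xi>. FI (trunc R u) \<xi> - FI u \<xi>) = sqn (\<lambda>x. trunc R u x - u x)" for R
    by (rule sqn_FI_diff) (use u trunc_L2 in auto)
  then show ?thesis using u plancherel_FI(1)[OF u(2,1)] trunc_tendsto[OF u(1)] by (simp add: has_fourier_iff)
qed

lemma has_fourier_sqn_diff:
  fixes u :: "real ^ 'n \<Rightarrow> real"
  assumes "\<And>k. has_fourier (f k) (g k)" "has_fourier u v"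
  shows "sqn (\<lambda>\<xi>. g k \<xi> - v \<xi>) = sqn (\<lambda>x. f k x - u x)"
  by (rule has_fourier_sqn[OF has_fourier_diff[OF assms]])

lemma has_fourier_closed:
  fixes u :: "real ^ 'n \<Rightarrow> real"
  assumes f: "\<And>k::nat. has_fourier (f k) (g k)" and u: "u \<in> L2" and v: "v \<in> L2"
    and fu: "(\<lambda>k. sqn (\<lambda>x. f k x - u x)) \<longlonglongrightarrow> 0" and gv: "(\<lambda>k. sqn (\<lambda>\<xi>. g k \<xi> - v \<xi>)) \<longlonglongrightarrow> 0"
  shows "has_fourier u v"
proof -
  obtain w where w: "has_fourier u w" using has_fourier_exists[OF u] by blast
  have gw: "(\<lambda>k. sqn (\<lambda>\<xi>. g k \<xi> - w \<xi>)) \<longlonglongrightarrow> 0"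
    using fu has_fourier_sqn_diff[of f g, OF f w] by simp
  have "(\<lambda>k. 2 * sqn (\<lambda>\<xi>. g k \<xi> - w \<xi>) + 2 * sqn (\<lambda>\<xi>. g k \<xi> - v \<xi>)) \<longlonglongrightarrow> 2 * 0 + 2 * 0"
    by (intro tendsto_intros gw gv)
  moreover have "sqn (\<lambda>\<xi>. w \<xi> - v \<xi>) \<le> 2 * sqn (\<lambda>\<xi>. g k \<xi> - w \<xi>) + 2 * sqn (\<lambda>\<xi>. g k \<xi> - v \<xi>)" for k
    using sqn_triangle[OF has_fourier_L2(2)[OF w] has_fourier_L2(2)[OF f] v, of k] sqn_commute[of w "g k"] by simp
  ultimately have "sqn (\<lambda>\<xi>. w \<xi> - v \<xi>) \<le> 0"
    by (intro LIMSEQ_le_const) auto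
  then have "sqn (\<lambda>\<xi>. w \<xi> - v \<xi>) = 0" using sqn_nonneg[of "\<lambda>\<xi>. w \<xi> - v \<xi>"] by linarith
  then have "AE \<xi> in lebesgue. w \<xi> = v \<xi>" using sqn_eq_0D[OF L2_diff[OF has_fourier_L2(2)[OF w] v]] by simp
  then show ?thesis using has_fourier_cong[OF w] by simp
qed

lemma cis_inner_measurable [measurable]:
  "(\<lambda>\<xi> :: real ^ 'n. cis (h \<bullet> \<xi>)) \<in> borel_measurable lebesgue"
  by (intro measurable_completion) measurable

lemma has_fourier_shift:
  fixes u :: "real ^ 'n \<Rightarrow> real"
  assumes u: "has_fourier u v"
  shows "has_fourier (\<lambda>x. u (x + h)) (\<lambda>\<xi>. cis (h \<bullet> \<xi>) * v \<xi>)"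
proof (rule has_fourier_closed)
  note uL = has_fourier_L2[OF u] and t = trunc_L2[OF has_fourier_L2(1)[OF u]]
  have R: "filterlim (\<lambda>k::nat. real k) at_top sequentially" by (rule filterlim_real_sequentially)
  have b: "(\<lambda>\<xi>. cis (h \<bullet> \<xi>) * q \<xi>) \<in> L2 \<and> sqn (\<lambda>\<xi>. cis (h \<bullet> \<xi>) * q \<xi>) \<le> 1\<^sup>2 * sqn q" if "q \<in> L2" for q
    using L2_mult_bounded[OF that cis_inner_measurable, of h 1] by simp
  show "has_fourier (\<lambda>x. trunc (real k) u (x + h)) (\<lambda>\<xi>. cis (h \<bullet> \<xi>) * FI (trunc (real k) u) \<xi>)" for k
  proof -
    have "FI (\<lambda>x. trunc (real k) u (x + h)) = (\<lambda>\<xi>. cis (h \<bullet> \<xi>) * FI (trunc (real k) u) \<xi>)"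
      using FI_shift[OF t(2)] by blast
    then show ?thesis
      using has_fourier_FI[OF L2_shift(1)[OF t(1)] integrable_lebesgue_shift[OF t(2)], of "real k" h] by simp
  qed
  show "(\<lambda>x. u (x + h)) \<in> L2" by (rule L2_shift(1)[OF uL(1)])
  show "(\<lambda>\<xi>. cis (h \<bullet> \<xi>) * v \<xi>) \<in> L2" using b[OF uL(2)] by simp
  show "(\<lambda>k. sqn (\<lambda>x. trunc (real k) u (x + h) - u (x + h))) \<longlonglongrightarrow> 0"
    unfolding L2_shift(2)[OF L2_diff[OF t(1) uL(1)]]
    by (rule filterlim_compose[OF trunc_tendsto[OF uL(1)] R])
  show "(\<lambda>k. sqn (\<lambda>\<xi>. cis (h \<bullet> \<xi>) * FI (trunc (real k) u) \<xi> - cis (h \<bullet> \<xi>) * v \<xi>)) \<longlonglongrightarrow> 0"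
  proof (rule tendsto_sandwich[OF _ _ tendsto_const])
    show "(\<lambda>k. sqn (\<lambda>\<xi>. FI (trunc (real k) u) \<xi> - v \<xi>)) \<longlonglongrightarrow> 0"
      using u[unfolded has_fourier_iff] filterlim_compose[OF _ R] by blast
    show "\<forall>\<^sub>F k in sequentially. sqn (\<lambda>\<xi>. cis (h \<bullet> \<xi>) * FI (trunc (real k) u) \<xi> - cis (h \<bullet> \<xi>) * v \<xi>) \<le> sqn (\<lambda>\<xi>. FI (trunc (real k) u) \<xi> - v \<xi>)"
      using b[OF L2_diff[OF FI_trunc_L2[OF uL(1)] uL(2)]] by (simp add: right_diff_distrib)
  qed simp
qed

lemma cnj_measurable [measurable]: "cnj \<in> borel_measurable borel"
  by (intro borel_measurable_continuous_onI continuous_intros)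

lemma L2_Re_product_integrable:
  fixes v w :: "real ^ 'n \<Rightarrow> complex"
  assumes "v \<in> L2" "w \<in> L2"
  shows "integrable lebesgue (\<lambda>\<xi>. Re (v \<xi> * cnj (w \<xi>)))"
proof (rule Bochner_Integration.integrable_bound[OF L2_product_integrable[OF assms]])
  show "(\<lambda>\<xi>. Re (v \<xi> * cnj (w \<xi>))) \<in> borel_measurable lebesgue"
    using L2_measurable[OF assms(1)] L2_measurable[OF assms(2)] by simp
  show "AE \<xi> in lebesgue. norm (Re (v \<xi> * cnj (w \<xi>))) \<le> norm (norm (v \<xi>) * norm (w \<xi>))"
  proof (rule AE_I2)
    fix \<xi>
    show "norm (Re (v \<xi> * cnj (w \<xi>))) \<le> norm (norm (v \<xi>) * norm (w \<xi>))"
      using abs_Re_le_cmod[of "v \<xi> * cnj (w \<xi>)"] by (simp add: norm_mult del: times_complex.sel)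
  qed
qed

lemma norm_add_Re: "(norm (a + b :: complex))\<^sup>2 = (norm a)\<^sup>2 + 2 * Re (a * cnj b) + (norm b)\<^sup>2"
  unfolding cmod_power2 by (simp add: power2_eq_square algebra_simps)

text \<open>Polarisation of the isometry.\<close>
lemma has_fourier_inner:
  fixes u w :: "real ^ 'n \<Rightarrow> real"
  assumes "has_fourier u v" "has_fourier w z"
  shows "(LINT \<xi>|lebesgue. Re (v \<xi> * cnj (z \<xi>))) = (LINT x|lebesgue. u x * w x)"
proof -
  note L = has_fourier_L2[OF assms(1)] has_fourier_L2[OF assms(2)]
  note i = L[THEN L2_integrable] L2_Re_product_integrable[OF L(2,4)] L2_real_product_integrable[OF L(1,3)]
  have "sqn (\<lambda>\<xi>. v \<xi> + z \<xi>) = sqn v + 2 * (LINT \<xi>|lebesgue. Re (v \<xi> * cnj (z \<xi>))) + sqn z"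
    unfolding sqn_def norm_add_Re using i by (simp del: times_complex.sel)
  moreover have "sqn (\<lambda>x. u x + w x) = sqn u + 2 * (LINT x|lebesgue. u x * w x) + sqn w"
    unfolding sqn_def using i by (simp add: power2_sum mult.assoc)
  ultimately show ?thesis
    using has_fourier_sqn[OF assms(1)] has_fourier_sqn[OF assms(2)] has_fourier_sqn[OF has_fourier_add[OF assms]] by simp
qed

section \<open>The heat pairing of functions with separated supports\<close>

text \<open>For the transforms of real functions \<open>f\<close> and \<open>g\<close> this is the inner product of \<open>g\<close> with the heat
  evolution of \<open>f\<close> at time \<open>t\<close>.\<close>
definition heat_pairing :: "(real ^ 'n \<Rightarrow> complex) \<Rightarrow> (real ^ 'n \<Rightarrow> complex) \<Rightarrow> real \<Rightarrow> real" where
  "heat_pairing v w t = (LINT \<xi>|lebesgue. exp (- t * (norm \<xi>)\<^sup>2) * Re (v \<xi> * cnj (w \<xi>)))"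

lemma supported_borel_representative:
  fixes f :: "real ^ 'n \<Rightarrow> real"
  assumes f: "f \<in> L2" "integrable lebesgue f" and S: "S \<in> sets borel" "AE x in lebesgue. x \<notin> S \<longrightarrow> f x = 0"
  obtains g where "g \<in> borel_measurable borel" "integrable lborel g" "AE x in lebesgue. f x = g x" "\<And>x. x \<notin> S \<Longrightarrow> g x = 0"
    "(LINT x|lborel. g x) = (LINT x|lebesgue. f x)" "(LINT x|lborel. \<bar>g x\<bar>) = (LINT x|lebesgue. \<bar>f x\<bar>)"
proof -
  have fm: "f \<in> borel_measurable lebesgue" using f(1) by (rule L2_measurable)
  obtain g where g: "g \<in> borel_measurable borel" "AE x in lebesgue. f x = g x"
    using lebesgue_borel_representative[OF fm] by blast
  define h where "h x = indicator S x * g x" for x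
  have hm: "h \<in> borel_measurable borel" unfolding h_def using g(1) S(1) by simp
  have ae: "AE x in lebesgue. f x = h x"
    using g(2) S(2) by eventually_elim (auto simp: h_def indicator_def)
  have hl: "h \<in> borel_measurable lebesgue" using hm by (simp add: measurable_completion)
  have "integrable lebesgue h" using integrable_cong_AE[OF fm hl ae] f(2) by simp
  then have 1: "integrable lborel h" using hm by (simp add: integrable_completion)
  have "(LINT x|lebesgue. h x) = (LINT x|lebesgue. f x)"
    by (rule integral_cong_AE[OF hl fm]) (rule eventually_mono[OF ae], simp)
  then have 2: "(LINT x|lborel. h x) = (LINT x|lebesgue. f x)" using hm by (simp add: integral_completion)
  have "(LINT x|lebesgue. \<bar>h x\<bar>) = (LINT x|lebesgue. \<bar>f x\<bar>)"
    by (rule integral_cong_AE) (use hl fm in \<open>auto intro: eventually_mono[OF ae]\<close>)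
  then have 3: "(LINT x|lborel. \<bar>h x\<bar>) = (LINT x|lebesgue. \<bar>f x\<bar>)" using hm by (simp add: integral_completion)
  show thesis by (rule that[OF hm 1 ae _ 2 3]) (simp add: h_def)
qed

text \<open>The pairing is the double integral of \<open>heat t (x - y) * (f x * g y)\<close>, and for \<open>x \<in> S\<close> and \<open>y \<in> T\<close>
  the kernel lies between its values at the distances \<open>R\<close> and \<open>1\<close>.\<close>
lemma heat_pairing_bounds:
  fixes f g :: "real ^ 'n \<Rightarrow> real"
  assumes f: "integrable lebesgue f" "has_fourier f v" and g: "integrable lebesgue g" "has_fourier g w"
    and S: "S \<in> sets borel" "AE x in lebesgue. x \<notin> S \<longrightarrow> f x = 0"
    and T: "T \<in> sets borel" "AE x in lebesgue. x \<notin> T \<longrightarrow> g x = 0"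
    and dist: "\<And>x y. x \<in> S \<Longrightarrow> y \<in> T \<Longrightarrow> 1 \<le> norm (x - y)" "\<And>x y. x \<in> S \<Longrightarrow> y \<in> T \<Longrightarrow> norm (x - y) \<le> R"
    and t: "t > 0"
  shows "\<bar>heat_pairing v w t\<bar> \<le> (1 / sqrt (4 * pi * t)) ^ CARD('n) * exp (- 1 / (4 * t)) * ((LINT x|lebesgue. \<bar>f x\<bar>) * (LINT x|lebesgue. \<bar>g x\<bar>))"
    and "AE x in lebesgue. 0 \<le> f x \<Longrightarrow> AE x in lebesgue. 0 \<le> g x \<Longrightarrow>
      (1 / sqrt (4 * pi * t)) ^ CARD('n) * exp (- R\<^sup>2 / (4 * t)) * ((LINT x|lebesgue. f x) * (LINT x|lebesgue. g x)) \<le> heat_pairing v w t"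
proof -
  let ?P = "lborel \<Otimes>\<^sub>M lborel :: ((real ^ 'n) \<times> (real ^ 'n)) measure"
  let ?k = "(1 / sqrt (4 * pi * t)) ^ CARD('n)"
  note fL = has_fourier_L2[OF f(2)] and gL = has_fourier_L2[OF g(2)]
  obtain f' where f': "f' \<in> borel_measurable borel" "integrable lborel f'" "AE x in lebesgue. f x = f' x" "\<And>x. x \<notin> S \<Longrightarrow> f' x = 0"
    "(LINT x|lborel. f' x) = (LINT x|lebesgue. f x)" "(LINT x|lborel. \<bar>f' x\<bar>) = (LINT x|lebesgue. \<bar>f x\<bar>)"
    using supported_borel_representative[OF fL(1) f(1) S] by blast
  obtain g' where g': "g' \<in> borel_measurable borel" "integrable lborel g'" "AE x in lebesgue. g x = g' x" "\<And>x. x \<notin> T \<Longrightarrow> g' x = 0"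
    "(LINT x|lborel. g' x) = (LINT x|lebesgue. g x)" "(LINT x|lborel. \<bar>g' x\<bar>) = (LINT x|lebesgue. \<bar>g x\<bar>)"
    using supported_borel_representative[OF gL(1) g(1) T] by blast
  have fF: "FI f = FI f'" by (rule FI_cong_AE[OF _ f'(3)]) (use f in simp)
  have gF: "FI g = FI g'" by (rule FI_cong_AE[OF _ g'(3)]) (use g in simp)
  have v: "AE \<xi> in lebesgue. v \<xi> = FI f \<xi>" by (rule has_fourier_unique[OF f(2) has_fourier_FI[OF fL(1) f(1)]])
  have w: "AE \<xi> in lebesgue. w \<xi> = FI g \<xi>" by (rule has_fourier_unique[OF g(2) has_fourier_FI[OF gL(1) g(1)]])
  have em: "(\<lambda>\<xi>::real^'n. exp (- t * (norm \<xi>)\<^sup>2)) \<in> borel_measurable lebesgue"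
    by (intro measurable_completion) measurable
  have [measurable]: "FI f \<in> borel_measurable borel" "FI g \<in> borel_measurable borel" using FI_measurable f g by auto
  then have Fl: "FI f \<in> borel_measurable lebesgue" "FI g \<in> borel_measurable lebesgue" by (simp_all add: measurable_completion)
  have "heat_pairing v w t = (LINT \<xi>|lebesgue. exp (- t * (norm \<xi>)\<^sup>2) * Re (FI f \<xi> * cnj (FI g \<xi>)))"
    unfolding heat_pairing_def
  proof (rule integral_cong_AE)
    show "(\<lambda>\<xi>. exp (- t * (norm \<xi>)\<^sup>2) * Re (v \<xi> * cnj (w \<xi>))) \<in> borel_measurable lebesgue"
      using L2_measurable[OF fL(2)] L2_measurable[OF gL(2)] by (intro borel_measurable_times em) simp
    show "(\<lambda>\<xi>. exp (- t * (norm \<xi>)\<^sup>2) * Re (FI f \<xi> * cnj (FI g \<xi>))) \<in> borel_measurable lebesgue"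
      using Fl by (intro borel_measurable_times em) simp
    show "AE \<xi> in lebesgue. exp (- t * (norm \<xi>)\<^sup>2) * Re (v \<xi> * cnj (w \<xi>)) = exp (- t * (norm \<xi>)\<^sup>2) * Re (FI f \<xi> * cnj (FI g \<xi>))"
      using v w by eventually_elim simp
  qed
  also have "\<dots> = (LINT \<xi>|lborel. exp (- t * (norm \<xi>)\<^sup>2) * Re (FI f \<xi> * cnj (FI g \<xi>)))"
    by (rule integral_completion) measurable
  also have "\<dots> = (LINT p|?P. heat t (fst p - snd p) * (f' (fst p) * g' (snd p)))"
    unfolding fF gF by (rule gaussian_pairing_borel(2)[OF t f'(2) g'(2)])
  finally have eq: "heat_pairing v w t = (LINT p|?P. heat t (fst p - snd p) * (f' (fst p) * g' (snd p)))" .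
  have ip: "integrable ?P (\<lambda>p. heat t (fst p - snd p) * (f' (fst p) * g' (snd p)))"
    by (rule gaussian_pairing_borel(1)[OF t f'(2) g'(2)])
  show "\<bar>heat_pairing v w t\<bar> \<le> ?k * exp (- 1 / (4 * t)) * ((LINT x|lebesgue. \<bar>f x\<bar>) * (LINT x|lebesgue. \<bar>g x\<bar>))"
  proof -
    have ia: "integrable ?P (\<lambda>p. \<bar>f' (fst p)\<bar> * \<bar>g' (snd p)\<bar>)"
      by (rule lborel_product_integral(1)) (use f' g' in auto)
    have "\<bar>heat_pairing v w t\<bar> \<le> (LINT p|?P. \<bar>heat t (fst p - snd p) * (f' (fst p) * g' (snd p))\<bar>)"
      unfolding eq by (rule integral_abs_bound)
    also have "\<dots> \<le> (LINT p|?P. (?k * exp (- 1 / (4 * t))) * (\<bar>f' (fst p)\<bar> * \<bar>g' (snd p)\<bar>))"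
    proof (rule integral_mono)
      fix p :: "(real ^ 'n) \<times> (real ^ 'n)"
      show "\<bar>heat t (fst p - snd p) * (f' (fst p) * g' (snd p))\<bar> \<le> (?k * exp (- 1 / (4 * t))) * (\<bar>f' (fst p)\<bar> * \<bar>g' (snd p)\<bar>)"
      proof (cases "fst p \<in> S \<and> snd p \<in> T")
        case True
        then have "1 \<le> norm (fst p - snd p)" using dist(1) by blast
        then have "1 \<le> (norm (fst p - snd p))\<^sup>2" by simp
        then have "heat t (fst p - snd p) \<le> ?k * exp (- 1 / (4 * t))" unfolding heat_def
          using t by (intro mult_left_mono) (auto simp: divide_right_mono)
        moreover have "0 \<le> heat t (fst p - snd p)" using t by (simp add: heat_def)
        ultimately show ?thesis by (simp add: abs_mult mult_right_mono)
      qed (use f'(4) g'(4) in auto)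
    qed (use ip ia in auto)
    also have "\<dots> = ?k * exp (- 1 / (4 * t)) * ((LINT x|lborel. \<bar>f' x\<bar>) * (LINT x|lborel. \<bar>g' x\<bar>))"
      unfolding integral_mult_right_zero by (subst lborel_product_integral(2)) (use f' g' in auto)
    finally show ?thesis unfolding f' g' .
  qed
  show "?k * exp (- R\<^sup>2 / (4 * t)) * ((LINT x|lebesgue. f x) * (LINT x|lebesgue. g x)) \<le> heat_pairing v w t"
    if nn: "AE x in lebesgue. 0 \<le> f x" "AE x in lebesgue. 0 \<le> g x"
  proof -
    have ia: "integrable ?P (\<lambda>p. f' (fst p) * g' (snd p))"
      by (rule lborel_product_integral(1)) (use f' g' in auto)
    have "AE x in lebesgue. 0 \<le> f' x" using nn(1) f'(3) by eventually_elim simp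
    then have fn: "AE x in lborel. 0 \<le> f' x" by (simp add: AE_completion_iff)
    have "AE x in lebesgue. 0 \<le> g' x" using nn(2) g'(3) by eventually_elim simp
    then have gn: "AE x in lborel. 0 \<le> g' x" by (simp add: AE_completion_iff)
    note [measurable] = f'(1) g'(1)
    have fgn: "AE p in ?P. 0 \<le> f' (fst p) \<and> 0 \<le> g' (snd p)"
    proof (rule lborel_pair.AE_pair_measure)
      show "AE x in lborel. AE y in lborel. 0 \<le> f' (fst (x, y)) \<and> 0 \<le> g' (snd (x, y))"
        using fn by eventually_elim (use gn in auto)
    qed measurable
    have "?k * exp (- R\<^sup>2 / (4 * t)) * ((LINT x|lborel. f' x) * (LINT x|lborel. g' x)) = (LINT p|?P. (?k * exp (- R\<^sup>2 / (4 * t))) * (f' (fst p) * g' (snd p)))"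
      unfolding integral_mult_right_zero by (subst lborel_product_integral(2)) (use f' g' in auto)
    also have "\<dots> \<le> heat_pairing v w t"
      unfolding eq
    proof (rule integral_mono_AE)
      show "AE p in ?P. (?k * exp (- R\<^sup>2 / (4 * t))) * (f' (fst p) * g' (snd p)) \<le> heat t (fst p - snd p) * (f' (fst p) * g' (snd p))"
        using fgn
      proof eventually_elim
        case (elim p)
        show ?case
        proof (cases "fst p \<in> S \<and> snd p \<in> T")
          case True
          then have "norm (fst p - snd p) \<le> R" using dist(2) by blast
          then have "(norm (fst p - snd p))\<^sup>2 \<le> R\<^sup>2" by (intro power_mono) auto
          then have "?k * exp (- R\<^sup>2 / (4 * t)) \<le> heat t (fst p - snd p)" unfolding heat_def
            using t by (intro mult_left_mono) (auto simp: divide_right_mono)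
          then show ?thesis using elim by (intro mult_right_mono) auto
        qed (use f'(4) g'(4) in auto)
      qed
    qed (use ip ia in auto)
    finally show ?thesis unfolding f' g' .
  qed
qed

section \<open>Mellin integrals of positive functions\<close>

definition mellin :: "real \<Rightarrow> (real \<Rightarrow> ennreal) \<Rightarrow> ennreal" where
  "mellin p g = (\<integral>\<^sup>+t. ennreal (indicator {0<..} t * t powr (p - 1)) * g t \<partial>lborel)"

lemma mellin_cong: "(\<And>t. t > 0 \<Longrightarrow> g t = h t) \<Longrightarrow> mellin p g = mellin p h"
  unfolding mellin_def by (intro nn_integral_cong) (auto simp: indicator_def)

lemma mellin_scale:
  assumes c: "c > 0" and [measurable]: "g \<in> borel_measurable borel"
  shows "mellin p (\<lambda>t. g (c * t)) = ennreal (c powr (- p)) * mellin p g"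
proof -
  have "mellin p g = ennreal c * (\<integral>\<^sup>+t. ennreal (indicator {0<..} (0 + c * t) * (0 + c * t) powr (p - 1)) * g (0 + c * t) \<partial>lborel)"
    unfolding mellin_def using c by (subst nn_integral_real_affine[where c=c and t=0]) auto
  also have "(\<lambda>t. ennreal (indicator {0<..} (0 + c * t) * (0 + c * t) powr (p - 1)) * g (0 + c * t)) =
     (\<lambda>t. ennreal (c powr (p - 1)) * (ennreal (indicator {0<..} t * t powr (p - 1)) * g (c * t)))"
    using c by (auto simp: fun_eq_iff indicator_def powr_mult zero_less_mult_iff ennreal_mult mult.assoc)
  also have "(\<integral>\<^sup>+t. ennreal (c powr (p - 1)) * (ennreal (indicator {0<..} t * t powr (p - 1)) * g (c * t)) \<partial>lborel) =
     ennreal (c powr (p - 1)) * mellin p (\<lambda>t. g (c * t))"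
    unfolding mellin_def by (rule nn_integral_cmult) measurable
  also have "ennreal c * (ennreal (c powr (p - 1)) * mellin p (\<lambda>t. g (c * t))) = ennreal (c powr p) * mellin p (\<lambda>t. g (c * t))"
  proof -
    have "c * c powr (p - 1) = c powr p" using c powr_mult_base[of c "p - 1"] by simp
    then show ?thesis using c by (simp add: mult.assoc[symmetric] ennreal_mult[symmetric])
  qed
  finally have "ennreal (c powr (- p)) * mellin p g = ennreal (c powr (- p) * c powr p) * mellin p (\<lambda>t. g (c * t))"
    by (simp add: mult.assoc ennreal_mult)
  also have "c powr (- p) * c powr p = 1" using c by (simp add: powr_minus)
  finally show ?thesis by simp
qed

lemma mellin_finite:
  assumes [measurable]: "g \<in> borel_measurable borel"
    and b1: "\<And>t. 0 < t \<Longrightarrow> t \<le> 1 \<Longrightarrow> g t \<le> ennreal (C * t powr b1)"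
    and b2: "\<And>t. 1 \<le> t \<Longrightarrow> g t \<le> ennreal (C * t powr b2)"
    and p: "p + b1 > 0" "p + b2 < 0"
  shows "mellin p g < \<infinity>"
proof -
  define A where "A = (\<integral>\<^sup>+t. ennreal (indicator {0..1} t * t powr (p + b1 - 1)) \<partial>lborel)"
  define B where "B = (\<integral>\<^sup>+t. ennreal (indicator {1..} t * t powr (p + b2 - 1)) \<partial>lborel)"
  have A: "A < \<infinity>"
  proof -
    have "((\<lambda>t. t powr (p + b1 - 1)) has_integral (1 powr (p + b1 - 1 + 1) / (p + b1 - 1 + 1))) {0..1}"
      using p(1) by (intro has_integral_powr_from_0) auto
    from nn_integral_has_integral_lebesgue[OF _ this] show ?thesis unfolding A_def by simp
  qed
  have B: "B < \<infinity>"
  proof -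
    have "((\<lambda>t. t powr (p + b2 - 1)) has_integral (- (1 powr (p + b2 - 1 + 1)) / (p + b2 - 1 + 1))) {1..}"
      using p(2) by (intro has_integral_powr_to_inf) auto
    from nn_integral_has_integral_lebesgue[OF _ this] show ?thesis unfolding B_def by simp
  qed
  have "mellin p g \<le> (\<integral>\<^sup>+t. ennreal \<bar>C\<bar> * ennreal (indicator {0..1} t * t powr (p + b1 - 1)) + ennreal \<bar>C\<bar> * ennreal (indicator {1..} t * t powr (p + b2 - 1)) \<partial>lborel)"
    unfolding mellin_def
  proof (rule nn_integral_mono)
    fix t :: real
    have e: "ennreal (t powr (p - 1)) * ennreal (C * t powr b) \<le> ennreal \<bar>C\<bar> * ennreal (t powr (p + b - 1))" for b
    proof -
      have "t powr (p - 1) * t powr b = t powr (p + b - 1)" by (simp add: powr_add[symmetric] algebra_simps)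
      have "ennreal (t powr (p - 1)) * ennreal (C * t powr b) \<le> ennreal (t powr (p - 1)) * ennreal (\<bar>C\<bar> * t powr b)"
        by (intro mult_left_mono ennreal_leI mult_right_mono) auto
      also have "\<dots> = ennreal \<bar>C\<bar> * ennreal (t powr (p - 1) * t powr b)"
        by (simp add: ennreal_mult ac_simps)
      finally show ?thesis unfolding \<open>t powr (p - 1) * t powr b = t powr (p + b - 1)\<close> .
    qed
    show "ennreal (indicator {0<..} t * t powr (p - 1)) * g t \<le>
       ennreal \<bar>C\<bar> * ennreal (indicator {0..1} t * t powr (p + b1 - 1)) + ennreal \<bar>C\<bar> * ennreal (indicator {1..} t * t powr (p + b2 - 1))"
    proof -
      consider "t \<le> 0" | "0 < t" "t < 1" | "t \<ge> 1" by linarith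
      then show ?thesis
      proof cases
        case 2
        then have "ennreal (t powr (p - 1)) * g t \<le> ennreal (t powr (p - 1)) * ennreal (C * t powr b1)"
          by (intro mult_left_mono b1) auto
        from order_trans[OF this e] show ?thesis using 2 by (simp add: indicator_def)
      next
        case 3
        then have "ennreal (t powr (p - 1)) * g t \<le> ennreal (t powr (p - 1)) * ennreal (C * t powr b2)"
          by (intro mult_left_mono b2) auto
        from order_trans[OF this e] have "ennreal (t powr (p - 1)) * g t \<le> ennreal \<bar>C\<bar> * ennreal (t powr (p + b2 - 1))" .
        then show ?thesis using 3 by (simp add: indicator_def add_increasing)
      qed (simp add: indicator_def)
    qed
  qed
  also have "\<dots> = ennreal \<bar>C\<bar> * A + ennreal \<bar>C\<bar> * B"
    unfolding A_def B_def by (simp add: nn_integral_add nn_integral_cmult)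
  also have "\<dots> < \<infinity>" using A B by (simp add: ennreal_mult_less_top)
  finally show ?thesis .
qed

lemma mellin_pos:
  assumes [measurable]: "g \<in> borel_measurable borel" and pos: "\<And>t. t > 0 \<Longrightarrow> g t > 0"
  shows "mellin p g > 0"
proof (rule ccontr)
  assume "\<not> mellin p g > 0"
  then have "mellin p g = 0" by simp
  then have "AE t in lborel. ennreal (indicator {0<..} t * t powr (p - 1)) * g t = 0"
    unfolding mellin_def by (subst (asm) nn_integral_0_iff_AE) auto
  then have "AE t in lborel. t \<notin> {0<..<1::real}"
  proof (rule eventually_mono)
    fix t :: real assume "ennreal (indicator {0<..} t * t powr (p - 1)) * g t = 0"
    then show "t \<notin> {0<..<1}" using pos[of t] by (auto simp: indicator_def)
  qed
  then have "{0<..<1::real} \<in> null_sets lborel"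
    by (subst AE_iff_null_sets) auto
  then show False by (simp add: null_sets_def)
qed

lemma mellin_exp:
  assumes p: "p > 0" and c: "c > 0"
  shows "mellin p (\<lambda>t. ennreal (exp (- (c * t)))) = ennreal (c powr (- p) * Gamma p)"
proof -
  have "mellin p (\<lambda>t. ennreal (exp (- t))) = (\<integral>\<^sup>+t. ennreal (indicator {0..} t * t powr (p - 1) / exp t) \<partial>lborel)"
    unfolding mellin_def
    by (rule nn_integral_cong_AE, rule eventually_mono[OF AE_lborel_singleton[of 0]])
       (auto simp: indicator_def ennreal_mult[symmetric] exp_minus divide_inverse)
  also have "\<dots> = ennreal (Gamma p)" using Gamma_conv_nn_integral_real[OF p] by simp
  finally show ?thesis using mellin_scale[OF c, of "\<lambda>t. ennreal (exp (- t))" p] p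
    by (simp add: ennreal_mult Gamma_real_pos less_imp_le)
qed

lemma one_minus_exp_bounds: "0 \<le> (t::real) \<Longrightarrow> 0 \<le> 1 - exp (- t) \<and> 1 - exp (- t) \<le> 1 \<and> 1 - exp (- t) \<le> t"
  using exp_ge_add_one_self[of "- t"] by auto

text \<open>By homogeneity only \<open>c = 1\<close> matters. The integral converges at \<open>0\<close> because of \<open>s < M\<close>,
  and at infinity because of \<open>0 < s\<close>.\<close>
lemma mellin_one_minus_exp_power:
  assumes s: "0 < s" "s < real M"
  obtains C where "C > 0" "\<And>c. c \<ge> 0 \<Longrightarrow> mellin (- s) (\<lambda>t. ennreal ((1 - exp (- (c * t))) ^ M)) = ennreal (C * c powr s)"
proof -
  let ?g = "\<lambda>t::real. ennreal ((1 - exp (- t)) ^ M)"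
  have M: "M > 0" using s by (cases M) auto
  have fin: "mellin (- s) ?g < \<infinity>"
  proof (rule mellin_finite[where C=1 and ?b1.0="real M" and ?b2.0=0])
    show "?g t \<le> ennreal (1 * t powr real M)" if "0 < t" "t \<le> 1" for t
      using that one_minus_exp_bounds[of t] by (auto simp: powr_realpow intro!: ennreal_leI power_mono)
    show "?g t \<le> ennreal (1 * t powr 0)" if "1 \<le> t" for t
      using that one_minus_exp_bounds[of t] by (auto intro!: power_le_one)
  qed (use s in auto)
  have pos: "mellin (- s) ?g > 0"
    by (rule mellin_pos) auto
  obtain C where C: "mellin (- s) ?g = ennreal C" "C > 0"
    using fin pos by (cases "mellin (- s) ?g") (auto simp: ennreal_less_zero_iff)
  show thesis
  proof (rule that[OF C(2)])
    fix c :: real assume "c \<ge> 0"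
    show "mellin (- s) (\<lambda>t. ennreal ((1 - exp (- (c * t))) ^ M)) = ennreal (C * c powr s)"
    proof (cases "c = 0")
      case True
      then show ?thesis using M by (simp add: mellin_def zero_power)
    next
      case False
      then show ?thesis using mellin_scale[of c ?g "- s"] C \<open>c \<ge> 0\<close> by (simp add: ennreal_mult mult.commute)
    qed
  qed
qed

section \<open>The Gagliardo form on the Fourier side\<close>

lemma nn_integral_lborel_shift:
  fixes f :: "real ^ 'n \<Rightarrow> ennreal"
  assumes "f \<in> borel_measurable borel"
  shows "(\<integral>\<^sup>+y. f y \<partial>lborel) = (\<integral>\<^sup>+h. f (x + h) \<partial>lborel)"
proof -
  have "(\<integral>\<^sup>+y. f y \<partial>lborel) = (\<integral>\<^sup>+y. f y \<partial>(distr lborel borel ((+) x)))" by (simp add: lborel_distr_plus)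
  also have "\<dots> = (\<integral>\<^sup>+h. f (x + h) \<partial>lborel)" using assms by (subst nn_integral_distr) auto
  finally show ?thesis .
qed

lemma nn_integral_gaussian_cos:
  fixes \<xi> :: "real ^ 'n"
  assumes t: "t > 0"
  shows "(\<integral>\<^sup>+h. ennreal (exp (- (t * (norm h)\<^sup>2)) * (2 - 2 * cos (h \<bullet> \<xi>))) \<partial>lborel) =
    ennreal (2 * sqrt (pi / t) ^ CARD('n) * (1 - exp (- (norm \<xi>)\<^sup>2 / (4 * t))))"
proof -
  note g = gaussian_integral[OF t]
  have e: "exp (- (t * (norm h)\<^sup>2)) * (2 - 2 * cos (h \<bullet> \<xi>)) =
     2 * Re (complex_of_real (exp (- t * (norm h)\<^sup>2)) * cis (0 \<bullet> h)) - 2 * Re (complex_of_real (exp (- t * (norm h)\<^sup>2)) * cis (\<xi> \<bullet> h))" for h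
    by (simp add: algebra_simps inner_commute)
  have i: "integrable lborel (\<lambda>h. exp (- (t * (norm h)\<^sup>2)) * (2 - 2 * cos (h \<bullet> \<xi>)))"
    unfolding e by (intro Bochner_Integration.integrable_diff integrable_mult_right integrable_Re g(1))
  have "(LINT h|lborel. exp (- (t * (norm h)\<^sup>2)) * (2 - 2 * cos (h \<bullet> \<xi>))) =
     2 * Re (LINT h::real^'n|lborel. complex_of_real (exp (- t * (norm h)\<^sup>2)) * cis (0 \<bullet> h)) - 2 * Re (LINT h|lborel. complex_of_real (exp (- t * (norm h)\<^sup>2)) * cis (\<xi> \<bullet> h))"
    unfolding e by (subst Bochner_Integration.integral_diff) (simp_all only: integrable_mult_right integrable_Re g(1) integral_mult_right_zero integral_Re)
  also have "\<dots> = 2 * sqrt (pi / t) ^ CARD('n) * (1 - exp (- (norm \<xi>)\<^sup>2 / (4 * t)))"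
    unfolding g(2) by (simp add: algebra_simps)
  finally have v: "(LINT h|lborel. exp (- (t * (norm h)\<^sup>2)) * (2 - 2 * cos (h \<bullet> \<xi>))) = 2 * sqrt (pi / t) ^ CARD('n) * (1 - exp (- (norm \<xi>)\<^sup>2 / (4 * t)))" .
  show ?thesis
    unfolding v[symmetric] by (rule nn_integral_eq_integral[OF i]) auto
qed

text \<open>The symbol of the Gagliardo form. Writing the singular kernel as a superposition of
  Gaussians reduces the integral over \<open>h\<close> to an explicit one and leaves a Mellin integral, whose
  homogeneity gives the power of \<open>norm \<xi>\<close>.\<close>
lemma gagliardo_symbol:
  fixes \<sigma> :: real
  assumes \<sigma>: "0 < \<sigma>" "\<sigma> < 1"
  obtains K where "K > 0" "\<And>\<xi> :: real ^ 'n. (\<integral>\<^sup>+h. ennreal ((2 - 2 * cos (h \<bullet> \<xi>)) / norm h powr (real CARD('n) + 2 * \<sigma>)) \<partial>lborel) = ennreal (K * norm \<xi> powr (2 * \<sigma>))"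
proof -
  define a where "a = real CARD('n) + 2 * \<sigma>"
  have a: "a / 2 > 0" using \<sigma> by (simp add: a_def add_nonneg_pos)
  have Gp: "Gamma (a / 2) > 0" using a by (rule Gamma_real_pos)
  let ?g = "\<lambda>t::real. ennreal (1 - exp (- 1 / (4 * t)))"
  have fin: "mellin \<sigma> ?g < \<infinity>"
  proof (rule mellin_finite[where C=1 and ?b1.0=0 and ?b2.0="-1"])
    show "?g t \<le> ennreal (1 * t powr - 1)" if "1 \<le> t" for t
      using that one_minus_exp_bounds[of "1 / (4 * t)"]
      by (auto simp: powr_minus divide_simps intro!: ennreal_leI elim: order_trans)
  qed (use \<sigma> in auto)
  have pos: "mellin \<sigma> ?g > 0"
    by (rule mellin_pos) auto
  obtain C where C: "mellin \<sigma> ?g = ennreal C" "C > 0"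
    using fin pos by (cases "mellin \<sigma> ?g") (auto simp: ennreal_less_zero_iff)
  define K where "K = 2 * sqrt pi ^ CARD('n) * C / Gamma (a / 2)"
  have K: "K > 0" unfolding K_def using C Gp by simp
  show thesis
  proof (rule that[OF K])
    fix \<xi> :: "real ^ 'n"
    let ?I = "\<integral>\<^sup>+h. ennreal ((2 - 2 * cos (h \<bullet> \<xi>)) / norm h powr a) \<partial>lborel"
    have c0: "0 \<le> 2 - 2 * cos x" for x :: real by simp
    have 1: "ennreal (Gamma (a / 2)) * ennreal ((2 - 2 * cos (h \<bullet> \<xi>)) / norm h powr a) =
       mellin (a / 2) (\<lambda>t. ennreal (exp (- (t * (norm h)\<^sup>2)))) * ennreal (2 - 2 * cos (h \<bullet> \<xi>))" for h
    proof (cases "h = 0")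
      case False
      then have "mellin (a / 2) (\<lambda>t. ennreal (exp (- (t * (norm h)\<^sup>2)))) = ennreal (((norm h)\<^sup>2) powr (- (a / 2)) * Gamma (a / 2))"
        using mellin_exp[OF a, of "(norm h)\<^sup>2"] by (simp add: mult.commute)
      also have "((norm h)\<^sup>2) powr (- (a / 2)) = 1 / norm h powr a"
      proof -
        have "(norm h)\<^sup>2 = norm h powr 2" using False by (simp add: powr_numeral)
        then have "((norm h)\<^sup>2) powr (- (a / 2)) = norm h powr (- a)" by (simp only: powr_powr) simp
        then show ?thesis by (simp only: powr_minus_divide)
      qed
      finally show ?thesis using Gp c0 by (simp add: ennreal_mult[symmetric] mult.commute)
    qed simp
    have "ennreal (Gamma (a / 2)) * ?I = (\<integral>\<^sup>+h. mellin (a / 2) (\<lambda>t. ennreal (exp (- (t * (norm h)\<^sup>2)))) * ennreal (2 - 2 * cos (h \<bullet> \<xi>)) \<partial>lborel)"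
      unfolding 1[symmetric] by (rule nn_integral_cmult[symmetric]) measurable
    also have "\<dots> = (\<integral>\<^sup>+h. (\<integral>\<^sup>+t. ennreal (indicator {0<..} t * t powr (a / 2 - 1)) * ennreal (exp (- (t * (norm h)\<^sup>2)) * (2 - 2 * cos (h \<bullet> \<xi>))) \<partial>lborel) \<partial>lborel)"
      unfolding mellin_def
      by (subst nn_integral_multc[symmetric]) (auto simp: ennreal_mult c0 mult.assoc)
    also have "\<dots> = (\<integral>\<^sup>+t. (\<integral>\<^sup>+h. ennreal (indicator {0<..} t * t powr (a / 2 - 1)) * ennreal (exp (- (t * (norm h)\<^sup>2)) * (2 - 2 * cos (h \<bullet> \<xi>))) \<partial>lborel) \<partial>lborel)"
      by (rule lborel_pair.Fubini') measurable
    also have "\<dots> = (\<integral>\<^sup>+t. ennreal (2 * sqrt pi ^ CARD('n)) * (ennreal (indicator {0<..} t * t powr (\<sigma> - 1)) * ennreal (1 - exp (- (norm \<xi>)\<^sup>2 / (4 * t)))) \<partial>lborel)"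
    proof (rule nn_integral_cong)
      fix t :: real
      show "(\<integral>\<^sup>+h. ennreal (indicator {0<..} t * t powr (a / 2 - 1)) * ennreal (exp (- (t * (norm h)\<^sup>2)) * (2 - 2 * cos (h \<bullet> \<xi>))) \<partial>lborel) =
        ennreal (2 * sqrt pi ^ CARD('n)) * (ennreal (indicator {0<..} t * t powr (\<sigma> - 1)) * ennreal (1 - exp (- (norm \<xi>)\<^sup>2 / (4 * t))))"
      proof (cases "t > 0")
        case True
        have "t powr (a / 2 - 1) * sqrt (pi / t) ^ CARD('n) = sqrt pi ^ CARD('n) * (t powr (a / 2 - 1) * (1 / sqrt t) ^ CARD('n))"
          by (simp add: real_sqrt_divide power_divide)
        also have "(1 / sqrt t) ^ CARD('n) = t powr (- real CARD('n) / 2)"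
        proof -
          have "(1 / sqrt t) ^ CARD('n) = (t powr (- 1 / 2)) ^ CARD('n)"
            using True by (simp add: powr_minus powr_half_sqrt field_simps)
          then show ?thesis using True by (simp add: powr_power)
        qed
        also have "t powr (a / 2 - 1) * t powr (- real CARD('n) / 2) = t powr (\<sigma> - 1)"
          by (simp add: powr_add[symmetric] a_def add_divide_distrib)
        finally have tt: "t powr (a / 2 - 1) * sqrt (pi / t) ^ CARD('n) = sqrt pi ^ CARD('n) * t powr (\<sigma> - 1)" .
        have e0: "0 \<le> 1 - exp (- (norm \<xi>)\<^sup>2 / (4 * t))" using True by simp
        have "(\<integral>\<^sup>+h. ennreal (indicator {0<..} t * t powr (a / 2 - 1)) * ennreal (exp (- (t * (norm h)\<^sup>2)) * (2 - 2 * cos (h \<bullet> \<xi>))) \<partial>lborel) =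
           ennreal (t powr (a / 2 - 1)) * ennreal (2 * sqrt (pi / t) ^ CARD('n) * (1 - exp (- (norm \<xi>)\<^sup>2 / (4 * t))))"
          using True nn_integral_gaussian_cos[OF True, of \<xi>] by (subst nn_integral_cmult) auto
        also have "\<dots> = ennreal ((t powr (a / 2 - 1) * sqrt (pi / t) ^ CARD('n)) * (2 * (1 - exp (- (norm \<xi>)\<^sup>2 / (4 * t)))))"
          using True e0 by (subst ennreal_mult[symmetric]) (auto simp: ac_simps)
        also have "\<dots> = ennreal (2 * sqrt pi ^ CARD('n)) * (ennreal (t powr (\<sigma> - 1)) * ennreal (1 - exp (- (norm \<xi>)\<^sup>2 / (4 * t))))"
        proof -
          have "ennreal (A * B * (2 * E)) = ennreal (2 * A) * (ennreal B * ennreal E)" if "0 \<le> A" "0 \<le> B" "0 \<le> E" for A B E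
            using that by (simp add: ennreal_mult[symmetric] ac_simps)
          from this[OF _ _ e0] show ?thesis unfolding tt by simp
        qed
        finally show ?thesis using True by simp
      qed simp
    qed
    also have "\<dots> = ennreal (2 * sqrt pi ^ CARD('n)) * mellin \<sigma> (\<lambda>t. ennreal (1 - exp (- (norm \<xi>)\<^sup>2 / (4 * t))))"
      unfolding mellin_def by (rule nn_integral_cmult) measurable
    also have "mellin \<sigma> (\<lambda>t. ennreal (1 - exp (- (norm \<xi>)\<^sup>2 / (4 * t)))) = ennreal (C * norm \<xi> powr (2 * \<sigma>))"
    proof (cases "\<xi> = 0")
      case True
      then show ?thesis using \<sigma> by (simp add: mellin_def)
    next
      case False
      then have c: "1 / (norm \<xi>)\<^sup>2 > 0" by simp
      have "mellin \<sigma> (\<lambda>t. ennreal (1 - exp (- (norm \<xi>)\<^sup>2 / (4 * t)))) = mellin \<sigma> (\<lambda>t. ?g (1 / (norm \<xi>)\<^sup>2 * t))"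
        by simp
      also have "\<dots> = ennreal ((1 / (norm \<xi>)\<^sup>2) powr (- \<sigma>)) * mellin \<sigma> ?g"
        by (rule mellin_scale[OF c]) measurable
      also have "(1 / (norm \<xi>)\<^sup>2) powr (- \<sigma>) = norm \<xi> powr (2 * \<sigma>)"
      proof -
        have "1 / (norm \<xi>)\<^sup>2 = norm \<xi> powr (- 2)" using False by (simp add: powr_minus powr_numeral divide_inverse)
        then show ?thesis by (simp only: powr_powr) simp
      qed
      finally show ?thesis using C by (simp add: ennreal_mult mult.commute)
    qed
    finally have "ennreal (Gamma (a / 2)) * ?I = ennreal (2 * sqrt pi ^ CARD('n)) * ennreal (C * norm \<xi> powr (2 * \<sigma>))" .
    then have "ennreal (1 / Gamma (a / 2)) * (ennreal (Gamma (a / 2)) * ?I) = ennreal (1 / Gamma (a / 2)) * (ennreal (2 * sqrt pi ^ CARD('n)) * ennreal (C * norm \<xi> powr (2 * \<sigma>)))"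
      by simp
    moreover have "ennreal (1 / Gamma (a / 2)) * (ennreal (Gamma (a / 2)) * ?I) = ?I"
      using Gp by (simp add: mult.assoc[symmetric] ennreal_mult[symmetric])
    moreover have "ennreal (1 / Gamma (a / 2)) * (ennreal (2 * sqrt pi ^ CARD('n)) * ennreal (C * norm \<xi> powr (2 * \<sigma>))) = ennreal (K * norm \<xi> powr (2 * \<sigma>))"
      using Gp C by (simp add: K_def ennreal_mult[symmetric])
    ultimately show "(\<integral>\<^sup>+h. ennreal ((2 - 2 * cos (h \<bullet> \<xi>)) / norm h powr (real CARD('n) + 2 * \<sigma>)) \<partial>lborel) = ennreal (K * norm \<xi> powr (2 * \<sigma>))"
      unfolding a_def by simp
  qed
qed

lemma norm_cis_minus_one: "(norm (cis x * z - z))\<^sup>2 = (2 - 2 * cos x) * (norm z)\<^sup>2"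
proof -
  have "cis x * z - z = (cis x - 1) * z" by (simp add: algebra_simps)
  moreover have "(norm (cis x - 1))\<^sup>2 = 2 - 2 * cos x"
    unfolding cmod_power2 using sin_cos_squared_add[of x] by (simp add: power2_eq_square algebra_simps)
  ultimately show ?thesis by (simp add: norm_mult power_mult_distrib)
qed

text \<open>For fixed \<open>h\<close> the increment \<open>u (x + h) - u x\<close> has the transform \<open>(cis (h \<bullet> \<xi>) - 1) * v \<xi>\<close>. Plancherel's
  identity and Tonelli's theorem leave the integral over \<open>h\<close> that defines the symbol.\<close>
lemma gagliardo_nn_integral:
  fixes u :: "real ^ 'n \<Rightarrow> real"
  assumes K: "\<And>\<xi> :: real ^ 'n. (\<integral>\<^sup>+h. ennreal ((2 - 2 * cos (h \<bullet> \<xi>)) / norm h powr a) \<partial>lborel) = ennreal (K * norm \<xi> powr (2 * \<sigma>))" "K > 0"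
    and u: "has_fourier u v" and um[measurable]: "u \<in> borel_measurable borel"
  shows "(\<integral>\<^sup>+x. (\<integral>\<^sup>+y. ennreal ((u x - u y)\<^sup>2 / norm (x - y) powr a) \<partial>lborel) \<partial>lborel) =
     ennreal K * (\<integral>\<^sup>+\<xi>. ennreal (norm \<xi> powr (2 * \<sigma>) * (norm (v \<xi>))\<^sup>2) \<partial>lebesgue)"
proof -
  note L = has_fourier_L2[OF u]
  have "(\<lambda>\<xi>. (norm (v \<xi>))\<^sup>2) \<in> borel_measurable lebesgue" using L2_measurable[OF L(2)] by measurable
  then obtain w0 where w0: "w0 \<in> borel_measurable borel" "AE \<xi> in lebesgue. (norm (v \<xi>))\<^sup>2 = w0 \<xi>"
    using lebesgue_borel_representative by blast
  define w where "w \<xi> = max 0 (w0 \<xi>)" for \<xi>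
  have wm[measurable]: "w \<in> borel_measurable borel" unfolding w_def using w0(1) by measurable
  have w: "AE \<xi> in lebesgue. (norm (v \<xi>))\<^sup>2 = w \<xi>" using w0(2) by eventually_elim (auto simp: w_def, metis zero_le_power2 max_absorb2)
  have wn: "0 \<le> w \<xi>" for \<xi> by (simp add: w_def)
  have c0: "0 \<le> 2 - 2 * cos x" for x :: real by simp
  have inner: "(\<integral>\<^sup>+x. ennreal ((u x - u (x + h))\<^sup>2) \<partial>lborel) = (\<integral>\<^sup>+\<xi>. ennreal ((2 - 2 * cos (h \<bullet> \<xi>)) * w \<xi>) \<partial>lborel)" for h
  proof -
    note d = has_fourier_diff[OF has_fourier_shift[OF u, of h] u]
    note dL = has_fourier_L2[OF d]
    have "(\<integral>\<^sup>+x. ennreal ((u x - u (x + h))\<^sup>2) \<partial>lborel) = (\<integral>\<^sup>+x. ennreal ((norm (u (x + h) - u x))\<^sup>2) \<partial>lebesgue)"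
      by (simp add: nn_integral_completion power2_commute)
    also have "\<dots> = ennreal (sqn (\<lambda>x. u (x + h) - u x))"
      unfolding sqn_def by (rule nn_integral_eq_integral[OF L2_integrable[OF dL(1)]]) simp
    also have "\<dots> = ennreal (sqn (\<lambda>\<xi>. cis (h \<bullet> \<xi>) * v \<xi> - v \<xi>))" using has_fourier_sqn[OF d] by simp
    also have "\<dots> = (\<integral>\<^sup>+\<xi>. ennreal ((norm (cis (h \<bullet> \<xi>) * v \<xi> - v \<xi>))\<^sup>2) \<partial>lebesgue)"
      unfolding sqn_def by (rule nn_integral_eq_integral[OF L2_integrable[OF dL(2)], symmetric]) simp
    also have "\<dots> = (\<integral>\<^sup>+\<xi>. ennreal ((2 - 2 * cos (h \<bullet> \<xi>)) * w \<xi>) \<partial>lebesgue)"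
      unfolding norm_cis_minus_one by (rule nn_integral_cong_AE, rule eventually_mono[OF w]) simp
    finally show ?thesis by (simp add: nn_integral_completion)
  qed
  have "(\<integral>\<^sup>+x. (\<integral>\<^sup>+y. ennreal ((u x - u y)\<^sup>2 / norm (x - y) powr a) \<partial>lborel) \<partial>lborel) =
     (\<integral>\<^sup>+x. (\<integral>\<^sup>+h. ennreal ((u x - u (x + h))\<^sup>2 / norm h powr a) \<partial>lborel) \<partial>lborel)"
  proof (rule nn_integral_cong)
    fix x
    have "(\<integral>\<^sup>+y. ennreal ((u x - u y)\<^sup>2 / norm (x - y) powr a) \<partial>lborel) = (\<integral>\<^sup>+h. ennreal ((u x - u (x + h))\<^sup>2 / norm (x - (x + h)) powr a) \<partial>lborel)"
      by (rule nn_integral_lborel_shift) measurable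
    then show "(\<integral>\<^sup>+y. ennreal ((u x - u y)\<^sup>2 / norm (x - y) powr a) \<partial>lborel) = (\<integral>\<^sup>+h. ennreal ((u x - u (x + h))\<^sup>2 / norm h powr a) \<partial>lborel)"
      by simp
  qed
  also have "\<dots> = (\<integral>\<^sup>+h. (\<integral>\<^sup>+x. ennreal ((u x - u (x + h))\<^sup>2 / norm h powr a) \<partial>lborel) \<partial>lborel)"
    by (rule lborel_pair.Fubini'[symmetric]) measurable
  also have "\<dots> = (\<integral>\<^sup>+h. (\<integral>\<^sup>+\<xi>. ennreal ((2 - 2 * cos (h \<bullet> \<xi>)) / norm h powr a * w \<xi>) \<partial>lborel) \<partial>lborel)"
  proof (rule nn_integral_cong)
    fix h :: "real ^ 'n"
    have "(\<integral>\<^sup>+x. ennreal ((u x - u (x + h))\<^sup>2 / norm h powr a) \<partial>lborel) = (\<integral>\<^sup>+x. ennreal (1 / norm h powr a) * ennreal ((u x - u (x + h))\<^sup>2) \<partial>lborel)"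
      by (simp add: ennreal_mult[symmetric])
    also have "\<dots> = ennreal (1 / norm h powr a) * (\<integral>\<^sup>+\<xi>. ennreal ((2 - 2 * cos (h \<bullet> \<xi>)) * w \<xi>) \<partial>lborel)"
      unfolding inner[symmetric] by (rule nn_integral_cmult) measurable
    also have "\<dots> = (\<integral>\<^sup>+\<xi>. ennreal (1 / norm h powr a) * ennreal ((2 - 2 * cos (h \<bullet> \<xi>)) * w \<xi>) \<partial>lborel)"
      by (rule nn_integral_cmult[symmetric]) measurable
    also have "\<dots> = (\<integral>\<^sup>+\<xi>. ennreal ((2 - 2 * cos (h \<bullet> \<xi>)) / norm h powr a * w \<xi>) \<partial>lborel)"
      using c0 wn by (simp add: ennreal_mult[symmetric])
    finally show "(\<integral>\<^sup>+x. ennreal ((u x - u (x + h))\<^sup>2 / norm h powr a) \<partial>lborel) = (\<integral>\<^sup>+\<xi>. ennreal ((2 - 2 * cos (h \<bullet> \<xi>)) / norm h powr a * w \<xi>) \<partial>lborel)" .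
  qed
  also have "\<dots> = (\<integral>\<^sup>+\<xi>. (\<integral>\<^sup>+h. ennreal ((2 - 2 * cos (h \<bullet> \<xi>)) / norm h powr a * w \<xi>) \<partial>lborel) \<partial>lborel)"
    by (rule lborel_pair.Fubini') measurable
  also have "\<dots> = (\<integral>\<^sup>+\<xi>. ennreal K * ennreal (norm \<xi> powr (2 * \<sigma>) * w \<xi>) \<partial>lborel)"
  proof (rule nn_integral_cong)
    fix \<xi> :: "real ^ 'n"
    have "(\<integral>\<^sup>+h. ennreal ((2 - 2 * cos (h \<bullet> \<xi>)) / norm h powr a * w \<xi>) \<partial>lborel) = (\<integral>\<^sup>+h. ennreal ((2 - 2 * cos (h \<bullet> \<xi>)) / norm h powr a) \<partial>lborel) * ennreal (w \<xi>)"
      using c0 wn by (subst nn_integral_multc[symmetric]) (auto intro!: nn_integral_cong simp: ennreal_mult[symmetric])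
    then show "(\<integral>\<^sup>+h. ennreal ((2 - 2 * cos (h \<bullet> \<xi>)) / norm h powr a * w \<xi>) \<partial>lborel) = ennreal K * ennreal (norm \<xi> powr (2 * \<sigma>) * w \<xi>)"
      using K(2) wn by (simp add: K(1) ennreal_mult mult.assoc)
  qed
  also have "\<dots> = ennreal K * (\<integral>\<^sup>+\<xi>. ennreal (norm \<xi> powr (2 * \<sigma>) * w \<xi>) \<partial>lborel)"
    by (rule nn_integral_cmult) measurable
  also have "(\<integral>\<^sup>+\<xi>. ennreal (norm \<xi> powr (2 * \<sigma>) * w \<xi>) \<partial>lborel) = (\<integral>\<^sup>+\<xi>. ennreal (norm \<xi> powr (2 * \<sigma>) * (norm (v \<xi>))\<^sup>2) \<partial>lebesgue)"
    unfolding nn_integral_completion[symmetric, of lborel]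
    by (rule nn_integral_cong_AE, rule eventually_mono[OF w]) simp
  finally show ?thesis .
qed

text \<open>The homogeneous Sobolev form of order \<open>r\<close>, on the Fourier side.\<close>

definition hom_integrable :: "real \<Rightarrow> (real ^ 'n \<Rightarrow> complex) \<Rightarrow> bool" where
  "hom_integrable r v \<longleftrightarrow> v \<in> L2 \<and> integrable lebesgue (\<lambda>\<xi>. norm \<xi> powr (2 * r) * (norm (v \<xi>))\<^sup>2)"

definition hom_form :: "real \<Rightarrow> (real ^ 'n \<Rightarrow> complex) \<Rightarrow> (real ^ 'n \<Rightarrow> complex) \<Rightarrow> real" where
  "hom_form r v w = (LINT \<xi>|lebesgue. norm \<xi> powr (2 * r) * Re (v \<xi> * cnj (w \<xi>)))"

lemma norm_powr_measurable [measurable]: "(\<lambda>\<xi> :: real ^ 'n. norm \<xi> powr r) \<in> borel_measurable lebesgue"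
  by (intro measurable_completion) measurable

lemma hom_form_self: "hom_form r v v = (LINT \<xi>|lebesgue. norm \<xi> powr (2 * r) * (norm (v \<xi>))\<^sup>2)"
  unfolding hom_form_def by (simp only: Re_mult_cnj)

lemma hom_form_nonneg: "0 \<le> hom_form r v v"
  unfolding hom_form_self by simp

lemma hom_form_commute: "hom_form r v w = hom_form r w v"
  unfolding hom_form_def by (simp add: mult.commute)

lemma hom_form_integrable:
  assumes "hom_integrable r v" "hom_integrable r w"
  shows "integrable lebesgue (\<lambda>\<xi>. norm \<xi> powr (2 * r) * norm (v \<xi> * cnj (w \<xi>)))"
    and "integrable lebesgue (\<lambda>\<xi>. norm \<xi> powr (2 * r) * Re (v \<xi> * cnj (w \<xi>)))"
proof -
  have [measurable]: "v \<in> borel_measurable lebesgue" "w \<in> borel_measurable lebesgue"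
    using assms L2_measurable by (auto simp: hom_integrable_def)
  have i: "integrable lebesgue (\<lambda>\<xi>. norm \<xi> powr (2 * r) * (norm (v \<xi>))\<^sup>2 + norm \<xi> powr (2 * r) * (norm (w \<xi>))\<^sup>2)"
    using assms by (simp add: hom_integrable_def)
  have b: "norm \<xi> powr (2 * r) * norm (v \<xi> * cnj (w \<xi>)) \<le> norm \<xi> powr (2 * r) * (norm (v \<xi>))\<^sup>2 + norm \<xi> powr (2 * r) * (norm (w \<xi>))\<^sup>2" for \<xi>
  proof -
    have "2 * norm (v \<xi>) * norm (w \<xi>) \<le> (norm (v \<xi>))\<^sup>2 + (norm (w \<xi>))\<^sup>2" by (rule sum_squares_bound)
    moreover have "0 \<le> norm (v \<xi>) * norm (w \<xi>)" by simp
    ultimately have "norm (v \<xi> * cnj (w \<xi>)) \<le> (norm (v \<xi>))\<^sup>2 + (norm (w \<xi>))\<^sup>2" unfolding norm_mult complex_mod_cnj by linarith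
    from mult_left_mono[OF this, of "norm \<xi> powr (2 * r)"] show ?thesis by (simp add: distrib_left)
  qed
  show 1: "integrable lebesgue (\<lambda>\<xi>. norm \<xi> powr (2 * r) * norm (v \<xi> * cnj (w \<xi>)))"
    by (rule Bochner_Integration.integrable_bound[OF i]) (use b in \<open>auto intro: order_trans[OF _ abs_ge_self]\<close>)
  show "integrable lebesgue (\<lambda>\<xi>. norm \<xi> powr (2 * r) * Re (v \<xi> * cnj (w \<xi>)))"
  proof (rule Bochner_Integration.integrable_bound[OF 1])
    show "(\<lambda>\<xi>. norm \<xi> powr (2 * r) * Re (v \<xi> * cnj (w \<xi>))) \<in> borel_measurable lebesgue" by measurable
    show "AE \<xi> in lebesgue. norm (norm \<xi> powr (2 * r) * Re (v \<xi> * cnj (w \<xi>))) \<le> norm (norm \<xi> powr (2 * r) * norm (v \<xi> * cnj (w \<xi>)))"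
      by (intro AE_I2) (simp add: abs_mult mult_left_mono abs_Re_le_cmod del: times_complex.sel norm_mult)
  qed
qed

lemma hom_integrable_linear:
  assumes v: "hom_integrable r v" and w: "hom_integrable r w"
  shows "hom_integrable r (\<lambda>\<xi>. of_real a * v \<xi> + of_real b * w \<xi>)"
proof -
  have L: "(\<lambda>\<xi>. of_real a * v \<xi> + of_real b * w \<xi>) \<in> L2"
    using L2_add[OF L2_scaleR(1)[of v a] L2_scaleR(1)[of w b]] v w by (simp add: hom_integrable_def scaleR_conv_of_real)
  have e: "norm \<xi> powr (2 * r) * (norm (of_real a * v \<xi> + of_real b * w \<xi>))\<^sup>2 =
     a\<^sup>2 * (norm \<xi> powr (2 * r) * (norm (v \<xi>))\<^sup>2) + (2 * a * b) * (norm \<xi> powr (2 * r) * Re (v \<xi> * cnj (w \<xi>))) + b\<^sup>2 * (norm \<xi> powr (2 * r) * (norm (w \<xi>))\<^sup>2)" for \<xi>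
    unfolding norm_add_Re by (simp add: norm_mult power_mult_distrib algebra_simps)
  have "integrable lebesgue (\<lambda>\<xi>. norm \<xi> powr (2 * r) * (norm (of_real a * v \<xi> + of_real b * w \<xi>))\<^sup>2)"
    unfolding e by (intro Bochner_Integration.integrable_add integrable_mult_right hom_form_integrable(2)[OF v w])
      (use v w in \<open>simp_all add: hom_integrable_def\<close>)
  then show ?thesis using L by (simp add: hom_integrable_def)
qed

lemma hom_form_linear:
  assumes v: "hom_integrable r v" and w: "hom_integrable r w" and z: "hom_integrable r z"
  shows "hom_form r (\<lambda>\<xi>. of_real a * v \<xi> + of_real b * w \<xi>) z = a * hom_form r v z + b * hom_form r w z"
proof -
  have e: "norm \<xi> powr (2 * r) * Re ((of_real a * v \<xi> + of_real b * w \<xi>) * cnj (z \<xi>)) =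
     a * (norm \<xi> powr (2 * r) * Re (v \<xi> * cnj (z \<xi>))) + b * (norm \<xi> powr (2 * r) * Re (w \<xi> * cnj (z \<xi>)))" for \<xi>
    by (simp add: algebra_simps)
  show ?thesis unfolding hom_form_def e
    using hom_form_integrable(2)[OF v z] hom_form_integrable(2)[OF w z] by (simp del: times_complex.sel)
qed

lemma hom_form_add_self:
  assumes v: "hom_integrable r v" and w: "hom_integrable r w"
  shows "hom_form r (\<lambda>\<xi>. v \<xi> + w \<xi>) (\<lambda>\<xi>. v \<xi> + w \<xi>) = hom_form r v v + 2 * hom_form r v w + hom_form r w w"
proof -
  have vw: "hom_integrable r (\<lambda>\<xi>. v \<xi> + w \<xi>)" using hom_integrable_linear[OF v w, of 1 1] by simp
  have "hom_form r (\<lambda>\<xi>. v \<xi> + w \<xi>) (\<lambda>\<xi>. v \<xi> + w \<xi>) = hom_form r v (\<lambda>\<xi>. v \<xi> + w \<xi>) + hom_form r w (\<lambda>\<xi>. v \<xi> + w \<xi>)"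
    using hom_form_linear[OF v w vw, of 1 1] by simp
  also have "hom_form r v (\<lambda>\<xi>. v \<xi> + w \<xi>) = hom_form r v v + hom_form r v w"
    using hom_form_linear[OF v w v, of 1 1] hom_form_commute[of r v "\<lambda>\<xi>. v \<xi> + w \<xi>"] hom_form_commute[of r w v] by simp
  also have "hom_form r w (\<lambda>\<xi>. v \<xi> + w \<xi>) = hom_form r v w + hom_form r w w"
    using hom_form_linear[OF v w w, of 1 1] hom_form_commute[of r w "\<lambda>\<xi>. v \<xi> + w \<xi>"] by simp
  finally show ?thesis by simp
qed

lemma frac_const_pos:
  assumes "0 < \<sigma>" "\<sigma> < 1"
  shows "frac_const TYPE('n::finite) \<sigma> > 0"
proof -
  have "- \<sigma> \<notin> \<int>\<^sub>\<le>\<^sub>0"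
  proof
    assume "- \<sigma> \<in> \<int>\<^sub>\<le>\<^sub>0"
    then obtain n :: nat where "- \<sigma> = - of_nat n" by (auto elim!: nonpos_Ints_cases')
    then have "\<sigma> = real n" by simp
    then show False using assms by (cases n) auto
  qed
  then have "Gamma (- \<sigma>) \<noteq> 0" by (simp add: Gamma_eq_zero_iff)
  moreover have "Gamma (real CARD('n) / 2 + \<sigma>) > 0" using assms by (intro Gamma_real_pos) (simp add: add_nonneg_pos)
  ultimately show ?thesis unfolding frac_const_def by simp
qed

text \<open>Polarisation of the preceding identity. The arguments below compare signs only, so that positivity
  is all that is recorded of the factor.\<close>
theorem form_frac_fourier:
  fixes \<sigma> :: real
  assumes \<sigma>: "0 < \<sigma>" "\<sigma> < 1"
  obtains \<kappa> where "\<kappa> > 0" "\<And>(u :: real ^ 'n \<Rightarrow> real) w v z. has_fourier u v \<Longrightarrow> has_fourier w z \<Longrightarrow>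
    hom_integrable \<sigma> v \<Longrightarrow> hom_integrable \<sigma> z \<Longrightarrow> form_frac \<sigma> u w = \<kappa> * hom_form \<sigma> v z"
proof -
  obtain K where K: "K > 0" "\<And>\<xi> :: real ^ 'n. (\<integral>\<^sup>+h. ennreal ((2 - 2 * cos (h \<bullet> \<xi>)) / norm h powr (real CARD('n) + 2 * \<sigma>)) \<partial>lborel) = ennreal (K * norm \<xi> powr (2 * \<sigma>))"
    using gagliardo_symbol[OF \<sigma>, where 'n='n] by blast
  define a where "a = real CARD('n) + 2 * \<sigma>"
  note Ka = K(2)[folded a_def]
  let ?P = "lborel \<Otimes>\<^sub>M lborel :: ((real ^ 'n) \<times> (real ^ 'n)) measure"
  \<comment> \<open>Half of the singular weight goes to each factor, so that the form is an inner product of quotients.\<close>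
  define D where "D u p = (u (fst p) - u (snd p)) / norm (fst p - snd p) powr (a / 2)" for u :: "real ^ 'n \<Rightarrow> real" and p
  have pp: "norm x powr (a / 2) * norm x powr (a / 2) = norm x powr a" for x :: "real ^ 'n"
    by (simp add: powr_add[symmetric])
  have D2: "(D u p)\<^sup>2 = (u (fst p) - u (snd p))\<^sup>2 / norm (fst p - snd p) powr a" for u p
    unfolding D_def power2_eq_square times_divide_times_eq pp ..
  have Dm: "D u \<in> borel_measurable ?P" if "u \<in> borel_measurable borel" for u
  proof -
    note that[measurable]
    show ?thesis unfolding D_def[abs_def] by measurable
  qed
  have sq: "integrable ?P (\<lambda>p. (D u p)\<^sup>2) \<and> (LINT p|?P. (D u p)\<^sup>2) = K * hom_form \<sigma> v v"
    if u: "has_fourier u v" "hom_integrable \<sigma> v" and um[measurable]: "u \<in> borel_measurable borel" for u v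
  proof -
    note Dm[OF um, measurable]
    have i: "integrable lebesgue (\<lambda>\<xi>. norm \<xi> powr (2 * \<sigma>) * (norm (v \<xi>))\<^sup>2)" using u(2) by (simp add: hom_integrable_def)
    have "(\<integral>\<^sup>+p. ennreal ((D u p)\<^sup>2) \<partial>?P) = (\<integral>\<^sup>+x. (\<integral>\<^sup>+y. ennreal ((D u (x, y))\<^sup>2) \<partial>lborel) \<partial>lborel)"
      by (rule lborel.nn_integral_fst[symmetric]) measurable
    also have "\<dots> = ennreal K * (\<integral>\<^sup>+\<xi>. ennreal (norm \<xi> powr (2 * \<sigma>) * (norm (v \<xi>))\<^sup>2) \<partial>lebesgue)"
      unfolding D2 fst_conv snd_conv by (rule gagliardo_nn_integral[OF Ka K(1) u(1) um])
    also have "(\<integral>\<^sup>+\<xi>. ennreal (norm \<xi> powr (2 * \<sigma>) * (norm (v \<xi>))\<^sup>2) \<partial>lebesgue) = ennreal (hom_form \<sigma> v v)"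
      unfolding hom_form_self by (rule nn_integral_eq_integral[OF i]) simp
    finally have n: "(\<integral>\<^sup>+p. ennreal ((D u p)\<^sup>2) \<partial>?P) = ennreal (K * hom_form \<sigma> v v)"
      using K(1) hom_form_nonneg[of \<sigma> v] by (simp add: ennreal_mult less_imp_le)
    have "integrable ?P (\<lambda>p. (D u p)\<^sup>2)"
      by (rule integrableI_nonneg) (use n in auto)
    moreover have "(LINT p|?P. (D u p)\<^sup>2) = K * hom_form \<sigma> v v"
      by (rule integral_eq_nn_integral[THEN trans]) (use n K(1) hom_form_nonneg[of \<sigma> v] in auto)
    ultimately show ?thesis by blast
  qed
  have bil: "integrable ?P (\<lambda>p. D u p * D w p) \<and> (LINT p|?P. D u p * D w p) = K * hom_form \<sigma> v z"
    if u: "has_fourier u v" "hom_integrable \<sigma> v" "u \<in> borel_measurable borel"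
    and w: "has_fourier w z" "hom_integrable \<sigma> z" "w \<in> borel_measurable borel" for u w v z
  proof -
    have vz: "hom_integrable \<sigma> (\<lambda>\<xi>. v \<xi> + z \<xi>)" using hom_integrable_linear[OF u(2) w(2), of 1 1] by simp
    have m: "(\<lambda>x. u x + w x) \<in> borel_measurable borel" using u(3) w(3) by simp
    note s = sq[OF u] sq[OF w] sq[OF has_fourier_add[OF u(1) w(1)] vz m]
    have e: "D u p * D w p = ((D (\<lambda>x. u x + w x) p)\<^sup>2 - (D u p)\<^sup>2 - (D w p)\<^sup>2) / 2" for p
      by (simp add: D_def power2_eq_square add_divide_distrib diff_divide_distrib algebra_simps)
    have "integrable ?P (\<lambda>p. D u p * D w p)" unfolding e using s by simp
    moreover have "(LINT p|?P. D u p * D w p) = K * hom_form \<sigma> v z"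
      unfolding e using s hom_form_add_self[OF u(2) w(2)] by (simp add: algebra_simps)
    ultimately show ?thesis by blast
  qed
  define \<kappa> where "\<kappa> = frac_const TYPE('n) \<sigma> / 2 * K"
  show thesis
  proof (rule that)
    show "\<kappa> > 0" unfolding \<kappa>_def using frac_const_pos[OF \<sigma>, where 'n='n] K(1) by simp
    fix u w :: "real ^ 'n \<Rightarrow> real" and v z
    assume uv: "has_fourier u v" and wz: "has_fourier w z" and hv: "hom_integrable \<sigma> v" and hz: "hom_integrable \<sigma> z"
    have um: "u \<in> borel_measurable lebesgue" "w \<in> borel_measurable lebesgue"
      using has_fourier_L2(1) uv wz L2_measurable by blast+
    obtain u' where u': "u' \<in> borel_measurable borel" "AE x in lebesgue. u x = u' x"
      using lebesgue_borel_representative[OF um(1)] by blast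
    obtain w' where w': "w' \<in> borel_measurable borel" "AE x in lebesgue. w x = w' x"
      using lebesgue_borel_representative[OF um(2)] by blast
    have u'v: "has_fourier u' v" and w'z: "has_fourier w' z"
      using has_fourier_cong[OF uv u'(2)] has_fourier_cong[OF wz w'(2)] by auto
    note [measurable] = u'(1) w'(1)
    define k where "k x y = norm (x - y) powr a" for x y :: "real ^ 'n"
    note b = bil[OF u'v hv u'(1) w'z hz w'(1)]
    have DD: "D u' (x, y) * D w' (x, y) = (u' x - u' y) * (w' x - w' y) / k x y" for x y
      unfolding D_def k_def fst_conv snd_conv times_divide_times_eq pp ..
    have inner: "(LINT y|lebesgue. (u' x - u' y) * (w' x - w' y) / k x y) = (LINT y|lborel. D u' (x, y) * D w' (x, y))" for x
      unfolding DD k_def by (rule integral_completion) measurable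
    have ae: "AE x in lebesgue. (LINT y|lborel. D u' (x, y) * D w' (x, y)) = (LINT y|lebesgue. (u x - u y) * (w x - w y) / k x y)"
      using u'(2) w'(2)
    proof eventually_elim
      case (elim x)
      have km: "k x \<in> borel_measurable lebesgue" unfolding k_def[abs_def] by (intro measurable_completion) measurable
      have "u' \<in> borel_measurable lebesgue" "w' \<in> borel_measurable lebesgue" using u'(1) w'(1) by (simp_all add: measurable_completion)
      then have "(LINT y|lebesgue. (u' x - u' y) * (w' x - w' y) / k x y) = (LINT y|lebesgue. (u x - u y) * (w x - w y) / k x y)"
      proof (intro integral_cong_AE)
        show "AE y in lebesgue. (u' x - u' y) * (w' x - w' y) / k x y = (u x - u y) * (w x - w y) / k x y"
          using u'(2) w'(2) by eventually_elim (use elim in simp)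
      qed (use um km in \<open>auto intro!: borel_measurable_divide borel_measurable_times borel_measurable_diff\<close>)
      then show ?case using inner by simp
    qed
    have m: "(\<lambda>x. LINT y|lborel. D u' (x, y) * D w' (x, y)) \<in> borel_measurable borel"
    proof -
      have "(\<lambda>(x, y). D u' (x, y) * D w' (x, y)) \<in> borel_measurable ?P"
        using Dm[OF u'(1)] Dm[OF w'(1)] by (simp add: split_beta')
      from lborel.borel_measurable_lebesgue_integral[OF this] show ?thesis by simp
    qed
    then have m': "(\<lambda>x. LINT y|lborel. D u' (x, y) * D w' (x, y)) \<in> borel_measurable lebesgue" by (simp add: measurable_completion)
    have "(LINT x|lebesgue. LINT y|lebesgue. (u x - u y) * (w x - w y) / k x y) = (LINT x|lebesgue. LINT y|lborel. D u' (x, y) * D w' (x, y))"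
      by (rule integral_cong_AE[symmetric, OF m' lebesgue_measurable_cong_AE[OF m' ae] ae])
    also have "\<dots> = (LINT x|lborel. LINT y|lborel. D u' (x, y) * D w' (x, y))"
      by (rule integral_completion) (use m in simp)
    also have "\<dots> = (LINT p|?P. D u' p * D w' p)"
      by (rule lborel_pair.integral_fst') (use b in blast)
    also have "\<dots> = K * hom_form \<sigma> v z" using b by blast
    finally show "form_frac \<sigma> u w = \<kappa> * hom_form \<sigma> v z"
      unfolding form_frac_def \<kappa>_def k_def a_def by simp
  qed
qed

section \<open>Smooth bump functions\<close>

primrec diff_times :: "nat \<Rightarrow> (real \<Rightarrow> real) \<Rightarrow> bool" where
  "diff_times 0 f \<longleftrightarrow> True"
| "diff_times (Suc n) f \<longleftrightarrow> (\<forall>x. f differentiable at x) \<and> diff_times n (deriv f)"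

lemma diff_times_SucD: "diff_times (Suc n) f \<Longrightarrow> diff_times n f"
  by (induction n arbitrary: f) auto

lemma diff_DERIV: "f differentiable at x \<Longrightarrow> (f has_real_derivative deriv f x) (at x)"
  using DERIV_deriv_iff_real_differentiable by blast

lemma DERIV_differentiable: "(f has_real_derivative d) (at x) \<Longrightarrow> f differentiable at x"
  using real_differentiable_def by blast

lemma diff_times_add: "diff_times n f \<Longrightarrow> diff_times n g \<Longrightarrow> diff_times n (\<lambda>x. f x + g x)"
proof (induction n arbitrary: f g)
  case (Suc n)
  have d: "((\<lambda>x. f x + g x) has_real_derivative deriv f x + deriv g x) (at x)" for x
    using Suc.prems by (intro DERIV_add diff_DERIV) auto
  then have "deriv (\<lambda>x. f x + g x) = (\<lambda>x. deriv f x + deriv g x)" using DERIV_imp_deriv by blast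
  then show ?case using Suc DERIV_differentiable[OF d] by simp
qed simp

lemma diff_times_mult: "diff_times n f \<Longrightarrow> diff_times n g \<Longrightarrow> diff_times n (\<lambda>x. f x * g x)"
proof (induction n arbitrary: f g)
  case (Suc n)
  have d: "((\<lambda>x. f x * g x) has_real_derivative deriv f x * g x + deriv g x * f x) (at x)" for x
    using Suc.prems by (intro DERIV_mult diff_DERIV) auto
  then have "deriv (\<lambda>x. f x * g x) = (\<lambda>x. deriv f x * g x + deriv g x * f x)" using DERIV_imp_deriv by blast
  moreover have "diff_times n (\<lambda>x. deriv f x * g x + deriv g x * f x)"
    using Suc.prems diff_times_SucD by (intro diff_times_add Suc.IH) auto
  ultimately show ?case using DERIV_differentiable[OF d] by simp
qed simp

lemma diff_times_cmult: "diff_times n f \<Longrightarrow> diff_times n (\<lambda>x. c * f x)"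
proof (induction n arbitrary: f)
  case (Suc n)
  have d: "((\<lambda>x. c * f x) has_real_derivative c * deriv f x) (at x)" for x
    using Suc.prems by (intro DERIV_cmult diff_DERIV) auto
  then have "deriv (\<lambda>x. c * f x) = (\<lambda>x. c * deriv f x)" using DERIV_imp_deriv by blast
  then show ?case using Suc DERIV_differentiable[OF d] by simp
qed simp

lemma diff_times_affine: "diff_times n f \<Longrightarrow> diff_times n (\<lambda>x. f (c * x + d))"
proof (induction n arbitrary: f)
  case (Suc n)
  have d: "((\<lambda>x. f (c * x + d)) has_real_derivative c * deriv f (c * x + d)) (at x)" for x
  proof -
    have "((\<lambda>x. f (c * x + d)) has_real_derivative deriv f (c * x + d) * c) (at x)"
      by (rule DERIV_chain2[where g="\<lambda>x. c * x + d"])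
         (use Suc.prems diff_DERIV in \<open>auto intro!: derivative_eq_intros\<close>)
    then show ?thesis by (simp add: mult.commute)
  qed
  then have "deriv (\<lambda>x. f (c * x + d)) = (\<lambda>x. c * deriv f (c * x + d))" using DERIV_imp_deriv by blast
  then show ?case using Suc.prems Suc.IH[of "deriv f"] DERIV_differentiable[OF d] diff_times_cmult by auto
qed simp

text \<open>The functions \<open>p (1 / t) * exp (- 1 / t)\<close>, extended by \<open>0\<close>, form a family stable under
  differentiation, which makes all of them smooth.\<close>
definition flat :: "real poly \<Rightarrow> real \<Rightarrow> real" where
  "flat p t = (if t > 0 then poly p (1 / t) * exp (- (1 / t)) else 0)"

lemma poly_exp_tendsto_0: "((\<lambda>s. poly p s * exp (- s)) \<longlongrightarrow> (0::real)) at_top"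
proof -
  have *: "((\<lambda>s. s ^ j * exp (- s)) \<longlongrightarrow> (0::real)) at_top" for j
    using tendsto_power_div_exp_0[of j] by (simp add: exp_minus divide_inverse)
  have "((\<lambda>s. \<Sum>i\<le>degree p. coeff p i * (s ^ i * exp (- s))) \<longlongrightarrow> (\<Sum>i\<le>degree p. coeff p i * 0)) at_top"
    by (intro tendsto_sum tendsto_mult tendsto_const *)
  moreover have "(\<Sum>i\<le>degree p. coeff p i * (s ^ i * exp (- s))) = poly p s * exp (- s)" for s
    by (simp add: poly_altdef sum_distrib_right mult.assoc)
  ultimately show ?thesis by simp
qed

lemma flat_has_derivative:
  "(flat p has_real_derivative flat ([:0, 0, 1:] * (p - pderiv p)) t) (at t)"
proof -
  consider "t > 0" | "t < 0" | "t = 0" by linarith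
  then show ?thesis
  proof cases
    case 1
    have "((\<lambda>t. poly p (1 / t) * exp (- (1 / t))) has_real_derivative
        poly (pderiv p) (1 / t) * (- 1 / t\<^sup>2) * exp (- (1 / t)) + (exp (- (1 / t)) * (1 / t\<^sup>2)) * poly p (1 / t)) (at t)"
    proof (rule DERIV_mult)
      have d: "((\<lambda>t. 1 / t) has_real_derivative (- 1 / t\<^sup>2)) (at t)"
        using 1 by (auto intro!: derivative_eq_intros simp: power2_eq_square)
      show "((\<lambda>t. poly p (1 / t)) has_real_derivative poly (pderiv p) (1 / t) * (- 1 / t\<^sup>2)) (at t)"
        by (rule DERIV_chain2[OF poly_DERIV d])
      have "((\<lambda>t. - (1 / t)) has_real_derivative (1 / t\<^sup>2)) (at t)"
        using DERIV_minus[OF d] by simp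
      from DERIV_chain2[OF DERIV_exp this]
      show "((\<lambda>t. exp (- (1 / t))) has_real_derivative exp (- (1 / t)) * (1 / t\<^sup>2)) (at t)" .
    qed
    then have "(flat p has_real_derivative
        poly (pderiv p) (1 / t) * (- 1 / t\<^sup>2) * exp (- (1 / t)) + (exp (- (1 / t)) * (1 / t\<^sup>2)) * poly p (1 / t)) (at t)"
      by (rule has_field_derivative_transform_within_open[where S="{0<..}"]) (use 1 in \<open>auto simp: flat_def\<close>)
    then show ?thesis using 1 by (simp add: flat_def power2_eq_square algebra_simps diff_divide_distrib)
  next
    case 2
    have "((\<lambda>t. 0) has_real_derivative 0) (at t)" by simp
    then have "(flat p has_real_derivative 0) (at t)"
      by (rule has_field_derivative_transform_within_open[where S="{..<0}"]) (use 2 in \<open>auto simp: flat_def\<close>)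
    then show ?thesis using 2 by (simp add: flat_def)
  next
    case 3
    have r: "((\<lambda>h. flat p h / h) \<longlongrightarrow> 0) (at_right 0)"
    proof -
      have "((\<lambda>h. poly (pCons 0 p) (inverse h) * exp (- inverse h)) \<longlongrightarrow> 0) (at_right (0::real))"
        by (rule filterlim_compose[OF poly_exp_tendsto_0 filterlim_inverse_at_top_right])
      moreover have "\<forall>\<^sub>F h in at_right (0::real). poly (pCons 0 p) (inverse h) * exp (- inverse h) = flat p h / h"
        using eventually_at_right_less[of "0::real"] by eventually_elim (simp add: flat_def divide_inverse)
      ultimately show ?thesis by (rule Lim_transform_eventually)
    qed
    have l: "((\<lambda>h. flat p h / h) \<longlongrightarrow> 0) (at_left 0)"
      by (rule tendsto_eventually) (simp add: eventually_at_filter flat_def)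
    have "((\<lambda>h. (flat p (0 + h) - flat p 0) / h) \<longlongrightarrow> 0) (at 0)"
      using filterlim_split_at[OF l r] by (simp add: flat_def)
    then show ?thesis using 3 by (simp add: DERIV_def flat_def)
  qed
qed

lemma diff_times_flat: "diff_times n (flat p)"
proof (induction n arbitrary: p)
  case (Suc n)
  have "deriv (flat p) = flat ([:0, 0, 1:] * (p - pderiv p))"
    using flat_has_derivative DERIV_imp_deriv by blast
  then show ?case using Suc DERIV_differentiable[OF flat_has_derivative] by simp
qed simp

text \<open>The parameter \<open>n\<close> sharpens the bump, which tends to the indicator of the interval.\<close>
definition bump1 :: "nat \<Rightarrow> real \<Rightarrow> real \<Rightarrow> real \<Rightarrow> real" where
  "bump1 n a b t = flat 1 (real n * t + (- (real n * a))) * flat 1 ((- real n) * t + real n * b)"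

lemma diff_times_bump1: "diff_times j (bump1 n a b)"
  unfolding bump1_def[abs_def] by (intro diff_times_mult diff_times_affine diff_times_flat)

lemma flat_1_bounds: "0 \<le> flat 1 t" "flat 1 t \<le> 1" "t > 0 \<Longrightarrow> flat 1 t > 0"
  by (auto simp: flat_def)

lemma bump1_bounds: "0 \<le> bump1 n a b t" "bump1 n a b t \<le> 1"
  unfolding bump1_def using flat_1_bounds by (auto intro!: mult_nonneg_nonneg mult_le_one)

lemma bump1_outside: "\<not> (a < t \<and> t < b) \<Longrightarrow> bump1 n a b t = 0"
proof -
  assume "\<not> (a < t \<and> t < b)"
  then have "real n * t + (- (real n * a)) \<le> 0 \<or> (- real n) * t + real n * b \<le> 0"
    using mult_left_mono[of t a "real n"] mult_left_mono[of b t "real n"] by auto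
  then show ?thesis by (auto simp: bump1_def flat_def)
qed

lemma bump1_pos: "a < t \<Longrightarrow> t < b \<Longrightarrow> n > 0 \<Longrightarrow> bump1 n a b t > 0"
  unfolding bump1_def by (intro mult_pos_pos flat_1_bounds(3)) auto

lemma flat_1_tendsto:
  assumes "c > 0" shows "(\<lambda>n. flat 1 (real n * c)) \<longlonglongrightarrow> 1"
proof -
  have "(\<lambda>n. exp (- (1 / (real n * c)))) \<longlonglongrightarrow> exp (- 0)"
    using assms by (intro tendsto_intros real_tendsto_divide_at_top[OF tendsto_const] filterlim_tendsto_pos_mult_at_top[OF tendsto_const] filterlim_real_sequentially)
       (simp add: mult.commute filterlim_tendsto_pos_mult_at_top[OF tendsto_const _ filterlim_real_sequentially])
  moreover have "\<forall>\<^sub>F n in sequentially. exp (- (1 / (real n * c))) = flat 1 (real n * c)"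
    using eventually_gt_at_top[of 0] by eventually_elim (use assms in \<open>simp add: flat_def\<close>)
  ultimately show ?thesis using Lim_transform_eventually by fastforce
qed

lemma bump1_tendsto: "(\<lambda>n. bump1 n a b t) \<longlonglongrightarrow> indicator {a<..<b} t"
proof (cases "a < t \<and> t < b")
  case True
  have "(\<lambda>n. flat 1 (real n * (t - a)) * flat 1 (real n * (b - t))) \<longlonglongrightarrow> 1 * 1"
    using True by (intro tendsto_mult flat_1_tendsto) auto
  then show ?thesis using True by (simp add: bump1_def algebra_simps indicator_def)
next
  case False
  then have "bump1 n a b t = 0" for n using bump1_outside by blast
  then show ?thesis using False by (auto simp: indicator_def)
qed

definition tensor :: "('n::finite \<Rightarrow> real \<Rightarrow> real) \<Rightarrow> real ^ 'n \<Rightarrow> real" where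
  "tensor g x = (\<Prod>k\<in>UNIV. g k (x $ k))"

lemma tensor_has_derivative:
  fixes g :: "'n::finite \<Rightarrow> real \<Rightarrow> real"
  assumes "\<And>k x. g k differentiable at x"
  shows "(tensor g has_derivative (\<lambda>h. \<Sum>k\<in>UNIV. (h $ k) * tensor (g(k := deriv (g k))) x)) (at x)"
proof -
  have "((\<lambda>x. g k (x $ k)) has_derivative (\<lambda>h. (h $ k) * deriv (g k) (x $ k))) (at x)" for k
  proof -
    have "(g k has_derivative (\<lambda>h. h * deriv (g k) (x $ k))) (at (x $ k))"
      using diff_DERIV[OF assms, of k "x $ k"] unfolding has_field_derivative_def
      by (rule has_derivative_eq_rhs) (auto simp: mult.commute)
    from has_derivative_compose[OF bounded_linear_imp_has_derivative[OF bounded_linear_vec_nth] this]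
    show ?thesis by simp
  qed
  then have "(tensor g has_derivative (\<lambda>h. \<Sum>k\<in>UNIV. (h $ k) * deriv (g k) (x $ k) * (\<Prod>j\<in>UNIV - {k}. g j (x $ j)))) (at x)"
    unfolding tensor_def[abs_def] by (intro has_derivative_prod) auto
  moreover have "deriv (g k) (x $ k) * (\<Prod>j\<in>UNIV - {k}. g j (x $ j)) = tensor (g(k := deriv (g k))) x" for k
    unfolding tensor_def by (subst prod.remove[of UNIV k]) (auto intro!: prod.cong)
  ultimately show ?thesis by (simp add: mult.assoc)
qed

lemma partial_deriv_tensor:
  assumes "\<And>k x. g k differentiable at x"
  shows "partial_deriv i (tensor g) = tensor (g(i := deriv (g i)))"
proof
  fix x
  have "partial_deriv i (tensor g) x = (\<Sum>k\<in>UNIV. ((axis i 1 :: real ^ 'a) $ k) * tensor (g(k := deriv (g k))) x)"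
    unfolding partial_deriv_def frechet_derivative_at[OF tensor_has_derivative[OF assms], symmetric] ..
  also have "\<dots> = (\<Sum>k\<in>UNIV. if k = i then tensor (g(k := deriv (g k))) x else 0)"
    by (intro sum.cong) (auto simp: axis_def)
  finally show "partial_deriv i (tensor g) x = tensor (g(i := deriv (g i))) x" by simp
qed

lemma tensor_partial_derivs:
  assumes "\<And>k n. diff_times n (g k)"
  shows "\<exists>h. foldr partial_deriv ks (tensor g) = tensor h \<and> (\<forall>k n. diff_times n (h k))"
proof (induction ks)
  case (Cons k ks)
  then obtain h where h: "foldr partial_deriv ks (tensor g) = tensor h" "\<And>k n. diff_times n (h k)" by blast
  have d: "h k differentiable at x" for k x using h(2)[of "Suc 0" k] by simp
  have "diff_times n ((h(k := deriv (h k))) j)" for j n using h(2)[of n j] h(2)[of "Suc n" k] by simp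
  then show ?case using h(1) partial_deriv_tensor[of h k, OF d] by auto
qed (use assms in auto)

lemma test_function_partials: "\<phi> \<in> test_functions \<Longrightarrow> foldr partial_deriv ks \<phi> differentiable_on UNIV"
  by (simp add: test_functions_def)

definition box_bump :: "nat \<Rightarrow> real ^ 'n::finite \<Rightarrow> real ^ 'n \<Rightarrow> real ^ 'n \<Rightarrow> real" where
  "box_bump n a b = tensor (\<lambda>k. bump1 n (a $ k) (b $ k))"

lemma box_bump_outside: "x \<notin> box a b \<Longrightarrow> box_bump n a b x = 0"
proof -
  assume "x \<notin> box a b"
  then obtain k where "\<not> (a $ k < x $ k \<and> x $ k < b $ k)" by (auto simp: mem_box_cart)
  then have "bump1 n (a $ k) (b $ k) (x $ k) = 0" by (rule bump1_outside)
  then show ?thesis unfolding box_bump_def tensor_def by (intro prod_zero) auto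
qed

lemma box_bump_bounds: "0 \<le> box_bump n a b x" "box_bump n a b x \<le> 1"
  by (auto simp: box_bump_def tensor_def bump1_bounds intro!: prod_nonneg prod_le_1)

lemma box_bump_pos: "x \<in> box a b \<Longrightarrow> n > 0 \<Longrightarrow> box_bump n a b x > 0"
  by (auto simp: box_bump_def tensor_def mem_box_cart bump1_pos intro!: prod_pos)

lemma box_bump_tendsto: "(\<lambda>n. box_bump n a b x) \<longlonglongrightarrow> indicator (box a b) x"
proof -
  have "(\<lambda>n. box_bump n a b x) \<longlonglongrightarrow> (\<Prod>k\<in>UNIV. indicator {a $ k<..<b $ k} (x $ k))"
    unfolding box_bump_def tensor_def by (intro tendsto_prod bump1_tendsto)
  moreover have "(\<Prod>k\<in>UNIV. indicator {a $ k<..<b $ k} (x $ k)) = (indicator (box a b) x :: real)"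
  proof (cases "x \<in> box a b")
    case False
    then obtain k where "\<not> (a $ k < x $ k \<and> x $ k < b $ k)" by (auto simp: mem_box_cart)
    then have "(\<Prod>k\<in>UNIV. indicator {a $ k<..<b $ k} (x $ k)) = (0::real)"
      by (intro prod_zero) (auto simp: indicator_def)
    then show ?thesis using False by simp
  qed (auto simp: mem_box_cart indicator_def)
  ultimately show ?thesis by simp
qed

lemma box_bump_test_function: "box_bump n a b \<in> test_functions"
proof -
  have "foldr partial_deriv ks (box_bump n a b) differentiable_on UNIV" for ks
  proof -
    obtain h where h: "foldr partial_deriv ks (box_bump n a b) = tensor h" "\<And>k n. diff_times n (h k)"
      using tensor_partial_derivs[of "\<lambda>k. bump1 n (a $ k) (b $ k)" ks] diff_times_bump1
      unfolding box_bump_def by blast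
    have "h k differentiable at x" for k x using h(2)[of "Suc 0" k] by simp
    then show ?thesis unfolding h(1) differentiable_on_def
      using tensor_has_derivative[of h] by (auto simp: differentiable_def)
  qed
  moreover have "compact (closure {x. box_bump n a b x \<noteq> 0})"
  proof -
    have "{x. box_bump n a b x \<noteq> 0} \<subseteq> box a b" using box_bump_outside by blast
    then have "bounded {x. box_bump n a b x \<noteq> 0}" using bounded_box bounded_subset by blast
    then show ?thesis by (simp add: compact_closure)
  qed
  ultimately show ?thesis by (simp add: test_functions_def)
qed

text \<open>Testing against bumps that tend to the indicator of a box shows that the positive and
  negative parts are densities of measures that agree on boxes, hence coincide.\<close>
theorem fundamental_lemma_of_variations:
  fixes g :: "real ^ 'n \<Rightarrow> real"
  assumes g: "locally_integrable g" and z: "\<And>\<phi>. \<phi> \<in> test_functions \<Longrightarrow> (LINT x|lebesgue. g x * \<phi> x) = 0"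
  shows "AE x in lebesgue. g x = 0"
proof -
  have gi: "integrable lebesgue (\<lambda>x. indicator K x * g x)" if "compact K" for K
    using g that by (simp add: locally_integrable_def set_integrable_def)
  have gm: "g \<in> borel_measurable lebesgue"
  proof (rule borel_measurable_LIMSEQ_real)
    show "(\<lambda>x. indicator (cball 0 (real i)) x * g x) \<in> borel_measurable lebesgue" for i
      using gi[OF compact_cball] by blast
    fix x :: "real ^ 'n"
    obtain n :: nat where n: "norm x \<le> real n" using real_arch_simple by blast
    have "indicator (cball 0 (real i)) x * g x = g x" if "i \<ge> n" for i
    proof -
      have "norm x \<le> real i" using n that by linarith
      then show ?thesis by (simp add: indicator_def)
    qed
    then show "(\<lambda>i. indicator (cball 0 (real i)) x * g x) \<longlonglongrightarrow> g x"
      by (intro tendsto_eventually) (auto simp: eventually_sequentially)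
  qed
  obtain g' where g': "g' \<in> borel_measurable borel" "AE x in lebesgue. g x = g' x"
    using lebesgue_borel_representative[OF gm] by blast
  note [measurable] = g'(1)
  have g'i: "integrable lborel (\<lambda>x. indicator (box a b) x * g' x) \<and> (LINT x|lborel. indicator (box a b) x * g' x) = 0" for a b
  proof -
    have bi: "integrable lebesgue (\<lambda>x. indicator (cbox a b) x * g x)" by (rule gi[OF compact_cbox])
    have bm: "(\<lambda>x. indicator (box a b) x * g x) \<in> borel_measurable lebesgue"
      using gm by (intro borel_measurable_times borel_measurable_indicator) auto
    have fm: "(\<lambda>x. g x * box_bump n a b x) \<in> borel_measurable lebesgue" for n
    proof -
      have "box_bump n a b differentiable_on UNIV"
        using test_function_partials[OF box_bump_test_function, of "[]" n a b] by simp
      then have "box_bump n a b \<in> borel_measurable borel"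
        by (intro borel_measurable_continuous_onI differentiable_imp_continuous_on)
      then show ?thesis using gm by (intro borel_measurable_times) (simp_all add: measurable_completion)
    qed
    have bd: "AE x in lebesgue. norm (g x * box_bump n a b x) \<le> \<bar>indicator (cbox a b) x * g x\<bar>" for n
    proof (rule AE_I2)
      fix x
      show "norm (g x * box_bump n a b x) \<le> \<bar>indicator (cbox a b) x * g x\<bar>"
      proof (cases "x \<in> box a b")
        case True
        then have "x \<in> cbox a b" using box_subset_cbox by blast
        then show ?thesis using box_bump_bounds[of n a b x] by (simp add: abs_mult mult_left_le)
      qed (simp add: box_bump_outside)
    qed
    have lim: "AE x in lebesgue. (\<lambda>n. g x * box_bump n a b x) \<longlonglongrightarrow> indicator (box a b) x * g x"
      using box_bump_tendsto by (auto intro!: AE_I2 tendsto_eq_intros simp: mult.commute)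
    have c: "integrable lebesgue (\<lambda>x. indicator (box a b) x * g x)"
        "(\<lambda>n. LINT x|lebesgue. g x * box_bump n a b x) \<longlonglongrightarrow> (LINT x|lebesgue. indicator (box a b) x * g x)"
      by (rule integrable_dominated_convergence[OF bm fm integrable_abs[OF bi] lim bd]
          integral_dominated_convergence[OF bm fm integrable_abs[OF bi] lim bd])+
    have z0: "(LINT x|lebesgue. indicator (box a b) x * g x) = 0"
      using c(2) unfolding z[OF box_bump_test_function] by (rule LIMSEQ_unique) (rule tendsto_const)
    have ae: "AE x in lebesgue. indicator (box a b) x * g x = indicator (box a b) x * g' x"
      using g'(2) by eventually_elim simp
    have m': "(\<lambda>x. indicator (box a b) x * g' x) \<in> borel_measurable borel" by measurable
    then have m'': "(\<lambda>x. indicator (box a b) x * g' x) \<in> borel_measurable lebesgue"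
      by (intro measurable_completion) simp
    have "integrable lebesgue (\<lambda>x. indicator (box a b) x * g' x)" "(LINT x|lebesgue. indicator (box a b) x * g' x) = 0"
      using integrable_cong_AE[OF bm m'' ae] integral_cong_AE[OF bm m'' ae] c(1) z0 by argo+
    then show ?thesis using m' by (simp add: integrable_completion integral_completion)
  qed
  let ?E = "range (\<lambda>(a, b). box a b :: (real ^ 'n) set)"
  have em: "emeasure (density lborel (\<lambda>x. ennreal (h (g' x)))) (box a b) = (\<integral>\<^sup>+x. ennreal (h (indicator (box a b) x * g' x)) \<partial>lborel)"
    if [measurable]: "h \<in> borel_measurable borel" and "h 0 = 0" for h :: "real \<Rightarrow> real" and a b
    using that(2) by (subst emeasure_density) (auto intro!: nn_integral_cong simp: indicator_def)
  define P where "P x = max 0 x" for x :: real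
  define Q where "Q x = max 0 (- x)" for x :: real
  have [measurable]: "P \<in> borel_measurable borel" "Q \<in> borel_measurable borel" unfolding P_def[abs_def] Q_def[abs_def] by measurable
  have fin: "(\<integral>\<^sup>+x. ennreal (P (indicator (box a b) x * g' x)) \<partial>lborel) = ennreal (LINT x|lborel. P (indicator (box a b) x * g' x))"
      "(\<integral>\<^sup>+x. ennreal (Q (indicator (box a b) x * g' x)) \<partial>lborel) = ennreal (LINT x|lborel. P (indicator (box a b) x * g' x))" for a b
  proof -
    have i: "integrable lborel (\<lambda>x. P (indicator (box a b) x * g' x))" "integrable lborel (\<lambda>x. Q (indicator (box a b) x * g' x))"
      unfolding P_def Q_def using g'i[of a b] by (auto intro!: integrable_max)
    have "(LINT x|lborel. P (indicator (box a b) x * g' x)) - (LINT x|lborel. Q (indicator (box a b) x * g' x)) =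
        (LINT x|lborel. P (indicator (box a b) x * g' x) - Q (indicator (box a b) x * g' x))"
      using i by simp
    also have "\<dots> = (LINT x|lborel. indicator (box a b) x * g' x)"
      by (intro Bochner_Integration.integral_cong refl) (auto simp: P_def Q_def max_def)
    also have "\<dots> = 0" using g'i by blast
    finally have e: "(LINT x|lborel. Q (indicator (box a b) x * g' x)) = (LINT x|lborel. P (indicator (box a b) x * g' x))" by simp
    show "(\<integral>\<^sup>+x. ennreal (P (indicator (box a b) x * g' x)) \<partial>lborel) = ennreal (LINT x|lborel. P (indicator (box a b) x * g' x))"
      by (rule nn_integral_eq_integral[OF i(1)]) (simp add: P_def)
    show "(\<integral>\<^sup>+x. ennreal (Q (indicator (box a b) x * g' x)) \<partial>lborel) = ennreal (LINT x|lborel. P (indicator (box a b) x * g' x))"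
      unfolding e[symmetric] by (rule nn_integral_eq_integral[OF i(2)]) (simp add: Q_def)
  qed
  have "density lborel (\<lambda>x. ennreal (P (g' x))) = density lborel (\<lambda>x. ennreal (Q (g' x)))"
  proof (rule measure_eqI_generator_eq)
    show "Int_stable ?E" by (auto simp: Int_stable_def box_Int_box)
    show "?E \<subseteq> Pow UNIV" by simp
    show "emeasure (density lborel (\<lambda>x. ennreal (P (g' x)))) X = emeasure (density lborel (\<lambda>x. ennreal (Q (g' x)))) X" if "X \<in> ?E" for X
      using that by (auto simp: em fin P_def[of 0] Q_def[of 0])
    show "sets (density lborel (\<lambda>x. ennreal (P (g' x)))) = sigma_sets UNIV ?E"
      by (simp add: borel_eq_box)
    show "sets (density lborel (\<lambda>x. ennreal (Q (g' x)))) = sigma_sets UNIV ?E"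
      by (simp add: borel_eq_box)
    let ?A = "\<lambda>n::nat. box (- (real n *\<^sub>R One)) (real n *\<^sub>R One) :: (real ^ 'n) set"
    show "range ?A \<subseteq> ?E" by auto
    show "(\<Union>i. ?A i) = UNIV" unfolding UN_box_eq_UNIV by auto
    show "emeasure (density lborel (\<lambda>x. ennreal (P (g' x)))) (?A i) \<noteq> \<infinity>" for i
      by (simp add: em fin P_def[of 0])
  qed
  then have "AE x in lborel. ennreal (P (g' x)) = ennreal (Q (g' x))"
    by (intro sigma_finite_measure.density_unique[OF sigma_finite_lborel]) auto
  then have "AE x in lborel. g' x = 0"
    by eventually_elim (auto simp: P_def Q_def max_def split: if_splits)
  then have "AE x in lebesgue. g' x = 0" by (simp add: AE_completion_iff)
  then show ?thesis using g'(2) by eventually_elim simp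
qed

section \<open>Test functions and difference quotients\<close>

lemma test_function_differentiable:
  assumes "\<phi> \<in> test_functions" shows "\<phi> differentiable (at x)"
  using test_function_partials[OF assms, of "[]"] by (simp add: differentiable_on_def)

lemma test_function_continuous:
  assumes "\<phi> \<in> test_functions" shows "continuous_on UNIV \<phi>"
  using test_function_partials[OF assms, of "[]"] by (simp add: differentiable_imp_continuous_on)

lemma test_function_partial:
  fixes \<phi> :: "real ^ 'n \<Rightarrow> real"
  assumes \<phi>: "\<phi> \<in> test_functions" shows "partial_deriv k \<phi> \<in> test_functions"
proof -
  have 1: "foldr partial_deriv ks (partial_deriv k \<phi>) differentiable_on UNIV" for ks
    using test_function_partials[OF \<phi>, of "ks @ [k]"] by simp
  have "partial_deriv k \<phi> x = 0" if "x \<notin> closure {x. \<phi> x \<noteq> 0}" for x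
  proof -
    have "((\<lambda>x. 0 :: real) has_derivative (\<lambda>h. 0)) (at x)" by simp
    then have "(\<phi> has_derivative (\<lambda>h. 0)) (at x)"
    proof (rule has_derivative_transform_within_open[where s="- closure {x. \<phi> x \<noteq> 0}"])
      show "0 = \<phi> y" if "y \<in> - closure {x. \<phi> x \<noteq> 0}" for y
        using that closure_subset[of "{x. \<phi> x \<noteq> 0}"] by auto
    qed (use that in auto)
    then have "frechet_derivative \<phi> (at x) = (\<lambda>h. 0)" by (rule frechet_derivative_at[symmetric])
    then show ?thesis by (simp add: partial_deriv_def)
  qed
  then have "{x. partial_deriv k \<phi> x \<noteq> 0} \<subseteq> closure {x. \<phi> x \<noteq> 0}" by blast
  then have "closure {x. partial_deriv k \<phi> x \<noteq> 0} \<subseteq> closure {x. \<phi> x \<noteq> 0}" by (simp add: closure_minimal)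
  moreover have "compact (closure {x. \<phi> x \<noteq> 0})" using \<phi> by (simp add: test_functions_def)
  ultimately have "compact (closure {x. partial_deriv k \<phi> x \<noteq> 0})"
    by (meson closed_closure closed_subset compact_eq_bounded_closed bounded_subset)
  then show ?thesis using 1 by (simp add: test_functions_def)
qed

lemma test_function_bounded:
  fixes \<phi> :: "real ^ 'n \<Rightarrow> real"
  assumes \<phi>: "\<phi> \<in> test_functions"
  obtains C r where "C \<ge> 0" "\<And>x. \<bar>\<phi> x\<bar> \<le> C * indicator (cball 0 r) x"
proof -
  define S where "S = closure {x. \<phi> x \<noteq> 0}"
  have S: "compact S" using \<phi> by (simp add: test_functions_def S_def)
  then have "compact (\<phi> ` S)"
    using test_function_continuous[OF \<phi>] continuous_on_subset by (intro compact_continuous_image) auto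
  then obtain C where C: "\<And>y. y \<in> \<phi> ` S \<Longrightarrow> \<bar>y\<bar> \<le> C"
    using compact_imp_bounded[of "\<phi> ` S"] unfolding bounded_iff real_norm_def by blast
  obtain r where r: "\<And>x. x \<in> S \<Longrightarrow> norm x \<le> r"
    using compact_imp_bounded[OF S] unfolding bounded_iff by blast
  show thesis
  proof (rule that[of "\<bar>C\<bar>" r])
    show "\<bar>\<phi> x\<bar> \<le> \<bar>C\<bar> * indicator (cball 0 r) x" for x
    proof (cases "\<phi> x = 0")
      case False
      then have "x \<in> S" unfolding S_def by (intro subsetD[OF closure_subset]) simp
      from C[OF imageI[OF this]] r[OF this] have "\<bar>\<phi> x\<bar> \<le> C" "norm x \<le> r" .
      then show ?thesis by (simp add: indicator_def)
    qed (simp add: indicator_def)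
  qed simp
qed

lemma test_function_measurable:
  fixes \<phi> :: "real ^ 'n \<Rightarrow> real"
  assumes "\<phi> \<in> test_functions" shows "\<phi> \<in> borel_measurable lebesgue"
  using borel_measurable_continuous_onI[OF test_function_continuous[OF assms]] by (simp add: measurable_completion)

lemma test_function_L2:
  fixes \<phi> :: "real ^ 'n \<Rightarrow> real"
  assumes "\<phi> \<in> test_functions" shows "\<phi> \<in> L2"
proof -
  obtain C r where "C \<ge> 0" "\<And>x. \<bar>\<phi> x\<bar> \<le> C * indicator (cball 0 r) x" using test_function_bounded[OF assms] by blast
  then show ?thesis by (intro L2_bounded_support[of _ C r] test_function_measurable assms) auto
qed

lemma test_function_line_derivative:
  fixes \<phi> :: "real ^ 'n \<Rightarrow> real"
  assumes "\<phi> \<in> test_functions"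
  shows "((\<lambda>t. \<phi> (x + t *\<^sub>R axis k 1)) has_real_derivative partial_deriv k \<phi> (x + t *\<^sub>R axis k 1)) (at t)"
proof -
  let ?y = "x + t *\<^sub>R axis k 1"
  have d: "(\<phi> has_derivative frechet_derivative \<phi> (at ?y)) (at ?y)"
    using frechet_derivative_works test_function_differentiable[OF assms] by blast
  have "((\<lambda>t. x + t *\<^sub>R axis k 1) has_derivative (\<lambda>h. h *\<^sub>R axis k 1)) (at t)"
    by (auto intro!: derivative_eq_intros)
  from has_derivative_compose[OF this d]
  have "((\<lambda>t. \<phi> (x + t *\<^sub>R axis k 1)) has_derivative (\<lambda>h. frechet_derivative \<phi> (at ?y) (h *\<^sub>R axis k 1))) (at t)" .
  moreover have "frechet_derivative \<phi> (at ?y) (h *\<^sub>R axis k 1) = partial_deriv k \<phi> ?y * h" for h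
    using linear_scale[OF linear_frechet_derivative[OF test_function_differentiable[OF assms]]]
    by (simp add: partial_deriv_def mult.commute)
  ultimately show ?thesis by (simp add: has_field_derivative_def)
qed

definition quotient :: "'n \<Rightarrow> real \<Rightarrow> (real ^ 'n \<Rightarrow> real) \<Rightarrow> real ^ 'n \<Rightarrow> real" where
  "quotient k t u x = (u (x + t *\<^sub>R axis k 1) - u x) / t"

lemma quotient_L2: "u \<in> L2 \<Longrightarrow> quotient k t u \<in> L2"
  unfolding quotient_def[abs_def] using L2_cmult(1)[OF L2_diff[OF L2_shift(1)], of u u "1 / t" "t *\<^sub>R axis k 1"] by simp

lemma MVT_symmetric:
  fixes f f' :: "real \<Rightarrow> real"
  assumes "\<And>t. (f has_real_derivative f' t) (at t)" "s \<noteq> 0"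
  shows "\<exists>t. \<bar>t\<bar> \<le> \<bar>s\<bar> \<and> (f s - f 0) / s = f' t"
proof (cases "s > 0")
  case True
  obtain t where "0 < t" "t < s" "f s - f 0 = (s - 0) * f' t" using MVT2[OF True, of f f'] assms(1) by blast
  then show ?thesis using assms(2) by (intro exI[of _ t]) auto
next
  case False
  then have s: "s < 0" using assms(2) by simp
  obtain t where "s < t" "t < 0" "f 0 - f s = (0 - s) * f' t" using MVT2[OF s, of f f'] assms(1) by blast
  then show ?thesis using s by (intro exI[of _ t]) (auto simp: field_simps)
qed

lemma quotient_test_function_tendsto:
  fixes \<phi> :: "real ^ 'n \<Rightarrow> real"
  assumes \<phi>: "\<phi> \<in> test_functions" and s: "\<And>j::nat. s j \<noteq> 0" "s \<longlonglongrightarrow> 0"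
  shows "(\<lambda>j. sqn (\<lambda>x. quotient k (s j) \<phi> x - partial_deriv k \<phi> x)) \<longlonglongrightarrow> 0"
proof -
  note p = test_function_partial[OF \<phi>, of k]
  obtain C r where C: "C \<ge> 0" "\<And>x. \<bar>partial_deriv k \<phi> x\<bar> \<le> C * indicator (cball 0 r) x" using test_function_bounded[OF p] by blast
  have "Bseq s" using s(2) convergentI convergent_imp_Bseq by blast
  then obtain B where B: "B > 0" "\<And>j. \<bar>s j\<bar> \<le> B" by (auto simp: Bseq_def)
  have wL: "(\<lambda>x. C * indicator (cball 0 (r + B)) x) \<in> (L2 :: (real ^ 'n \<Rightarrow> real) set)"
    by (rule L2_bounded_support[of _ C "r + B"]) (intro borel_measurable_times borel_measurable_const borel_measurable_indicator cball_in_lebesgue, use C(1) in \<open>simp add: abs_mult\<close>)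
  show ?thesis
  proof (rule L2_dominated_convergence(3)[OF wL])
    show "partial_deriv k \<phi> \<in> borel_measurable lebesgue" by (rule test_function_measurable[OF p])
    show "quotient k (s j) \<phi> \<in> borel_measurable lebesgue" for j
      by (rule L2_measurable[OF quotient_L2[OF test_function_L2[OF \<phi>]]])
    show "AE x in lebesgue. norm (quotient k (s j) \<phi> x) \<le> C * indicator (cball 0 (r + B)) x" for j
    proof (rule AE_I2)
      fix x
      obtain t where t: "\<bar>t\<bar> \<le> \<bar>s j\<bar>" "(\<phi> (x + s j *\<^sub>R axis k 1) - \<phi> (x + 0 *\<^sub>R axis k 1)) / s j = partial_deriv k \<phi> (x + t *\<^sub>R axis k 1)"
        using MVT_symmetric[OF test_function_line_derivative[OF \<phi>] s(1)] by blast
      have "norm x \<le> r + B" if "norm (x + t *\<^sub>R axis k 1) \<le> r"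
        using that norm_triangle_ineq4[of "x + t *\<^sub>R axis k 1" "t *\<^sub>R axis k (1::real)"] t(1) B(2)[of j] by simp
      then have "indicator (cball 0 r) (x + t *\<^sub>R axis k 1) \<le> (indicator (cball 0 (r + B)) x :: real)"
        by (simp add: indicator_def)
      from mult_left_mono[OF this C(1)] show "norm (quotient k (s j) \<phi> x) \<le> C * indicator (cball 0 (r + B)) x"
        using t(2) C(2)[of "x + t *\<^sub>R axis k 1"] by (simp add: quotient_def)
    qed
    show "AE x in lebesgue. (\<lambda>j. quotient k (s j) \<phi> x) \<longlonglongrightarrow> partial_deriv k \<phi> x"
    proof (rule AE_I2)
      fix x
      have "((\<lambda>h. (\<phi> (x + (0 + h) *\<^sub>R axis k 1) - \<phi> (x + 0 *\<^sub>R axis k 1)) / h) \<longlongrightarrow> partial_deriv k \<phi> (x + 0 *\<^sub>R axis k 1)) (at 0)"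
        using test_function_line_derivative[OF \<phi>, of x k 0] unfolding DERIV_def .
      moreover have "filterlim s (at 0) sequentially" using s by (simp add: filterlim_at)
      ultimately have "(\<lambda>j. (\<phi> (x + (0 + s j) *\<^sub>R axis k 1) - \<phi> (x + 0 *\<^sub>R axis k 1)) / s j) \<longlonglongrightarrow> partial_deriv k \<phi> (x + 0 *\<^sub>R axis k 1)"
        by (rule filterlim_compose)
      then show "(\<lambda>j. quotient k (s j) \<phi> x) \<longlonglongrightarrow> partial_deriv k \<phi> x" by (simp add: quotient_def)
    qed
  qed
qed

lemma integral_quotient_by_parts:
  fixes u \<phi> :: "real ^ 'n \<Rightarrow> real"
  assumes u: "u \<in> L2" and \<phi>: "\<phi> \<in> L2"
  shows "(LINT x|lebesgue. quotient k t u x * \<phi> x) = - (LINT x|lebesgue. u x * quotient k (- t) \<phi> x)"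
proof -
  let ?h = "t *\<^sub>R axis k 1 :: real ^ 'n"
  note p = L2_real_product_integrable
  have sh: "(LINT x|lebesgue. u (x + ?h) * \<phi> x) = (LINT x|lebesgue. u x * \<phi> (x + - ?h))"
    using integral_lebesgue_shift[of "\<lambda>x. u x * \<phi> (x + - ?h)" ?h] p[OF u L2_shift(1)[OF \<phi>], of "- ?h"] by simp
  have "(LINT x|lebesgue. quotient k t u x * \<phi> x) = (LINT x|lebesgue. (1 / t) * (u (x + ?h) * \<phi> x) - (1 / t) * (u x * \<phi> x))"
    by (intro Bochner_Integration.integral_cong refl) (simp add: quotient_def left_diff_distrib diff_divide_distrib)
  also have "\<dots> = (1 / t) * (LINT x|lebesgue. u x * \<phi> (x + - ?h)) - (1 / t) * (LINT x|lebesgue. u x * \<phi> x)"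
    unfolding sh[symmetric]
    by (subst Bochner_Integration.integral_diff) (use p[OF L2_shift(1)[OF u] \<phi>, of ?h] p[OF u \<phi>] in auto)
  also have "\<dots> = (LINT x|lebesgue. (1 / t) * (u x * \<phi> (x + - ?h)) - (1 / t) * (u x * \<phi> x))"
    by (subst Bochner_Integration.integral_diff) (use p[OF u L2_shift(1)[OF \<phi>], of "- ?h"] p[OF u \<phi>] in auto)
  also have "\<dots> = (LINT x|lebesgue. - (u x * quotient k (- t) \<phi> x))"
    by (intro Bochner_Integration.integral_cong refl) (simp add: quotient_def algebra_simps diff_divide_distrib)
  finally show ?thesis by simp
qed

definition quotient_symbol :: "real \<Rightarrow> real \<Rightarrow> complex" where
  "quotient_symbol t \<theta> = (cis (t * \<theta>) - 1) / of_real t"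

lemma has_fourier_quotient:
  fixes u :: "real ^ 'n \<Rightarrow> real"
  assumes u: "has_fourier u v"
  shows "has_fourier (quotient k t u) (\<lambda>\<xi>. quotient_symbol t (\<xi> $ k) * v \<xi>)"
proof -
  have "has_fourier (\<lambda>x. (1 / t) * u (x + t *\<^sub>R axis k 1) + (- 1 / t) * u x) (\<lambda>\<xi>. of_real (1 / t) * (cis ((t *\<^sub>R axis k 1) \<bullet> \<xi>) * v \<xi>) + of_real (- 1 / t) * v \<xi>)"
    by (rule has_fourier_linear[OF has_fourier_shift[OF u] u])
  moreover have "(\<lambda>x. (1 / t) * u (x + t *\<^sub>R axis k 1) + (- 1 / t) * u x) = quotient k t u"
    by (auto simp: quotient_def diff_divide_distrib)
  moreover have "(\<lambda>\<xi>. of_real (1 / t) * (cis ((t *\<^sub>R axis k 1) \<bullet> \<xi>) * v \<xi>) + of_real (- 1 / t) * v \<xi>) = (\<lambda>\<xi>. quotient_symbol t (\<xi> $ k) * v \<xi>)"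
    by (auto simp: quotient_symbol_def inner_axis' fun_eq_iff diff_divide_distrib algebra_simps)
  ultimately show ?thesis by simp
qed

lemma norm_quotient_symbol_le: "norm (quotient_symbol t \<theta>) \<le> \<bar>\<theta>\<bar>"
proof -
  have "norm (cis x - 1) \<le> \<bar>x\<bar>" for x
  proof -
    have "(norm (cis x - 1))\<^sup>2 = 2 - 2 * cos x" using norm_cis_minus_one[of x 1] by simp
    also have "\<dots> = 4 * (sin (x / 2))\<^sup>2" using cos_double_sin[of "x / 2"] by simp
    also have "\<dots> = (2 * \<bar>sin (x / 2)\<bar>)\<^sup>2" by (simp add: power_mult_distrib)
    also have "\<dots> \<le> \<bar>x\<bar>\<^sup>2" using abs_sin_x_le_abs_x[of "x / 2"] by (intro power_mono) auto
    finally show ?thesis by (rule power2_le_imp_le) simp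
  qed
  from this[of "t * \<theta>"] show ?thesis
    by (cases "t = 0") (auto simp: quotient_symbol_def norm_divide abs_mult field_simps)
qed

lemma quotient_symbol_tendsto:
  assumes s: "\<And>j::nat. s j \<noteq> 0" "s \<longlonglongrightarrow> 0"
  shows "(\<lambda>j. quotient_symbol (s j) \<theta>) \<longlonglongrightarrow> \<i> * of_real \<theta>"
proof -
  have "((\<lambda>z. exp (\<i> * of_real \<theta> * z)) has_field_derivative exp (\<i> * of_real \<theta> * 0) * (\<i> * of_real \<theta>)) (at 0)"
    by (auto intro!: derivative_eq_intros)
  then have "((\<lambda>h. (exp (\<i> * of_real \<theta> * (0 + h)) - exp (\<i> * of_real \<theta> * 0)) / h) \<longlongrightarrow> exp (\<i> * of_real \<theta> * 0) * (\<i> * of_real \<theta>)) (at 0)"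
    unfolding DERIV_def .
  moreover have "filterlim (\<lambda>j. complex_of_real (s j)) (at 0) sequentially"
    using s tendsto_of_real[OF s(2), where 'a=complex] by (simp add: filterlim_at)
  ultimately have "(\<lambda>j. (exp (\<i> * of_real \<theta> * (0 + of_real (s j))) - exp (\<i> * of_real \<theta> * 0)) / of_real (s j)) \<longlonglongrightarrow> exp (\<i> * of_real \<theta> * 0) * (\<i> * of_real \<theta>)"
    by (rule filterlim_compose)
  then show ?thesis by (simp add: quotient_symbol_def cis_conv_exp mult.commute mult.left_commute)
qed

lemma inverse_Suc_sequence: "inverse (real (Suc j)) \<noteq> 0" "(\<lambda>j. inverse (real (Suc j))) \<longlonglongrightarrow> 0"
  using LIMSEQ_inverse_real_of_nat by auto

text \<open>The difference quotients converge in \<open>L2\<close>, so a subsequence of their transforms converges almost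
  everywhere, and the limit of the symbols is explicit.\<close>
lemma test_function_fourier_partial:
  fixes \<phi> :: "real ^ 'n \<Rightarrow> real"
  assumes \<phi>: "\<phi> \<in> test_functions" and v: "has_fourier \<phi> v"
  shows "has_fourier (partial_deriv k \<phi>) (\<lambda>\<xi>. \<i> * of_real (\<xi> $ k) * v \<xi>)"
proof -
  let ?s = "\<lambda>j. inverse (real (Suc j))"
  obtain w where w: "has_fourier (partial_deriv k \<phi>) w"
    using has_fourier_exists[OF test_function_L2[OF test_function_partial[OF \<phi>]]] by blast
  note q = has_fourier_quotient[OF v, of k]
  have "(\<lambda>j. sqn (\<lambda>\<xi>. quotient_symbol (?s j) (\<xi> $ k) * v \<xi> - w \<xi>)) \<longlonglongrightarrow> 0"
    unfolding has_fourier_sqn_diff[of "\<lambda>j. quotient k (?s j) \<phi>", OF q w]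
    by (rule quotient_test_function_tendsto[OF \<phi> inverse_Suc_sequence])
  from L2_convergence_AE_subseq[OF has_fourier_L2(2)[OF q] has_fourier_L2(2)[OF w] this]
  obtain r :: "nat \<Rightarrow> nat" where r: "strict_mono r" "AE \<xi> in lebesgue. (\<lambda>j. quotient_symbol (?s (r j)) (\<xi> $ k) * v \<xi>) \<longlonglongrightarrow> w \<xi>" by blast
  have "AE \<xi> in lebesgue. w \<xi> = \<i> * of_real (\<xi> $ k) * v \<xi>"
    using r(2)
  proof eventually_elim
    case (elim \<xi>)
    have "(\<lambda>j. quotient_symbol (?s j) (\<xi> $ k)) \<longlonglongrightarrow> \<i> * of_real (\<xi> $ k)"
      by (rule quotient_symbol_tendsto[OF inverse_Suc_sequence])
    from LIMSEQ_subseq_LIMSEQ[OF this r(1)]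
    have "(\<lambda>j. quotient_symbol (?s (r j)) (\<xi> $ k) * v \<xi>) \<longlonglongrightarrow> \<i> * of_real (\<xi> $ k) * v \<xi>"
      by (intro tendsto_intros) (simp add: o_def)
    then show ?case using LIMSEQ_unique[OF elim] by blast
  qed
  then show ?thesis using has_fourier_cong[OF w] by simp
qed

section \<open>Weak derivatives on the Fourier side\<close>

lemma coordinate_measurable [measurable]: "(\<lambda>\<xi> :: real ^ 'n. complex_of_real (\<xi> $ k)) \<in> borel_measurable lebesgue"
  by (intro measurable_completion) measurable

lemma hom_integrable_mono:
  assumes v: "hom_integrable r v" and q: "0 \<le> q" "q \<le> r"
  shows "hom_integrable q v"
proof -
  have vL: "v \<in> L2" using v by (simp add: hom_integrable_def)
  have [measurable]: "v \<in> borel_measurable lebesgue" by (rule L2_measurable[OF vL])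
  have i: "integrable lebesgue (\<lambda>\<xi>. (norm (v \<xi>))\<^sup>2 + norm \<xi> powr (2 * r) * (norm (v \<xi>))\<^sup>2)"
    using v L2_integrable[OF vL] by (simp add: hom_integrable_def)
  have b: "norm \<xi> powr (2 * q) * (norm (v \<xi>))\<^sup>2 \<le> (norm (v \<xi>))\<^sup>2 + norm \<xi> powr (2 * r) * (norm (v \<xi>))\<^sup>2" for \<xi>
  proof -
    have "norm \<xi> powr (2 * q) \<le> 1 + norm \<xi> powr (2 * r)"
    proof (cases "norm \<xi> \<le> 1")
      case True
      then have "norm \<xi> powr (2 * q) \<le> 1" using q by (intro powr_le1) auto
      then show ?thesis by (simp add: add_increasing2)
    next
      case False
      then have "norm \<xi> powr (2 * q) \<le> norm \<xi> powr (2 * r)" using q by (intro powr_mono) auto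
      then show ?thesis by simp
    qed
    from mult_right_mono[OF this, of "(norm (v \<xi>))\<^sup>2"] show ?thesis by (simp add: distrib_right)
  qed
  have "integrable lebesgue (\<lambda>\<xi>. norm \<xi> powr (2 * q) * (norm (v \<xi>))\<^sup>2)"
    by (rule Bochner_Integration.integrable_bound[OF i]) (use b in \<open>auto intro: order_trans[OF _ abs_ge_self]\<close>)
  then show ?thesis using vL by (simp add: hom_integrable_def)
qed

lemma hom_integrable_multiplier:
  assumes v: "hom_integrable r v" and d: "0 < d" "real d \<le> r"
    and p: "p \<in> borel_measurable lebesgue" "\<And>\<xi>. norm (p \<xi>) \<le> norm \<xi> ^ d"
  shows "hom_integrable (r - real d) (\<lambda>\<xi>. p \<xi> * v \<xi>)"
proof -
  have vL: "v \<in> L2" using v by (simp add: hom_integrable_def)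
  have [measurable]: "v \<in> borel_measurable lebesgue" by (rule L2_measurable[OF vL])
  note p(1)[measurable]
  have pb: "(norm (p \<xi> * v \<xi>))\<^sup>2 \<le> norm \<xi> powr (2 * real d) * (norm (v \<xi>))\<^sup>2" for \<xi>
  proof -
    have "norm \<xi> powr (2 * real d) = (norm \<xi> ^ d)\<^sup>2"
      using d(1) powr_realpow'[of "norm \<xi>" "2 * d"] by (simp add: power_mult[symmetric] mult.commute)
    moreover have "(norm (p \<xi>))\<^sup>2 \<le> (norm \<xi> ^ d)\<^sup>2" by (intro power_mono p) simp
    ultimately show ?thesis by (simp add: norm_mult power_mult_distrib mult_right_mono)
  qed
  have "hom_integrable (real d) v" by (rule hom_integrable_mono[OF v]) (use d in auto)
  then have i: "integrable lebesgue (\<lambda>\<xi>. norm \<xi> powr (2 * real d) * (norm (v \<xi>))\<^sup>2)" by (simp add: hom_integrable_def)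
  have "integrable lebesgue (\<lambda>\<xi>. (norm (p \<xi> * v \<xi>))\<^sup>2)"
    by (rule Bochner_Integration.integrable_bound[OF i]) (use pb in \<open>auto intro: order_trans[OF _ abs_ge_self]\<close>)
  then have 1: "(\<lambda>\<xi>. p \<xi> * v \<xi>) \<in> L2" by (simp add: L2_def)
  have i2: "integrable lebesgue (\<lambda>\<xi>. norm \<xi> powr (2 * r) * (norm (v \<xi>))\<^sup>2)" using v by (simp add: hom_integrable_def)
  have "norm \<xi> powr (2 * (r - real d)) * (norm (p \<xi> * v \<xi>))\<^sup>2 \<le> norm \<xi> powr (2 * r) * (norm (v \<xi>))\<^sup>2" for \<xi>
  proof -
    have "norm \<xi> powr (2 * (r - real d)) * norm \<xi> powr (2 * real d) = norm \<xi> powr (2 * r)"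
      by (simp add: powr_add[symmetric] algebra_simps)
    then show ?thesis using mult_left_mono[OF pb, of "norm \<xi> powr (2 * (r - real d))" \<xi>] by (simp add: mult.assoc[symmetric])
  qed
  then have "integrable lebesgue (\<lambda>\<xi>. norm \<xi> powr (2 * (r - real d)) * (norm (p \<xi> * v \<xi>))\<^sup>2)"
    by (intro Bochner_Integration.integrable_bound[OF i2]) (auto intro: order_trans[OF _ abs_ge_self])
  then show ?thesis using 1 by (simp add: hom_integrable_def)
qed

lemma norm_coordinate_symbol: "norm (\<i> * complex_of_real (\<xi> $ k)) \<le> norm \<xi> ^ 1"
  using component_le_norm_cart[of \<xi> k] by (simp add: norm_mult)

lemma hom_integrable_partial:
  fixes v :: "real ^ 'n \<Rightarrow> complex"
  assumes "hom_integrable r v" "1 \<le> r"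
  shows "hom_integrable (r - 1) (\<lambda>\<xi>. \<i> * of_real (\<xi> $ k) * v \<xi>)"
  using hom_integrable_multiplier[OF assms(1), of 1 "\<lambda>\<xi>. \<i> * of_real (\<xi> $ k)", OF _ _ _ norm_coordinate_symbol] assms(2) by simp

lemma L2_locally_integrable:
  fixes u :: "real ^ 'n \<Rightarrow> real"
  assumes "u \<in> L2" shows "locally_integrable u"
  unfolding locally_integrable_def set_integrable_def
proof (intro allI impI)
  fix K :: "(real ^ 'n) set" assume K: "compact K"
  then have "K \<in> sets lebesgue" by (intro sets_completionI_sets) (simp add: borel_closed compact_imp_closed)
  from L2_indicator_integrable[OF assms compact_imp_bounded[OF K] this]
  show "integrable lebesgue (\<lambda>x. indicator K x *\<^sub>R u x)" by simp
qed

text \<open>The difference quotients of \<open>u\<close> converge in \<open>L2\<close> because their transforms do, dominated by those of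
  the limit. Discrete integration by parts shows that the limit is a weak derivative.\<close>
lemma has_weak_partial_exists:
  fixes u :: "real ^ 'n \<Rightarrow> real"
  assumes u: "has_fourier u v" and v: "hom_integrable 1 v"
  obtains g where "has_weak_partial k u g" "has_fourier g (\<lambda>\<xi>. \<i> * of_real (\<xi> $ k) * v \<xi>)"
proof -
  let ?s = "\<lambda>j. inverse (real (Suc j))" and ?G = "\<lambda>\<xi>. \<i> * of_real (\<xi> $ k) * v \<xi>"
  note uL = has_fourier_L2[OF u] and q = has_fourier_quotient[OF u, of k]
  have GL: "?G \<in> L2" using hom_integrable_partial[OF v, of k] by (simp add: hom_integrable_def)
  then have wL: "(\<lambda>\<xi>. norm (?G \<xi>)) \<in> L2"
    by (rule L2_dominated(1)) (use L2_measurable[OF GL] in auto)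
  have lim: "(\<lambda>j. sqn (\<lambda>\<xi>. quotient_symbol (?s j) (\<xi> $ k) * v \<xi> - ?G \<xi>)) \<longlonglongrightarrow> 0"
  proof (rule L2_dominated_convergence(3)[OF wL L2_measurable[OF GL] L2_measurable[OF has_fourier_L2(2)[OF q]]])
    show "AE \<xi> in lebesgue. norm (quotient_symbol (?s j) (\<xi> $ k) * v \<xi>) \<le> norm (?G \<xi>)" for j
      using norm_quotient_symbol_le by (intro AE_I2) (auto simp: norm_mult intro!: mult_right_mono)
    show "AE \<xi> in lebesgue. (\<lambda>j. quotient_symbol (?s j) (\<xi> $ k) * v \<xi>) \<longlonglongrightarrow> ?G \<xi>"
      by (intro AE_I2 tendsto_mult quotient_symbol_tendsto inverse_Suc_sequence tendsto_const)
  qed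
  have "\<exists>g\<in>L2. (\<lambda>j. sqn (\<lambda>x. quotient k (?s j) u x - g x)) \<longlonglongrightarrow> 0"
  proof (rule L2_complete[OF has_fourier_L2(1)[OF q]])
    fix e :: real assume "e > 0"
    then have "\<forall>\<^sub>F j in sequentially. sqn (\<lambda>\<xi>. quotient_symbol (?s j) (\<xi> $ k) * v \<xi> - ?G \<xi>) < e / 4"
      by (intro order_tendstoD(2)[OF lim]) simp
    then obtain J where J: "\<And>j. j \<ge> J \<Longrightarrow> sqn (\<lambda>\<xi>. quotient_symbol (?s j) (\<xi> $ k) * v \<xi> - ?G \<xi>) < e / 4" by (auto simp: eventually_sequentially)
    have "sqn (\<lambda>x. quotient k (?s j) u x - quotient k (?s l) u x) < e" if "j \<ge> J" "l \<ge> J" for j l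
    proof -
      have "sqn (\<lambda>x. quotient k (?s j) u x - quotient k (?s l) u x) =
         sqn (\<lambda>\<xi>. quotient_symbol (?s j) (\<xi> $ k) * v \<xi> - quotient_symbol (?s l) (\<xi> $ k) * v \<xi>)"
        by (rule has_fourier_sqn[OF has_fourier_diff[OF q q], symmetric])
      also have "\<dots> \<le> 2 * sqn (\<lambda>\<xi>. quotient_symbol (?s j) (\<xi> $ k) * v \<xi> - ?G \<xi>) + 2 * sqn (\<lambda>\<xi>. ?G \<xi> - quotient_symbol (?s l) (\<xi> $ k) * v \<xi>)"
        by (rule sqn_triangle[OF has_fourier_L2(2)[OF q] GL has_fourier_L2(2)[OF q]])
      also have "sqn (\<lambda>\<xi>. ?G \<xi> - quotient_symbol (?s l) (\<xi> $ k) * v \<xi>) = sqn (\<lambda>\<xi>. quotient_symbol (?s l) (\<xi> $ k) * v \<xi> - ?G \<xi>)"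
        by (rule sqn_commute)
      finally show ?thesis using J[OF that(1)] J[OF that(2)] by linarith
    qed
    then show "\<exists>K. \<forall>j\<ge>K. \<forall>l\<ge>K. sqn (\<lambda>x. quotient k (?s j) u x - quotient k (?s l) u x) < e" by blast
  qed
  then obtain g where g: "g \<in> L2" "(\<lambda>j. sqn (\<lambda>x. quotient k (?s j) u x - g x)) \<longlonglongrightarrow> 0" by blast
  have gf: "has_fourier g ?G" by (rule has_fourier_closed[OF q g(1) GL g(2) lim])
  have "(LINT x|lebesgue. u x * partial_deriv k \<phi> x) = - (LINT x|lebesgue. g x * \<phi> x)" if \<phi>: "\<phi> \<in> test_functions" for \<phi>
  proof -
    note \<phi>L = test_function_L2[OF \<phi>] test_function_L2[OF test_function_partial[OF \<phi>, of k]]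
    have 1: "(\<lambda>j. LINT x|lebesgue. quotient k (?s j) u x * \<phi> x) \<longlonglongrightarrow> (LINT x|lebesgue. g x * \<phi> x)"
      by (rule L2_inner_tendsto[OF has_fourier_L2(1)[OF q] g(1) \<phi>L(1) g(2)])
    have "(\<lambda>j. sqn (\<lambda>x. quotient k (- ?s j) \<phi> x - partial_deriv k \<phi> x)) \<longlonglongrightarrow> 0"
      by (rule quotient_test_function_tendsto[OF \<phi>]) (use inverse_Suc_sequence tendsto_minus[OF inverse_Suc_sequence(2)] in auto)
    from L2_inner_tendsto[OF quotient_L2[OF \<phi>L(1)] \<phi>L(2) uL(1) this]
    have "(\<lambda>j. - (LINT x|lebesgue. u x * quotient k (- ?s j) \<phi> x)) \<longlonglongrightarrow> - (LINT x|lebesgue. u x * partial_deriv k \<phi> x)"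
      by (intro tendsto_minus) (simp add: mult.commute)
    then have "(\<lambda>j. LINT x|lebesgue. quotient k (?s j) u x * \<phi> x) \<longlonglongrightarrow> - (LINT x|lebesgue. u x * partial_deriv k \<phi> x)"
      unfolding integral_quotient_by_parts[OF uL(1) \<phi>L(1)] .
    from LIMSEQ_unique[OF 1 this] show ?thesis by simp
  qed
  then have "has_weak_partial k u g"
    unfolding has_weak_partial_def using L2_locally_integrable uL(1) g(1) by blast
  then show thesis using that gf by blast
qed

lemma locally_integrable_test_product:
  fixes g :: "real ^ 'n \<Rightarrow> real"
  assumes g: "locally_integrable g" and \<phi>: "\<phi> \<in> test_functions"
  shows "integrable lebesgue (\<lambda>x. g x * \<phi> x)"
proof -
  obtain C r where C: "C \<ge> 0" "\<And>x. \<bar>\<phi> x\<bar> \<le> C * indicator (cball 0 r) x" using test_function_bounded[OF \<phi>] by blast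
  have i: "integrable lebesgue (\<lambda>x. indicator (cball 0 r) x * g x)"
    using g compact_cball by (simp add: locally_integrable_def set_integrable_def)
  have e: "(\<lambda>x. g x * \<phi> x) = (\<lambda>x. (indicator (cball 0 r) x * g x) * \<phi> x)"
  proof
    fix x show "g x * \<phi> x = (indicator (cball 0 r) x * g x) * \<phi> x"
      using C(2)[of x] by (cases "x \<in> cball 0 r") auto
  qed
  have m: "(\<lambda>x. (indicator (cball 0 r) x * g x) * \<phi> x) \<in> borel_measurable lebesgue"
    by (intro borel_measurable_times[OF borel_measurable_integrable[OF i]] test_function_measurable \<phi>)
  show ?thesis unfolding e
  proof (rule Bochner_Integration.integrable_bound[OF integrable_mult_right[OF i, of C] m], rule AE_I2)
    fix x
    have "\<bar>\<phi> x\<bar> \<le> C" using C(2)[of x] C(1) by (cases "x \<in> cball 0 r") auto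
    then show "norm ((indicator (cball 0 r) x * g x) * \<phi> x) \<le> norm (C * (indicator (cball 0 r) x * g x))"
      using C(1) mult_right_mono[of "\<bar>\<phi> x\<bar>" C "\<bar>indicator (cball 0 r) x * g x\<bar>"] by (simp add: abs_mult ac_simps)
  qed
qed

lemma locally_integrable_diff:
  "locally_integrable f \<Longrightarrow> locally_integrable g \<Longrightarrow> locally_integrable (\<lambda>x. f x - g x)"
  by (simp add: locally_integrable_def set_integrable_def right_diff_distrib)

text \<open>The weak derivative that is selected agrees almost everywhere with the limit of difference quotients.\<close>
lemma weak_partial_fourier:
  fixes u :: "real ^ 'n \<Rightarrow> real"
  assumes u: "has_fourier u v" and v: "hom_integrable 1 v"
  shows "has_fourier (weak_partial k u) (\<lambda>\<xi>. \<i> * of_real (\<xi> $ k) * v \<xi>)"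
proof -
  obtain g where g: "has_weak_partial k u g" "has_fourier g (\<lambda>\<xi>. \<i> * of_real (\<xi> $ k) * v \<xi>)"
    using has_weak_partial_exists[OF u v] by blast
  define w where "w = weak_partial k u"
  have w: "has_weak_partial k u w" unfolding w_def weak_partial_def using g(1) by (rule someI[where P="has_weak_partial k u"])
  have li: "locally_integrable g" "locally_integrable w" using g(1) w by (auto simp: has_weak_partial_def)
  have "AE x in lebesgue. g x - w x = 0"
  proof (rule fundamental_lemma_of_variations[OF locally_integrable_diff[OF li]])
    fix \<phi> :: "real ^ 'n \<Rightarrow> real" assume \<phi>: "\<phi> \<in> test_functions"
    have "(LINT x|lebesgue. g x * \<phi> x) = (LINT x|lebesgue. w x * \<phi> x)"
      using g(1) w \<phi> by (auto simp: has_weak_partial_def)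
    then show "(LINT x|lebesgue. (g x - w x) * \<phi> x) = 0"
      using locally_integrable_test_product[OF li(1) \<phi>] locally_integrable_test_product[OF li(2) \<phi>]
      by (simp add: left_diff_distrib)
  qed
  then have "AE x in lebesgue. g x = w x" by simp
  then show ?thesis using has_fourier_cong[OF g(2)] unfolding w_def by simp
qed

lemma neg_laplacian_fourier:
  fixes u :: "real ^ 'n \<Rightarrow> real"
  assumes u: "has_fourier u v" and v: "hom_integrable r v" "2 \<le> r"
  shows "has_fourier (neg_laplacian u) (\<lambda>\<xi>. of_real ((norm \<xi>)\<^sup>2) * v \<xi>)"
    and "hom_integrable (r - 2) (\<lambda>\<xi>. of_real ((norm \<xi>)\<^sup>2) * v \<xi>)"
proof -
  have h1: "hom_integrable 1 v" by (rule hom_integrable_mono[OF v(1)]) (use v in auto)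
  have h2: "hom_integrable 1 (\<lambda>\<xi>. \<i> * of_real (\<xi> $ k) * v \<xi>)" for k
    by (rule hom_integrable_mono[OF hom_integrable_partial[OF v(1)]]) (use v in auto)
  have "has_fourier (\<lambda>x. (- 1) * (\<Sum>k\<in>UNIV. weak_partial k (weak_partial k u) x))
     (\<lambda>\<xi>. of_real (- 1) * (\<Sum>k\<in>UNIV. \<i> * of_real (\<xi> $ k) * (\<i> * of_real (\<xi> $ k) * v \<xi>)))"
    by (intro has_fourier_cmult has_fourier_sum weak_partial_fourier u h1 h2) simp
  moreover have "of_real (- 1) * (\<Sum>k\<in>UNIV. \<i> * of_real (\<xi> $ k) * (\<i> * of_real (\<xi> $ k) * v \<xi>)) = of_real ((norm \<xi>)\<^sup>2) * v \<xi>" for \<xi> :: "real ^ 'n"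
  proof -
    have "(norm \<xi>)\<^sup>2 = (\<Sum>k\<in>UNIV. (\<xi> $ k)\<^sup>2)" by (simp add: norm_eq_sqrt_inner inner_vec_def power2_eq_square sum_nonneg)
    moreover have "\<i> * of_real (\<xi> $ k) * (\<i> * of_real (\<xi> $ k) * v \<xi>) = - (of_real ((\<xi> $ k)\<^sup>2) * v \<xi>)" for k
      by (simp add: complex_eq_iff power2_eq_square algebra_simps)
    ultimately show ?thesis by (simp add: sum_negf sum_distrib_right)
  qed
  ultimately show "has_fourier (neg_laplacian u) (\<lambda>\<xi>. of_real ((norm \<xi>)\<^sup>2) * v \<xi>)"
    by (simp add: neg_laplacian_def)
  have m: "(\<lambda>\<xi> :: real ^ 'n. complex_of_real ((norm \<xi>)\<^sup>2)) \<in> borel_measurable lebesgue"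
    by (intro measurable_completion) measurable
  show "hom_integrable (r - 2) (\<lambda>\<xi>. of_real ((norm \<xi>)\<^sup>2) * v \<xi>)"
    using hom_integrable_multiplier[OF v(1), of 2, OF _ _ m] v(2) by (simp add: norm_power)
qed

lemma neg_laplacian_power_fourier:
  fixes u :: "real ^ 'n \<Rightarrow> real"
  assumes u: "has_fourier u v" and v: "hom_integrable r v" "real (2 * j) \<le> r"
  shows "has_fourier ((neg_laplacian ^^ j) u) (\<lambda>\<xi>. of_real (norm \<xi> ^ (2 * j)) * v \<xi>) \<and>
    hom_integrable (r - real (2 * j)) (\<lambda>\<xi>. of_real (norm \<xi> ^ (2 * j)) * v \<xi>)"
  using v(2)
proof (induction j)
  case (Suc j)
  then have IH: "has_fourier ((neg_laplacian ^^ j) u) (\<lambda>\<xi>. of_real (norm \<xi> ^ (2 * j)) * v \<xi>)"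
    "hom_integrable (r - real (2 * j)) (\<lambda>\<xi>. of_real (norm \<xi> ^ (2 * j)) * v \<xi>)" by auto
  have e: "of_real ((norm \<xi>)\<^sup>2) * (of_real (norm \<xi> ^ (2 * j)) * v \<xi>) = of_real (norm \<xi> ^ (2 * Suc j)) * v \<xi>" for \<xi>
    by (simp add: power2_eq_square)
  have r2: "2 \<le> r - real (2 * j)" "r - real (2 * j) - 2 = r - real (2 * Suc j)" using Suc.prems by auto
  show ?case using neg_laplacian_fourier[OF IH r2(1)] unfolding e r2(2) by simp
qed (use u v in auto)

text \<open>With \<open>m = 2 * j + 1\<close> the weights multiply up to \<open>norm \<xi> powr (2 * \<sigma>) * (\<Sum>k. (\<xi> $ k)\<^sup>2) * norm \<xi> ^ (4 * j)\<close>,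
  which is the pure power of order \<open>2 * (m + \<sigma>)\<close>.\<close>
theorem form_odd_fourier:
  fixes \<sigma> :: real
  assumes \<sigma>: "0 < \<sigma>" "\<sigma> < 1" and m: "odd m"
  obtains \<kappa> where "\<kappa> > 0" "\<And>(u :: real ^ 'n \<Rightarrow> real) w v z. has_fourier u v \<Longrightarrow> has_fourier w z \<Longrightarrow>
    hom_integrable (real m + \<sigma>) v \<Longrightarrow> hom_integrable (real m + \<sigma>) z \<Longrightarrow> form_odd m \<sigma> u w = \<kappa> * hom_form (real m + \<sigma>) v z"
proof -
  obtain \<kappa> where \<kappa>: "\<kappa> > 0" "\<And>(u :: real ^ 'n \<Rightarrow> real) w v z. has_fourier u v \<Longrightarrow> has_fourier w z \<Longrightarrow>
    hom_integrable \<sigma> v \<Longrightarrow> hom_integrable \<sigma> z \<Longrightarrow> form_frac \<sigma> u w = \<kappa> * hom_form \<sigma> v z"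
    using form_frac_fourier[OF \<sigma>, where 'n='n] by blast
  obtain j where j: "m = 2 * j + 1" using m by (rule oddE)
  have j': "(m - 1) div 2 = j" using j by simp
  show thesis
  proof (rule that[OF \<kappa>(1)])
    fix u w :: "real ^ 'n \<Rightarrow> real" and v z
    assume u: "has_fourier u v" and w: "has_fourier w z" and v: "hom_integrable (real m + \<sigma>) v" and z: "hom_integrable (real m + \<sigma>) z"
    define D where "D q k \<xi> = \<i> * of_real (\<xi> $ k) * (of_real (norm \<xi> ^ (2 * j)) * q \<xi>)" for q and k :: 'n and \<xi> :: "real ^ 'n"
    have D: "has_fourier (weak_partial k ((neg_laplacian ^^ j) f)) (D q k) \<and> hom_integrable \<sigma> (D q k)"
      if "has_fourier f q" "hom_integrable (real m + \<sigma>) q" for f q k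
    proof -
      have "real (2 * j) \<le> real m + \<sigma>" using j \<sigma> by simp
      from neg_laplacian_power_fourier[OF that this]
      have n: "has_fourier ((neg_laplacian ^^ j) f) (\<lambda>\<xi>. of_real (norm \<xi> ^ (2 * j)) * q \<xi>)"
        "hom_integrable (1 + \<sigma>) (\<lambda>\<xi>. of_real (norm \<xi> ^ (2 * j)) * q \<xi>)" by (simp_all add: j algebra_simps)
      have n1: "hom_integrable 1 (\<lambda>\<xi>. of_real (norm \<xi> ^ (2 * j)) * q \<xi>)" by (rule hom_integrable_mono[OF n(2)]) (use \<sigma> in auto)
      show ?thesis unfolding D_def[abs_def]
        using weak_partial_fourier[OF n(1) n1, of k] hom_integrable_partial[OF n(2), of k] \<sigma> by simp
    qed
    have "form_odd m \<sigma> u w = (\<Sum>k\<in>UNIV. \<kappa> * hom_form \<sigma> (D v k) (D z k))"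
      unfolding form_odd_def j' using D[OF u v] D[OF w z] by (intro sum.cong refl \<kappa>(2)) auto
    also have "\<dots> = \<kappa> * (LINT \<xi>|lebesgue. (\<Sum>k\<in>UNIV. norm \<xi> powr (2 * \<sigma>) * Re (D v k \<xi> * cnj (D z k \<xi>))))"
    proof -
      have "(LINT \<xi>|lebesgue. (\<Sum>k\<in>UNIV. norm \<xi> powr (2 * \<sigma>) * Re (D v k \<xi> * cnj (D z k \<xi>)))) = (\<Sum>k\<in>UNIV. hom_form \<sigma> (D v k) (D z k))"
        unfolding hom_form_def
        by (rule Bochner_Integration.integral_sum) (rule hom_form_integrable(2)[OF conjunct2[OF D[OF u v]] conjunct2[OF D[OF w z]]])
      then show ?thesis by (simp only: sum_distrib_left)
    qed
    also have "(\<lambda>\<xi>. \<Sum>k\<in>UNIV. norm \<xi> powr (2 * \<sigma>) * Re (D v k \<xi> * cnj (D z k \<xi>))) = (\<lambda>\<xi>. norm \<xi> powr (2 * (real m + \<sigma>)) * Re (v \<xi> * cnj (z \<xi>)))"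
    proof
      fix \<xi> :: "real ^ 'n"
      have n: "(norm \<xi>)\<^sup>2 = (\<Sum>k\<in>UNIV. (\<xi> $ k)\<^sup>2)" by (simp add: norm_eq_sqrt_inner inner_vec_def power2_eq_square sum_nonneg)
      have "D v k \<xi> * cnj (D z k \<xi>) = of_real ((\<xi> $ k)\<^sup>2 * (norm \<xi> ^ (2 * j))\<^sup>2) * (v \<xi> * cnj (z \<xi>))" for k
        unfolding D_def by (simp add: power2_eq_square algebra_simps)
      moreover have "Re (of_real c * q) = c * Re q" for c q by simp
      ultimately have "Re (D v k \<xi> * cnj (D z k \<xi>)) = (\<xi> $ k)\<^sup>2 * (norm \<xi> ^ (2 * j))\<^sup>2 * Re (v \<xi> * cnj (z \<xi>))" for k
        by (simp only:)
      then have "(\<Sum>k\<in>UNIV. norm \<xi> powr (2 * \<sigma>) * Re (D v k \<xi> * cnj (D z k \<xi>))) =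
         (norm \<xi> powr (2 * \<sigma>) * ((norm \<xi>)\<^sup>2 * (norm \<xi> ^ (2 * j))\<^sup>2)) * Re (v \<xi> * cnj (z \<xi>))"
        unfolding n by (simp add: sum_distrib_left sum_distrib_right ac_simps)
      also have "norm \<xi> powr (2 * \<sigma>) * ((norm \<xi>)\<^sup>2 * (norm \<xi> ^ (2 * j))\<^sup>2) = norm \<xi> powr (2 * (real m + \<sigma>))"
      proof (cases "\<xi> = 0")
        case False
        have "(norm \<xi>)\<^sup>2 * (norm \<xi> ^ (2 * j))\<^sup>2 = norm \<xi> ^ (2 * m)"
          by (simp add: j power_mult[symmetric] power_add[symmetric] algebra_simps)
        also have "\<dots> = norm \<xi> powr (2 * real m)" using False by (simp add: powr_realpow[symmetric])
        finally show ?thesis by (simp add: powr_add[symmetric] algebra_simps)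
      qed simp
      finally show "(\<Sum>k\<in>UNIV. norm \<xi> powr (2 * \<sigma>) * Re (D v k \<xi> * cnj (D z k \<xi>))) = norm \<xi> powr (2 * (real m + \<sigma>)) * Re (v \<xi> * cnj (z \<xi>))" .
    qed
    finally show "form_odd m \<sigma> u w = \<kappa> * hom_form (real m + \<sigma>) v z" unfolding hom_form_def .
  qed
qed

text \<open>The weight \<open>(1 + (norm \<xi>)\<^sup>2) powr s\<close> is comparable to \<open>1 + norm \<xi> powr (2 * s)\<close>.\<close>
lemma sobolev_iff:
  fixes u :: "real ^ 'n \<Rightarrow> real"
  assumes s: "0 < s"
  shows "u \<in> sobolev s \<longleftrightarrow> (\<exists>v. has_fourier u v \<and> hom_integrable s v)"
proof -
  have "(\<lambda>\<xi>. complex_of_real ((1 + (norm \<xi>)\<^sup>2) powr (s / 2)) * v \<xi>) \<in> L2 \<longleftrightarrow> hom_integrable s v"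
    if vL: "v \<in> L2" for v :: "real ^ 'n \<Rightarrow> complex"
  proof -
    have [measurable]: "v \<in> borel_measurable lebesgue" by (rule L2_measurable[OF vL])
    have m1: "(\<lambda>\<xi> :: real ^ 'n. (1 + (norm \<xi>)\<^sup>2) powr r) \<in> borel_measurable lebesgue" for r
      by (intro measurable_completion) measurable
    have m: "(\<lambda>\<xi>. complex_of_real ((1 + (norm \<xi>)\<^sup>2) powr (s / 2)) * v \<xi>) \<in> borel_measurable lebesgue"
      using m1 by (intro borel_measurable_times borel_measurable_of_real) auto
    have e: "(norm (complex_of_real ((1 + (norm \<xi>)\<^sup>2) powr (s / 2)) * v \<xi>))\<^sup>2 = (1 + (norm \<xi>)\<^sup>2) powr s * (norm (v \<xi>))\<^sup>2" for \<xi>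
    proof -
      have "((1 + (norm \<xi>)\<^sup>2) powr (s / 2))\<^sup>2 = (1 + (norm \<xi>)\<^sup>2) powr s"
        by (simp add: power2_eq_square powr_add[symmetric])
      then show ?thesis by (simp add: norm_mult power_mult_distrib)
    qed
    have np: "norm \<xi> powr (2 * s) = ((norm \<xi>)\<^sup>2) powr s" for \<xi> :: "real ^ 'n"
      by (cases "\<xi> = 0") (auto simp: powr_powr[symmetric] powr_numeral)
    have lo: "norm \<xi> powr (2 * s) \<le> (1 + (norm \<xi>)\<^sup>2) powr s" for \<xi> :: "real ^ 'n"
      unfolding np using s by (intro powr_mono2) auto
    have hi: "(1 + (norm \<xi>)\<^sup>2) powr s \<le> 2 powr s * (1 + norm \<xi> powr (2 * s))" for \<xi> :: "real ^ 'n"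
    proof -
      have "(1 + (norm \<xi>)\<^sup>2) powr s \<le> (2 * max 1 ((norm \<xi>)\<^sup>2)) powr s" using s by (intro powr_mono2) auto
      also have "\<dots> = 2 powr s * max 1 ((norm \<xi>)\<^sup>2) powr s" by (rule powr_mult)
      also have "max 1 ((norm \<xi>)\<^sup>2) powr s \<le> 1 + norm \<xi> powr (2 * s)" unfolding np by (auto simp: max_def)
      finally show ?thesis by simp
    qed
    show ?thesis
    proof
      assume "(\<lambda>\<xi>. complex_of_real ((1 + (norm \<xi>)\<^sup>2) powr (s / 2)) * v \<xi>) \<in> L2"
      then have i: "integrable lebesgue (\<lambda>\<xi>. (1 + (norm \<xi>)\<^sup>2) powr s * (norm (v \<xi>))\<^sup>2)"
        unfolding e[symmetric] by (rule L2_integrable)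
      have "integrable lebesgue (\<lambda>\<xi>. norm \<xi> powr (2 * s) * (norm (v \<xi>))\<^sup>2)"
        by (rule Bochner_Integration.integrable_bound[OF i]) (use lo in \<open>auto intro!: mult_right_mono\<close>)
      then show "hom_integrable s v" using vL by (simp add: hom_integrable_def)
    next
      assume "hom_integrable s v"
      then have i: "integrable lebesgue (\<lambda>\<xi>. 2 powr s * ((norm (v \<xi>))\<^sup>2 + norm \<xi> powr (2 * s) * (norm (v \<xi>))\<^sup>2))"
        using L2_integrable[OF vL] by (simp add: hom_integrable_def)
      have "integrable lebesgue (\<lambda>\<xi>. (1 + (norm \<xi>)\<^sup>2) powr s * (norm (v \<xi>))\<^sup>2)"
      proof (rule Bochner_Integration.integrable_bound[OF i])
        show "(\<lambda>\<xi>. (1 + (norm \<xi>)\<^sup>2) powr s * (norm (v \<xi>))\<^sup>2) \<in> borel_measurable lebesgue"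
          using m1 by (intro borel_measurable_times) auto
        show "AE \<xi> in lebesgue. norm ((1 + (norm \<xi>)\<^sup>2) powr s * (norm (v \<xi>))\<^sup>2) \<le> norm (2 powr s * ((norm (v \<xi>))\<^sup>2 + norm \<xi> powr (2 * s) * (norm (v \<xi>))\<^sup>2))"
        proof (rule AE_I2)
          fix \<xi>
          have "(1 + (norm \<xi>)\<^sup>2) powr s * (norm (v \<xi>))\<^sup>2 \<le> (2 powr s * (1 + norm \<xi> powr (2 * s))) * (norm (v \<xi>))\<^sup>2"
            by (intro mult_right_mono hi) simp
          also have "\<dots> = 2 powr s * ((norm (v \<xi>))\<^sup>2 + norm \<xi> powr (2 * s) * (norm (v \<xi>))\<^sup>2)" by (simp add: algebra_simps)
          finally show "norm ((1 + (norm \<xi>)\<^sup>2) powr s * (norm (v \<xi>))\<^sup>2) \<le> norm (2 powr s * ((norm (v \<xi>))\<^sup>2 + norm \<xi> powr (2 * s) * (norm (v \<xi>))\<^sup>2))"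
            by simp
        qed
      qed
      then have "integrable lebesgue (\<lambda>\<xi>. (norm (complex_of_real ((1 + (norm \<xi>)\<^sup>2) powr (s / 2)) * v \<xi>))\<^sup>2)"
        unfolding e .
      with m show "(\<lambda>\<xi>. complex_of_real ((1 + (norm \<xi>)\<^sup>2) powr (s / 2)) * v \<xi>) \<in> L2"
        unfolding L2_def by blast
    qed
  qed
  then show ?thesis unfolding sobolev_def using has_fourier_L2 by blast
qed

text \<open>The norm of \<open>\<xi>\<close> is controlled by its largest coordinate, so it suffices that the pure partial derivatives
  of a high order \<open>M\<close> are square integrable.\<close>
lemma test_function_sobolev:
  fixes \<phi> :: "real ^ 'n \<Rightarrow> real"
  assumes \<phi>: "\<phi> \<in> test_functions" and s: "0 < s"
  shows "\<phi> \<in> sobolev s"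
proof -
  obtain v where v: "has_fourier \<phi> v" using has_fourier_exists[OF test_function_L2[OF \<phi>]] by blast
  obtain M :: nat where M: "s \<le> real M" using real_arch_simple by blast
  then have M0: "0 < M" using s by (cases M) auto
  have vL: "v \<in> L2" by (rule has_fourier_L2(2)[OF v])
  have [measurable]: "v \<in> borel_measurable lebesgue" by (rule L2_measurable[OF vL])
  have it: "(partial_deriv k ^^ j) \<phi> \<in> test_functions \<and> has_fourier ((partial_deriv k ^^ j) \<phi>) (\<lambda>\<xi>. (\<i> * of_real (\<xi> $ k)) ^ j * v \<xi>)" for j k
  proof (induction j)
    case (Suc j)
    then show ?case using test_function_partial[of "(partial_deriv k ^^ j) \<phi>" k] test_function_fourier_partial[of "(partial_deriv k ^^ j) \<phi>" _ k]
      by (auto simp: mult.assoc)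
  qed (use \<phi> v in auto)
  have i: "integrable lebesgue (\<lambda>\<xi>. \<bar>\<xi> $ k\<bar> ^ (2 * M) * (norm (v \<xi>))\<^sup>2)" for k
  proof -
    have "(\<lambda>\<xi>. (\<i> * of_real (\<xi> $ k)) ^ M * v \<xi>) \<in> L2" using it[of M k] has_fourier_L2(2) by blast
    from L2_integrable[OF this] show ?thesis
      by (simp add: norm_mult norm_power power_mult_distrib power_mult[symmetric] mult.commute)
  qed
  have b: "norm \<xi> powr (2 * real M) \<le> real CARD('n) ^ (2 * M) * (\<Sum>k\<in>UNIV. \<bar>\<xi> $ k\<bar> ^ (2 * M))" for \<xi> :: "real ^ 'n"
  proof -
    have "Max (range (\<lambda>k. \<bar>\<xi> $ k\<bar>)) \<in> range (\<lambda>k. \<bar>\<xi> $ k\<bar>)" by (rule Max_in) auto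
    then obtain k where "Max (range (\<lambda>k. \<bar>\<xi> $ k\<bar>)) = \<bar>\<xi> $ k\<bar>" by blast
    then have k: "\<bar>\<xi> $ k\<bar> = Max (range (\<lambda>k. \<bar>\<xi> $ k\<bar>))" by simp
    have "norm \<xi> \<le> (\<Sum>l\<in>UNIV. \<bar>\<xi> $ l\<bar>)" by (rule norm_le_l1_cart)
    also have "\<dots> \<le> (\<Sum>l\<in>(UNIV::'n set). \<bar>\<xi> $ k\<bar>)" unfolding k by (intro sum_mono Max_ge) auto
    finally have "norm \<xi> \<le> real CARD('n) * \<bar>\<xi> $ k\<bar>" by simp
    then have "norm \<xi> ^ (2 * M) \<le> (real CARD('n) * \<bar>\<xi> $ k\<bar>) ^ (2 * M)" by (intro power_mono) auto
    also have "\<dots> = real CARD('n) ^ (2 * M) * \<bar>\<xi> $ k\<bar> ^ (2 * M)" by (simp add: power_mult_distrib)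
    also have "\<dots> \<le> real CARD('n) ^ (2 * M) * (\<Sum>k\<in>UNIV. \<bar>\<xi> $ k\<bar> ^ (2 * M))"
      by (intro mult_left_mono member_le_sum) auto
    finally show ?thesis using M0 powr_realpow'[of "norm \<xi>" "2 * M"] by simp
  qed
  have i2: "integrable lebesgue (\<lambda>\<xi>. real CARD('n) ^ (2 * M) * (\<Sum>k\<in>UNIV. \<bar>\<xi> $ k\<bar> ^ (2 * M) * (norm (v \<xi>))\<^sup>2))"
    using i by (intro integrable_mult_right Bochner_Integration.integrable_sum) auto
  have "integrable lebesgue (\<lambda>\<xi>. norm \<xi> powr (2 * real M) * (norm (v \<xi>))\<^sup>2)"
  proof (rule Bochner_Integration.integrable_bound[OF i2])
    show "AE \<xi> in lebesgue. norm (norm \<xi> powr (2 * real M) * (norm (v \<xi>))\<^sup>2) \<le>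
        norm (real CARD('n) ^ (2 * M) * (\<Sum>k\<in>UNIV. \<bar>\<xi> $ k\<bar> ^ (2 * M) * (norm (v \<xi>))\<^sup>2))"
      using mult_right_mono[OF b] by (intro AE_I2) (auto simp: sum_distrib_right mult.assoc abs_mult sum_nonneg)
  qed measurable
  then have "hom_integrable (real M) v" using vL by (simp add: hom_integrable_def)
  then have "hom_integrable s v" using hom_integrable_mono M s by force
  then show ?thesis using v sobolev_iff[OF s] by blast
qed

section \<open>The energy form on Sobolev spaces\<close>

definition fourier :: "(real ^ 'n \<Rightarrow> real) \<Rightarrow> real ^ 'n \<Rightarrow> complex" where
  "fourier u = (SOME v. has_fourier u v)"

text \<open>The form of the operator \<open>(-\<Delta>) ^ s\<close>, up to a positive factor.\<close>
definition energy :: "real \<Rightarrow> (real ^ 'n \<Rightarrow> real) \<Rightarrow> (real ^ 'n \<Rightarrow> real) \<Rightarrow> real" where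
  "energy s u w = hom_form s (fourier u) (fourier w)"

lemma has_fourier_fourier: "u \<in> L2 \<Longrightarrow> has_fourier u (fourier u)"
  unfolding fourier_def using has_fourier_exists[of u] by (rule someI_ex)

lemma hom_form_cong:
  assumes L: "v \<in> L2" "w \<in> L2" and v: "AE \<xi> in lebesgue. v \<xi> = v' \<xi>" and w: "AE \<xi> in lebesgue. w \<xi> = w' \<xi>"
  shows "hom_form r v w = hom_form r v' w'"
proof -
  have [measurable]: "v \<in> borel_measurable lebesgue" "w \<in> borel_measurable lebesgue" "v' \<in> borel_measurable lebesgue" "w' \<in> borel_measurable lebesgue"
    using L L2_cong_AE(1)[OF L(1) v] L2_cong_AE(1)[OF L(2) w] by (auto intro: L2_measurable)
  show ?thesis unfolding hom_form_def
  proof (rule integral_cong_AE)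
    show "AE \<xi> in lebesgue. norm \<xi> powr (2 * r) * Re (v \<xi> * cnj (w \<xi>)) = norm \<xi> powr (2 * r) * Re (v' \<xi> * cnj (w' \<xi>))"
      using v w by eventually_elim simp
  qed measurable
qed

lemma hom_integrable_cong:
  assumes h: "hom_integrable r v" and v: "AE \<xi> in lebesgue. v \<xi> = v' \<xi>"
  shows "hom_integrable r v'"
proof -
  have L: "v \<in> L2" "v' \<in> L2" using h L2_cong_AE(1)[OF _ v] by (auto simp: hom_integrable_def)
  then have [measurable]: "v \<in> borel_measurable lebesgue" "v' \<in> borel_measurable lebesgue" by (auto intro: L2_measurable)
  have i: "integrable lebesgue (\<lambda>\<xi>. norm \<xi> powr (2 * r) * (norm (v \<xi>))\<^sup>2)" using h by (simp add: hom_integrable_def)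
  have "integrable lebesgue (\<lambda>\<xi>. norm \<xi> powr (2 * r) * (norm (v' \<xi>))\<^sup>2)"
  proof (rule integrable_cong_AE_imp[OF i])
    show "AE \<xi> in lebesgue. norm \<xi> powr (2 * r) * (norm (v \<xi>))\<^sup>2 = norm \<xi> powr (2 * r) * (norm (v' \<xi>))\<^sup>2"
      using v by eventually_elim simp
  qed measurable
  then show ?thesis using L by (simp add: hom_integrable_def)
qed

lemma energy_eq:
  fixes u w :: "real ^ 'n \<Rightarrow> real"
  assumes "has_fourier u v" "has_fourier w z"
  shows "energy s u w = hom_form s v z"
proof -
  note L = has_fourier_L2[OF assms(1)] has_fourier_L2[OF assms(2)]
  note F = has_fourier_fourier[OF L(1)] has_fourier_fourier[OF L(3)]
  show ?thesis unfolding energy_def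
    by (rule hom_form_cong[OF has_fourier_L2(2)[OF F(1)] has_fourier_L2(2)[OF F(2)]
      has_fourier_unique[OF F(1) assms(1)] has_fourier_unique[OF F(2) assms(2)]])
qed

lemma sobolevD:
  fixes u :: "real ^ 'n \<Rightarrow> real"
  assumes "u \<in> sobolev s" "0 < s"
  shows "u \<in> L2" "has_fourier u (fourier u)" "hom_integrable s (fourier u)"
proof -
  obtain v where v: "has_fourier u v" "hom_integrable s v" using assms sobolev_iff by blast
  show u: "u \<in> L2" by (rule has_fourier_L2(1)[OF v(1)])
  show f: "has_fourier u (fourier u)" by (rule has_fourier_fourier[OF u])
  show "hom_integrable s (fourier u)" by (rule hom_integrable_cong[OF v(2) has_fourier_unique[OF v(1) f]])
qed

lemma energy_cong:
  fixes u w :: "real ^ 'n \<Rightarrow> real"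
  assumes u: "u \<in> L2" and w: "w \<in> L2" and ae: "AE x in lebesgue. u x = u' x"
  shows "energy s u w = energy s u' w"
proof -
  have "has_fourier u' (fourier u)" by (rule has_fourier_cong[OF has_fourier_fourier[OF u] ae]) simp
  from energy_eq[OF this has_fourier_fourier[OF w], of s] show ?thesis by (simp add: energy_def)
qed

lemma sobolev_linear:
  fixes u w :: "real ^ 'n \<Rightarrow> real"
  assumes "u \<in> sobolev s" "w \<in> sobolev s" "0 < s"
  shows "(\<lambda>x. a * u x + b * w x) \<in> sobolev s"
  using has_fourier_linear[OF sobolevD(2)[OF assms(1,3)] sobolevD(2)[OF assms(2,3)]]
    hom_integrable_linear[OF sobolevD(3)[OF assms(1,3)] sobolevD(3)[OF assms(2,3)]] sobolev_iff[OF assms(3)] by blast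

lemma energy_commute: "energy s u w = energy s w u"
  unfolding energy_def by (rule hom_form_commute)

lemma energy_nonneg: "0 \<le> energy s u u"
  unfolding energy_def by (rule hom_form_nonneg)

lemma energy_linear:
  fixes u w z :: "real ^ 'n \<Rightarrow> real"
  assumes "u \<in> sobolev s" "w \<in> sobolev s" "z \<in> sobolev s" "0 < s"
  shows "energy s (\<lambda>x. a * u x + b * w x) z = a * energy s u z + b * energy s w z"
proof -
  note D = sobolevD[OF assms(1,4)] sobolevD[OF assms(2,4)] sobolevD[OF assms(3,4)]
  show ?thesis unfolding energy_eq[OF has_fourier_linear[OF D(2,5)] D(8)] unfolding energy_def
    by (rule hom_form_linear[OF D(3,6,9)])
qed

lemma energy_quadratic:
  fixes u w :: "real ^ 'n \<Rightarrow> real"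
  assumes u: "u \<in> sobolev s" and w: "w \<in> sobolev s" and s: "0 < s"
  shows "energy s (\<lambda>x. a * u x + b * w x) (\<lambda>x. a * u x + b * w x) = a\<^sup>2 * energy s u u + 2 * a * b * energy s u w + b\<^sup>2 * energy s w w"
proof -
  note l = sobolev_linear[OF u w s, of a b]
  have "energy s (\<lambda>x. a * u x + b * w x) (\<lambda>x. a * u x + b * w x) = a * energy s u (\<lambda>x. a * u x + b * w x) + b * energy s w (\<lambda>x. a * u x + b * w x)"
    by (rule energy_linear[OF u w l s])
  also have "energy s u (\<lambda>x. a * u x + b * w x) = a * energy s u u + b * energy s u w"
    using energy_linear[OF u w u s, of a b] energy_commute[of s u "\<lambda>x. a * u x + b * w x"] energy_commute[of s w u] by simp
  also have "energy s w (\<lambda>x. a * u x + b * w x) = a * energy s u w + b * energy s w w"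
    using energy_linear[OF u w w s, of a b] energy_commute[of s w "\<lambda>x. a * u x + b * w x"] by simp
  finally show ?thesis by (simp add: power2_eq_square algebra_simps)
qed

lemma energy_diff:
  fixes u w :: "real ^ 'n \<Rightarrow> real"
  assumes "u \<in> sobolev s" "w \<in> sobolev s" "0 < s"
  shows "energy s (\<lambda>x. u x - w x) (\<lambda>x. u x - w x) = energy s u u - 2 * energy s u w + energy s w w"
  using energy_quadratic[OF assms, of 1 "-1"] by simp

lemma sobolev_diff: "u \<in> sobolev s \<Longrightarrow> w \<in> sobolev s \<Longrightarrow> 0 < s \<Longrightarrow> (\<lambda>x. u x - w x) \<in> sobolev s"
  using sobolev_linear[of u s w 1 "-1"] by simp

lemma sobolev_zero: "0 < s \<Longrightarrow> (\<lambda>x. 0) \<in> sobolev s"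
proof -
  assume s: "0 < s"
  have "hom_integrable s (\<lambda>\<xi>::real^'a. 0)" using L2_zero(1) by (simp add: hom_integrable_def)
  then show ?thesis using has_fourier_zero sobolev_iff[OF s] by blast
qed

lemma energy_Cauchy_Schwarz:
  fixes u w :: "real ^ 'n \<Rightarrow> real"
  assumes "u \<in> sobolev s" "w \<in> sobolev s" "0 < s"
  shows "(energy s u w)\<^sup>2 \<le> energy s u u * energy s w w"
proof (rule quadratic_nonneg_imp_discriminant)
  show "0 \<le> energy s u u + 2 * t * energy s u w + t\<^sup>2 * energy s w w" for t
    using energy_quadratic[OF assms, of 1 t] energy_nonneg[of s "\<lambda>x. 1 * u x + t * w x"] by simp
qed (rule energy_nonneg)

lemma energy_tendsto:
  fixes u :: "real ^ 'n \<Rightarrow> real"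
  assumes f: "\<And>k::nat. f k \<in> sobolev s" and u: "u \<in> sobolev s" and s: "0 < s"
    and lim: "(\<lambda>k. energy s (\<lambda>x. f k x - u x) (\<lambda>x. f k x - u x)) \<longlonglongrightarrow> 0"
  shows "\<And>\<phi>. \<phi> \<in> sobolev s \<Longrightarrow> (\<lambda>k. energy s (f k) \<phi>) \<longlonglongrightarrow> energy s u \<phi>"
    and "(\<lambda>k. energy s (f k) (f k)) \<longlonglongrightarrow> energy s u u"
proof -
  show c: "(\<lambda>k. energy s (f k) \<phi>) \<longlonglongrightarrow> energy s u \<phi>" if \<phi>: "\<phi> \<in> sobolev s" for \<phi>
  proof -
    have d: "energy s (\<lambda>x. f k x - u x) \<phi> = energy s (f k) \<phi> - energy s u \<phi>" for k
      using energy_linear[OF f u \<phi> s, of 1 _ "-1"] by simp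
    have "(\<lambda>k. (energy s (f k) \<phi> - energy s u \<phi>)\<^sup>2) \<longlonglongrightarrow> 0"
    proof (rule tendsto_sandwich[OF _ _ tendsto_const])
      show "(\<lambda>k. energy s (\<lambda>x. f k x - u x) (\<lambda>x. f k x - u x) * energy s \<phi> \<phi>) \<longlonglongrightarrow> 0"
        by (rule tendsto_mult_left_zero[OF lim])
      show "\<forall>\<^sub>F k in sequentially. (energy s (f k) \<phi> - energy s u \<phi>)\<^sup>2 \<le> energy s (\<lambda>x. f k x - u x) (\<lambda>x. f k x - u x) * energy s \<phi> \<phi>"
        using energy_Cauchy_Schwarz[OF sobolev_diff[OF f u s] \<phi> s] unfolding d by simp
    qed simp
    from tendsto_real_sqrt[OF this] show ?thesis by (simp add: tendsto_rabs_zero_iff Lim_null[symmetric])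
  qed
  have e: "energy s (f k) (f k) = energy s (\<lambda>x. f k x - u x) (\<lambda>x. f k x - u x) + 2 * energy s (f k) u - energy s u u" for k
    using energy_diff[OF f u s, of k] by simp
  have "(\<lambda>k. energy s (\<lambda>x. f k x - u x) (\<lambda>x. f k x - u x) + 2 * energy s (f k) u - energy s u u) \<longlonglongrightarrow> 0 + 2 * energy s u u - energy s u u"
    by (intro tendsto_intros lim c u)
  then show "(\<lambda>k. energy s (f k) (f k)) \<longlonglongrightarrow> energy s u u" unfolding e[symmetric] by simp
qed

section \<open>The Poincare inequality and completeness\<close>

lemma sobolev0D:
  assumes "u \<in> sobolev0 s U"
  shows "u \<in> sobolev s" "AE x in lebesgue. x \<notin> U \<longrightarrow> u x = 0"
  using assms by (auto simp: sobolev0_def)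

lemma sobolev0_linear:
  fixes u w :: "real ^ 'n \<Rightarrow> real"
  assumes u: "u \<in> sobolev0 s U" and w: "w \<in> sobolev0 s U" and s: "0 < s"
  shows "(\<lambda>x. a * u x + b * w x) \<in> sobolev0 s U"
proof -
  have "AE x in lebesgue. x \<notin> U \<longrightarrow> a * u x + b * w x = 0"
    using sobolev0D(2)[OF u] sobolev0D(2)[OF w] by eventually_elim auto
  then show ?thesis using sobolev_linear[OF sobolev0D(1)[OF u] sobolev0D(1)[OF w] s] by (simp add: sobolev0_def)
qed

lemma sobolev0_diff: "u \<in> sobolev0 s U \<Longrightarrow> w \<in> sobolev0 s U \<Longrightarrow> 0 < s \<Longrightarrow> (\<lambda>x. u x - w x) \<in> sobolev0 s U"
  using sobolev0_linear[of u s U w 1 "-1"] by simp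

text \<open>A function of bounded support has a bounded transform, so that only a small part of its
  mass can sit at low frequencies.\<close>
theorem poincare:
  fixes U :: "(real ^ 'n) set"
  assumes U: "bounded U" and s: "0 < s"
  obtains C where "C > 0" "\<And>u. u \<in> sobolev0 s U \<Longrightarrow> sqn u \<le> C * energy s u u"
proof -
  obtain R where R: "U \<subseteq> cball 0 R" using U by (metis bounded_iff mem_cball_0 subsetI)
  define I where "I = (indicator (cball 0 R) :: real ^ 'n \<Rightarrow> real)"
  have IL: "I \<in> L2" unfolding I_def
    by (rule L2_bounded_support[of _ 1 R]) (auto simp: indicator_def)
  define A where "A = ((2 * pi) powr (- real CARD('n) / 2))\<^sup>2 * sqn I"
  have A: "0 \<le> A" unfolding A_def by simp
  define V where "V = unit_ball_vol (real CARD('n))"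
  have V: "0 < V" unfolding V_def by simp
  define q where "q = A * V"
  have q: "0 \<le> q" unfolding q_def using A V by simp
  \<comment> \<open>The ball of radius \<open>r \<le> 1\<close> is so small that the frequencies in it carry at most half of the mass;
    outside of it the weight of the energy is at least \<open>r powr (2 * s)\<close>.\<close>
  define r where "r = 1 / (2 * q + 1)"
  have "q * r \<le> 1 / 2" unfolding r_def using q by (simp add: field_simps)
  then have r: "0 < r" "r \<le> 1" "A * (V * r) \<le> 1 / 2" unfolding r_def using q by (auto simp: q_def mult.assoc)
  have vol: "A * (V * r ^ CARD('n)) \<le> 1 / 2"
  proof -
    have "r ^ CARD('n) \<le> r ^ 1" using r by (intro power_decreasing) (auto simp: Suc_leI)
    then have "A * (V * r ^ CARD('n)) \<le> A * (V * r)" using A V by (intro mult_left_mono) auto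
    then show ?thesis using r(3) by linarith
  qed
  have meas: "measure lebesgue (cball (0 :: real ^ 'n) r) = V * r ^ CARD('n)"
    using content_cball[of r "0 :: real ^ 'n"] r by (simp add: V_def)
  define C where "C = 2 * r powr (- 2 * s)"
  show thesis
  proof (rule that[of C])
    show "C > 0" unfolding C_def using r by simp
    fix u assume u: "u \<in> sobolev0 s U"
    note D = sobolevD[OF sobolev0D(1)[OF u] s]
    have supp: "AE x in lebesgue. x \<notin> cball 0 R \<longrightarrow> u x = 0"
      using sobolev0D(2)[OF u] R by (auto elim!: eventually_mono)
    have ui: "integrable lebesgue u" by (rule L2_bounded_support_integrable[OF D(1) bounded_cball cball_in_lebesgue supp])
    have v: "AE \<xi> in lebesgue. fourier u \<xi> = FI u \<xi>" by (rule has_fourier_unique[OF D(2) has_fourier_FI[OF D(1) ui]])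
    have "(LINT x|lebesgue. \<bar>u x\<bar>) = (LINT x|lebesgue. norm (I x) * norm (u x))"
    proof (rule integral_cong_AE)
      show "AE x in lebesgue. \<bar>u x\<bar> = norm (I x) * norm (u x)" using supp by eventually_elim (auto simp: I_def indicator_def)
      show "(\<lambda>x. norm (I x) * norm (u x)) \<in> borel_measurable lebesgue"
        by (rule borel_measurable_integrable[OF L2_product_integrable[OF IL D(1)]])
    qed (use ui in auto)
    then have l1: "(LINT x|lebesgue. \<bar>u x\<bar>)\<^sup>2 \<le> sqn I * sqn u" using L2_Cauchy_Schwarz[OF IL D(1)] by simp
    have fb: "(norm (FI u \<xi>))\<^sup>2 \<le> A * sqn u" for \<xi>
    proof -
      have "(norm (FI u \<xi>))\<^sup>2 \<le> ((2 * pi) powr (- real CARD('n) / 2) * (LINT x|lebesgue. \<bar>u x\<bar>))\<^sup>2"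
        by (intro power_mono norm_FI_le) simp
      also have "\<dots> \<le> ((2 * pi) powr (- real CARD('n) / 2))\<^sup>2 * (sqn I * sqn u)"
        unfolding power_mult_distrib by (intro mult_left_mono l1) simp
      finally show ?thesis by (simp add: A_def mult.assoc)
    qed
    have h: "integrable lebesgue (\<lambda>\<xi>. norm \<xi> powr (2 * s) * (norm (fourier u \<xi>))\<^sup>2)"
      using D(3) by (simp add: hom_integrable_def)
    have ci: "integrable lebesgue (\<lambda>\<xi>. (A * sqn u) * indicator (cball (0 :: real ^ 'n) r) \<xi>)"
      by (intro integrable_mult_right integrable_real_indicator cball_in_lebesgue) (use emeasure_bounded_finite[OF bounded_cball] in auto)
    have pt: "AE \<xi> in lebesgue. (norm (fourier u \<xi>))\<^sup>2 \<le> (A * sqn u) * indicator (cball 0 r) \<xi> + r powr (- 2 * s) * (norm \<xi> powr (2 * s) * (norm (fourier u \<xi>))\<^sup>2)"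
      using v
    proof eventually_elim
      case (elim \<xi>)
      show ?case
      proof (cases "norm \<xi> \<le> r")
        case True
        then show ?thesis using fb[of \<xi>] elim by (simp add: add_increasing2)
      next
        case False
        then have "r powr (2 * s) \<le> norm \<xi> powr (2 * s)" using s r by (intro powr_mono2) auto
        then have "1 \<le> r powr (- 2 * s) * norm \<xi> powr (2 * s)" using r by (simp add: powr_minus field_simps)
        from mult_right_mono[OF this, of "(norm (fourier u \<xi>))\<^sup>2"] show ?thesis using False by (simp add: mult.assoc)
      qed
    qed
    have "sqn u = sqn (fourier u)" using has_fourier_sqn[OF D(2)] by simp
    also have "\<dots> \<le> (LINT \<xi>|lebesgue. (A * sqn u) * indicator (cball 0 r) \<xi> + r powr (- 2 * s) * (norm \<xi> powr (2 * s) * (norm (fourier u \<xi>))\<^sup>2))"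
      unfolding sqn_def[of "fourier u"]
      by (rule integral_mono_AE[OF L2_integrable[OF has_fourier_L2(2)[OF D(2)]] _ pt]) (use ci h in simp)
    also have "\<dots> = (A * sqn u) * measure lebesgue (cball (0 :: real ^ 'n) r) + r powr (- 2 * s) * energy s u u"
      using ci h by (simp add: energy_def hom_form_self)
    also have "\<dots> = (A * (V * r ^ CARD('n))) * sqn u + r powr (- 2 * s) * energy s u u" unfolding meas by simp
    also have "\<dots> \<le> 1 / 2 * sqn u + r powr (- 2 * s) * energy s u u" by (intro add_right_mono mult_right_mono vol) simp
    finally show "sqn u \<le> C * energy s u u" by (simp add: C_def)
  qed
qed

text \<open>By the Poincare inequality the sequence converges in \<open>L2\<close>. The transforms with the weight of the energy
  converge as well, and the two limits are identified along a subsequence that converges almost everywhere.\<close>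
lemma sobolev0_complete:
  fixes U :: "(real ^ 'n) set"
  assumes U: "bounded U" and s: "0 < s" and f: "\<And>k::nat. f k \<in> sobolev0 s U"
    and cauchy: "\<And>e. e > 0 \<Longrightarrow> \<exists>K. \<forall>k\<ge>K. \<forall>l\<ge>K. energy s (\<lambda>x. f k x - f l x) (\<lambda>x. f k x - f l x) < e"
  obtains u where "u \<in> sobolev s" "(\<lambda>k. sqn (\<lambda>x. f k x - u x)) \<longlonglongrightarrow> 0"
    "(\<lambda>k. energy s (\<lambda>x. f k x - u x) (\<lambda>x. f k x - u x)) \<longlonglongrightarrow> 0"
proof -
  obtain C where C: "C > 0" "\<And>u. u \<in> sobolev0 s U \<Longrightarrow> sqn u \<le> C * energy s u u" using poincare[OF U s] by blast
  note D = sobolevD[OF sobolev0D(1)[OF f] s]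
  have "\<exists>u\<in>L2. (\<lambda>k. sqn (\<lambda>x. f k x - u x)) \<longlonglongrightarrow> 0"
  proof (rule L2_complete[OF D(1)])
    fix e :: real assume "e > 0"
    then obtain K where K: "\<And>k l. k \<ge> K \<Longrightarrow> l \<ge> K \<Longrightarrow> energy s (\<lambda>x. f k x - f l x) (\<lambda>x. f k x - f l x) < e / C"
      using cauchy[of "e / C"] C(1) by auto
    have "sqn (\<lambda>x. f k x - f l x) < e" if "k \<ge> K" "l \<ge> K" for k l
      using C(2)[OF sobolev0_diff[OF f f s], of k l] mult_strict_left_mono[OF K[OF that] C(1)] C(1) by simp
    then show "\<exists>K. \<forall>k\<ge>K. \<forall>l\<ge>K. sqn (\<lambda>x. f k x - f l x) < e" by blast
  qed
  then obtain u where u: "u \<in> L2" "(\<lambda>k. sqn (\<lambda>x. f k x - u x)) \<longlonglongrightarrow> 0" by blast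
  note F = has_fourier_fourier[OF u(1)]
  define W where "W q \<xi> = complex_of_real (norm \<xi> powr s) * q \<xi>" for q and \<xi> :: "real ^ 'n"
  have Wn: "(norm (W q \<xi>))\<^sup>2 = norm \<xi> powr (2 * s) * (norm (q \<xi>))\<^sup>2" for q \<xi>
  proof -
    have "(norm \<xi> powr s)\<^sup>2 = norm \<xi> powr (2 * s)" by (simp add: power2_eq_square powr_add[symmetric])
    then show ?thesis by (simp add: W_def norm_mult power_mult_distrib)
  qed
  have Wm: "W q \<in> borel_measurable lebesgue" if "q \<in> L2" for q
  proof -
    have [measurable]: "q \<in> borel_measurable lebesgue" by (rule L2_measurable[OF that])
    show ?thesis unfolding W_def[abs_def] by measurable
  qed
  have WL: "W q \<in> L2 \<longleftrightarrow> hom_integrable s q" if "q \<in> L2" for q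
    using Wm[OF that] that unfolding L2_def hom_integrable_def by (simp add: Wn L2_def)
  have Ws: "sqn (W q) = hom_form s q q" for q unfolding sqn_def Wn hom_form_self ..
  have Wd: "(\<lambda>\<xi>. W q \<xi> - W p \<xi>) = W (\<lambda>\<xi>. q \<xi> - p \<xi>)" for q p by (auto simp: W_def right_diff_distrib)
  have We: "sqn (\<lambda>\<xi>. W (fourier (f k)) \<xi> - W (fourier (f l)) \<xi>) = energy s (\<lambda>x. f k x - f l x) (\<lambda>x. f k x - f l x)" for k l
    unfolding Wd Ws using has_fourier_diff[OF D(2) D(2)] by (intro energy_eq[symmetric])
  have WkL: "W (fourier (f k)) \<in> L2" for k using WL D(3) has_fourier_L2(2)[OF D(2)] by blast
  have "\<exists>w\<in>L2. (\<lambda>k. sqn (\<lambda>\<xi>. W (fourier (f k)) \<xi> - w \<xi>)) \<longlonglongrightarrow> 0"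
    by (rule L2_complete[OF WkL]) (unfold We, rule cauchy)
  then obtain w where w: "w \<in> L2" "(\<lambda>k. sqn (\<lambda>\<xi>. W (fourier (f k)) \<xi> - w \<xi>)) \<longlonglongrightarrow> 0" by blast
  have fl: "(\<lambda>k. sqn (\<lambda>\<xi>. fourier (f k) \<xi> - fourier u \<xi>)) \<longlonglongrightarrow> 0"
    using u(2) has_fourier_sqn_diff[of f, OF D(2) F] by simp
  from L2_convergence_AE_subseq[OF has_fourier_L2(2)[OF D(2)] has_fourier_L2(2)[OF F] fl]
  obtain r :: "nat \<Rightarrow> nat" where r: "strict_mono r" "AE \<xi> in lebesgue. (\<lambda>k. fourier (f (r k)) \<xi>) \<longlonglongrightarrow> fourier u \<xi>" by blast
  have "(\<lambda>k. sqn (\<lambda>\<xi>. W (fourier (f (r k))) \<xi> - w \<xi>)) \<longlonglongrightarrow> 0"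
    using LIMSEQ_subseq_LIMSEQ[OF w(2) r(1)] by (simp add: o_def)
  from L2_convergence_AE_subseq[OF WkL w(1) this]
  obtain r' :: "nat \<Rightarrow> nat" where r': "strict_mono r'" "AE \<xi> in lebesgue. (\<lambda>k. W (fourier (f (r (r' k)))) \<xi>) \<longlonglongrightarrow> w \<xi>" by blast
  have ae: "AE \<xi> in lebesgue. w \<xi> = W (fourier u) \<xi>"
    using r(2) r'(2)
  proof eventually_elim
    case (elim \<xi>)
    have "(\<lambda>k. fourier (f (r (r' k))) \<xi>) \<longlonglongrightarrow> fourier u \<xi>" using LIMSEQ_subseq_LIMSEQ[OF elim(1) r'(1)] by (simp add: o_def)
    then have "(\<lambda>k. W (fourier (f (r (r' k)))) \<xi>) \<longlonglongrightarrow> W (fourier u) \<xi>" unfolding W_def by (intro tendsto_intros)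
    then show ?case by (rule LIMSEQ_unique[OF elim(2)])
  qed
  have WuL: "W (fourier u) \<in> L2" by (rule L2_cong_AE(1)[OF w(1) ae])
  then have hu: "hom_integrable s (fourier u)" using WL has_fourier_L2(2)[OF F] by blast
  have us: "u \<in> sobolev s" using F hu sobolev_iff[OF s] by blast
  have "energy s (\<lambda>x. f k x - u x) (\<lambda>x. f k x - u x) = sqn (\<lambda>\<xi>. W (fourier (f k)) \<xi> - w \<xi>)" for k
  proof -
    have d: "has_fourier (\<lambda>x. f k x - u x) (\<lambda>\<xi>. fourier (f k) \<xi> - fourier u \<xi>)" by (rule has_fourier_diff[OF D(2) F])
    have "energy s (\<lambda>x. f k x - u x) (\<lambda>x. f k x - u x) = sqn (\<lambda>\<xi>. W (fourier (f k)) \<xi> - W (fourier u) \<xi>)"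
      unfolding Wd Ws by (rule energy_eq[OF d d])
    also have "\<dots> = sqn (\<lambda>\<xi>. W (fourier (f k)) \<xi> - w \<xi>)"
      by (rule L2_cong_AE(2)[OF L2_diff[OF WkL w(1)]]) (use ae in eventually_elim, simp)
    finally show ?thesis .
  qed
  then show thesis using that[OF us u(2)] w(2) by simp
qed

lemma L2_limit_zero_outside:
  assumes f: "\<And>k::nat. f k \<in> L2" "u \<in> L2" "(\<lambda>k. sqn (\<lambda>x. f k x - u x)) \<longlonglongrightarrow> 0"
    and z: "\<And>k. k \<ge> n \<Longrightarrow> AE x in lebesgue. x \<notin> U \<longrightarrow> f k x = 0"
  shows "AE x in lebesgue. x \<notin> U \<longrightarrow> u x = 0"
proof -
  obtain r :: "nat \<Rightarrow> nat" where r: "strict_mono r" "AE x in lebesgue. (\<lambda>k. f (r k) x) \<longlonglongrightarrow> u x"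
    using L2_convergence_AE_subseq[OF f] by blast
  have "AE x in lebesgue. \<forall>k. k \<ge> n \<longrightarrow> x \<notin> U \<longrightarrow> f k x = 0"
    using z by (auto simp: AE_all_countable)
  then show ?thesis using r(2)
  proof eventually_elim
    case (elim x)
    show ?case
    proof
      assume x: "x \<notin> U"
      have "f (r k) x = 0" if "k \<ge> n" for k
        using elim(1) x that seq_suble[OF r(1), of k] by auto
      then have "(\<lambda>k. f (r k) x) \<longlonglongrightarrow> 0" by (intro tendsto_eventually) (auto simp: eventually_sequentially)
      then show "u x = 0" by (rule LIMSEQ_unique[OF elim(2)])
    qed
  qed
qed

lemma L2_limit_nonneg:
  fixes u :: "real ^ 'n \<Rightarrow> real"
  assumes f: "\<And>k::nat. f k \<in> L2" "u \<in> L2" "(\<lambda>k. sqn (\<lambda>x. f k x - u x)) \<longlonglongrightarrow> 0"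
    and z: "\<And>k. AE x in lebesgue. 0 \<le> f k x"
  shows "AE x in lebesgue. 0 \<le> u x"
proof -
  obtain r :: "nat \<Rightarrow> nat" where r: "strict_mono r" "AE x in lebesgue. (\<lambda>k. f (r k) x) \<longlonglongrightarrow> u x"
    using L2_convergence_AE_subseq[OF f] by blast
  have "AE x in lebesgue. \<forall>k. 0 \<le> f k x" using z by (simp add: AE_all_countable)
  then show ?thesis using r(2)
  proof eventually_elim
    case (elim x)
    show ?case by (rule LIMSEQ_le_const[OF elim(2)]) (use elim(1) in auto)
  qed
qed

text \<open>The solution minimises \<open>energy s u u / 2 - (LINT x|lebesgue. f x * u x)\<close>; a minimising
  sequence is a Cauchy sequence by the parallelogram law.\<close>
theorem energy_solution_exists:
  fixes U :: "(real ^ 'n) set" and f :: "real ^ 'n \<Rightarrow> real"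
  assumes U: "bounded U" and s: "0 < s" and f: "f \<in> L2"
  obtains u where "u \<in> sobolev0 s U" "\<And>\<phi>. \<phi> \<in> sobolev0 s U \<Longrightarrow> energy s u \<phi> = (LINT x|lebesgue. f x * \<phi> x)"
proof -
  define H where "H = sobolev0 s U"
  define l where "l u = (LINT x|lebesgue. f x * u x)" for u
  define J where "J u = energy s u u / 2 - l u" for u
  have HL: "u \<in> L2" if "u \<in> H" for u using that sobolevD(1)[OF sobolev0D(1) s] unfolding H_def by blast
  have HS: "u \<in> sobolev s" if "u \<in> H" for u using that sobolev0D(1) unfolding H_def by blast
  have lin: "(\<lambda>x. a * u x + b * w x) \<in> H" if "u \<in> H" "w \<in> H" for a b u w
    using sobolev0_linear[of u s U w] that s unfolding H_def by blast
  have l_lin: "l (\<lambda>x. a * u x + b * w x) = a * l u + b * l w" if "u \<in> H" "w \<in> H" for a b u w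
  proof -
    have "l (\<lambda>x. a * u x + b * w x) = (LINT x|lebesgue. a * (f x * u x) + b * (f x * w x))"
      unfolding l_def by (simp add: algebra_simps)
    then show ?thesis unfolding l_def
      using L2_real_product_integrable[OF f HL[OF that(1)]] L2_real_product_integrable[OF f HL[OF that(2)]] by simp
  qed
  obtain C where C: "C > 0" "\<And>u. u \<in> H \<Longrightarrow> sqn u \<le> C * energy s u u" using poincare[OF U s] unfolding H_def by blast
  have bdd: "- (C * sqn f) / 2 \<le> J u" if "u \<in> H" for u
  proof -
    have "(l u)\<^sup>2 \<le> sqn f * sqn u" unfolding l_def by (rule L2_real_Cauchy_Schwarz[OF f HL[OF that]])
    also have "\<dots> \<le> sqn f * (C * energy s u u)" by (intro mult_left_mono C that) simp
    also have "\<dots> \<le> ((C * sqn f + energy s u u) / 2)\<^sup>2"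
      using sum_squares_bound[of "C * sqn f" "energy s u u"] by (simp add: power2_eq_square field_simps)
    finally have "\<bar>l u\<bar> \<le> \<bar>(C * sqn f + energy s u u) / 2\<bar>" by (simp only: abs_le_square_iff)
    also have "\<dots> = (C * sqn f + energy s u u) / 2" using C(1) energy_nonneg[of s u] by simp
    finally show ?thesis unfolding J_def by (simp add: field_simps)
  qed
  have H0: "(\<lambda>x. 0) \<in> H" using sobolev_zero[OF s] by (simp add: H_def sobolev0_def)
  define d where "d = Inf (J ` H)"
  have bb: "bdd_below (J ` H)" using bdd by (intro bdd_belowI2[of _ "- (C * sqn f) / 2"]) auto
  have dle: "d \<le> J u" if "u \<in> H" for u unfolding d_def using bb that by (intro cInf_lower) auto
  have "\<exists>u\<in>H. J u < d + inverse (real (Suc k))" for k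
  proof -
    have "Inf (J ` H) < d + inverse (real (Suc k))" unfolding d_def by simp
    then show ?thesis using cInf_lessD[of "J ` H"] H0 by blast
  qed
  then obtain g where g: "\<And>k. g k \<in> H" "\<And>k. J (g k) < d + inverse (real (Suc k))" by metis
  \<comment> \<open>The parallelogram law, with the midpoint as a competitor.\<close>
  have par: "energy s (\<lambda>x. u x - w x) (\<lambda>x. u x - w x) \<le> 4 * (J u - d) + 4 * (J w - d)" if "u \<in> H" "w \<in> H" for u w
  proof -
    have "J (\<lambda>x. (1/2) * u x + (1/2) * w x) = (energy s u u + 2 * energy s u w + energy s w w) / 8 - (l u + l w) / 2"
      unfolding J_def l_lin[OF that] energy_quadratic[OF HS[OF that(1)] HS[OF that(2)] s] by (simp add: power2_eq_square field_simps)
    then have "energy s (\<lambda>x. u x - w x) (\<lambda>x. u x - w x) = 4 * J u + 4 * J w - 8 * J (\<lambda>x. (1/2) * u x + (1/2) * w x)"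
      unfolding energy_diff[OF HS[OF that(1)] HS[OF that(2)] s] by (simp add: J_def field_simps)
    then show ?thesis using dle[OF lin[OF that, of "1/2" "1/2"]] by simp
  qed
  have cau: "\<exists>K. \<forall>k\<ge>K. \<forall>l\<ge>K. energy s (\<lambda>x. g k x - g l x) (\<lambda>x. g k x - g l x) < e" if "e > 0" for e
  proof -
    obtain K where K: "inverse (real (Suc K)) < e / 8" using reals_Archimedean[of "e / 8"] \<open>e > 0\<close> by auto
    have Jk: "J (g k) - d < e / 8" if "k \<ge> K" for k
    proof -
      have "inverse (real (Suc k)) \<le> inverse (real (Suc K))" using that by (simp add: field_simps)
      then show ?thesis using g(2)[of k] K by linarith
    qed
    have "energy s (\<lambda>x. g k x - g l x) (\<lambda>x. g k x - g l x) < e" if "k \<ge> K" "l \<ge> K" for k l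
    proof -
      have "a < e" if "a \<le> 4 * b + 4 * c" "b < e / 8" "c < e / 8" for a b c using that by linarith
      from this[OF par[OF g(1) g(1)] Jk[OF that(1)] Jk[OF that(2)]] show ?thesis .
    qed
    then show ?thesis by blast
  qed
  obtain u where u: "u \<in> sobolev s" "(\<lambda>k. sqn (\<lambda>x. g k x - u x)) \<longlonglongrightarrow> 0"
    "(\<lambda>k. energy s (\<lambda>x. g k x - u x) (\<lambda>x. g k x - u x)) \<longlonglongrightarrow> 0"
    using sobolev0_complete[OF U s, of g, OF g(1)[unfolded H_def] cau] by blast
  have uL: "u \<in> L2" by (rule sobolevD(1)[OF u(1) s])
  have uz: "AE x in lebesgue. x \<notin> U \<longrightarrow> u x = 0"
    by (rule L2_limit_zero_outside[OF HL[OF g(1)] uL u(2)]) (use g(1) sobolev0D(2) H_def in blast)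
  have uH: "u \<in> H" using u(1) uz by (simp add: H_def sobolev0_def)
  have "(\<lambda>k. J (g k)) \<longlonglongrightarrow> J u"
  proof -
    have "(\<lambda>k. l (g k)) \<longlonglongrightarrow> l u"
      using L2_inner_tendsto[OF HL[OF g(1)] uL f u(2)] unfolding l_def by (simp add: mult.commute)
    then show ?thesis unfolding J_def by (intro tendsto_intros energy_tendsto(2)[OF HS[OF g(1)] u(1) s u(3)]) simp_all
  qed
  moreover have "(\<lambda>k. d + inverse (real (Suc k))) \<longlonglongrightarrow> d + 0" by (intro tendsto_intros LIMSEQ_inverse_real_of_nat)
  ultimately have "J u \<le> d + 0" by (rule LIMSEQ_le) (use g(2) less_imp_le in blast)
  then have min: "J u \<le> J w" if "w \<in> H" for w using dle[OF that] by linarith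
  have "energy s u \<phi> = l \<phi>" if \<phi>: "\<phi> \<in> H" for \<phi>
  proof -
    \<comment> \<open>The first variation vanishes, read off from a quadratic in \<open>t\<close> that is nonnegative and vanishes at \<open>0\<close>.\<close>
    have "(energy s u \<phi> - l \<phi>)\<^sup>2 \<le> 0 * energy s \<phi> \<phi>"
    proof (rule quadratic_nonneg_imp_discriminant)
      fix t
      have "J u \<le> J (\<lambda>x. 1 * u x + t * \<phi> x)" by (rule min[OF lin[OF uH \<phi>]])
      then show "0 \<le> 0 + 2 * t * (energy s u \<phi> - l \<phi>) + t\<^sup>2 * energy s \<phi> \<phi>"
        unfolding J_def l_lin[OF uH \<phi>] energy_quadratic[OF u(1) HS[OF \<phi>] s] by (simp add: algebra_simps)
    qed (rule energy_nonneg)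
    then show ?thesis by simp
  qed
  then show thesis using that uH unfolding H_def l_def by blast
qed

text \<open>For nested domains the energies of the solutions decrease, and the energy of the difference of
  two solutions is the difference of their energies. So the solutions converge to the solution
  for the intersection.\<close>
theorem energy_solutions_decreasing_domains:
  fixes U :: "nat \<Rightarrow> (real ^ 'n) set" and f :: "real ^ 'n \<Rightarrow> real"
  assumes U: "bounded (U 0)" "\<And>n. U (Suc n) \<subseteq> U n" and s: "0 < s" and f: "f \<in> L2"
    and u: "\<And>n. u n \<in> sobolev0 s (U n)" "\<And>n \<phi>. \<phi> \<in> sobolev0 s (U n) \<Longrightarrow> energy s (u n) \<phi> = (LINT x|lebesgue. f x * \<phi> x)"
  obtains w where "w \<in> sobolev s" "\<And>n. AE x in lebesgue. x \<notin> U n \<longrightarrow> w x = 0" "(\<lambda>n. sqn (\<lambda>x. u n x - w x)) \<longlonglongrightarrow> 0"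
    "\<And>\<phi>. (\<And>n. \<phi> \<in> sobolev0 s (U n)) \<Longrightarrow> energy s w \<phi> = (LINT x|lebesgue. f x * \<phi> x)"
proof -
  have mono: "U p \<subseteq> U n" if "n \<le> p" for n p using lift_Suc_antimono_le[of U, OF U(2) that] .
  have sub: "q \<in> sobolev0 s (U n)" if "q \<in> sobolev0 s (U p)" "n \<le> p" for q n p
  proof -
    have "AE x in lebesgue. x \<notin> U n \<longrightarrow> q x = 0"
      using sobolev0D(2)[OF that(1)] mono[OF that(2)] by (auto elim!: eventually_mono)
    then show ?thesis using sobolev0D(1)[OF that(1)] by (simp add: sobolev0_def)
  qed
  have us: "u n \<in> sobolev s" for n by (rule sobolev0D(1)[OF u(1)])
  note D = sobolevD[OF us s]
  have diff: "energy s (\<lambda>x. u n x - u p x) (\<lambda>x. u n x - u p x) = energy s (u n) (u n) - energy s (u p) (u p)" if "n \<le> p" for n p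
    using u(2)[OF sub[OF u(1) that]] u(2)[OF u(1), of p] unfolding energy_diff[OF us us s] by simp
  have dec: "decseq (\<lambda>n. energy s (u n) (u n))"
    unfolding decseq_def using diff energy_nonneg by (metis diff_ge_0_iff_ge)
  have "convergent (\<lambda>n. energy s (u n) (u n))"
    by (rule Bseq_monoseq_convergent) (use dec energy_nonneg in \<open>auto simp: decseq_def intro!: decseq_imp_monoseq decseq_bounded[of _ 0]\<close>)
  then have "Cauchy (\<lambda>n. energy s (u n) (u n))" by (rule convergent_Cauchy)
  then have cau: "\<exists>K. \<forall>k\<ge>K. \<forall>l\<ge>K. energy s (\<lambda>x. u k x - u l x) (\<lambda>x. u k x - u l x) < e" if "e > 0" for e
  proof -
    assume "Cauchy (\<lambda>n. energy s (u n) (u n))"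
    then obtain K where K: "\<And>k l. k \<ge> K \<Longrightarrow> l \<ge> K \<Longrightarrow> \<bar>energy s (u k) (u k) - energy s (u l) (u l)\<bar> < e"
      using \<open>e > 0\<close> unfolding Cauchy_def dist_real_def by blast
    have "energy s (\<lambda>x. u k x - u l x) (\<lambda>x. u k x - u l x) < e" if "k \<ge> K" "l \<ge> K" for k l
    proof (cases "k \<le> l")
      case True
      then show ?thesis using diff[OF True] K[OF that] by linarith
    next
      case False
      have "energy s (\<lambda>x. u k x - u l x) (\<lambda>x. u k x - u l x) = energy s (\<lambda>x. u l x - u k x) (\<lambda>x. u l x - u k x)"
        unfolding energy_diff[OF us us s] by (simp add: energy_commute)
      then show ?thesis using diff[of l k] False K[OF that] by linarith
    qed
    then show ?thesis by blast
  qed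
  obtain w where w: "w \<in> sobolev s" "(\<lambda>n. sqn (\<lambda>x. u n x - w x)) \<longlonglongrightarrow> 0"
    "(\<lambda>n. energy s (\<lambda>x. u n x - w x) (\<lambda>x. u n x - w x)) \<longlonglongrightarrow> 0"
    using sobolev0_complete[OF U(1) s, of u, OF sub[OF u(1)] cau] by blast
  have 1: "AE x in lebesgue. x \<notin> U n \<longrightarrow> w x = 0" for n
    by (rule L2_limit_zero_outside[OF D(1) sobolevD(1)[OF w(1) s] w(2), of n]) (rule sobolev0D(2)[OF sub[OF u(1)]])
  have 2: "energy s w \<phi> = (LINT x|lebesgue. f x * \<phi> x)" if \<phi>: "\<And>n. \<phi> \<in> sobolev0 s (U n)" for \<phi>
    using LIMSEQ_unique[OF energy_tendsto(1)[OF us w(1) s w(3) sobolev0D(1)[OF \<phi>], unfolded u(2)[OF \<phi>]] tendsto_const] .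
  show thesis by (rule that[OF w(1) 1 w(2) 2])
qed

section \<open>Positivity of finite differences of powers\<close>

primrec fwd_diff :: "nat \<Rightarrow> (real \<Rightarrow> real) \<Rightarrow> real \<Rightarrow> real" where
  "fwd_diff 0 f = f"
| "fwd_diff (Suc k) f = (\<lambda>x. fwd_diff k f (x + 1) - fwd_diff k f x)"

lemma fwd_diff_cmult: "fwd_diff k (\<lambda>y. c * f y) x = c * fwd_diff k f x"
  by (induction k arbitrary: x) (auto simp: right_diff_distrib)

lemma fwd_diff_DERIV:
  assumes "\<And>y. y > 0 \<Longrightarrow> (f has_real_derivative f' y) (at y)" "y > 0"
  shows "(fwd_diff k f has_real_derivative fwd_diff k f' y) (at y)"
  using assms(2)
proof (induction k arbitrary: y)
  case (Suc k)
  have "(fwd_diff k f has_real_derivative fwd_diff k f' (y + 1)) (at (y + 1))" using Suc by simp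
  then have "((\<lambda>x. fwd_diff k f (x + 1)) has_real_derivative fwd_diff k f' (y + 1)) (at y)"
    by (simp add: DERIV_shift)
  then show ?case using Suc.IH[OF Suc.prems] by (auto intro!: DERIV_diff)
qed (use assms in auto)

lemma fwd_diff_continuous: "continuous_on {0..} f \<Longrightarrow> continuous_on {0..} (fwd_diff k f)"
proof (induction k)
  case (Suc k)
  then have c: "continuous_on {0..} (fwd_diff k f)" by simp
  have "continuous_on {0..} (\<lambda>x. fwd_diff k f (x + 1))"
    by (rule continuous_on_compose2[OF c]) (auto intro!: continuous_intros)
  then show ?case using c by (auto intro!: continuous_on_diff)
qed simp

lemma fwd_diff_abs_le:
  assumes "\<And>j. j \<le> k \<Longrightarrow> \<bar>g (x + real j)\<bar> \<le> B"
  shows "\<bar>fwd_diff k g x\<bar> \<le> 2 ^ k * B"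
  using assms
proof (induction k arbitrary: x)
  case (Suc k)
  have "\<bar>fwd_diff k g (x + 1)\<bar> \<le> 2 ^ k * B"
  proof (rule Suc.IH)
    fix j assume "j \<le> k"
    then show "\<bar>g (x + 1 + real j)\<bar> \<le> B" using Suc.prems[of "Suc j"] by (simp add: add_ac)
  qed
  moreover have "\<bar>fwd_diff k g x\<bar> \<le> 2 ^ k * B" by (rule Suc.IH) (use Suc.prems in simp)
  ultimately show ?case by simp
qed (use assms[of 0] in simp)

text \<open>By the mean value theorem one difference is a derivative at an interior point, which lowers the
  exponent and the order. The point \<open>x = 0\<close> is included because the derivative is taken inside.\<close>
lemma fwd_diff_powr_step:
  assumes IH: "\<And>y. y > 0 \<Longrightarrow> fwd_diff k (\<lambda>y. y powr (s - 1)) y > 0" and s: "s > 0" and x: "x \<ge> 0"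
  shows "fwd_diff (Suc k) (\<lambda>y. y powr s) x > 0"
proof -
  have d: "((\<lambda>y. y powr s) has_real_derivative s * y powr (s - 1)) (at y)" if "y > 0" for y
    using has_real_derivative_powr[OF that] .
  note D = fwd_diff_DERIV[OF d, of _ k]
  have c: "continuous_on {0..} (\<lambda>y::real. y powr s)"
    using s by (intro continuous_on_powr' continuous_intros) auto
  have c': "continuous_on {x..x + 1} (fwd_diff k (\<lambda>y. y powr s))"
    by (rule continuous_on_subset[OF fwd_diff_continuous[OF c]]) (use x in auto)
  obtain l z where z: "x < z" "z < x + 1" "(fwd_diff k (\<lambda>y. y powr s) has_real_derivative l) (at z)"
      "fwd_diff k (\<lambda>y. y powr s) (x + 1) - fwd_diff k (\<lambda>y. y powr s) x = (x + 1 - x) * l"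
    using MVT[of x "x + 1" "fwd_diff k (\<lambda>y. y powr s)", OF _ c'] D x real_differentiable_def
    by (smt (verit))
  have "l = fwd_diff k (\<lambda>y. s * y powr (s - 1)) z" using DERIV_unique[OF z(3) D] x z(1) by simp
  also have "\<dots> = s * fwd_diff k (\<lambda>y. y powr (s - 1)) z" by (rule fwd_diff_cmult)
  also have "\<dots> > 0" using s IH[of z] x z(1) by simp
  finally show ?thesis using z(4) by simp
qed

lemma fwd_diff_powr_pos:
  assumes "real k < s + 1" "x > 0"
  shows "fwd_diff k (\<lambda>y. y powr s) x > 0"
  using assms
proof (induction k arbitrary: s x)
  case (Suc k)
  show ?case by (rule fwd_diff_powr_step) (use Suc in auto)
qed auto

lemma fwd_diff_powr_pos_0:
  assumes "0 < k" "real k < s + 1"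
  shows "fwd_diff k (\<lambda>y. y powr s) 0 > 0"
proof (cases k)
  case (Suc j)
  show ?thesis unfolding Suc by (rule fwd_diff_powr_step[OF fwd_diff_powr_pos]) (use assms Suc in auto)
qed (use assms in simp)

section \<open>Energies as Mellin transforms of heat pairings\<close>

text \<open>Up to the sign an \<open>M\<close>-th difference in time of the heat pairing, written with its Fourier multiplier.\<close>
definition heat_diff :: "nat \<Rightarrow> (real ^ 'n \<Rightarrow> complex) \<Rightarrow> (real ^ 'n \<Rightarrow> complex) \<Rightarrow> real \<Rightarrow> real" where
  "heat_diff M v w t = (LINT \<xi>|lebesgue. (1 - exp (- (t * (norm \<xi>)\<^sup>2))) ^ M * Re (v \<xi> * cnj (w \<xi>)))"

lemma heat_factor_measurable [measurable]: "(\<lambda>\<xi> :: real ^ 'n. exp (- (t * (norm \<xi>)\<^sup>2))) \<in> borel_measurable lebesgue"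
  by (intro measurable_completion) measurable

lemma heat_multiplier_integrable:
  fixes v w :: "real ^ 'n \<Rightarrow> complex"
  assumes v: "v \<in> L2" and w: "w \<in> L2" and a: "0 \<le> a" and t: "0 \<le> t"
  shows "integrable lebesgue (\<lambda>\<xi>. exp (- (a * t * (norm \<xi>)\<^sup>2)) * (1 - exp (- (t * (norm \<xi>)\<^sup>2))) ^ k * Re (v \<xi> * cnj (w \<xi>)))"
proof (rule Bochner_Integration.integrable_bound[OF L2_Re_product_integrable[OF v w]])
  have [measurable]: "v \<in> borel_measurable lebesgue" "w \<in> borel_measurable lebesgue" using v w L2_measurable by auto
  show "(\<lambda>\<xi>. exp (- (a * t * (norm \<xi>)\<^sup>2)) * (1 - exp (- (t * (norm \<xi>)\<^sup>2))) ^ k * Re (v \<xi> * cnj (w \<xi>))) \<in> borel_measurable lebesgue"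
    by measurable
  show "AE \<xi> in lebesgue. norm (exp (- (a * t * (norm \<xi>)\<^sup>2)) * (1 - exp (- (t * (norm \<xi>)\<^sup>2))) ^ k * Re (v \<xi> * cnj (w \<xi>))) \<le> norm (Re (v \<xi> * cnj (w \<xi>)))"
  proof (rule AE_I2)
    fix \<xi> :: "real ^ 'n"
    have 1: "0 \<le> exp (- (a * t * (norm \<xi>)\<^sup>2))" "exp (- (a * t * (norm \<xi>)\<^sup>2)) \<le> 1" using a t by auto
    have 2: "0 \<le> (1 - exp (- (t * (norm \<xi>)\<^sup>2))) ^ k" "(1 - exp (- (t * (norm \<xi>)\<^sup>2))) ^ k \<le> 1"
      using t by (auto intro!: power_le_one)
    have "\<bar>exp (- (a * t * (norm \<xi>)\<^sup>2)) * (1 - exp (- (t * (norm \<xi>)\<^sup>2))) ^ k\<bar> \<le> 1"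
      using 1 2 by (simp add: abs_mult mult_le_one)
    from mult_right_mono[OF this, of "\<bar>Re (v \<xi> * cnj (w \<xi>))\<bar>"]
    show "norm (exp (- (a * t * (norm \<xi>)\<^sup>2)) * (1 - exp (- (t * (norm \<xi>)\<^sup>2))) ^ k * Re (v \<xi> * cnj (w \<xi>))) \<le> norm (Re (v \<xi> * cnj (w \<xi>)))"
      by (simp add: abs_mult del: times_complex.sel)
  qed
qed

text \<open>Multiplication by \<open>1 - exp (- (t * (norm \<xi>)\<^sup>2))\<close> is minus the unit forward difference in the
  parameter \<open>a\<close> of \<open>exp (- (a * t * (norm \<xi>)\<^sup>2))\<close>.\<close>
lemma heat_diff_eq_fwd_diff:
  fixes v w :: "real ^ 'n \<Rightarrow> complex"
  assumes v: "v \<in> L2" and w: "w \<in> L2" and t: "0 \<le> t"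
  shows "heat_diff M v w t = (- 1) ^ M * fwd_diff M (\<lambda>a. heat_pairing v w (a * t)) 0"
proof -
  have "(LINT \<xi>|lebesgue. exp (- (a * t * (norm \<xi>)\<^sup>2)) * (1 - exp (- (t * (norm \<xi>)\<^sup>2))) ^ k * Re (v \<xi> * cnj (w \<xi>))) =
     (- 1) ^ k * fwd_diff k (\<lambda>a. heat_pairing v w (a * t)) a" if "0 \<le> a" for a k
    using that
  proof (induction k arbitrary: a)
    case 0
    then show ?case by (simp add: heat_pairing_def)
  next
    case (Suc k)
    have "exp (- ((a + 1) * t * (norm \<xi>)\<^sup>2)) = exp (- (a * t * (norm \<xi>)\<^sup>2)) * exp (- (t * (norm \<xi>)\<^sup>2))" for \<xi> :: "real ^ 'n"
      unfolding exp_add[symmetric] by (simp add: algebra_simps)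
    then have "(LINT \<xi>|lebesgue. exp (- (a * t * (norm \<xi>)\<^sup>2)) * (1 - exp (- (t * (norm \<xi>)\<^sup>2))) ^ Suc k * Re (v \<xi> * cnj (w \<xi>))) =
      (LINT \<xi>|lebesgue. exp (- (a * t * (norm \<xi>)\<^sup>2)) * (1 - exp (- (t * (norm \<xi>)\<^sup>2))) ^ k * Re (v \<xi> * cnj (w \<xi>)) -
         exp (- ((a + 1) * t * (norm \<xi>)\<^sup>2)) * (1 - exp (- (t * (norm \<xi>)\<^sup>2))) ^ k * Re (v \<xi> * cnj (w \<xi>)))"
      by (intro Bochner_Integration.integral_cong refl) (simp add: algebra_simps del: times_complex.sel)
    also have "\<dots> = (- 1) ^ k * fwd_diff k (\<lambda>a. heat_pairing v w (a * t)) a - (- 1) ^ k * fwd_diff k (\<lambda>a. heat_pairing v w (a * t)) (a + 1)"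
      using heat_multiplier_integrable[OF v w, of a t k] heat_multiplier_integrable[OF v w, of "a + 1" t k] Suc.IH[of a] Suc.IH[of "a + 1"] Suc.prems t
      by (subst Bochner_Integration.integral_diff) auto
    finally show ?case by (simp add: algebra_simps del: times_complex.sel)
  qed
  from this[of 0 M] show ?thesis by (simp add: heat_diff_def)
qed

lemma parametric_pairing_measurable:
  fixes v w :: "real ^ 'n \<Rightarrow> complex"
  assumes v: "v \<in> L2" and w: "w \<in> L2" and m: "(\<lambda>(t, \<xi>). m t \<xi>) \<in> borel_measurable (borel \<Otimes>\<^sub>M borel)"
  shows "(\<lambda>t::real. LINT \<xi>|lebesgue. m t \<xi> * Re (v \<xi> * cnj (w \<xi>))) \<in> borel_measurable borel"
proof -
  note m[measurable]
  have vw: "(\<lambda>\<xi>. Re (v \<xi> * cnj (w \<xi>))) \<in> borel_measurable lebesgue" using L2_Re_product_integrable[OF v w] by blast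
  then obtain g where g: "g \<in> borel_measurable borel" "AE \<xi> in lebesgue. Re (v \<xi> * cnj (w \<xi>)) = g \<xi>"
    using lebesgue_borel_representative by blast
  note g(1)[measurable]
  have mt: "m t \<in> borel_measurable borel" for t using measurable_Pair2[OF m, of t] by simp
  have "(LINT \<xi>|lebesgue. m t \<xi> * Re (v \<xi> * cnj (w \<xi>))) = (LINT \<xi>|lborel. m t \<xi> * g \<xi>)" for t
  proof -
    have "m t \<in> borel_measurable lebesgue" "g \<in> borel_measurable lebesgue" using mt[of t] g(1) by (simp_all add: measurable_completion)
    then have "(LINT \<xi>|lebesgue. m t \<xi> * Re (v \<xi> * cnj (w \<xi>))) = (LINT \<xi>|lebesgue. m t \<xi> * g \<xi>)"
      by (intro integral_cong_AE borel_measurable_times vw) (use g(2) in \<open>auto elim!: eventually_mono\<close>)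
    also have "\<dots> = (LINT \<xi>|lborel. m t \<xi> * g \<xi>)"
      by (rule integral_completion) (use mt[of t] g(1) in simp)
    finally show ?thesis .
  qed
  then show ?thesis by (simp add: lborel.borel_measurable_lebesgue_integral split_beta')
qed

lemma heat_pairing_measurable: "v \<in> L2 \<Longrightarrow> w \<in> L2 \<Longrightarrow> heat_pairing v w \<in> borel_measurable borel"
  unfolding heat_pairing_def[abs_def] by (rule parametric_pairing_measurable) auto

lemma heat_diff_measurable: "v \<in> L2 \<Longrightarrow> w \<in> L2 \<Longrightarrow> heat_diff M v w \<in> borel_measurable borel"
  unfolding heat_diff_def[abs_def] by (rule parametric_pairing_measurable) auto

lemma heat_diff_integrable:
  assumes "v \<in> L2" "w \<in> L2" "0 \<le> t"
  shows "integrable lebesgue (\<lambda>\<xi>. (1 - exp (- (t * (norm \<xi>)\<^sup>2))) ^ M * Re (v \<xi> * cnj (w \<xi>)))"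
  using heat_multiplier_integrable[OF assms(1,2), of 0 t M] assms(3) by simp

lemma heat_diff_abs_le:
  fixes v w :: "real ^ 'n \<Rightarrow> complex"
  assumes "v \<in> L2" "w \<in> L2" "0 \<le> t"
  shows "\<bar>heat_diff M v w t\<bar> \<le> (LINT \<xi>|lebesgue. \<bar>Re (v \<xi> * cnj (w \<xi>))\<bar>)"
proof -
  have "\<bar>heat_diff M v w t\<bar> \<le> (LINT \<xi>|lebesgue. \<bar>(1 - exp (- (t * (norm \<xi>)\<^sup>2))) ^ M * Re (v \<xi> * cnj (w \<xi>))\<bar>)"
    unfolding heat_diff_def by (rule integral_abs_bound)
  also have "\<dots> \<le> (LINT \<xi>|lebesgue. \<bar>Re (v \<xi> * cnj (w \<xi>))\<bar>)"
  proof (rule integral_mono)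
    fix \<xi> :: "real ^ 'n"
    have "\<bar>(1 - exp (- (t * (norm \<xi>)\<^sup>2))) ^ M\<bar> \<le> 1" using assms(3) by (auto intro!: power_le_one simp: power_abs)
    from mult_right_mono[OF this, of "\<bar>Re (v \<xi> * cnj (w \<xi>))\<bar>"]
    show "\<bar>(1 - exp (- (t * (norm \<xi>)\<^sup>2))) ^ M * Re (v \<xi> * cnj (w \<xi>))\<bar> \<le> \<bar>Re (v \<xi> * cnj (w \<xi>))\<bar>"
      by (simp add: abs_mult del: times_complex.sel)
  qed (use heat_diff_integrable[OF assms, of M] L2_Re_product_integrable[OF assms(1,2)] in \<open>auto simp del: times_complex.sel\<close>)
  finally show ?thesis .
qed

lemma heat_diff_add_self:
  assumes v: "v \<in> L2" and w: "w \<in> L2" and t: "0 \<le> t"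
  shows "heat_diff M (\<lambda>\<xi>. v \<xi> + w \<xi>) (\<lambda>\<xi>. v \<xi> + w \<xi>) t = heat_diff M v v t + 2 * heat_diff M v w t + heat_diff M w w t"
proof -
  have "(1 - exp (- (t * (norm \<xi>)\<^sup>2))) ^ M * Re ((v \<xi> + w \<xi>) * cnj (v \<xi> + w \<xi>)) =
    (1 - exp (- (t * (norm \<xi>)\<^sup>2))) ^ M * Re (v \<xi> * cnj (v \<xi>)) + 2 * ((1 - exp (- (t * (norm \<xi>)\<^sup>2))) ^ M * Re (v \<xi> * cnj (w \<xi>))) + (1 - exp (- (t * (norm \<xi>)\<^sup>2))) ^ M * Re (w \<xi> * cnj (w \<xi>))" for \<xi>
    unfolding Re_mult_cnj norm_add_Re by (simp add: algebra_simps del: times_complex.sel)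
  then show ?thesis unfolding heat_diff_def
    using heat_diff_integrable[OF v v t, of M] heat_diff_integrable[OF v w t, of M] heat_diff_integrable[OF w w t, of M]
    by (simp del: times_complex.sel)
qed

lemma heat_diff_self_nonneg: "0 \<le> t \<Longrightarrow> 0 \<le> heat_diff M v v t"
  unfolding heat_diff_def Re_mult_cnj by (intro Bochner_Integration.integral_nonneg mult_nonneg_nonneg zero_le_power) auto

text \<open>The weight \<open>norm \<xi> powr (2 * s)\<close> is, up to the factor \<open>C\<close>, a Mellin integral of
  \<open>(1 - exp (- t * (norm \<xi>)\<^sup>2)) ^ M\<close>.\<close>
lemma mellin_heat_diff:
  fixes v :: "real ^ 'n \<Rightarrow> complex"
  assumes C: "C > 0" "\<forall>c\<ge>0. mellin (- s) (\<lambda>t. ennreal ((1 - exp (- (c * t))) ^ M)) = ennreal (C * c powr s)"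
    and v: "v \<in> L2"
  shows "mellin (- s) (\<lambda>t. ennreal (heat_diff M v v t)) = ennreal C * (\<integral>\<^sup>+\<xi>. ennreal (norm \<xi> powr (2 * s) * (norm (v \<xi>))\<^sup>2) \<partial>lebesgue)"
proof -
  have "(\<lambda>\<xi>. (norm (v \<xi>))\<^sup>2) \<in> borel_measurable lebesgue" using L2_measurable[OF v] by measurable
  then obtain w0 where w0: "w0 \<in> borel_measurable borel" "AE \<xi> in lebesgue. (norm (v \<xi>))\<^sup>2 = w0 \<xi>"
    using lebesgue_borel_representative by blast
  define w where "w \<xi> = max 0 (w0 \<xi>)" for \<xi>
  have wm[measurable]: "w \<in> borel_measurable borel" unfolding w_def using w0(1) by measurable
  have w: "AE \<xi> in lebesgue. (norm (v \<xi>))\<^sup>2 = w \<xi>" using w0(2) by eventually_elim (auto simp: w_def, metis zero_le_power2 max_absorb2)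
  have wn: "0 \<le> w \<xi>" for \<xi> by (simp add: w_def)
  have "mellin (- s) (\<lambda>t. ennreal (heat_diff M v v t)) = mellin (- s) (\<lambda>t. (\<integral>\<^sup>+\<xi>. ennreal ((1 - exp (- ((norm \<xi>)\<^sup>2 * t))) ^ M) * ennreal (w \<xi>) \<partial>lborel))"
  proof (rule mellin_cong)
    fix t :: real assume t: "t > 0"
    have "ennreal (heat_diff M v v t) = (\<integral>\<^sup>+\<xi>. ennreal ((1 - exp (- (t * (norm \<xi>)\<^sup>2))) ^ M * Re (v \<xi> * cnj (v \<xi>))) \<partial>lebesgue)"
      unfolding heat_diff_def
      by (rule nn_integral_eq_integral[symmetric, OF heat_diff_integrable[OF v v]]) (use t in \<open>auto simp only: Re_mult_cnj intro!: AE_I2 mult_nonneg_nonneg zero_le_power, auto\<close>)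
    also have "\<dots> = (\<integral>\<^sup>+\<xi>. ennreal ((1 - exp (- ((norm \<xi>)\<^sup>2 * t))) ^ M) * ennreal (w \<xi>) \<partial>lebesgue)"
      unfolding Re_mult_cnj by (rule nn_integral_cong_AE, use w in eventually_elim) (simp add: ennreal_mult'' wn mult.commute[of t])
    finally show "ennreal (heat_diff M v v t) = (\<integral>\<^sup>+\<xi>. ennreal ((1 - exp (- ((norm \<xi>)\<^sup>2 * t))) ^ M) * ennreal (w \<xi>) \<partial>lborel)"
      by (simp add: nn_integral_completion)
  qed
  also have "\<dots> = (\<integral>\<^sup>+t. (\<integral>\<^sup>+\<xi>. ennreal (indicator {0<..} t * t powr (- s - 1)) * (ennreal ((1 - exp (- ((norm \<xi>)\<^sup>2 * t))) ^ M) * ennreal (w \<xi>)) \<partial>lborel) \<partial>lborel)"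
    unfolding mellin_def by (subst nn_integral_cmult) auto
  also have "\<dots> = (\<integral>\<^sup>+\<xi>. (\<integral>\<^sup>+t. ennreal (indicator {0<..} t * t powr (- s - 1)) * (ennreal ((1 - exp (- ((norm \<xi>)\<^sup>2 * t))) ^ M) * ennreal (w \<xi>)) \<partial>lborel) \<partial>lborel)"
    by (rule lborel_pair.Fubini') measurable
  also have "\<dots> = (\<integral>\<^sup>+\<xi>. ennreal C * ennreal (norm \<xi> powr (2 * s) * w \<xi>) \<partial>lborel)"
  proof (rule nn_integral_cong)
    fix \<xi> :: "real ^ 'n"
    have "(\<integral>\<^sup>+t. ennreal (indicator {0<..} t * t powr (- s - 1)) * (ennreal ((1 - exp (- ((norm \<xi>)\<^sup>2 * t))) ^ M) * ennreal (w \<xi>)) \<partial>lborel) =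
       mellin (- s) (\<lambda>t. ennreal ((1 - exp (- ((norm \<xi>)\<^sup>2 * t))) ^ M)) * ennreal (w \<xi>)"
      unfolding mellin_def by (subst nn_integral_multc[symmetric]) (auto simp: mult.assoc)
    also have "\<dots> = ennreal (C * ((norm \<xi>)\<^sup>2) powr s) * ennreal (w \<xi>)" using C(2) by simp
    also have "((norm \<xi>)\<^sup>2) powr s = norm \<xi> powr (2 * s)"
      by (cases "\<xi> = 0") (auto simp: powr_powr[symmetric] powr_numeral)
    finally show "(\<integral>\<^sup>+t. ennreal (indicator {0<..} t * t powr (- s - 1)) * (ennreal ((1 - exp (- ((norm \<xi>)\<^sup>2 * t))) ^ M) * ennreal (w \<xi>)) \<partial>lborel) =
        ennreal C * ennreal (norm \<xi> powr (2 * s) * w \<xi>)"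
      using C(1) wn by (simp add: ennreal_mult mult.assoc)
  qed
  also have "\<dots> = ennreal C * (\<integral>\<^sup>+\<xi>. ennreal (norm \<xi> powr (2 * s) * w \<xi>) \<partial>lborel)"
    by (rule nn_integral_cmult) measurable
  also have "(\<integral>\<^sup>+\<xi>. ennreal (norm \<xi> powr (2 * s) * w \<xi>) \<partial>lborel) = (\<integral>\<^sup>+\<xi>. ennreal (norm \<xi> powr (2 * s) * (norm (v \<xi>))\<^sup>2) \<partial>lebesgue)"
    unfolding nn_integral_completion[symmetric, of lborel]
    by (rule nn_integral_cong_AE, rule eventually_mono[OF w]) simp
  finally show ?thesis .
qed

section \<open>Functions with separated supports\<close>

lemma power_over_fact_le_exp:
  fixes x :: real
  assumes "0 \<le> x" shows "x ^ k / fact k \<le> exp x"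
proof -
  have "(\<Sum>n\<in>{k}. x ^ n / fact n) \<le> (\<Sum>n. x ^ n / fact n)"
    using assms exp_converges[of x] by (intro sum_le_suminf) (auto simp: sums_iff divide_inverse mult.commute)
  also have "\<dots> = exp x" using exp_converges[of x] by (simp add: sums_iff divide_inverse mult.commute)
  finally show ?thesis by simp
qed

text \<open>The factor \<open>exp (- 1 / (4 * t))\<close> in the heat kernel at distance at least \<open>1\<close> beats every power of \<open>t\<close>.
  At time \<open>0\<close> the pairing is the inner product of functions with disjoint supports.\<close>
lemma heat_pairing_separated:
  fixes f g :: "real ^ 'n \<Rightarrow> real"
  assumes f: "f \<in> L2" and g: "g \<in> L2"
    and S: "S \<in> sets borel" "bounded S" "AE x in lebesgue. x \<notin> S \<longrightarrow> f x = 0"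
    and T: "T \<in> sets borel" "bounded T" "AE x in lebesgue. x \<notin> T \<longrightarrow> g x = 0"
    and dist: "\<And>x y. x \<in> S \<Longrightarrow> y \<in> T \<Longrightarrow> 1 \<le> norm (x - y)"
  shows "heat_pairing (fourier f) (fourier g) 0 = 0"
    and "\<exists>D\<ge>0. \<forall>t>0. \<bar>heat_pairing (fourier f) (fourier g) t\<bar> \<le> D * t ^ M"
    and "\<forall>t\<ge>0. \<bar>heat_pairing (fourier f) (fourier g) t\<bar> \<le> (LINT \<xi>|lebesgue. \<bar>Re (fourier f \<xi> * cnj (fourier g \<xi>))\<bar>)"
    and "AE x in lebesgue. 0 \<le> f x \<Longrightarrow> AE x in lebesgue. 0 \<le> g x \<Longrightarrow> t > 0 \<Longrightarrow>
      \<exists>c>0. c * ((LINT x|lebesgue. f x) * (LINT x|lebesgue. g x)) \<le> heat_pairing (fourier f) (fourier g) t"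
proof -
  define F where "F = heat_pairing (fourier f) (fourier g)"
  note Ff = has_fourier_fourier[OF f] and Fg = has_fourier_fourier[OF g]
  note L = has_fourier_L2(2)[OF Ff] has_fourier_L2(2)[OF Fg]
  have fi: "integrable lebesgue f" by (rule L2_bounded_support_integrable[OF f S(2) _ S(3)]) (use S(1) in simp)
  have gi: "integrable lebesgue g" by (rule L2_bounded_support_integrable[OF g T(2) _ T(3)]) (use T(1) in simp)
  obtain R where R: "\<And>x y. x \<in> S \<Longrightarrow> y \<in> T \<Longrightarrow> norm (x - y) \<le> R"
  proof -
    obtain a where a: "\<And>x. x \<in> S \<Longrightarrow> norm x \<le> a" using S(2) unfolding bounded_iff by blast
    obtain b where b: "\<And>x. x \<in> T \<Longrightarrow> norm x \<le> b" using T(2) unfolding bounded_iff by blast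
    show thesis
    proof (rule that)
      fix x y assume "x \<in> S" "y \<in> T"
      then show "norm (x - y) \<le> a + b" using a[of x] b[of y] norm_triangle_ineq4[of x y] by linarith
    qed
  qed
  define A where "A = (LINT x|lebesgue. \<bar>f x\<bar>) * (LINT x|lebesgue. \<bar>g x\<bar>)"
  have A: "0 \<le> A" unfolding A_def by simp
  define B where "B = (LINT \<xi>|lebesgue. \<bar>Re (fourier f \<xi> * cnj (fourier g \<xi>))\<bar>)"
  have B: "0 \<le> B" unfolding B_def by simp
  have "AE x in lebesgue. f x * g x = 0"
    using S(3) T(3)
  proof eventually_elim
    case (elim x)
    show ?case using elim dist[of x x] by auto
  qed
  then have "(LINT x|lebesgue. f x * g x) = 0" by (rule integral_eq_zero_AE)
  then show "heat_pairing (fourier f) (fourier g) 0 = 0"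
    unfolding heat_pairing_def using has_fourier_inner[OF Ff Fg] by (simp del: times_complex.sel)
  have FB: "\<bar>F t\<bar> \<le> B" if "0 \<le> t" for t
  proof -
    have Ft: "F t = (LINT \<xi>|lebesgue. exp (- (1 * t * (norm \<xi>)\<^sup>2)) * (1 - exp (- (t * (norm \<xi>)\<^sup>2))) ^ 0 * Re (fourier f \<xi> * cnj (fourier g \<xi>)))"
      unfolding F_def heat_pairing_def by simp
    have "\<bar>F t\<bar> \<le> (LINT \<xi>|lebesgue. \<bar>exp (- (1 * t * (norm \<xi>)\<^sup>2)) * (1 - exp (- (t * (norm \<xi>)\<^sup>2))) ^ 0 * Re (fourier f \<xi> * cnj (fourier g \<xi>))\<bar>)"
      unfolding Ft by (rule integral_abs_bound)
    also have "\<dots> \<le> B" unfolding B_def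
    proof (rule integral_mono)
      show "integrable lebesgue (\<lambda>\<xi>. \<bar>exp (- (1 * t * (norm \<xi>)\<^sup>2)) * (1 - exp (- (t * (norm \<xi>)\<^sup>2))) ^ 0 * Re (fourier f \<xi> * cnj (fourier g \<xi>))\<bar>)"
        by (rule integrable_abs[OF heat_multiplier_integrable[OF L, of 1 t 0]]) (use that in simp_all)
      show "integrable lebesgue (\<lambda>\<xi>. \<bar>Re (fourier f \<xi> * cnj (fourier g \<xi>))\<bar>)"
        by (rule integrable_abs[OF L2_Re_product_integrable[OF L]])
      fix \<xi> :: "real ^ 'n"
      have "\<bar>exp (- (1 * t * (norm \<xi>)\<^sup>2)) * (1 - exp (- (t * (norm \<xi>)\<^sup>2))) ^ 0\<bar> \<le> 1" using that by simp
      from mult_right_mono[OF this, of "\<bar>Re (fourier f \<xi> * cnj (fourier g \<xi>))\<bar>"]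
      show "\<bar>exp (- (1 * t * (norm \<xi>)\<^sup>2)) * (1 - exp (- (t * (norm \<xi>)\<^sup>2))) ^ 0 * Re (fourier f \<xi> * cnj (fourier g \<xi>))\<bar> \<le> \<bar>Re (fourier f \<xi> * cnj (fourier g \<xi>))\<bar>"
        by (simp add: abs_mult del: times_complex.sel)
    qed
    finally show ?thesis .
  qed
  then show "\<forall>t\<ge>0. \<bar>heat_pairing (fourier f) (fourier g) t\<bar> \<le> (LINT \<xi>|lebesgue. \<bar>Re (fourier f \<xi> * cnj (fourier g \<xi>))\<bar>)"
    unfolding F_def B_def by blast
  define N where "N = CARD('n)"
  \<comment> \<open>The heat kernel is singular of order at most \<open>N\<close> at \<open>t = 0\<close>, so \<open>N\<close> additional powers are needed.\<close>
  define k where "k = M + N"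
  define D where "D = max B (fact k * 4 ^ k * A)"
  have "\<bar>F t\<bar> \<le> D * t ^ M" if t: "t > 0" for t
  proof (cases "t \<le> 1")
    case True
    have "(1 / (4 * t)) ^ k / fact k \<le> exp (1 / (4 * t))"
      using power_over_fact_le_exp[of "1 / (4 * t)" k] t by simp
    then have e: "exp (- 1 / (4 * t)) \<le> fact k * (4 * t) ^ k"
      using t by (simp add: exp_minus power_divide field_simps)
    have "t\<^sup>2 \<le> 4 * pi * t"
    proof -
      have "t * t \<le> 1 * t" using True t by (intro mult_right_mono) auto
      also have "1 * t \<le> (4 * pi) * t" using t pi_gt3 by (intro mult_right_mono) auto
      finally show ?thesis by (simp add: power2_eq_square)
    qed
    then have "t \<le> sqrt (4 * pi * t)" using t by (simp add: real_le_rsqrt)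
    then have "1 / sqrt (4 * pi * t) \<le> 1 / t" using t by (intro divide_left_mono) auto
    then have h: "(1 / sqrt (4 * pi * t)) ^ N \<le> (1 / t) ^ N" using t by (intro power_mono) auto
    have "\<bar>F t\<bar> \<le> (1 / sqrt (4 * pi * t)) ^ N * exp (- 1 / (4 * t)) * A"
      unfolding F_def N_def A_def
      by (rule heat_pairing_bounds(1)[OF fi Ff gi Fg S(1,3) T(1,3)])
        (rule dist, assumption+, rule R, assumption+, rule t)
    also have "\<dots> \<le> (1 / t) ^ N * (fact k * (4 * t) ^ k) * A"
      using t A by (intro mult_right_mono mult_mono h e) auto
    also have "\<dots> = (fact k * 4 ^ k * A) * t ^ M"
      using t by (simp add: k_def power_add power_mult_distrib power_divide field_simps)
    also have "\<dots> \<le> D * t ^ M" using t unfolding D_def by (intro mult_right_mono) auto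
    finally show ?thesis .
  next
    case False
    then have "B * 1 \<le> D * t ^ M" unfolding D_def using B by (intro mult_mono) (auto simp: one_le_power)
    then show ?thesis using FB[of t] t by linarith
  qed
  moreover have "0 \<le> D" using B by (simp add: D_def)
  ultimately show "\<exists>D\<ge>0. \<forall>t>0. \<bar>heat_pairing (fourier f) (fourier g) t\<bar> \<le> D * t ^ M" unfolding F_def by blast
  show "\<exists>c>0. c * ((LINT x|lebesgue. f x) * (LINT x|lebesgue. g x)) \<le> heat_pairing (fourier f) (fourier g) t"
    if "AE x in lebesgue. 0 \<le> f x" "AE x in lebesgue. 0 \<le> g x" "t > 0"
  proof -
    have "(1 / sqrt (4 * pi * t)) ^ CARD('n) * exp (- R\<^sup>2 / (4 * t)) * ((LINT x|lebesgue. f x) * (LINT x|lebesgue. g x)) \<le> heat_pairing (fourier f) (fourier g) t"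
      by (rule heat_pairing_bounds(2)[OF fi Ff gi Fg S(1,3) T(1,3) _ _ that(3) that(1,2)])
        (rule dist, assumption+, rule R, assumption+)
    moreover have "0 < (1 / sqrt (4 * pi * t)) ^ CARD('n) * exp (- R\<^sup>2 / (4 * t))" using that(3) by simp
    ultimately show ?thesis by blast
  qed
qed

text \<open>For small \<open>t\<close> the terms of the difference are of order \<open>t ^ M\<close>, which the weight \<open>t powr (- s - 1)\<close> integrates;
  for large \<open>t\<close> the differences are bounded.\<close>
lemma heat_diff_separated:
  fixes f g :: "real ^ 'n \<Rightarrow> real"
  assumes f: "f \<in> L2" and g: "g \<in> L2"
    and S: "S \<in> sets borel" "bounded S" "AE x in lebesgue. x \<notin> S \<longrightarrow> f x = 0"
    and T: "T \<in> sets borel" "bounded T" "AE x in lebesgue. x \<notin> T \<longrightarrow> g x = 0"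
    and dist: "\<And>x y. x \<in> S \<Longrightarrow> y \<in> T \<Longrightarrow> 1 \<le> norm (x - y)"
    and s: "0 < s" "s < real M"
  shows "mellin (- s) (\<lambda>t. ennreal \<bar>heat_diff M (fourier f) (fourier g) t\<bar>) < \<infinity>"
proof -
  define F where "F = heat_pairing (fourier f) (fourier g)"
  note L = has_fourier_L2(2)[OF has_fourier_fourier[OF f]] has_fourier_L2(2)[OF has_fourier_fourier[OF g]]
  note hp = heat_pairing_separated[OF f g S T dist]
  have M: "0 < M" using s by (cases M) auto
  obtain D where D: "0 \<le> D" "\<And>t. t > 0 \<Longrightarrow> \<bar>F t\<bar> \<le> D * t ^ M" using hp(2)[of M] unfolding F_def by blast
  define B where "B = (LINT \<xi>|lebesgue. \<bar>Re (fourier f \<xi> * cnj (fourier g \<xi>))\<bar>)"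
  define K where "K = max B (2 ^ M * (D * real M ^ M))"
  have hm: "heat_diff M (fourier f) (fourier g) \<in> borel_measurable borel" by (rule heat_diff_measurable[OF L])
  have 1: "\<bar>heat_diff M (fourier f) (fourier g) t\<bar> \<le> 2 ^ M * (D * real M ^ M) * t ^ M" if t: "t > 0" for t
  proof -
    have "\<bar>heat_diff M (fourier f) (fourier g) t\<bar> = \<bar>fwd_diff M (\<lambda>a. F (a * t)) 0\<bar>"
      unfolding F_def using t by (subst heat_diff_eq_fwd_diff[OF L]) (auto simp: abs_mult power_abs)
    also have "\<dots> \<le> 2 ^ M * (D * (real M * t) ^ M)"
    proof (rule fwd_diff_abs_le)
      fix j assume j: "j \<le> M"
      show "\<bar>F ((0 + real j) * t)\<bar> \<le> D * (real M * t) ^ M"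
      proof (cases "j = 0")
        case True
        then show ?thesis using hp(1) D t unfolding F_def by simp
      next
        case False
        then have "\<bar>F (real j * t)\<bar> \<le> D * (real j * t) ^ M" using D(2) t by simp
        also have "\<dots> \<le> D * (real M * t) ^ M" using D(1) t j by (intro mult_left_mono power_mono mult_right_mono) auto
        finally show ?thesis by simp
      qed
    qed
    finally show ?thesis by (simp add: power_mult_distrib mult.assoc)
  qed
  show ?thesis
  proof (rule mellin_finite[where C=K and ?b1.0="real M" and ?b2.0=0])
    show "(\<lambda>t. ennreal \<bar>heat_diff M (fourier f) (fourier g) t\<bar>) \<in> borel_measurable borel" using hm by measurable
    show "ennreal \<bar>heat_diff M (fourier f) (fourier g) t\<bar> \<le> ennreal (K * t powr real M)" if "0 < t" "t \<le> 1" for t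
    proof (rule ennreal_leI)
      have "2 ^ M * (D * real M ^ M) * t ^ M \<le> K * t ^ M" unfolding K_def using that by (intro mult_right_mono) auto
      from order_trans[OF 1[OF that(1)] this] show "\<bar>heat_diff M (fourier f) (fourier g) t\<bar> \<le> K * t powr real M"
        using that(1) by (simp add: powr_realpow)
    qed
    show "ennreal \<bar>heat_diff M (fourier f) (fourier g) t\<bar> \<le> ennreal (K * t powr 0)" if "1 \<le> t" for t
    proof (rule ennreal_leI)
      have "\<bar>heat_diff M (fourier f) (fourier g) t\<bar> \<le> B" unfolding B_def by (rule heat_diff_abs_le[OF L]) (use that in simp)
      then show "\<bar>heat_diff M (fourier f) (fourier g) t\<bar> \<le> K * t powr 0" using that by (simp add: K_def)
    qed
  qed (use s in auto)
qed

text \<open>The regularity of a function that lives on two separated sets passes to its parts: in the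
  Mellin integral of the energy of the sum, the mixed terms converge absolutely and the two diagonal
  terms are nonnegative.\<close>
theorem sobolev_restrict_separated:
  fixes u :: "real ^ 'n \<Rightarrow> real"
  assumes u: "u \<in> sobolev s" and s: "0 < s"
    and S: "S \<in> sets borel" "bounded S" and T: "T \<in> sets borel" "bounded T"
    and supp: "AE x in lebesgue. x \<notin> S \<union> T \<longrightarrow> u x = 0"
    and dist: "\<And>x y. x \<in> S \<Longrightarrow> y \<in> T \<Longrightarrow> 1 \<le> norm (x - y)"
  shows "(\<lambda>x. indicator S x * u x) \<in> sobolev s"
proof -
  obtain M :: nat where M: "s < real M" using reals_Archimedean2 by blast
  obtain C where C: "C > 0" "\<forall>c\<ge>0. mellin (- s) (\<lambda>t. ennreal ((1 - exp (- (c * t))) ^ M)) = ennreal (C * c powr s)"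
    using mellin_one_minus_exp_power[OF s M] by blast
  note D = sobolevD[OF u s]
  define f where "f x = indicator S x * u x" for x
  define g where "g x = indicator T x * u x" for x
  have fL: "f \<in> L2" unfolding f_def by (rule L2_indicator[OF D(1)]) (use S in simp)
  have gL: "g \<in> L2" unfolding g_def by (rule L2_indicator[OF D(1)]) (use T in simp)
  have fz: "AE x in lebesgue. x \<notin> S \<longrightarrow> f x = 0" and gz: "AE x in lebesgue. x \<notin> T \<longrightarrow> g x = 0"
    by (auto simp: f_def g_def)
  note Ff = has_fourier_fourier[OF fL] and Fg = has_fourier_fourier[OF gL]
  note L = has_fourier_L2(2)[OF Ff] has_fourier_L2(2)[OF Fg]
  define h where "h \<xi> = fourier f \<xi> + fourier g \<xi>" for \<xi>
  have "has_fourier (\<lambda>x. f x + g x) h" unfolding h_def by (rule has_fourier_add[OF Ff Fg])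
  moreover have "AE x in lebesgue. f x + g x = u x"
    using supp
  proof eventually_elim
    case (elim x)
    show ?case using elim dist[of x x] by (auto simp: f_def g_def indicator_def)
  qed
  ultimately have hu: "has_fourier u h" by (rule has_fourier_cong) simp
  have hh: "hom_integrable s h" by (rule hom_integrable_cong[OF D(3) has_fourier_unique[OF D(2) hu]])
  have hL: "h \<in> L2" by (rule has_fourier_L2(2)[OF hu])
  have "(\<integral>\<^sup>+\<xi>. ennreal (norm \<xi> powr (2 * s) * (norm (h \<xi>))\<^sup>2) \<partial>lebesgue) < \<infinity>"
    using hh nn_integral_eq_integral[of lebesgue "\<lambda>\<xi>. norm \<xi> powr (2 * s) * (norm (h \<xi>))\<^sup>2"] by (simp add: hom_integrable_def)
  then have mh: "mellin (- s) (\<lambda>t. ennreal (heat_diff M h h t)) < \<infinity>"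
    unfolding mellin_heat_diff[OF C hL] by (simp add: ennreal_mult_less_top)
  have mfg: "mellin (- s) (\<lambda>t. ennreal \<bar>heat_diff M (fourier f) (fourier g) t\<bar>) < \<infinity>"
    by (rule heat_diff_separated[OF fL gL S fz T gz dist s M])
  have [measurable]: "heat_diff M h h \<in> borel_measurable borel" "heat_diff M (fourier f) (fourier g) \<in> borel_measurable borel"
    by (intro heat_diff_measurable hL L)+
  have "mellin (- s) (\<lambda>t. ennreal (heat_diff M (fourier f) (fourier f) t)) \<le>
     (\<integral>\<^sup>+t. ennreal (indicator {0<..} t * t powr (- s - 1)) * ennreal (heat_diff M h h t) +
        2 * (ennreal (indicator {0<..} t * t powr (- s - 1)) * ennreal \<bar>heat_diff M (fourier f) (fourier g) t\<bar>) \<partial>lborel)"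
    unfolding mellin_def
  proof (rule nn_integral_mono)
    fix t :: real
    show "ennreal (indicator {0<..} t * t powr (- s - 1)) * ennreal (heat_diff M (fourier f) (fourier f) t) \<le>
      ennreal (indicator {0<..} t * t powr (- s - 1)) * ennreal (heat_diff M h h t) + 2 * (ennreal (indicator {0<..} t * t powr (- s - 1)) * ennreal \<bar>heat_diff M (fourier f) (fourier g) t\<bar>)"
    proof (cases "t > 0")
      case True
      then have t: "0 \<le> t" by simp
      have le: "heat_diff M (fourier f) (fourier f) t \<le> heat_diff M h h t + 2 * \<bar>heat_diff M (fourier f) (fourier g) t\<bar>"
        using heat_diff_add_self[OF L t, of M] heat_diff_self_nonneg[OF t, of M "fourier g"] unfolding h_def[abs_def] by linarith
      have "ennreal (heat_diff M (fourier f) (fourier f) t) \<le> ennreal (heat_diff M h h t) + 2 * ennreal \<bar>heat_diff M (fourier f) (fourier g) t\<bar>"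
      proof -
        have "ennreal (heat_diff M (fourier f) (fourier f) t) \<le> ennreal (heat_diff M h h t + 2 * \<bar>heat_diff M (fourier f) (fourier g) t\<bar>)" using le by (rule ennreal_leI)
        also have "\<dots> = ennreal (heat_diff M h h t) + 2 * ennreal \<bar>heat_diff M (fourier f) (fourier g) t\<bar>"
        proof -
          have "ennreal (a + 2 * \<bar>b\<bar>) = ennreal a + 2 * ennreal \<bar>b\<bar>" if "0 \<le> a" for a b
            using that ennreal_plus[OF that, of "2 * \<bar>b\<bar>"] ennreal_mult'[of 2 "\<bar>b\<bar>"] by simp
          from this[OF heat_diff_self_nonneg[OF t]] show ?thesis .
        qed
        finally show ?thesis .
      qed
      then have "ennreal (t powr (- s - 1)) * ennreal (heat_diff M (fourier f) (fourier f) t) \<le> ennreal (t powr (- s - 1)) * (ennreal (heat_diff M h h t) + 2 * ennreal \<bar>heat_diff M (fourier f) (fourier g) t\<bar>)"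
        by (intro mult_left_mono) auto
      then show ?thesis using True by (simp add: distrib_left mult.left_commute)
    qed simp
  qed
  also have "\<dots> = mellin (- s) (\<lambda>t. ennreal (heat_diff M h h t)) + 2 * mellin (- s) (\<lambda>t. ennreal \<bar>heat_diff M (fourier f) (fourier g) t\<bar>)"
    unfolding mellin_def by (simp add: nn_integral_add nn_integral_cmult)
  also have "\<dots> < \<infinity>" using mh mfg by (simp add: ennreal_mult_less_top)
  finally have fin: "ennreal C * (\<integral>\<^sup>+\<xi>. ennreal (norm \<xi> powr (2 * s) * (norm (fourier f \<xi>))\<^sup>2) \<partial>lebesgue) < \<infinity>"
    unfolding mellin_heat_diff[OF C L(1)] .
  have fin': "(\<integral>\<^sup>+\<xi>. ennreal (norm \<xi> powr (2 * s) * (norm (fourier f \<xi>))\<^sup>2) \<partial>lebesgue) < \<infinity>"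
    using fin C(1) by (auto simp: ennreal_mult_less_top)
  have [measurable]: "fourier f \<in> borel_measurable lebesgue" by (rule L2_measurable[OF L(1)])
  have "integrable lebesgue (\<lambda>\<xi>. norm \<xi> powr (2 * s) * (norm (fourier f \<xi>))\<^sup>2)"
    by (rule integrableI_nonneg) (use fin' in auto)
  then have "hom_integrable s (fourier f)" using L(1) by (simp add: hom_integrable_def)
  then show ?thesis using Ff sobolev_iff[OF s] unfolding f_def by blast
qed

lemma mellin_integrable:
  fixes F :: "real \<Rightarrow> real"
  assumes [measurable]: "F \<in> borel_measurable borel" and fin: "mellin p (\<lambda>t. ennreal \<bar>F t\<bar>) < \<infinity>"
  shows "integrable lborel (\<lambda>t. indicator {0<..} t * t powr (p - 1) * F t)"
proof (rule integrableI_bounded)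
  have "(\<integral>\<^sup>+t. ennreal (norm (indicator {0<..} t * t powr (p - 1) * F t)) \<partial>lborel) = mellin p (\<lambda>t. ennreal \<bar>F t\<bar>)"
    unfolding mellin_def by (intro nn_integral_cong) (simp add: abs_mult ennreal_mult)
  then show "(\<integral>\<^sup>+t. ennreal (norm (indicator {0<..} t * t powr (p - 1) * F t)) \<partial>lborel) < \<infinity>" using fin by simp
qed measurable

lemma fwd_diff_integral:
  fixes G :: "real \<Rightarrow> real \<Rightarrow> real"
  assumes G: "\<And>a. a \<ge> 0 \<Longrightarrow> integrable lborel (\<lambda>t. W t * G a t) \<and> (LINT t|lborel. W t * G a t) = H a" and a: "a \<ge> 0"
  shows "integrable lborel (\<lambda>t. W t * fwd_diff k (\<lambda>b. G b t) a) \<and> (LINT t|lborel. W t * fwd_diff k (\<lambda>b. G b t) a) = fwd_diff k H a"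
  using a
proof (induction k arbitrary: a)
  case (Suc k)
  then have "integrable lborel (\<lambda>t. W t * fwd_diff k (\<lambda>b. G b t) (a + 1)) \<and> (LINT t|lborel. W t * fwd_diff k (\<lambda>b. G b t) (a + 1)) = fwd_diff k H (a + 1)"
    "integrable lborel (\<lambda>t. W t * fwd_diff k (\<lambda>b. G b t) a) \<and> (LINT t|lborel. W t * fwd_diff k (\<lambda>b. G b t) a) = fwd_diff k H a"
    by auto
  then show ?case by (simp add: right_diff_distrib)
qed (use G in auto)

text \<open>By polarisation the mixed energy is a Mellin integral of the mixed heat differences. The \<open>M\<close>-th
  difference combines the heat pairings \<open>F (a * t)\<close> with \<open>a \<le> M\<close>, where the term with \<open>a = 0\<close> vanishes. Each
  of them may be integrated separately against \<open>t powr (- s - 1)\<close>, which gives \<open>a powr s\<close> times the same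
  integral. What remains is the forward difference of \<open>a powr s\<close> at \<open>0\<close>, with the sign \<open>(-1) ^ M = 1\<close>.\<close>
lemma energy_separated:
  fixes f g :: "real ^ 'n \<Rightarrow> real"
  assumes f: "f \<in> sobolev s" and g: "g \<in> sobolev s" and s: "0 < s" "real M - 1 < s" "s < real M" and M: "even M"
    and S: "S \<in> sets borel" "bounded S" "AE x in lebesgue. x \<notin> S \<longrightarrow> f x = 0"
    and T: "T \<in> sets borel" "bounded T" "AE x in lebesgue. x \<notin> T \<longrightarrow> g x = 0"
    and dist: "\<And>x y. x \<in> S \<Longrightarrow> y \<in> T \<Longrightarrow> 1 \<le> norm (x - y)"
  obtains K where "K > 0" "integrable lborel (\<lambda>t. indicator {0<..} t * t powr (- s - 1) * heat_pairing (fourier f) (fourier g) t)"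
    "energy s f g = K * (LINT t|lborel. indicator {0<..} t * t powr (- s - 1) * heat_pairing (fourier f) (fourier g) t)"
proof -
  obtain C where C: "C > 0" "\<forall>c\<ge>0. mellin (- s) (\<lambda>t. ennreal ((1 - exp (- (c * t))) ^ M)) = ennreal (C * c powr s)"
    using mellin_one_minus_exp_power[OF s(1,3)] by blast
  have M0: "0 < M" using s by (cases M) auto
  note Df = sobolevD[OF f s(1)] and Dg = sobolevD[OF g s(1)]
  note L = has_fourier_L2(2)[OF Df(2)] has_fourier_L2(2)[OF Dg(2)]
  define F where "F = heat_pairing (fourier f) (fourier g)"
  define W where "W t = indicator {0<..} t * t powr (- s - 1)" for t :: real
  note hp = heat_pairing_separated[OF Df(1) Dg(1) S T dist]
  have self: "integrable lborel (\<lambda>t. W t * heat_diff M v v t) \<and> (LINT t|lborel. W t * heat_diff M v v t) = C * hom_form s v v"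
    if v: "hom_integrable s v" for v :: "real ^ 'n \<Rightarrow> complex"
  proof -
    have vL: "v \<in> L2" and vi: "integrable lebesgue (\<lambda>\<xi>. norm \<xi> powr (2 * s) * (norm (v \<xi>))\<^sup>2)" using v by (auto simp: hom_integrable_def)
    have m[measurable]: "heat_diff M v v \<in> borel_measurable borel" by (rule heat_diff_measurable[OF vL vL])
    have wn: "0 \<le> W t * heat_diff M v v t" for t using heat_diff_self_nonneg[of t M v] by (simp add: W_def indicator_def)
    have "(\<integral>\<^sup>+t. ennreal (W t * heat_diff M v v t) \<partial>lborel) = mellin (- s) (\<lambda>t. ennreal (heat_diff M v v t))"
      unfolding mellin_def W_def by (intro nn_integral_cong) (simp add: ennreal_mult')
    also have "\<dots> = ennreal C * ennreal (hom_form s v v)"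
      unfolding mellin_heat_diff[OF C vL] hom_form_self by (subst nn_integral_eq_integral[OF vi]) auto
    also have "\<dots> = ennreal (C * hom_form s v v)" using C(1) hom_form_nonneg[of s v] by (simp add: ennreal_mult)
    finally have n: "(\<integral>\<^sup>+t. ennreal (W t * heat_diff M v v t) \<partial>lborel) = ennreal (C * hom_form s v v)" .
    have mW: "(\<lambda>t. W t * heat_diff M v v t) \<in> borel_measurable lborel" unfolding W_def[abs_def] by measurable
    have "integrable lborel (\<lambda>t. W t * heat_diff M v v t)" by (rule integrableI_nonneg[OF mW]) (use n wn in auto)
    moreover have "(LINT t|lborel. W t * heat_diff M v v t) = C * hom_form s v v"
      by (subst integral_eq_nn_integral[OF mW]) (use n wn C(1) hom_form_nonneg[of s v] in auto)
    ultimately show ?thesis by blast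
  qed
  define h where "h \<xi> = fourier f \<xi> + fourier g \<xi>" for \<xi>
  have hh: "hom_integrable s h" unfolding h_def using hom_integrable_linear[OF Df(3) Dg(3), of 1 1] by simp
  note sf = self[OF Df(3)] and sg = self[OF Dg(3)] and sh = self[OF hh]
  have e: "W t * heat_diff M (fourier f) (fourier g) t = (W t * heat_diff M h h t - W t * heat_diff M (fourier f) (fourier f) t - W t * heat_diff M (fourier g) (fourier g) t) / 2" for t
    using heat_diff_add_self[OF L, of t M] unfolding h_def[abs_def]
    by (cases "t > 0") (simp_all add: W_def algebra_simps)
  have "(LINT t|lborel. W t * heat_diff M (fourier f) (fourier g) t) = (C * hom_form s h h - C * hom_form s (fourier f) (fourier f) - C * hom_form s (fourier g) (fourier g)) / 2"
    unfolding e using sf sg sh by simp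
  also have "\<dots> = C * energy s f g"
    unfolding energy_def h_def[abs_def] hom_form_add_self[OF Df(3) Dg(3)] by (simp add: algebra_simps)
  finally have en: "C * energy s f g = (LINT t|lborel. W t * heat_diff M (fourier f) (fourier g) t)" by simp
  have Fm[measurable]: "F \<in> borel_measurable borel" unfolding F_def by (rule heat_pairing_measurable[OF L])
  obtain D where D: "0 \<le> D" "\<And>t. t > 0 \<Longrightarrow> \<bar>F t\<bar> \<le> D * t ^ M" using hp(2)[of M] unfolding F_def by blast
  define B where "B = (LINT \<xi>|lebesgue. \<bar>Re (fourier f \<xi> * cnj (fourier g \<xi>))\<bar>)"
  have mF: "mellin (- s) (\<lambda>t. ennreal \<bar>F t\<bar>) < \<infinity>"
  proof (rule mellin_finite[where C="max B D" and ?b1.0="real M" and ?b2.0=0])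
    show "ennreal \<bar>F t\<bar> \<le> ennreal (max B D * t powr real M)" if "0 < t" "t \<le> 1" for t
    proof (rule ennreal_leI)
      have "D * t ^ M \<le> max B D * t ^ M" using that by (intro mult_right_mono) auto
      from order_trans[OF D(2)[OF that(1)] this] show "\<bar>F t\<bar> \<le> max B D * t powr real M"
        using that(1) by (simp add: powr_realpow)
    qed
    show "ennreal \<bar>F t\<bar> \<le> ennreal (max B D * t powr 0)" if "1 \<le> t" for t
    proof (rule ennreal_leI)
      have "\<bar>F t\<bar> \<le> B" using hp(3) that unfolding F_def B_def by simp
      then show "\<bar>F t\<bar> \<le> max B D * t powr 0" using that by simp
    qed
  qed (use s in auto)
  have WFi: "integrable lborel (\<lambda>t. W t * F t)" unfolding W_def by (rule mellin_integrable[OF Fm mF])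
  define I where "I = (LINT t|lborel. W t * F t)"
  \<comment> \<open>For \<open>a = 0\<close> both sides vanish, as \<open>0 powr s = 0\<close>.\<close>
  have scale: "integrable lborel (\<lambda>t. W t * F (a * t)) \<and> (LINT t|lborel. W t * F (a * t)) = I * a powr s" if "a \<ge> 0" for a
  proof (cases "a = 0")
    case True
    then show ?thesis using hp(1) unfolding F_def by simp
  next
    case False
    then have a: "a > 0" using that by simp
    have p: "W (a * t) = a powr (- s - 1) * W t" for t
      using a by (simp add: W_def indicator_def powr_mult zero_less_mult_iff)
    have q: "W t * F (a * t) = a powr (s + 1) * (W (0 + a * t) * F (0 + a * t))" for t
    proof -
      have "a powr (s + 1) * a powr (- s - 1) = 1" using a by (simp add: powr_add[symmetric])
      then show ?thesis by (simp add: p mult.assoc[symmetric])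
    qed
    have i: "integrable lborel (\<lambda>t. W (0 + a * t) * F (0 + a * t))"
      using lborel_integrable_real_affine[OF WFi, of a 0] a by simp
    have "I = \<bar>a\<bar> *\<^sub>R (LINT t|lborel. W (0 + a * t) * F (0 + a * t))"
      unfolding I_def by (rule lborel_integral_real_affine) (use a in simp)
    then have "(LINT t|lborel. W (0 + a * t) * F (0 + a * t)) = I / a" using a by (simp add: field_simps)
    moreover have "a powr (s + 1) * (I / a) = I * a powr s" using a by (simp add: powr_add)
    ultimately show ?thesis unfolding q using i by simp
  qed
  have "(LINT t|lborel. W t * heat_diff M (fourier f) (fourier g) t) = (LINT t|lborel. W t * fwd_diff M (\<lambda>b. F (b * t)) 0)"
  proof (rule Bochner_Integration.integral_cong[OF refl])
    fix t
    show "W t * heat_diff M (fourier f) (fourier g) t = W t * fwd_diff M (\<lambda>b. F (b * t)) 0"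
    proof (cases "t > 0")
      case True
      then show ?thesis using heat_diff_eq_fwd_diff[OF L, of t M] M unfolding F_def by simp
    qed (simp add: W_def)
  qed
  also have "\<dots> = fwd_diff M (\<lambda>b. I * b powr s) 0"
    using fwd_diff_integral[of W "\<lambda>b t. F (b * t)" "\<lambda>b. I * b powr s" 0 M] scale by blast
  also have "\<dots> = I * fwd_diff M (\<lambda>b. b powr s) 0" by (rule fwd_diff_cmult)
  finally have fin: "C * energy s f g = I * fwd_diff M (\<lambda>b. b powr s) 0" unfolding en .
  define K where "K = fwd_diff M (\<lambda>b. b powr s) 0 / C"
  have "fwd_diff M (\<lambda>b. b powr s) 0 > 0" by (rule fwd_diff_powr_pos_0) (use M0 s in auto)
  then have K: "K > 0" unfolding K_def using C(1) by simp
  have "energy s f g = K * I" using fin C(1) by (simp add: K_def field_simps)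
  then show thesis using that[OF K] WFi unfolding I_def W_def F_def by blast
qed

text \<open>The heat kernel is positive, and so are the heat pairings of nonnegative functions.\<close>
theorem energy_separated_sign:
  fixes f g :: "real ^ 'n \<Rightarrow> real"
  assumes f: "f \<in> sobolev s" and g: "g \<in> sobolev s" and s: "0 < s" "real M - 1 < s" "s < real M" and M: "even M"
    and S: "S \<in> sets borel" "bounded S" "AE x in lebesgue. x \<notin> S \<longrightarrow> f x = 0"
    and T: "T \<in> sets borel" "bounded T" "AE x in lebesgue. x \<notin> T \<longrightarrow> g x = 0"
    and dist: "\<And>x y. x \<in> S \<Longrightarrow> y \<in> T \<Longrightarrow> 1 \<le> norm (x - y)"
    and pos: "AE x in lebesgue. 0 \<le> f x" "AE x in lebesgue. 0 \<le> g x"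
  shows "0 \<le> energy s f g"
    and "0 < (LINT x|lebesgue. f x) \<Longrightarrow> 0 < (LINT x|lebesgue. g x) \<Longrightarrow> 0 < energy s f g"
proof -
  obtain K where K: "K > 0" and i: "integrable lborel (\<lambda>t. indicator {0<..} t * t powr (- s - 1) * heat_pairing (fourier f) (fourier g) t)"
    and e: "energy s f g = K * (LINT t|lborel. indicator {0<..} t * t powr (- s - 1) * heat_pairing (fourier f) (fourier g) t)"
    using energy_separated[OF f g s M S T dist] by blast
  have c: "\<exists>c>0. c * ((LINT x|lebesgue. f x) * (LINT x|lebesgue. g x)) \<le> heat_pairing (fourier f) (fourier g) t" if "t > 0" for t
    by (rule heat_pairing_separated(4)[OF sobolevD(1)[OF f s(1)] sobolevD(1)[OF g s(1)] S T dist pos that])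
  have "0 \<le> (LINT x|lebesgue. f x)" "0 \<le> (LINT x|lebesgue. g x)" using pos by (auto intro: integral_nonneg_AE)
  then have fg: "0 \<le> (LINT x|lebesgue. f x) * (LINT x|lebesgue. g x)" by simp
  have F0: "0 \<le> heat_pairing (fourier f) (fourier g) t" if t: "t > 0" for t
  proof -
    obtain c where "c > 0" "c * ((LINT x|lebesgue. f x) * (LINT x|lebesgue. g x)) \<le> heat_pairing (fourier f) (fourier g) t"
      using c[OF t] by blast
    then show ?thesis using fg by (meson mult_nonneg_nonneg less_imp_le order_trans)
  qed
  have nn: "0 \<le> indicator {0<..} t * t powr (- s - 1) * heat_pairing (fourier f) (fourier g) t" for t
    using F0[of t] by (simp add: indicator_def)
  then show 0: "0 \<le> energy s f g" unfolding e using K by (intro mult_nonneg_nonneg integral_nonneg) auto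
  assume p: "0 < (LINT x|lebesgue. f x)" "0 < (LINT x|lebesgue. g x)"
  have "energy s f g \<noteq> 0"
  proof
    assume "energy s f g = 0"
    then have "(LINT t|lborel. indicator {0<..} t * t powr (- s - 1) * heat_pairing (fourier f) (fourier g) t) = 0" unfolding e using K by simp
    then have "AE t in lborel. indicator {0<..} t * t powr (- s - 1) * heat_pairing (fourier f) (fourier g) t = 0"
      using integral_nonneg_eq_0_iff_AE[OF i] nn by simp
    then have "AE t in lborel. t \<notin> {0<..<1::real}"
    proof (rule eventually_mono)
      fix t :: real assume z: "indicator {0<..} t * t powr (- s - 1) * heat_pairing (fourier f) (fourier g) t = 0"
      show "t \<notin> {0<..<1}"
      proof
        assume t: "t \<in> {0<..<1}"
        then obtain c where "c > 0" "c * ((LINT x|lebesgue. f x) * (LINT x|lebesgue. g x)) \<le> heat_pairing (fourier f) (fourier g) t"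
          using c[of t] by auto
        then have "0 < heat_pairing (fourier f) (fourier g) t" using p by (meson mult_pos_pos less_le_trans)
        then show False using z t by simp
      qed
    qed
    then have "{0<..<1::real} \<in> null_sets lborel" by (subst AE_iff_null_sets) auto
    then show False by (simp add: null_sets_def)
  qed
  then show "0 < energy s f g" using 0 by simp
qed

section \<open>The dumbbell domains\<close>

lemma axis_segment_nonempty: "axis_segment i \<noteq> {}"
  unfolding axis_segment_def by (auto intro: exI[of _ 1])

lemma two_balls_subset_dumbbell: "two_balls i \<subseteq> dumbbell i n"
  by (simp add: dumbbell_def)

lemma open_dumbbell: "open (dumbbell i n)"
  unfolding dumbbell_def two_balls_def
  by (intro open_Un open_ball open_Collect_less continuous_on_infdist continuous_intros)

lemma dumbbell_in_lebesgue: "dumbbell i n \<in> sets lebesgue"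
  by (intro sets_completionI_sets) (simp add: open_dumbbell)

lemma dumbbell_Suc_subset: "dumbbell i (Suc (Suc n)) \<subseteq> dumbbell i (Suc n)"
proof -
  have "1 / real (Suc (Suc n)) \<le> 1 / real (Suc n)" by (intro divide_left_mono) auto
  then show ?thesis unfolding dumbbell_def by (auto intro: less_le_trans)
qed

lemma bounded_dumbbell: "bounded (dumbbell i n)"
proof -
  have "norm x \<le> 3 + 1 / real n" if "infdist x (axis_segment i) < 1 / real n" for x :: "real ^ 'a"
  proof -
    have "norm x - 3 \<le> infdist x (axis_segment i)"
      unfolding infdist_notempty[OF axis_segment_nonempty]
    proof (rule cINF_greatest[OF axis_segment_nonempty])
      fix a :: "real ^ 'a" assume "a \<in> axis_segment i"
      then have "norm a \<le> 3" by (auto simp: axis_segment_def)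
      then show "norm x - 3 \<le> dist x a" using norm_triangle_ineq2[of x a] by (simp add: dist_norm)
    qed
    then show ?thesis using that by linarith
  qed
  then have "bounded {x. infdist x (axis_segment i) < 1 / real n}" by (auto simp: bounded_iff)
  then show ?thesis unfolding dumbbell_def two_balls_def by simp
qed

text \<open>In dimension at least two the axis is a null set, so that up to null sets the
  dumbbells shrink to the two balls.\<close>
lemma zero_outside_two_balls:
  fixes w :: "real ^ 'n \<Rightarrow> real"
  assumes N: "2 \<le> CARD('n)" and w: "\<And>n. AE x in lebesgue. x \<notin> dumbbell i (Suc n) \<longrightarrow> w x = 0"
  shows "AE x in lebesgue. x \<notin> two_balls i \<longrightarrow> w x = 0"
proof -
  have "\<exists>k::'n. k \<noteq> i"
  proof (rule ccontr)
    assume "\<nexists>k. k \<noteq> i"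
    then have "UNIV = {i}" by auto
    then have "CARD('n) = 1" by (metis card_1_singleton_iff One_nat_def)
    then show False using N by simp
  qed
  \<comment> \<open>The closed axis lies in the hyperplane where a second coordinate vanishes.\<close>
  then obtain k where k: "k \<noteq> i" by blast
  have "negligible {x :: real ^ 'n. axis k 1 \<bullet> x = 0}" by (rule negligible_hyperplane) simp
  then have "AE x in lebesgue. x \<notin> {x :: real ^ 'n. axis k 1 \<bullet> x = 0}"
    by (intro AE_not_in) (simp add: negligible_iff_null_sets)
  then have hyp: "AE x in lebesgue. x $ k \<noteq> (0::real)" by (simp add: inner_axis')
  have "AE x in lebesgue. \<forall>n. x \<notin> dumbbell i (Suc n) \<longrightarrow> w x = 0"
    unfolding AE_all_countable by (rule allI) (rule w)
  then show ?thesis using hyp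
  proof eventually_elim
    case (elim x)
    show ?case
    proof
      assume x: "x \<notin> two_balls i"
      have "closed {x :: real ^ 'n. x $ k = 0}" by (intro closed_Collect_eq continuous_intros)
      moreover have "axis_segment i \<subseteq> {x :: real ^ 'n. x $ k = 0}" using k by (auto simp: axis_segment_def axis_def)
      ultimately have "closure (axis_segment i) \<subseteq> {x :: real ^ 'n. x $ k = 0}" by (rule closure_minimal[rotated])
      then have "x \<notin> closure (axis_segment i)" using elim(2) by blast
      then have "infdist x (axis_segment i) > 0"
        using in_closure_iff_infdist_zero[OF axis_segment_nonempty] infdist_nonneg[of x "axis_segment i"] by fastforce
      then obtain n where "inverse (real (Suc n)) < infdist x (axis_segment i)" using reals_Archimedean by blast
      then have "x \<notin> dumbbell i (Suc n)" using x by (simp add: dumbbell_def inverse_eq_divide)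
      then show "w x = 0" using elim(1) by blast
    qed
  qed
qed

lemma ball_separation:
  fixes x y e :: "'a::real_normed_vector"
  assumes "norm e = 1" "x \<in> ball 0 1" "y \<in> ball (3 *\<^sub>R e) 1"
  shows "1 \<le> norm (x - y)"
proof -
  have "3 = norm (x + (y - x) + (3 *\<^sub>R e - y))" using assms(1) by simp
  also have "\<dots> \<le> norm x + norm (y - x) + norm (3 *\<^sub>R e - y)" by (intro norm_triangle_le add_mono order_refl)
  also have "\<dots> < 2 + norm (y - x)" using assms by (auto simp: dist_norm)
  finally show ?thesis by (simp add: norm_minus_commute)
qed

lemma essinf_negI:
  fixes f :: "'a \<Rightarrow> ereal"
  assumes "\<not> (AE x in M. 0 \<le> f x)" shows "essinf M f < 0"
proof (rule ccontr)
  assume "\<not> essinf M f < 0"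
  then have le: "esssup M (\<lambda>x. - f x) \<le> 0" by (cases "esssup M (\<lambda>x. - f x)") (auto simp: essinf_def zero_ereal_def)
  have "AE x in M. - f x \<le> 0" using esssup_AE[of "\<lambda>x. - f x" M]
    by (rule eventually_mono) (rule order_trans[OF _ le])
  then have "AE x in M. 0 \<le> f x"
  proof eventually_elim
    case (elim x)
    then show ?case by (cases "f x") (auto simp: zero_ereal_def)
  qed
  then show False using assms by blast
qed

lemma esssup_posI:
  fixes f :: "'a \<Rightarrow> ereal"
  assumes "\<not> (AE x in M. f x \<le> 0)" shows "0 < esssup M f"
proof (rule ccontr)
  assume "\<not> 0 < esssup M f"
  then have "esssup M f \<le> 0" by simp
  with esssup_AE[of f M] have "AE x in M. f x \<le> 0" by (auto elim!: eventually_mono)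
  then show False using assms by blast
qed

lemma nonneg_bump_in_ball:
  fixes c :: "real ^ 'n"
  assumes s: "0 < s"
  obtains \<phi> where "\<phi> \<in> sobolev s" "\<And>x. 0 \<le> \<phi> x" "\<And>x. x \<notin> ball c 1 \<Longrightarrow> \<phi> x = 0" "0 < (LINT x|lebesgue. \<phi> x)" "integrable lebesgue \<phi>"
proof -
  have "c \<in> ball c 1" by simp
  from open_contains_cbox[OF open_ball this]
  obtain a b where ab: "cbox a b \<subseteq> ball c 1" "c \<in> box a b" by metis
  have sub: "box a b \<subseteq> ball c 1" using ab(1) box_subset_cbox by blast
  define \<phi> where "\<phi> = box_bump 1 a b"
  have t: "\<phi> \<in> test_functions" unfolding \<phi>_def by (rule box_bump_test_function)
  have out: "\<phi> x = 0" if "x \<notin> ball c 1" for x unfolding \<phi>_def using that sub by (intro box_bump_outside) blast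
  have nn: "0 \<le> \<phi> x" for x unfolding \<phi>_def by (rule box_bump_bounds)
  have i: "integrable lebesgue \<phi>"
    by (rule L2_bounded_support_integrable[OF test_function_L2[OF t], of "ball c 1"]) (use out in auto)
  have "(LINT x|lebesgue. \<phi> x) \<noteq> 0"
  proof
    assume "(LINT x|lebesgue. \<phi> x) = 0"
    then have "AE x in lebesgue. \<phi> x = 0" using integral_nonneg_eq_0_iff_AE[OF i] nn by simp
    then have "AE x in lebesgue. x \<notin> box a b"
    proof eventually_elim
      case (elim x)
      then show ?case using box_bump_pos[of x a b 1] by (auto simp: \<phi>_def)
    qed
    then have "box a b \<in> null_sets lebesgue" by (subst AE_iff_null_sets) auto
    then have "negligible (box a b)" by (simp add: negligible_iff_null_sets)
    then show False using open_not_negligible[OF open_box, of a b] ab(2) by blast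
  qed
  moreover have "0 \<le> (LINT x|lebesgue. \<phi> x)" using nn by simp
  ultimately show thesis using that[OF test_function_sobolev[OF t s] nn out _ i] by simp
qed

theorem theorem1p11:
  fixes i :: "'n::finite" and m :: nat and \<sigma> :: real
  assumes "2 \<le> CARD('n)" and "odd m" and "0 < \<sigma>" and "\<sigma> < 1"
  shows "\<exists>n::nat. n \<ge> 1 \<and>
    (\<exists>(f :: real ^ 'n \<Rightarrow> real) (u :: real ^ 'n \<Rightarrow> real).
       f \<in> Linfty (dumbbell i n) \<and>
       (AE x in lebesgue_on (dumbbell i n). 0 \<le> f x) \<and>
       weak_solution m \<sigma> (dumbbell i n) f u \<and>
       essinf (lebesgue_on (dumbbell i n)) (\<lambda>x. ereal (u x)) < 0 \<and>
       0 < esssup (lebesgue_on (dumbbell i n)) (\<lambda>x. ereal (u x)))"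
proof -
  define s where "s = real m + \<sigma>"
  have s: "0 < s" "real (m + 1) - 1 < s" "s < real (m + 1)" using assms(3,4) by (auto simp: s_def)
  have ev: "even (m + 1)" using assms(2) by simp
  obtain \<kappa> where \<kappa>: "\<kappa> > 0" "\<And>(u :: real ^ 'n \<Rightarrow> real) w v z. has_fourier u v \<Longrightarrow> has_fourier w z \<Longrightarrow>
    hom_integrable (real m + \<sigma>) v \<Longrightarrow> hom_integrable (real m + \<sigma>) z \<Longrightarrow> form_odd m \<sigma> u w = \<kappa> * hom_form (real m + \<sigma>) v z"
    using form_odd_fourier[OF assms(3,4,2), where 'n='n] by blast
  define e where "e = (axis i 1 :: real ^ 'n)"
  have e1: "norm e = 1" by (simp add: e_def)
  define S where "S = ball (0 :: real ^ 'n) 1"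
  define T where "T = ball (3 *\<^sub>R e) 1"
  have ST: "two_balls i = S \<union> T" by (simp add: two_balls_def S_def T_def e_def)
  have dist: "1 \<le> norm (x - y)" if "x \<in> S" "y \<in> T" for x y
    using ball_separation[OF e1] that unfolding S_def T_def by blast
  have dist': "1 \<le> norm (x - y)" if "x \<in> T" "y \<in> S" for x y
    using dist[OF that(2,1)] by (simp add: norm_minus_commute)
  have Sb: "S \<in> sets borel" "bounded S" and Tb: "T \<in> sets borel" "bounded T" by (auto simp: S_def T_def)
  define f where "f x = (indicator S x :: real)" for x
  \<comment> \<open>Dividing by the factor between \<open>form_odd\<close> and \<open>energy\<close> turns solutions for \<open>g\<close> into weak solutions for \<open>f\<close>.\<close>
  define g where "g x = f x / \<kappa>" for x
  have fL: "f \<in> L2" unfolding f_def[abs_def]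
    by (rule L2_bounded_support[of _ 1 1], rule borel_measurable_indicator)
      (use Sb in simp, auto simp: indicator_def S_def)
  have gL: "g \<in> L2" using L2_cmult(1)[OF fL, of "1 / \<kappa>"] by (simp add: g_def[abs_def])
  \<comment> \<open>The index is shifted because the neck radius is \<open>1 / n\<close> with \<open>n \<ge> 1\<close>.\<close>
  define U where "U n = dumbbell i (Suc n)" for n
  have SU: "S \<union> T \<subseteq> U n" for n using two_balls_subset_dumbbell ST unfolding U_def by blast
  have Ub: "bounded (U n)" for n unfolding U_def by (rule bounded_dumbbell)
  have "\<exists>u. u \<in> sobolev0 s (U n) \<and> (\<forall>\<phi>\<in>sobolev0 s (U n). energy s u \<phi> = (LINT x|lebesgue. g x * \<phi> x))" for n
    using energy_solution_exists[OF Ub s(1) gL, of n] by metis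
  then obtain u where u: "\<And>n. u n \<in> sobolev0 s (U n)"
    "\<And>n \<phi>. \<phi> \<in> sobolev0 s (U n) \<Longrightarrow> energy s (u n) \<phi> = (LINT x|lebesgue. g x * \<phi> x)" by metis
  have us: "u n \<in> sobolev s" for n by (rule sobolev0D(1)[OF u(1)])
  note uD = sobolevD[OF us s(1)]
  have "\<exists>n. \<not> (AE x in lebesgue. 0 \<le> u n x)"
  proof (rule ccontr)
    assume "\<nexists>n. \<not> (AE x in lebesgue. 0 \<le> u n x)"
    then have un: "AE x in lebesgue. 0 \<le> u n x" for n by blast
    have U': "U (Suc n) \<subseteq> U n" for n unfolding U_def by (rule dumbbell_Suc_subset)
    obtain w where w: "w \<in> sobolev s" "\<And>n. AE x in lebesgue. x \<notin> U n \<longrightarrow> w x = 0" "(\<lambda>n. sqn (\<lambda>x. u n x - w x)) \<longlonglongrightarrow> 0"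
      "\<And>\<phi>. (\<And>n. \<phi> \<in> sobolev0 s (U n)) \<Longrightarrow> energy s w \<phi> = (LINT x|lebesgue. g x * \<phi> x)"
      using energy_solutions_decreasing_domains[of U, OF Ub U' s(1) gL u] by blast
    note wL = sobolevD(1)[OF w(1) s(1)]
    have wz: "AE x in lebesgue. x \<notin> S \<union> T \<longrightarrow> w x = 0"
      using zero_outside_two_balls[OF assms(1) w(2)[unfolded U_def]] ST by simp
    have wn: "AE x in lebesgue. 0 \<le> w x" by (rule L2_limit_nonneg[OF uD(1) wL w(3) un])
    have test: "energy s w \<phi> = (LINT x|lebesgue. g x * \<phi> x)" if "\<phi> \<in> sobolev s" "AE x in lebesgue. x \<notin> S \<union> T \<longrightarrow> \<phi> x = 0" for \<phi>
    proof (rule w(4))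
      fix n
      have "AE x in lebesgue. x \<notin> U n \<longrightarrow> \<phi> x = 0" using that(2) by eventually_elim (use SU in blast)
      then show "\<phi> \<in> sobolev0 s (U n)" using that(1) by (simp add: sobolev0_def)
    qed
    define w1 where "w1 x = indicator S x * w x" for x
    define w2 where "w2 x = indicator T x * w x" for x
    have w1: "w1 \<in> sobolev s" unfolding w1_def
      by (rule sobolev_restrict_separated[OF w(1) s(1) Sb Tb wz dist])
    have w2: "w2 \<in> sobolev s" unfolding w2_def
      by (rule sobolev_restrict_separated[OF w(1) s(1) Tb Sb _ dist']) (use wz in \<open>simp add: Un_commute\<close>)
    have z1: "AE x in lebesgue. x \<notin> S \<longrightarrow> w1 x = 0" and z2: "AE x in lebesgue. x \<notin> T \<longrightarrow> w2 x = 0"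
      by (auto simp: w1_def w2_def)
    have n1: "AE x in lebesgue. 0 \<le> w1 x" using wn by eventually_elim (simp add: w1_def)
    have n2: "AE x in lebesgue. 0 \<le> w2 x" using wn by eventually_elim (simp add: w2_def)
    have disj: "x \<notin> T" if "x \<in> S" for x using dist[of x x] that by auto
    have ww: "AE x in lebesgue. w x = 1 * w1 x + 1 * w2 x"
      using wz by eventually_elim (use disj in \<open>auto simp: w1_def w2_def indicator_def\<close>)
    have split: "energy s w \<phi> = energy s w1 \<phi> + energy s w2 \<phi>" if \<phi>: "\<phi> \<in> sobolev s" for \<phi>
      using energy_cong[OF wL sobolevD(1)[OF \<phi> s(1)] ww, of s] energy_linear[OF w1 w2 \<phi> s(1), of 1 1] by simp
    have supp: "(LINT x|lebesgue. g x * \<phi> x) = 0" if "\<And>x. x \<notin> T \<Longrightarrow> \<phi> x = 0" for \<phi>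
    proof -
      have "g x * \<phi> x = 0" for x using that[of x] disj[of x] by (cases "x \<in> S") (auto simp: g_def f_def)
      then have "(\<lambda>x. g x * \<phi> x) = (\<lambda>x. 0)" by blast
      then show ?thesis by (simp only: Bochner_Integration.integral_zero)
    qed
    \<comment> \<open>Testing with \<open>w2\<close>, on whose support the datum vanishes.\<close>
    have "energy s w w2 = 0" using test[OF w2] supp[of w2] z2 by (auto simp: w2_def)
    then have "energy s w1 w2 + energy s w2 w2 = 0" using split[OF w2] by simp
    moreover have "0 \<le> energy s w1 w2"
      by (rule energy_separated_sign(1)[OF w1 w2 s ev Sb z1 Tb z2 dist n1 n2])
    ultimately have w20: "energy s w2 w2 = 0" using energy_nonneg[of s w2] by linarith
    obtain \<phi> where \<phi>: "\<phi> \<in> sobolev s" "\<And>x. 0 \<le> \<phi> x" "\<And>x. x \<notin> T \<Longrightarrow> \<phi> x = 0" "0 < (LINT x|lebesgue. \<phi> x)"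
      using nonneg_bump_in_ball[OF s(1), of "3 *\<^sub>R e"] unfolding T_def by metis
    have "energy s w \<phi> = 0" using test[OF \<phi>(1)] supp[OF \<phi>(3)] \<phi>(3) by auto
    moreover have "energy s w2 \<phi> = 0" using energy_Cauchy_Schwarz[OF w2 \<phi>(1) s(1)] w20 by simp
    ultimately have w1\<phi>: "energy s w1 \<phi> = 0" using split[OF \<phi>(1)] by simp
    have w1i: "integrable lebesgue w1"
      by (rule L2_bounded_support_integrable[OF sobolevD(1)[OF w1 s(1)] Sb(2) _ z1]) (use Sb(1) in simp)
    \<comment> \<open>The strict sign leaves no room for \<open>w1\<close>.\<close>
    have "\<not> 0 < (LINT x|lebesgue. w1 x)"
    proof
      assume p: "0 < (LINT x|lebesgue. w1 x)"
      have "0 < energy s w1 \<phi>"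
        by (rule energy_separated_sign(2)[OF w1 \<phi>(1) s ev Sb z1 Tb _ dist n1 _ p \<phi>(4)]) (use \<phi> in auto)
      then show False using w1\<phi> by simp
    qed
    moreover have "0 \<le> (LINT x|lebesgue. w1 x)" using n1 by (rule integral_nonneg_AE)
    ultimately have "(LINT x|lebesgue. w1 x) = 0" by simp
    then have w10: "AE x in lebesgue. w1 x = 0" using integral_nonneg_eq_0_iff_AE[OF w1i n1] by simp
    have C: "energy s w1 \<psi> = 0" if \<psi>: "\<psi> \<in> sobolev s" for \<psi>
    proof -
      have "AE x in lebesgue. w1 x = 0 * w1 x + 0 * w1 x" using w10 by eventually_elim simp
      then show ?thesis using energy_cong[OF sobolevD(1)[OF w1 s(1)] sobolevD(1)[OF \<psi> s(1)], of _ s] energy_linear[OF w1 w1 \<psi> s(1), of 0 0] by simp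
    qed
    \<comment> \<open>A bump in the first ball detects the datum, but \<open>w\<close> has no energy left.\<close>
    obtain \<psi> where \<psi>: "\<psi> \<in> sobolev s" "\<And>x. 0 \<le> \<psi> x" "\<And>x. x \<notin> S \<Longrightarrow> \<psi> x = 0" "0 < (LINT x|lebesgue. \<psi> x)"
      using nonneg_bump_in_ball[OF s(1), of 0] unfolding S_def by metis
    have "energy s w2 \<psi> = 0" using energy_Cauchy_Schwarz[OF w2 \<psi>(1) s(1)] w20 by simp
    then have "energy s w \<psi> = 0" using split[OF \<psi>(1)] C[OF \<psi>(1)] by simp
    moreover have "energy s w \<psi> = (LINT x|lebesgue. g x * \<psi> x)" using test[OF \<psi>(1)] \<psi>(3) by auto
    moreover have "g x * \<psi> x = \<psi> x / \<kappa>" for x using \<psi>(3)[of x] by (cases "x \<in> S") (auto simp: g_def f_def)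
    ultimately show False using \<psi>(4) \<kappa>(1) by simp
  qed
  then obtain n where n: "\<not> (AE x in lebesgue. 0 \<le> u n x)" by blast
  have Um: "U n \<inter> space lebesgue \<in> sets lebesgue" using dumbbell_in_lebesgue[of i "Suc n"] unfolding U_def by simp
  have uz: "AE x in lebesgue. x \<notin> U n \<longrightarrow> u n x = 0" by (rule sobolev0D(2)[OF u(1)])
  have neg: "\<not> (AE x in lebesgue_on (U n). 0 \<le> ereal (u n x))"
  proof
    assume "AE x in lebesgue_on (U n). 0 \<le> ereal (u n x)"
    then have "AE x in lebesgue. x \<in> U n \<longrightarrow> 0 \<le> ereal (u n x)" by (simp add: AE_restrict_space_iff[OF Um])
    then have "AE x in lebesgue. 0 \<le> u n x" using uz by eventually_elim (auto simp: zero_ereal_def)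
    then show False using n by blast
  qed
  have pos: "\<not> (AE x in lebesgue_on (U n). ereal (u n x) \<le> 0)"
  proof
    assume "AE x in lebesgue_on (U n). ereal (u n x) \<le> 0"
    then have "AE x in lebesgue. x \<in> U n \<longrightarrow> ereal (u n x) \<le> 0" by (simp add: AE_restrict_space_iff[OF Um])
    then have le: "AE x in lebesgue. u n x \<le> 0" using uz by eventually_elim (auto simp: zero_ereal_def)
    have "0 \<le> (LINT x|lebesgue. - (g x * u n x))"
    proof (rule integral_nonneg_AE)
      show "AE x in lebesgue. 0 \<le> - (g x * u n x)"
        using le by eventually_elim (use \<kappa>(1) in \<open>auto simp: g_def f_def indicator_def divide_nonpos_pos\<close>)
    qed
    then have "energy s (u n) (u n) \<le> 0" using u(2)[OF u(1), of n] by simp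
    then have "energy s (u n) (u n) = 0" using energy_nonneg[of s "u n"] by linarith
    moreover obtain C where "sqn (u n) \<le> C * energy s (u n) (u n)" using poincare[OF Ub s(1), of n] u(1) by metis
    ultimately have "sqn (u n) = 0" using sqn_nonneg[of "u n"] by simp
    then have "AE x in lebesgue. u n x = 0" by (rule sqn_eq_0D[OF uD(1)])
    then have "AE x in lebesgue. 0 \<le> u n x" by eventually_elim simp
    then show False using n by blast
  qed
  have weak: "weak_solution m \<sigma> (U n) f (u n)"
    unfolding weak_solution_def
  proof (intro conjI ballI)
    show "u n \<in> sobolev0 (real m + \<sigma>) (U n)" using u(1) unfolding s_def .
    fix \<phi> assume "\<phi> \<in> sobolev0 (real m + \<sigma>) (U n)"
    then have \<phi>: "\<phi> \<in> sobolev0 s (U n)" by (simp add: s_def)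
    note \<phi>D = sobolevD[OF sobolev0D(1)[OF \<phi>] s(1)]
    have "form_odd m \<sigma> (u n) \<phi> = \<kappa> * energy s (u n) \<phi>"
      using \<kappa>(2)[OF uD(2) \<phi>D(2) uD(3)[unfolded s_def] \<phi>D(3)[unfolded s_def]] unfolding energy_def s_def .
    also have "\<dots> = \<kappa> * (LINT x|lebesgue. g x * \<phi> x)" by (simp add: u(2)[OF \<phi>])
    also have "\<dots> = (LINT x|lebesgue. \<kappa> * (g x * \<phi> x))" by simp
    also have "\<dots> = (LINT x:U n|lebesgue. f x * \<phi> x)"
      unfolding set_lebesgue_integral_def
    proof (intro Bochner_Integration.integral_cong refl)
      fix x
      show "\<kappa> * (g x * \<phi> x) = indicator (U n) x *\<^sub>R (f x * \<phi> x)"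
        using \<kappa>(1) SU[of n] by (cases "x \<in> S") (auto simp: g_def f_def indicator_def)
    qed
    finally show "form_odd m \<sigma> (u n) \<phi> = (LINT x:U n|lebesgue. f x * \<phi> x)" .
  qed
  have "f \<in> Linfty (U n)"
  proof -
    have "f \<in> borel_measurable (lebesgue_on (U n))"
      using L2_measurable[OF fL] by (rule measurable_restrict_space1)
    moreover have "AE x in lebesgue_on (U n). \<bar>f x\<bar> \<le> 1" by (auto simp: f_def indicator_def)
    ultimately show ?thesis unfolding Linfty_def by blast
  qed
  moreover have "AE x in lebesgue_on (U n). 0 \<le> f x" by (simp add: f_def)
  ultimately show ?thesis
    using weak essinf_negI[OF neg] esssup_posI[OF pos] unfolding U_def
    by (intro exI[of _ "Suc n"] conjI exI[of _ f] exI[of _ "u n"]) auto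
qed

end
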